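(* The (interactive, bounded-error) randomized communication complexity of the $\mathsf{ABCD}$ problem on $N\times N$ matrices is $\Omega(\sqrt{N})$; that is, there is an absolute constant $c>0$ such that every interactive randomized classical protocol solving the $\mathsf{ABCD}$ problem with bounded error has communication cost at least $c\sqrt{N}$.
   Context: $N=2^n$ for a positive integer $n$, and $\mathsf{SU}(N)$ denotes the group of $N\times N$ complex unitary matrices of determinant $1$. The $\mathsf{ABCD}$ problem: Alice is given $A,C\in\mathsf{SU}(N)$ explicitly and Bob is given $B,D\in\mathsf{SU}(N)$ explicitly; they must output $1$ if $\mathrm{Tr}(ABCD)\ge 0.9N$ and $0$ if $\mathrm{Tr}(ABCD)\le 0.1N$, promised that one of these holds. A randomized protocol solves the problem with bounded error if on every input satisfying the promise it outputs the correct value with probability at least $2/3$ (over the protocol's randomness, which may be shared); the cost is the number of bits exchanged in the worst case. *)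

theory Defs
  imports "HOL-Probability.Probability" "Jordan_Normal_Form.Determinant"
begin

definition ctrans :: "complex mat \<Rightarrow> complex mat" where
  "ctrans U = mat (dim_col U) (dim_row U) (\<lambda>(i,j). cnj (U $$ (j,i)))"

definition mtrace :: "complex mat \<Rightarrow> complex" where
  "mtrace M = (\<Sum>i<dim_row M. M $$ (i,i))"

definition SU :: "nat \<Rightarrow> complex mat set" where
  "SU N = {U \<in> carrier_mat N N. U * ctrans U = 1\<^sub>m N \<and> det U = 1}"

datatype ('a, 'b) protocol =
    Output bool
  | AliceSends "'a \<Rightarrow> bool" "('a, 'b) protocol" "('a, 'b) protocol"
  | BobSends "'b \<Rightarrow> bool" "('a, 'b) protocol" "('a, 'b) protocol"

fun run :: "('a, 'b) protocol \<Rightarrow> 'a \<Rightarrow> 'b \<Rightarrow> bool" where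
  "run (Output v) x y = v"
| "run (AliceSends f p0 p1) x y = (if f x then run p1 x y else run p0 x y)"
| "run (BobSends g p0 p1) x y = (if g y then run p1 x y else run p0 x y)"

fun bits :: "('a, 'b) protocol \<Rightarrow> 'a \<Rightarrow> 'b \<Rightarrow> nat" where
  "bits (Output v) x y = 0"
| "bits (AliceSends f p0 p1) x y = Suc (if f x then bits p1 x y else bits p0 x y)"
| "bits (BobSends g p0 p1) x y = Suc (if g y then bits p1 x y else bits p0 x y)"

type_synonym abcd_protocol = "(complex mat \<times> complex mat, complex mat \<times> complex mat) protocol"

(* promise of the ABCD problem; Tr(ABCD) >= 0.9N read literally as a real number >= 0.9N *)
definition abcd_yes :: "nat \<Rightarrow> complex mat \<Rightarrow> complex mat \<Rightarrow> complex mat \<Rightarrow> complex mat \<Rightarrow> bool" where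
  "abcd_yes N A B C D \<longleftrightarrow> Im (mtrace (A * B * C * D)) = 0 \<and> Re (mtrace (A * B * C * D)) \<ge> 9/10 * real N"

definition abcd_no :: "nat \<Rightarrow> complex mat \<Rightarrow> complex mat \<Rightarrow> complex mat \<Rightarrow> complex mat \<Rightarrow> bool" where
  "abcd_no N A B C D \<longleftrightarrow> Im (mtrace (A * B * C * D)) = 0 \<and> Re (mtrace (A * B * C * D)) \<le> 1/10 * real N"

(* A randomized protocol with shared randomness = a probability distribution M over
   deterministic protocols. Alice holds (A,C), Bob holds (B,D). *)
definition solves_ABCD :: "nat \<Rightarrow> abcd_protocol measure \<Rightarrow> bool" where
  "solves_ABCD N M \<longleftrightarrow> prob_space M \<and>
     (\<forall>A\<in>SU N. \<forall>B\<in>SU N. \<forall>C\<in>SU N. \<forall>D\<in>SU N.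
        (abcd_yes N A B C D \<longrightarrow>
           {p \<in> space M. run p (A, C) (B, D)} \<in> sets M \<and>
           measure M {p \<in> space M. run p (A, C) (B, D)} \<ge> 2/3) \<and>
        (abcd_no N A B C D \<longrightarrow>
           {p \<in> space M. \<not> run p (A, C) (B, D)} \<in> sets M \<and>
           measure M {p \<in> space M. \<not> run p (A, C) (B, D)} \<ge> 2/3))"

definition cost_le :: "nat \<Rightarrow> abcd_protocol measure \<Rightarrow> nat \<Rightarrow> bool" where
  "cost_le N M c \<longleftrightarrow> (\<forall>p\<in>space M. \<forall>A\<in>SU N. \<forall>B\<in>SU N. \<forall>C\<in>SU N. \<forall>D\<in>SU N.
      bits p (A, C) (B, D) \<le> c)"

end

theory Submission
  imports Defs
begin

text \<open>
  Choose a Haar random orthogonal matrix \<open>Z\<close> and independent sign matrices \<open>D, D'\<close>. Alice's matrices are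
  \<open>R = Z\<^sup>T D Z\<close> up to a phase, Bob's are \<open>S = Z\<^sup>T D' Z\<close> (yes) or \<open>S = (H Z)\<^sup>T D' (H Z)\<close> with a Hadamard matrix
  \<open>H\<close> (no); \<open>Tr(RSRS)\<close> is \<open>N\<close> in the first case and bounded in mean square in the second. On a rectangle with row
  indicator \<open>f\<close>, both distributions depend on \<open>f\<close> only through \<open>\<alpha>(Z)\<close>, the average of \<open>f(Z\<^sup>T D Z)\<close> over \<open>D\<close>.
  If \<open>\<alpha>\<close> has relative variance at most \<open>1/10\<close> whenever its mean is at least \<open>3\<^sup>-\<^sup>m\<close>, \<open>m\<close> of order \<open>\<surd>N\<close>, the two
  distributions cannot be told apart on rectangles that are not exponentially small.

  The variance bound combines two facts. Averaging over rotations of two rows \<open>i, j\<close> of \<open>Z\<close> does not see the part of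
  \<open>f\<close> supported on \<open>D\<^sub>i = D\<^sub>j\<close>, so the Dirichlet form of \<open>\<alpha>\<close> for Kac's walk is at most the
  sum of the squared degree-two Fourier coefficients of \<open>f\<close> on the cube, which the level-two inequality bounds by
  \<open>O(m\<^sup>2) \<alpha>\<^sup>2\<close>. On functions symmetric in the rows the walk has a spectral gap of order \<open>N\<close>, which reduces to an
  inequality for two planes with a common axis in dimension three. The Haar mean itself is only needed on Lipschitz functions and
  is the limit of the powers of the walk.
\<close>

subsection \<open>Orthogonal matrices and Lipschitz functions on them\<close>

text \<open>The messages of a protocol are arbitrary functions of matrices, so the sets they cut out
  need not be measurable. This dictates two choices: the Haar measure is replaced by a positive
  functional on Lipschitz functions, and the inputs are rounded to a finite net with Lipschitz
  weights, so that any set of inputs whatever turns into a Lipschitz function with values in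
  \<open>[0,1]\<close>. In a yes instance the two matrices are diagonal in a common basis and are
  their own inverses; they commute and \<open>RSRS\<close> is the identity. The square root arises
  because the squared level-two coefficients of a set of density \<open>3^-m\<close> may grow like
  \<open>m^2\<close>, while the gap is of order \<open>N\<close>: the relative variance stays small
  as long as \<open>m^2\<close> is below a small multiple of \<open>N\<close>. A protocol of cost
  \<open>c\<close> cuts the inputs into at most \<open>2^c\<close> rectangles, each of which loses
  \<open>3^-m\<close>; with base 3 the total loss is at most \<open>(2/3)^m\<close> once
  \<open>c \<le> m\<close>. Relative variance \<open>1/10\<close> on both sides keeps
  \<open>9/10\<close> of the product mass of a rectangle, and \<open>9/10\<close> exceeds
  \<open>2/3\<close>, the sum of the two error probabilities that a correct protocol may
  have.\<close>

definition orth :: "nat \<Rightarrow> real mat set" where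
  "orth n = {A \<in> carrier_mat n n. A * transpose_mat A = 1\<^sub>m n}"

lemma mult_index_sum:
  assumes "A \<in> carrier_mat n m" "B \<in> carrier_mat m k" "i < n" "j < k"
  shows "(A * B) $$ (i,j) = (\<Sum>l<m. A $$ (i,l) * B $$ (l,j))"
  using assms by (auto simp: scalar_prod_def atLeast0LessThan intro!: sum.cong)

lemma orth_carrier: "A \<in> orth n \<Longrightarrow> A \<in> carrier_mat n n"
  by (auto simp: orth_def)

lemma orth_mult_transpose: "A \<in> orth n \<Longrightarrow> A * transpose_mat A = 1\<^sub>m n"
  by (auto simp: orth_def)

lemma orth_transpose_mult: "A \<in> orth n \<Longrightarrow> transpose_mat A * A = 1\<^sub>m n"
  by (rule mat_mult_left_right_inverse[of A n]) (auto simp: orth_def)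

lemma orth_one: "1\<^sub>m n \<in> orth n"
  by (auto simp: orth_def)

lemma orth_transpose: "A \<in> orth n \<Longrightarrow> transpose_mat A \<in> orth n"
  using orth_transpose_mult[of A n] by (auto simp: orth_def)

lemma orth_mult:
  assumes A: "A \<in> orth n" and B: "B \<in> orth n"
  shows "A * B \<in> orth n"
proof -
  note c = orth_carrier[OF A] orth_carrier[OF B]
  have "(A * B) * transpose_mat (A * B) = (A * B) * (transpose_mat B * transpose_mat A)"
    using c by (simp add: transpose_mult)
  also have "\<dots> = A * (B * (transpose_mat B * transpose_mat A))"
    using c by (intro assoc_mult_mat) auto
  also have "B * (transpose_mat B * transpose_mat A) = (B * transpose_mat B) * transpose_mat A"
    using c by (intro assoc_mult_mat[symmetric]) auto
  also have "\<dots> = transpose_mat A" using c orth_mult_transpose[OF B] by simp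
  finally show ?thesis using c orth_mult_transpose[OF A] by (auto simp: orth_def)
qed

lemma orth_row_inner:
  assumes "A \<in> orth n" "i < n" "j < n"
  shows "(\<Sum>k<n. A $$ (i,k) * A $$ (j,k)) = (if i = j then 1 else 0)"
proof -
  have c: "A \<in> carrier_mat n n" using orth_carrier[OF assms(1)] .
  have "(A * transpose_mat A) $$ (i,j) = (\<Sum>k<n. A $$ (i,k) * transpose_mat A $$ (k,j))"
    using c assms by (intro mult_index_sum) auto
  also have "\<dots> = (\<Sum>k<n. A $$ (i,k) * A $$ (j,k))" using c assms by auto
  finally show ?thesis using orth_mult_transpose[OF assms(1)] assms by simp
qed

lemma orth_col_inner:
  assumes "A \<in> orth n" "i < n" "j < n"
  shows "(\<Sum>k<n. A $$ (k,i) * A $$ (k,j)) = (if i = j then 1 else 0)"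
  using orth_row_inner[OF orth_transpose[OF assms(1)] assms(2,3)] orth_carrier[OF assms(1)] assms
  by auto

lemma orth_I:
  assumes c: "A \<in> carrier_mat n n"
    and r: "\<And>i j. i < n \<Longrightarrow> j < n \<Longrightarrow> (\<Sum>k<n. A $$ (i,k) * A $$ (j,k)) = (if i = j then 1 else 0)"
  shows "A \<in> orth n"
proof -
  have "A * transpose_mat A = 1\<^sub>m n"
  proof (rule eq_matI)
    fix i j assume ij: "i < dim_row (1\<^sub>m n :: real mat)" "j < dim_col (1\<^sub>m n :: real mat)"
    have "(A * transpose_mat A) $$ (i,j) = (\<Sum>k<n. A $$ (i,k) * transpose_mat A $$ (k,j))"
      using c ij by (intro mult_index_sum) auto
    also have "\<dots> = (\<Sum>k<n. A $$ (i,k) * A $$ (j,k))" using c ij by auto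
    finally show "(A * transpose_mat A) $$ (i,j) = (1\<^sub>m n) $$ (i,j)" using r ij by simp
  qed (use c in auto)
  then show ?thesis using c by (auto simp: orth_def)
qed

lemma orth_entry_le:
  assumes "A \<in> orth n" "i < n" "j < n"
  shows "\<bar>A $$ (i,j)\<bar> \<le> 1"
proof -
  have "(A $$ (i,j))\<^sup>2 \<le> (\<Sum>k<n. (A $$ (i,k))\<^sup>2)"
    using assms by (intro member_le_sum) auto
  also have "\<dots> = 1" using orth_row_inner[OF assms(1,2,2)] by (simp add: power2_eq_square)
  finally show ?thesis using abs_square_le_1 by blast
qed

text \<open>The Frobenius distance. It does not change under transposition or under multiplication
  by an orthogonal matrix from either side, so translations of a function keep its Lipschitz
  constant.\<close>

definition fd :: "real mat \<Rightarrow> real mat \<Rightarrow> real" where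
  "fd A B = L2_set (\<lambda>p. A $$ p - B $$ p) ({..<dim_row A} \<times> {..<dim_col A})"

lemma fd_nonneg: "0 \<le> fd A B" by (simp add: fd_def L2_set_nonneg)

lemma fd_self: "fd A A = 0" by (simp add: fd_def L2_set_def)

lemma fd_commute: "A \<in> carrier_mat n m \<Longrightarrow> B \<in> carrier_mat n m \<Longrightarrow> fd A B = fd B A"
  by (auto simp: fd_def L2_set_def power2_commute intro!: arg_cong[where f=sqrt] sum.cong)

lemma fd_triangle:
  assumes "A \<in> carrier_mat n m" "B \<in> carrier_mat n m" "C \<in> carrier_mat n m"
  shows "fd A C \<le> fd A B + fd B C"
proof -
  have "L2_set (\<lambda>p. (A $$ p - B $$ p) + (B $$ p - C $$ p)) ({..<n} \<times> {..<m}) \<le>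
     L2_set (\<lambda>p. A $$ p - B $$ p) ({..<n} \<times> {..<m}) + L2_set (\<lambda>p. B $$ p - C $$ p) ({..<n} \<times> {..<m})"
    by (rule L2_set_triangle_ineq)
  then show ?thesis using assms by (auto simp: fd_def)
qed

lemma fd_sq:
  assumes "A \<in> carrier_mat n m"
  shows "(fd A B)\<^sup>2 = (\<Sum>i<n. \<Sum>j<m. (A $$ (i,j) - B $$ (i,j))\<^sup>2)"
proof -
  have d: "dim_row A = n" "dim_col A = m" using assms by auto
  show ?thesis unfolding fd_def L2_set_def d by (simp add: sum_nonneg sum.cartesian_product)
qed

lemma fd_eqI: "(fd A B)\<^sup>2 = (fd C D)\<^sup>2 \<Longrightarrow> fd A B = fd C D"
  by (rule power2_eq_imp_eq[OF _ fd_nonneg fd_nonneg])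

lemma fd_transpose:
  assumes "A \<in> carrier_mat n m" "B \<in> carrier_mat n m"
  shows "fd (transpose_mat A) (transpose_mat B) = fd A B"
proof (rule fd_eqI)
  have "(fd (transpose_mat A) (transpose_mat B))\<^sup>2 = (\<Sum>i<m. \<Sum>j<n. (A $$ (j,i) - B $$ (j,i))\<^sup>2)"
    using assms by (subst fd_sq[of _ m n]) auto
  also have "\<dots> = (\<Sum>j<n. \<Sum>i<m. (A $$ (j,i) - B $$ (j,i))\<^sup>2)" by (rule sum.swap)
  also have "\<dots> = (fd A B)\<^sup>2" by (rule fd_sq[OF assms(1), symmetric])
  finally show "(fd (transpose_mat A) (transpose_mat B))\<^sup>2 = (fd A B)\<^sup>2" .
qed

lemma orth_col_norm:
  assumes Q: "Q \<in> orth n" and "M \<in> carrier_mat n m" "j < m"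
  shows "(\<Sum>i<n. ((Q * M) $$ (i,j))\<^sup>2) = (\<Sum>i<n. (M $$ (i,j))\<^sup>2)"
proof -
  have "(\<Sum>i<n. ((Q * M) $$ (i,j))\<^sup>2) = (\<Sum>i<n. (\<Sum>k<n. Q $$ (i,k) * M $$ (k,j)) * (\<Sum>l<n. Q $$ (i,l) * M $$ (l,j)))"
    using mult_index_sum[OF orth_carrier[OF Q] assms(2)] assms(3) by (auto simp: power2_eq_square intro!: sum.cong)
  also have "\<dots> = (\<Sum>i<n. \<Sum>k<n. \<Sum>l<n. (M $$ (k,j) * M $$ (l,j)) * (Q $$ (i,k) * Q $$ (i,l)))"
    by (simp add: sum_product mult_ac)
  also have "\<dots> = (\<Sum>k<n. \<Sum>i<n. \<Sum>l<n. (M $$ (k,j) * M $$ (l,j)) * (Q $$ (i,k) * Q $$ (i,l)))"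
    by (rule sum.swap)
  also have "\<dots> = (\<Sum>k<n. \<Sum>l<n. \<Sum>i<n. (M $$ (k,j) * M $$ (l,j)) * (Q $$ (i,k) * Q $$ (i,l)))"
    by (intro sum.cong refl sum.swap)
  also have "\<dots> = (\<Sum>k<n. \<Sum>l<n. (M $$ (k,j) * M $$ (l,j)) * (if k = l then 1 else 0))"
    using orth_col_inner[OF Q] by (auto simp: sum_distrib_left[symmetric] intro!: sum.cong)
  also have "\<dots> = (\<Sum>i<n. (M $$ (i,j))\<^sup>2)"
    by (simp add: power2_eq_square if_distrib cong: if_cong)
  finally show ?thesis .
qed

lemma fd_left:
  assumes Q: "Q \<in> orth n" and A: "A \<in> carrier_mat n m" and B: "B \<in> carrier_mat n m"
  shows "fd (Q * A) (Q * B) = fd A B"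
proof (rule fd_eqI)
  have c: "Q \<in> carrier_mat n n" using orth_carrier[OF Q] .
  have e: "Q * (A - B) = Q * A - Q * B" using mult_minus_distrib_mat[OF c A B] .
  have "(fd (Q * A) (Q * B))\<^sup>2 = (\<Sum>i<n. \<Sum>j<m. ((Q * A) $$ (i,j) - (Q * B) $$ (i,j))\<^sup>2)"
    using c A by (intro fd_sq) auto
  also have "\<dots> = (\<Sum>i<n. \<Sum>j<m. ((Q * (A - B)) $$ (i,j))\<^sup>2)"
    unfolding e using c A B by auto
  also have "\<dots> = (\<Sum>j<m. \<Sum>i<n. ((Q * (A - B)) $$ (i,j))\<^sup>2)" by (rule sum.swap)
  also have "\<dots> = (\<Sum>j<m. \<Sum>i<n. ((A - B) $$ (i,j))\<^sup>2)"
    by (rule sum.cong[OF refl], rule orth_col_norm[OF Q minus_carrier_mat[OF B]]) simp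
  also have "\<dots> = (\<Sum>i<n. \<Sum>j<m. ((A - B) $$ (i,j))\<^sup>2)" by (rule sum.swap)
  also have "\<dots> = (fd A B)\<^sup>2" using fd_sq[OF A] A B by auto
  finally show "(fd (Q * A) (Q * B))\<^sup>2 = (fd A B)\<^sup>2" .
qed

lemma fd_right:
  assumes Q: "Q \<in> orth n" and A: "A \<in> carrier_mat m n" and B: "B \<in> carrier_mat m n"
  shows "fd (A * Q) (B * Q) = fd A B"
proof -
  have c: "Q \<in> carrier_mat n n" using orth_carrier[OF Q] .
  have "fd (A * Q) (B * Q) = fd (transpose_mat (A * Q)) (transpose_mat (B * Q))"
    using A B c by (intro fd_transpose[symmetric]) auto
  also have "\<dots> = fd (transpose_mat Q * transpose_mat A) (transpose_mat Q * transpose_mat B)"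
    using A B c by (simp add: transpose_mult)
  also have "\<dots> = fd (transpose_mat A) (transpose_mat B)"
    using A B by (intro fd_left[OF orth_transpose[OF Q]]) auto
  also have "\<dots> = fd A B" using A B by (intro fd_transpose) auto
  finally show ?thesis .
qed

lemma entry_le_fd:
  assumes "A \<in> carrier_mat n m" "i < n" "j < m"
  shows "\<bar>A $$ (i,j) - B $$ (i,j)\<bar> \<le> fd A B"
proof -
  have "(A $$ (i,j) - B $$ (i,j))\<^sup>2 \<le> (\<Sum>p\<in>{..<n}\<times>{..<m}. (A $$ p - B $$ p)\<^sup>2)"
    using assms by (intro member_le_sum[of "(i,j)" _ "\<lambda>p. (A $$ p - B $$ p)\<^sup>2"]) auto
  then show ?thesis using assms unfolding fd_def L2_set_def by (simp add: real_le_rsqrt)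
qed

lemma fd_le_entries:
  assumes "A \<in> carrier_mat n m" "\<And>i j. i < n \<Longrightarrow> j < m \<Longrightarrow> \<bar>A $$ (i,j) - B $$ (i,j)\<bar> \<le> e"
  shows "fd A B \<le> real n * real m * e"
proof -
  have "fd A B \<le> (\<Sum>p\<in>{..<n}\<times>{..<m}. \<bar>A $$ p - B $$ p\<bar>)"
    using L2_set_le_sum_abs[of "\<lambda>p. A $$ p - B $$ p" "{..<n}\<times>{..<m}"] assms(1) by (simp add: fd_def)
  also have "\<dots> \<le> (\<Sum>p\<in>{..<n}\<times>{..<m}. e)" using assms(2) by (intro sum_mono) auto
  finally show ?thesis by simp
qed

lemma fd_orth_le:
  assumes "A \<in> orth n" "B \<in> orth n"
  shows "fd A B \<le> real n * real n * 2"
proof (rule fd_le_entries[OF orth_carrier[OF assms(1)]])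
  fix i j assume "i < n" "j < n"
  then show "\<bar>A $$ (i,j) - B $$ (i,j)\<bar> \<le> 2"
    using orth_entry_le[OF assms(1), of i j] orth_entry_le[OF assms(2), of i j] by linarith
qed

text \<open>The constant stays visible because the contraction argument for Kac's walk needs one
  \<open>L\<close> that serves all iterates; elsewhere the existential version \<open>Lip\<close> is
  enough.\<close>

definition lipw :: "nat \<Rightarrow> real \<Rightarrow> (real mat \<Rightarrow> real) \<Rightarrow> bool" where
  "lipw n L \<phi> \<longleftrightarrow> 0 \<le> L \<and> (\<forall>A\<in>orth n. \<forall>B\<in>orth n. \<bar>\<phi> A - \<phi> B\<bar> \<le> L * fd A B)"

definition Lip :: "nat \<Rightarrow> (real mat \<Rightarrow> real) set" where
  "Lip n = {\<phi>. \<exists>L. lipw n L \<phi>}"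

lemma LipI: "lipw n L \<phi> \<Longrightarrow> \<phi> \<in> Lip n" by (auto simp: Lip_def)

lemma lipwI: "0 \<le> L \<Longrightarrow> (\<And>A B. A \<in> orth n \<Longrightarrow> B \<in> orth n \<Longrightarrow> \<bar>\<phi> A - \<phi> B\<bar> \<le> L * fd A B) \<Longrightarrow> lipw n L \<phi>"
  by (auto simp: lipw_def)

lemma lipwD: "lipw n L \<phi> \<Longrightarrow> A \<in> orth n \<Longrightarrow> B \<in> orth n \<Longrightarrow> \<bar>\<phi> A - \<phi> B\<bar> \<le> L * fd A B"
  by (auto simp: lipw_def)

lemma lipw_nonneg: "lipw n L \<phi> \<Longrightarrow> 0 \<le> L" by (auto simp: lipw_def)

lemma Lip_cong: "(\<And>A. A \<in> orth n \<Longrightarrow> \<phi> A = \<psi> A) \<Longrightarrow> \<phi> \<in> Lip n \<longleftrightarrow> \<psi> \<in> Lip n"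
  by (auto simp: Lip_def lipw_def)

lemma Lip_bounded:
  assumes "\<phi> \<in> Lip n"
  shows "\<exists>b>0. \<forall>A\<in>orth n. \<bar>\<phi> A\<bar> \<le> b"
proof -
  obtain L where L: "lipw n L \<phi>" using assms by (auto simp: Lip_def)
  have "\<bar>\<phi> A\<bar> \<le> \<bar>\<phi> (1\<^sub>m n)\<bar> + L * (real n * real n * 2) + 1" if "A \<in> orth n" for A
  proof -
    have "\<bar>\<phi> A - \<phi> (1\<^sub>m n)\<bar> \<le> L * fd A (1\<^sub>m n)" by (rule lipwD[OF L that orth_one])
    also have "\<dots> \<le> L * (real n * real n * 2)"
      by (intro mult_left_mono fd_orth_le that orth_one lipw_nonneg[OF L])
    finally show ?thesis by linarith
  qed
  moreover have "0 < \<bar>\<phi> (1\<^sub>m n)\<bar> + L * (real n * real n * 2) + 1"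
    using lipw_nonneg[OF L] by (simp add: add_nonneg_pos)
  ultimately show ?thesis by blast
qed

lemma Lip_const [intro,simp]: "(\<lambda>_. c) \<in> Lip n"
  by (rule LipI[of n 0]) (auto simp: lipw_def)

lemma lipw_add: "lipw n L \<phi> \<Longrightarrow> lipw n L' \<psi> \<Longrightarrow> lipw n (L + L') (\<lambda>A. \<phi> A + \<psi> A)"
  unfolding lipw_def by (smt (verit, best) distrib_right)

lemma Lip_add [intro,simp]: "\<phi> \<in> Lip n \<Longrightarrow> \<psi> \<in> Lip n \<Longrightarrow> (\<lambda>A. \<phi> A + \<psi> A) \<in> Lip n"
  unfolding Lip_def using lipw_add by blast

lemma lipw_cmult: "lipw n L \<phi> \<Longrightarrow> lipw n (\<bar>c\<bar> * L) (\<lambda>A. c * \<phi> A)"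
proof (rule lipwI)
  assume l: "lipw n L \<phi>"
  show "0 \<le> \<bar>c\<bar> * L" using lipw_nonneg[OF l] by simp
  fix A B assume "A \<in> orth n" "B \<in> orth n"
  from lipwD[OF l this] show "\<bar>c * \<phi> A - c * \<phi> B\<bar> \<le> \<bar>c\<bar> * L * fd A B"
    by (metis abs_ge_zero abs_mult mult.assoc mult_left_mono right_diff_distrib)
qed

lemma Lip_cmult [intro,simp]: "\<phi> \<in> Lip n \<Longrightarrow> (\<lambda>A. c * \<phi> A) \<in> Lip n"
  unfolding Lip_def using lipw_cmult by blast

lemma Lip_uminus [intro,simp]: "\<phi> \<in> Lip n \<Longrightarrow> (\<lambda>A. - \<phi> A) \<in> Lip n"
  using Lip_cmult[of \<phi> n "-1"] by simp

lemma Lip_diff [intro,simp]: "\<phi> \<in> Lip n \<Longrightarrow> \<psi> \<in> Lip n \<Longrightarrow> (\<lambda>A. \<phi> A - \<psi> A) \<in> Lip n"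
  using Lip_add[of \<phi> n "\<lambda>A. - \<psi> A"] by simp

lemma Lip_mult [intro,simp]:
  assumes "\<phi> \<in> Lip n" "\<psi> \<in> Lip n"
  shows "(\<lambda>A. \<phi> A * \<psi> A) \<in> Lip n"
proof -
  obtain L where L: "lipw n L \<phi>" using assms by (auto simp: Lip_def)
  obtain L' where L': "lipw n L' \<psi>" using assms by (auto simp: Lip_def)
  obtain b where b: "b > 0" "\<And>A. A \<in> orth n \<Longrightarrow> \<bar>\<phi> A\<bar> \<le> b" using Lip_bounded[OF assms(1)] by auto
  obtain b' where b': "b' > 0" "\<And>A. A \<in> orth n \<Longrightarrow> \<bar>\<psi> A\<bar> \<le> b'" using Lip_bounded[OF assms(2)] by auto
  have "lipw n (b * L' + b' * L) (\<lambda>A. \<phi> A * \<psi> A)"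
  proof (rule lipwI)
    show "0 \<le> b * L' + b' * L" using b b' lipw_nonneg[OF L] lipw_nonneg[OF L'] by simp
    fix A B assume AB: "A \<in> orth n" "B \<in> orth n"
    have "\<bar>\<phi> A * \<psi> A - \<phi> B * \<psi> B\<bar> = \<bar>\<phi> A * (\<psi> A - \<psi> B) + \<psi> B * (\<phi> A - \<phi> B)\<bar>" by (simp add: algebra_simps)
    also have "\<dots> \<le> \<bar>\<phi> A\<bar> * \<bar>\<psi> A - \<psi> B\<bar> + \<bar>\<psi> B\<bar> * \<bar>\<phi> A - \<phi> B\<bar>"
      by (metis abs_mult abs_triangle_ineq)
    also have "\<dots> \<le> b * (L' * fd A B) + b' * (L * fd A B)"
      using lipwD[OF L AB] lipwD[OF L' AB] b(2)[OF AB(1)] b'(2)[OF AB(2)] b(1) b'(1)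
      by (intro add_mono mult_mono) auto
    finally show "\<bar>\<phi> A * \<psi> A - \<phi> B * \<psi> B\<bar> \<le> (b * L' + b' * L) * fd A B" by (simp add: algebra_simps)
  qed
  then show ?thesis by (rule LipI)
qed

lemma Lip_power [intro,simp]: "\<phi> \<in> Lip n \<Longrightarrow> (\<lambda>A. \<phi> A ^ k) \<in> Lip n"
  by (induction k) auto

lemma Lip_sum [intro]: "(\<And>k. k \<in> K \<Longrightarrow> \<phi> k \<in> Lip n) \<Longrightarrow> (\<lambda>A. \<Sum>k\<in>K. \<phi> k A) \<in> Lip n"
  by (induction K rule: infinite_finite_induct) auto

lemma Lip_prod [intro]: "(\<And>k. k \<in> K \<Longrightarrow> \<phi> k \<in> Lip n) \<Longrightarrow> (\<lambda>A. \<Prod>k\<in>K. \<phi> k A) \<in> Lip n"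
  by (induction K rule: infinite_finite_induct) auto

lemma Lip_entry: "i < n \<Longrightarrow> j < n \<Longrightarrow> (\<lambda>A. A $$ (i,j)) \<in> Lip n"
  by (rule LipI[of n 1]) (auto intro!: lipwI entry_le_fd dest: orth_carrier)

lemma Lip_max0_abs:
  assumes "\<phi> \<in> Lip n"
  shows "(\<lambda>A. max 0 (1 - \<bar>\<phi> A\<bar>)) \<in> Lip n"
proof -
  obtain L where L: "lipw n L \<phi>" using assms by (auto simp: Lip_def)
  show ?thesis
  proof (rule LipI[of n L], rule lipwI[OF lipw_nonneg[OF L]])
    fix A B assume "A \<in> orth n" "B \<in> orth n"
    from lipwD[OF L this] show "\<bar>max 0 (1 - \<bar>\<phi> A\<bar>) - max 0 (1 - \<bar>\<phi> B\<bar>)\<bar> \<le> L * fd A B" by linarith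
  qed
qed

lemma lipw_left:
  assumes l: "lipw n L \<phi>" and Q: "Q \<in> orth n"
  shows "lipw n L (\<lambda>A. \<phi> (Q * A))"
proof (rule lipwI[OF lipw_nonneg[OF l]])
  fix A B assume AB: "A \<in> orth n" "B \<in> orth n"
  show "\<bar>\<phi> (Q * A) - \<phi> (Q * B)\<bar> \<le> L * fd A B"
    using lipwD[OF l orth_mult[OF Q AB(1)] orth_mult[OF Q AB(2)]] fd_left[OF Q AB[THEN orth_carrier]] by simp
qed

lemma lipw_right:
  assumes l: "lipw n L \<phi>" and Q: "Q \<in> orth n"
  shows "lipw n L (\<lambda>A. \<phi> (A * Q))"
proof (rule lipwI[OF lipw_nonneg[OF l]])
  fix A B assume AB: "A \<in> orth n" "B \<in> orth n"
  show "\<bar>\<phi> (A * Q) - \<phi> (B * Q)\<bar> \<le> L * fd A B"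
    using lipwD[OF l orth_mult[OF AB(1) Q] orth_mult[OF AB(2) Q]] fd_right[OF Q AB[THEN orth_carrier]] by simp
qed

lemma lipw_transpose:
  assumes l: "lipw n L \<phi>"
  shows "lipw n L (\<lambda>A. \<phi> (transpose_mat A))"
proof (rule lipwI[OF lipw_nonneg[OF l]])
  fix A B assume AB: "A \<in> orth n" "B \<in> orth n"
  show "\<bar>\<phi> (transpose_mat A) - \<phi> (transpose_mat B)\<bar> \<le> L * fd A B"
    using lipwD[OF l AB[THEN orth_transpose]] fd_transpose[OF AB[THEN orth_carrier]] by simp
qed

lemma Lip_left [intro]: "\<phi> \<in> Lip n \<Longrightarrow> Q \<in> orth n \<Longrightarrow> (\<lambda>A. \<phi> (Q * A)) \<in> Lip n"
  unfolding Lip_def using lipw_left by blast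

lemma Lip_right [intro]: "\<phi> \<in> Lip n \<Longrightarrow> Q \<in> orth n \<Longrightarrow> (\<lambda>A. \<phi> (A * Q)) \<in> Lip n"
  unfolding Lip_def using lipw_right by blast

lemma Lip_transpose [intro]: "\<phi> \<in> Lip n \<Longrightarrow> (\<lambda>A. \<phi> (transpose_mat A)) \<in> Lip n"
  unfolding Lip_def using lipw_transpose by blast

subsection \<open>A Lipschitz partition of unity\<close>

definition hat :: "real \<Rightarrow> real" where "hat t = max 0 (1 - \<bar>t\<bar>)"

lemma hat_nonneg: "0 \<le> hat t" by (simp add: hat_def)

text \<open>Only the tents at \<open>\<lfloor>u\<rfloor>\<close> and at the next integer can be
  nonzero at \<open>u\<close>, and their values are complementary. At the right end
  \<open>u = K\<close> the second tent would be outside the range, but there it vanishes.\<close>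

lemma hat_sum:
  fixes K :: int
  assumes "\<bar>u\<bar> \<le> of_int K"
  shows "(\<Sum>j\<in>{-K..K}. hat (u - of_int j)) = 1"
proof -
  define a where "a = \<lfloor>u\<rfloor>"
  have a: "of_int a \<le> u" "u < of_int a + 1" unfolding a_def by linarith+
  have lo: "-K \<le> a" using assms a by linarith
  have z: "hat (u - of_int j) = 0" if "j \<noteq> a" "j \<noteq> a + 1" for j
  proof -
    have "j \<le> a - 1 \<or> a + 2 \<le> j" using that by linarith
    then have "real_of_int j \<le> of_int a - 1 \<or> of_int a + 2 \<le> real_of_int j" by linarith
    then show ?thesis using a unfolding hat_def by linarith
  qed
  show ?thesis
  proof (cases "a < K")
    case True
    have "(\<Sum>j\<in>{-K..K}. hat (u - of_int j)) = (\<Sum>j\<in>{a,a+1}. hat (u - of_int j))"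
      by (rule sum.mono_neutral_right) (use True lo z in auto)
    also have "\<dots> = 1" using a by (simp add: hat_def)
    finally show ?thesis .
  next
    case False
    then have e: "u = of_int K" "a = K" using assms a by linarith+
    have "(\<Sum>j\<in>{-K..K}. hat (u - of_int j)) = (\<Sum>j\<in>{K}. hat (u - of_int j))"
      by (rule sum.mono_neutral_right) (use lo z e in auto)
    also have "\<dots> = 1" using e by (simp add: hat_def)
    finally show ?thesis .
  qed
qed

definition pidx :: "nat \<Rightarrow> nat \<Rightarrow> (nat \<times> nat \<Rightarrow> int) set" where
  "pidx n K = PiE ({..<n} \<times> {..<n}) (\<lambda>_. {- int K..int K})"

text \<open>A product of tents, one for each matrix entry, centred at the grid point
  \<open>k / K\<close>. The supports have side \<open>2 / K\<close>, so the index \<open>k\<close>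
  names a small cube of matrices.\<close>

definition pw :: "nat \<Rightarrow> nat \<Rightarrow> (nat \<times> nat \<Rightarrow> int) \<Rightarrow> real mat \<Rightarrow> real" where
  "pw n K k A = (\<Prod>p\<in>{..<n} \<times> {..<n}. hat (real K * A $$ p - of_int (k p)))"

text \<open>The grid point itself is usually not orthogonal, so an orthogonal matrix from the
  support is chosen as representative. For cubes that miss the group the identity is a harmless
  default, since their weight vanishes on \<open>orth n\<close>.\<close>

definition prep :: "nat \<Rightarrow> nat \<Rightarrow> (nat \<times> nat \<Rightarrow> int) \<Rightarrow> real mat" where
  "prep n K k = (if \<exists>R\<in>orth n. pw n K k R \<noteq> 0 then SOME R. R \<in> orth n \<and> pw n K k R \<noteq> 0 else 1\<^sub>m n)"

lemma finite_pidx: "finite (pidx n K)"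
  unfolding pidx_def by (intro finite_PiE) auto

lemma pw_nonneg: "0 \<le> pw n K k A"
  unfolding pw_def by (intro prod_nonneg) (auto simp: hat_nonneg)

lemma pw_Lip: "pw n K k \<in> Lip n"
proof -
  have "(\<lambda>A. \<Prod>p\<in>{..<n} \<times> {..<n}. hat (real K * A $$ p - of_int (k p))) \<in> Lip n"
    unfolding hat_def by (intro Lip_prod Lip_max0_abs Lip_diff Lip_cmult Lip_const) (auto intro: Lip_entry)
  then show ?thesis unfolding pw_def .
qed

lemma pw_sum:
  assumes "A \<in> orth n"
  shows "(\<Sum>k\<in>pidx n K. pw n K k A) = 1"
proof -
  have "(\<Sum>k\<in>pidx n K. pw n K k A) =
      (\<Prod>p\<in>{..<n} \<times> {..<n}. \<Sum>j\<in>{- int K..int K}. hat (real K * A $$ p - of_int j))"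
    unfolding pw_def pidx_def by (rule prod_sum_PiE[symmetric]) auto
  also have "\<dots> = (\<Prod>p\<in>{..<n} \<times> {..<n}. 1)"
  proof (rule prod.cong[OF refl])
    fix p assume p: "p \<in> {..<n} \<times> {..<n}"
    have "\<bar>A $$ p\<bar> \<le> 1" using p orth_entry_le[OF assms] by auto
    then have "\<bar>real K * A $$ p\<bar> \<le> of_int (int K)" by (simp add: abs_mult mult_left_le)
    then show "(\<Sum>j\<in>{- int K..int K}. hat (real K * A $$ p - of_int j)) = 1" by (rule hat_sum)
  qed
  finally show ?thesis by simp
qed

lemma prep_orth: "prep n K k \<in> orth n"
proof (cases "\<exists>R\<in>orth n. pw n K k R \<noteq> 0")
  case True
  then show ?thesis unfolding prep_def using someI_ex[of "\<lambda>R. R \<in> orth n \<and> pw n K k R \<noteq> 0"] by auto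
qed (auto simp: prep_def orth_one)

lemma prep_close:
  assumes A: "A \<in> orth n" and w: "pw n K k A \<noteq> 0" and K: "K > 0"
  shows "fd A (prep n K k) \<le> real n * real n * (2 / real K)"
proof (rule fd_le_entries[OF orth_carrier[OF A]])
  fix i j assume ij: "i < n" "j < n"
  have "\<exists>R. R \<in> orth n \<and> pw n K k R \<noteq> 0" using A w by auto
  then have w': "pw n K k (prep n K k) \<noteq> 0"
    unfolding prep_def using someI_ex[of "\<lambda>R. R \<in> orth n \<and> pw n K k R \<noteq> 0"] by auto
  have "hat (real K * R $$ (i,j) - of_int (k (i,j))) \<noteq> 0" if "pw n K k R \<noteq> 0" for R
    using that ij unfolding pw_def by (auto simp: prod_zero_iff)
  from this[OF w] this[OF w'] have
    "\<bar>real K * A $$ (i,j) - of_int (k (i,j))\<bar> < 1" "\<bar>real K * prep n K k $$ (i,j) - of_int (k (i,j))\<bar> < 1"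
    by (auto simp: hat_def max_def split: if_splits)
  then have "\<bar>real K * A $$ (i,j) - real K * prep n K k $$ (i,j)\<bar> \<le> 2" by linarith
  then have "real K * \<bar>A $$ (i,j) - prep n K k $$ (i,j)\<bar> \<le> 2"
    by (metis abs_mult abs_of_nat right_diff_distrib)
  then show "\<bar>A $$ (i,j) - prep n K k $$ (i,j)\<bar> \<le> 2 / real K"
    using K by (simp add: field_simps)
qed

subsection \<open>Means on Lipschitz functions\<close>

text \<open>A normalised positive linear functional takes the place of a probability measure on the
  group. All laws are required for Lipschitz functions only, and by \<open>eqI\<close> only the
  values on \<open>orth n\<close> matter.\<close>

locale mean =
  fixes n :: nat and lam :: "(real mat \<Rightarrow> real) \<Rightarrow> real"
  assumes add: "\<phi> \<in> Lip n \<Longrightarrow> \<psi> \<in> Lip n \<Longrightarrow> lam (\<lambda>A. \<phi> A + \<psi> A) = lam \<phi> + lam \<psi>"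
    and cmult: "\<phi> \<in> Lip n \<Longrightarrow> lam (\<lambda>A. c * \<phi> A) = c * lam \<phi>"
    and nonneg: "\<phi> \<in> Lip n \<Longrightarrow> (\<And>A. A \<in> orth n \<Longrightarrow> 0 \<le> \<phi> A) \<Longrightarrow> 0 \<le> lam \<phi>"
    and one: "lam (\<lambda>_. 1) = 1"
begin

lemma const: "lam (\<lambda>_. c) = c"
  using cmult[of "\<lambda>_. 1" c] one by simp

lemma cmult_right: "\<phi> \<in> Lip n \<Longrightarrow> lam (\<lambda>A. \<phi> A * c) = lam \<phi> * c"
  using cmult[of \<phi> c] by (simp add: mult.commute)

lemma diff: "\<phi> \<in> Lip n \<Longrightarrow> \<psi> \<in> Lip n \<Longrightarrow> lam (\<lambda>A. \<phi> A - \<psi> A) = lam \<phi> - lam \<psi>"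
  using add[of \<phi> "\<lambda>A. (-1) * \<psi> A"] cmult[of \<psi> "-1"] by simp

lemma mono:
  assumes "\<phi> \<in> Lip n" "\<psi> \<in> Lip n" "\<And>A. A \<in> orth n \<Longrightarrow> \<phi> A \<le> \<psi> A"
  shows "lam \<phi> \<le> lam \<psi>"
  using nonneg[of "\<lambda>A. \<psi> A - \<phi> A"] diff[of \<psi> \<phi>] assms by auto

lemma eqI:
  assumes "\<phi> \<in> Lip n" "\<And>A. A \<in> orth n \<Longrightarrow> \<phi> A = \<psi> A"
  shows "lam \<phi> = lam \<psi>"
proof -
  have "\<psi> \<in> Lip n" using assms Lip_cong[of n \<phi> \<psi>] by auto
  then show ?thesis using assms by (intro antisym mono) auto
qed

lemma sum:
  "(\<And>k. k \<in> K \<Longrightarrow> \<phi> k \<in> Lip n) \<Longrightarrow> lam (\<lambda>A. \<Sum>k\<in>K. \<phi> k A) = (\<Sum>k\<in>K. lam (\<phi> k))"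
  by (induction K rule: infinite_finite_induct) (auto simp: const add Lip_sum)

lemma abs_diff_le:
  assumes "\<phi> \<in> Lip n" "\<psi> \<in> Lip n" "\<And>A. A \<in> orth n \<Longrightarrow> \<bar>\<phi> A - \<psi> A\<bar> \<le> b"
  shows "\<bar>lam \<phi> - lam \<psi>\<bar> \<le> b"
proof -
  have "lam \<phi> \<le> lam (\<lambda>A. \<psi> A + b)" using assms by (intro mono) (auto simp: abs_le_iff algebra_simps)
  moreover have "lam \<psi> \<le> lam (\<lambda>A. \<phi> A + b)" using assms by (intro mono) (auto simp: abs_le_iff algebra_simps)
  ultimately show ?thesis using assms by (auto simp: add const abs_le_iff)
qed

lemma abs_le:
  assumes "\<phi> \<in> Lip n" "\<And>A. A \<in> orth n \<Longrightarrow> \<bar>\<phi> A\<bar> \<le> b"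
  shows "\<bar>lam \<phi>\<bar> \<le> b"
  using abs_diff_le[of \<phi> "\<lambda>_. 0" b] assms by (simp add: const)

lemma Cauchy_Schwarz:
  assumes "\<phi> \<in> Lip n" "\<psi> \<in> Lip n"
  shows "(lam (\<lambda>A. \<phi> A * \<psi> A))\<^sup>2 \<le> lam (\<lambda>A. (\<phi> A)\<^sup>2) * lam (\<lambda>A. (\<psi> A)\<^sup>2)"
proof -
  define a b c where "a = lam (\<lambda>A. (\<phi> A)\<^sup>2)" and "b = lam (\<lambda>A. \<phi> A * \<psi> A)" and "c = lam (\<lambda>A. (\<psi> A)\<^sup>2)"
  have q: "0 \<le> a + 2 * t * b + t\<^sup>2 * c" for t
  proof -
    have "0 \<le> lam (\<lambda>A. (\<phi> A + t * \<psi> A)\<^sup>2)" using assms by (intro nonneg) auto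
    also have "(\<lambda>A. (\<phi> A + t * \<psi> A)\<^sup>2) = (\<lambda>A. ((\<phi> A)\<^sup>2 + (2 * t) * (\<phi> A * \<psi> A)) + t\<^sup>2 * (\<psi> A)\<^sup>2)"
      by (auto simp: power2_eq_square algebra_simps)
    also have "lam \<dots> = a + 2 * t * b + t\<^sup>2 * c"
      using assms by (subst add add cmult, auto simp: cmult a_def b_def c_def)+
    finally show ?thesis .
  qed
  have c0: "0 \<le> c" unfolding c_def using assms by (intro nonneg) auto
  have a0: "0 \<le> a" unfolding a_def using assms by (intro nonneg) auto
  have "b\<^sup>2 \<le> a * c"
  proof (cases "c = 0")
    case True
    have "b = 0"
    proof (rule ccontr)
      assume "b \<noteq> 0"
      \<comment> \<open>With \<open>c = 0\<close> the quadratic is linear in \<open>t\<close>; at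
        this \<open>t\<close> it takes the value \<open>-1\<close>.\<close>
      then have "2 * (- (a + 1) / (2 * b)) * b = - (a + 1)" by (simp add: field_simps)
      then show False using q[of "- (a + 1) / (2 * b)"] True by simp
    qed
    then show ?thesis using True by simp
  next
    case False
    then have "0 \<le> a - b\<^sup>2 / c"
      using q[of "- b / c"] by (simp add: power2_eq_square field_simps)
    then show ?thesis using False c0 by (simp add: field_simps)
  qed
  then show ?thesis by (simp add: a_def b_def c_def)
qed

lemma sq_nonneg: "\<phi> \<in> Lip n \<Longrightarrow> 0 \<le> lam (\<lambda>A. (\<phi> A)\<^sup>2)"
  by (rule nonneg) auto

end

section \<open>Functions of two group variables and the interchange of means\<close>

definition jlip :: "nat \<Rightarrow> nat \<Rightarrow> (real mat \<Rightarrow> real mat \<Rightarrow> real) \<Rightarrow> bool" where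
  "jlip m n \<Phi> \<longleftrightarrow> (\<exists>L\<ge>0. \<forall>g\<in>orth m. \<forall>g'\<in>orth m. \<forall>Z\<in>orth n. \<forall>Z'\<in>orth n.
     \<bar>\<Phi> g Z - \<Phi> g' Z'\<bar> \<le> L * (fd g g' + fd Z Z'))"

lemma jlip_swap: "jlip m n \<Phi> \<Longrightarrow> jlip n m (\<lambda>Z g. \<Phi> g Z)"
  unfolding jlip_def by (metis add.commute)

lemma jlip_fst: "jlip m n \<Phi> \<Longrightarrow> Z \<in> orth n \<Longrightarrow> (\<lambda>g. \<Phi> g Z) \<in> Lip m"
proof -
  assume j: "jlip m n \<Phi>" and Z: "Z \<in> orth n"
  obtain L where L: "L \<ge> 0" "\<forall>g\<in>orth m. \<forall>g'\<in>orth m. \<forall>Z\<in>orth n. \<forall>Z'\<in>orth n.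
     \<bar>\<Phi> g Z - \<Phi> g' Z'\<bar> \<le> L * (fd g g' + fd Z Z')" using j by (auto simp: jlip_def)
  have "lipw m L (\<lambda>g. \<Phi> g Z)"
    by (rule lipwI[OF L(1)]) (use L(2) Z fd_self[of Z] in force)
  then show ?thesis by (rule LipI)
qed

lemma jlip_snd: "jlip m n \<Phi> \<Longrightarrow> g \<in> orth m \<Longrightarrow> \<Phi> g \<in> Lip n"
  by (rule jlip_fst[where \<Phi> = "\<lambda>Z g. \<Phi> g Z", simplified], rule jlip_swap)

lemma jlip_mean_snd:
  assumes "mean n lam" "jlip m n \<Phi>"
  shows "(\<lambda>g. lam (\<Phi> g)) \<in> Lip m"
proof -
  interpret mean n lam by fact
  obtain L where L: "L \<ge> 0" "\<forall>g\<in>orth m. \<forall>g'\<in>orth m. \<forall>Z\<in>orth n. \<forall>Z'\<in>orth n.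
     \<bar>\<Phi> g Z - \<Phi> g' Z'\<bar> \<le> L * (fd g g' + fd Z Z')" using assms(2) by (auto simp: jlip_def)
  have "lipw m L (\<lambda>g. lam (\<Phi> g))"
  proof (rule lipwI[OF L(1)])
    fix g g' assume g: "g \<in> orth m" "g' \<in> orth m"
    show "\<bar>lam (\<Phi> g) - lam (\<Phi> g')\<bar> \<le> L * fd g g'"
    proof (rule abs_diff_le)
      fix Z assume "Z \<in> orth n"
      then show "\<bar>\<Phi> g Z - \<Phi> g' Z\<bar> \<le> L * fd g g'" using L(2) g fd_self[of Z] by force
    qed (use jlip_snd[OF assms(2)] g in auto)
  qed
  then show ?thesis by (rule LipI)
qed

lemma jlip_mean_fst:
  "mean m lam \<Longrightarrow> jlip m n \<Phi> \<Longrightarrow> (\<lambda>Z. lam (\<lambda>g. \<Phi> g Z)) \<in> Lip n"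
  by (rule jlip_mean_snd[where \<Phi> = "\<lambda>Z g. \<Phi> g Z"], assumption, rule jlip_swap)

text \<open>Interchange of two means: replace \<open>\<Phi>\<close> by a finite sum of products, using the partition of unity
  in the first variable.\<close>

lemma mean_swap:
  assumes M1: "mean m lam1" and M2: "mean n lam2" and J: "jlip m n \<Phi>"
  shows "lam1 (\<lambda>g. lam2 (\<lambda>Z. \<Phi> g Z)) = lam2 (\<lambda>Z. lam1 (\<lambda>g. \<Phi> g Z))"
proof -
  interpret M1: mean m lam1 by fact
  interpret M2: mean n lam2 by fact
  obtain L where L: "L \<ge> 0" "\<And>g g' Z Z'. g\<in>orth m \<Longrightarrow> g'\<in>orth m \<Longrightarrow> Z\<in>orth n \<Longrightarrow> Z'\<in>orth n \<Longrightarrow>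
     \<bar>\<Phi> g Z - \<Phi> g' Z'\<bar> \<le> L * (fd g g' + fd Z Z')" using J by (auto simp: jlip_def)
  have "\<bar>lam1 (\<lambda>g. lam2 (\<lambda>Z. \<Phi> g Z)) - lam2 (\<lambda>Z. lam1 (\<lambda>g. \<Phi> g Z))\<bar> \<le> e" if "e > 0" for e
  proof -
    define b where "b = L * (real m * real m * 2) / (e / 2)"
    obtain K :: nat where K: "b < real K" "K > 0"
      by (metis reals_Archimedean2 gr0I less_le_trans of_nat_0 of_nat_0_le_iff max_less_iff_conj
          of_nat_less_iff less_trans linorder_not_less nle_le of_nat_less_0_iff)
    have Kb: "L * (real m * real m * (2 / real K)) \<le> e / 2"
      using K that unfolding b_def by (simp add: field_simps)
    define \<Psi> where "\<Psi> g Z = (\<Sum>k\<in>pidx m K. pw m K k g * \<Phi> (prep m K k) Z)" for g Z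
    have close: "\<bar>\<Phi> g Z - \<Psi> g Z\<bar> \<le> e / 2" if g: "g \<in> orth m" and Z: "Z \<in> orth n" for g Z
    proof -
      have "\<Phi> g Z - \<Psi> g Z = (\<Sum>k\<in>pidx m K. pw m K k g) * \<Phi> g Z - \<Psi> g Z" using pw_sum[OF g] by simp
      also have "\<dots> = (\<Sum>k\<in>pidx m K. pw m K k g * (\<Phi> g Z - \<Phi> (prep m K k) Z))"
        unfolding \<Psi>_def by (simp add: sum_distrib_right right_diff_distrib sum_subtractf)
      also have "\<bar>\<dots>\<bar> \<le> (\<Sum>k\<in>pidx m K. pw m K k g * (e / 2))"
      proof (rule order.trans[OF sum_abs sum_mono])
        fix k assume "k \<in> pidx m K"
        show "\<bar>pw m K k g * (\<Phi> g Z - \<Phi> (prep m K k) Z)\<bar> \<le> pw m K k g * (e / 2)"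
        proof (cases "pw m K k g = 0")
          case False
          have "\<bar>\<Phi> g Z - \<Phi> (prep m K k) Z\<bar> \<le> L * (fd g (prep m K k) + fd Z Z)"
            by (rule L(2)[OF g prep_orth Z Z])
          also have "\<dots> \<le> L * (real m * real m * (2 / real K))"
            using prep_close[OF g False K(2)] L(1) by (intro mult_left_mono) (auto simp: fd_self)
          finally have "\<bar>\<Phi> g Z - \<Phi> (prep m K k) Z\<bar> \<le> e / 2" using Kb by linarith
          then show ?thesis unfolding abs_mult using pw_nonneg[of m K k g] by (simp only: abs_of_nonneg mult_left_mono)
        qed simp
      qed
      also have "\<dots> = e / 2" using pw_sum[OF g, of K] by (simp only: sum_distrib_right[symmetric] mult_1)
      finally show ?thesis .
    qed
    have Lr: "\<Phi> (prep m K k) \<in> Lip n" for k by (rule jlip_snd[OF J prep_orth])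
    have L1: "\<Psi> g \<in> Lip n" for g unfolding \<Psi>_def using Lr by (intro Lip_sum Lip_cmult) auto
    have L2: "(\<lambda>g. \<Psi> g Z) \<in> Lip m" for Z
      unfolding \<Psi>_def by (intro Lip_sum Lip_mult pw_Lip Lip_const)
    define s where "s = (\<Sum>k\<in>pidx m K. lam1 (pw m K k) * lam2 (\<Phi> (prep m K k)))"
    have e1: "lam2 (\<Psi> g) = (\<Sum>k\<in>pidx m K. pw m K k g * lam2 (\<Phi> (prep m K k)))" for g
      unfolding \<Psi>_def using Lr by (subst M2.sum) (auto simp: M2.cmult)
    have "lam1 (\<lambda>g. lam2 (\<Psi> g)) = s"
      unfolding e1 s_def by (subst M1.sum) (auto simp: M1.cmult_right[OF pw_Lip] intro!: Lip_mult pw_Lip sum.cong)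
    moreover have e2: "lam1 (\<lambda>g. \<Psi> g Z) = (\<Sum>k\<in>pidx m K. lam1 (pw m K k) * \<Phi> (prep m K k) Z)" for Z
      unfolding \<Psi>_def by (subst M1.sum) (auto simp: M1.cmult_right[OF pw_Lip] intro!: Lip_mult pw_Lip sum.cong)
    have "lam2 (\<lambda>Z. lam1 (\<lambda>g. \<Psi> g Z)) = s"
      unfolding e2 s_def using Lr by (subst M2.sum) (auto simp: M2.cmult)
    moreover have "\<bar>lam1 (\<lambda>g. lam2 (\<Phi> g)) - lam1 (\<lambda>g. lam2 (\<Psi> g))\<bar> \<le> e / 2"
    proof (rule M1.abs_diff_le[OF jlip_mean_snd[OF M2 J]])
      show "(\<lambda>g. lam2 (\<Psi> g)) \<in> Lip m" unfolding e1 by (intro Lip_sum Lip_mult pw_Lip Lip_const)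
      show "\<bar>lam2 (\<Phi> g) - lam2 (\<Psi> g)\<bar> \<le> e / 2" if "g \<in> orth m" for g
        by (rule M2.abs_diff_le[OF jlip_snd[OF J that] L1 close[OF that]])
    qed
    moreover have "\<bar>lam2 (\<lambda>Z. lam1 (\<lambda>g. \<Phi> g Z)) - lam2 (\<lambda>Z. lam1 (\<lambda>g. \<Psi> g Z))\<bar> \<le> e / 2"
    proof (rule M2.abs_diff_le[OF jlip_mean_fst[OF M1 J]])
      show "(\<lambda>Z. lam1 (\<lambda>g. \<Psi> g Z)) \<in> Lip n" unfolding e2 using Lr by (intro Lip_sum Lip_cmult) auto
      show "\<bar>lam1 (\<lambda>g. \<Phi> g Z) - lam1 (\<lambda>g. \<Psi> g Z)\<bar> \<le> e / 2" if "Z \<in> orth n" for Z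
        by (rule M1.abs_diff_le[OF jlip_fst[OF J that] L2 close[OF _ that]])
    qed
    ultimately show ?thesis by linarith
  qed
  then show ?thesis by (metis abs_le_zero_iff eq_iff_diff_eq_0 field_le_epsilon add_0)
qed

section \<open>Invariant means: invariance on one side implies it on the other\<close>

locale haar = mean +
  assumes left: "\<phi> \<in> Lip n \<Longrightarrow> Q \<in> orth n \<Longrightarrow> lam (\<lambda>A. \<phi> (Q * A)) = lam \<phi>"
    and right: "\<phi> \<in> Lip n \<Longrightarrow> Q \<in> orth n \<Longrightarrow> lam (\<lambda>A. \<phi> (A * Q)) = lam \<phi>"

lemma jlip_mult:
  assumes "\<phi> \<in> Lip n"
  shows "jlip n n (\<lambda>g Z. \<phi> (g * Z))"
proof -
  obtain L where L: "lipw n L \<phi>" using assms by (auto simp: Lip_def)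
  show ?thesis unfolding jlip_def
  proof (intro exI[of _ L] conjI ballI lipw_nonneg[OF L])
    fix g g' Z Z' assume a: "g \<in> orth n" "g' \<in> orth n" "Z \<in> orth n" "Z' \<in> orth n"
    have "\<bar>\<phi> (g * Z) - \<phi> (g' * Z')\<bar> \<le> L * fd (g * Z) (g' * Z')"
      by (intro lipwD[OF L] orth_mult a)
    also have "fd (g * Z) (g' * Z') \<le> fd (g * Z) (g' * Z) + fd (g' * Z) (g' * Z')"
      using a[THEN orth_carrier] by (intro fd_triangle[of _ n n]) auto
    also have "\<dots> = fd g g' + fd Z Z'"
      using a[THEN orth_carrier] by (simp add: fd_right[OF a(3)] fd_left[OF a(2)])
    finally show "\<bar>\<phi> (g * Z) - \<phi> (g' * Z')\<bar> \<le> L * (fd g g' + fd Z Z')"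
      using lipw_nonneg[OF L] by (simp add: mult_left_mono)
  qed
qed

lemma jlip_comp:
  assumes "jlip m n \<Phi>" "\<And>g. g \<in> orth k \<Longrightarrow> f g \<in> orth m" "0 \<le> c"
    and "\<And>g g'. g \<in> orth k \<Longrightarrow> g' \<in> orth k \<Longrightarrow> fd (f g) (f g') \<le> c * fd g g'"
  shows "jlip k n (\<lambda>g Z. \<Phi> (f g) Z)"
proof -
  obtain L where L: "L \<ge> 0" "\<And>g g' Z Z'. g\<in>orth m \<Longrightarrow> g'\<in>orth m \<Longrightarrow> Z\<in>orth n \<Longrightarrow> Z'\<in>orth n \<Longrightarrow>
     \<bar>\<Phi> g Z - \<Phi> g' Z'\<bar> \<le> L * (fd g g' + fd Z Z')" using assms(1) by (auto simp: jlip_def)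
  show ?thesis unfolding jlip_def
  proof (intro exI[of _ "L * (c + 1)"] conjI ballI)
    show "0 \<le> L * (c + 1)" using L assms(3) by simp
    fix g g' Z Z' assume a: "g \<in> orth k" "g' \<in> orth k" "Z \<in> orth n" "Z' \<in> orth n"
    have "\<bar>\<Phi> (f g) Z - \<Phi> (f g') Z'\<bar> \<le> L * (fd (f g) (f g') + fd Z Z')"
      by (intro L assms(2) a)
    also have "\<dots> \<le> L * ((c + 1) * (fd g g' + fd Z Z'))"
    proof (intro mult_left_mono L(1))
      have "fd (f g) (f g') + fd Z Z' \<le> c * fd g g' + fd Z Z'" using assms(4)[OF a(1,2)] by simp
      also have "\<dots> \<le> (c + 1) * (fd g g' + fd Z Z')"
        using assms(3) by (simp add: algebra_simps fd_nonneg)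
      finally show "fd (f g) (f g') + fd Z Z' \<le> (c + 1) * (fd g g' + fd Z Z')" .
    qed
    finally show "\<bar>\<Phi> (f g) Z - \<Phi> (f g') Z'\<bar> \<le> L * (c + 1) * (fd g g' + fd Z Z')" by simp
  qed
qed

text \<open>Evaluate the double mean of \<open>\<phi> (g^T Z)\<close> in both orders. The inner mean
  over \<open>Z\<close> gives \<open>lam \<phi>\<close> by left invariance; the inner mean over
  \<open>g\<close>, with the argument read as the transpose of \<open>Z^T g\<close>, gives the mean
  of \<open>\<phi>\<close> composed with transposition.\<close>

lemma mean_left_transpose:
  assumes m: "mean n lam"
    and left: "\<And>\<phi> Q. \<phi> \<in> Lip n \<Longrightarrow> Q \<in> orth n \<Longrightarrow> lam (\<lambda>A. \<phi> (Q * A)) = lam \<phi>"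
    and \<phi>: "\<phi> \<in> Lip n"
  shows "lam (\<lambda>A. \<phi> (transpose_mat A)) = lam \<phi>"
proof -
  interpret mean n lam by fact
  have J: "jlip n n (\<lambda>g Z. \<phi> (transpose_mat g * Z))"
    by (rule jlip_comp[OF jlip_mult[OF \<phi>], of n transpose_mat 1])
      (auto simp: orth_transpose fd_transpose[OF orth_carrier orth_carrier])
  have "lam (\<lambda>g. lam (\<lambda>Z. \<phi> (transpose_mat g * Z))) = lam (\<lambda>_. lam \<phi>)"
  proof (rule eqI[OF jlip_mean_snd[OF m J]])
    show "lam (\<lambda>Z. \<phi> (transpose_mat g * Z)) = lam \<phi>" if "g \<in> orth n" for g
      by (rule left[OF \<phi> orth_transpose[OF that]])
  qed
  moreover have "lam (\<lambda>Z. lam (\<lambda>g. \<phi> (transpose_mat g * Z))) = lam (\<lambda>_. lam (\<lambda>A. \<phi> (transpose_mat A)))"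
  proof (rule eqI[OF jlip_mean_fst[OF m J]])
    fix Z assume Z: "Z \<in> orth n"
    have "lam (\<lambda>g. \<phi> (transpose_mat g * Z)) = lam (\<lambda>g. \<phi> (transpose_mat (transpose_mat Z * g)))"
    proof (rule eqI[OF jlip_fst[OF J Z]])
      fix g assume "g \<in> orth n"
      then show "\<phi> (transpose_mat g * Z) = \<phi> (transpose_mat (transpose_mat Z * g))"
        using Z[THEN orth_carrier] by (subst transpose_mult[of _ n n]) (auto dest: orth_carrier)
    qed
    also have "\<dots> = lam (\<lambda>A. \<phi> (transpose_mat A))"
      by (rule left[OF Lip_transpose[OF \<phi>] orth_transpose[OF Z]])
    finally show "lam (\<lambda>g. \<phi> (transpose_mat g * Z)) = lam (\<lambda>A. \<phi> (transpose_mat A))" .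
  qed
  ultimately show ?thesis using mean_swap[OF m m J] by (simp add: const)
qed

lemma haarI_left:
  assumes m: "mean n lam"
    and left: "\<And>\<phi> Q. \<phi> \<in> Lip n \<Longrightarrow> Q \<in> orth n \<Longrightarrow> lam (\<lambda>A. \<phi> (Q * A)) = lam \<phi>"
  shows "haar n lam"
proof -
  interpret mean n lam by fact
  have tr: "lam (\<lambda>A. \<phi> (transpose_mat A)) = lam \<phi>" if "\<phi> \<in> Lip n" for \<phi>
    by (rule mean_left_transpose[OF m _ that]) (rule left)
  show ?thesis
  proof
    show "lam (\<lambda>A. \<phi> (Q * A)) = lam \<phi>" if "\<phi> \<in> Lip n" "Q \<in> orth n" for \<phi> Q by (rule left[OF that])
    fix \<phi> Q assume p: "\<phi> \<in> Lip n" and Q: "Q \<in> orth n"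
    have "lam (\<lambda>A. \<phi> (A * Q)) = lam (\<lambda>A. \<phi> (transpose_mat A * Q))"
      by (rule tr[symmetric]) (use p Q in auto)
    also have "\<dots> = lam (\<lambda>A. \<phi> (transpose_mat (transpose_mat Q * A)))"
    proof (rule eqI)
      show "(\<lambda>A. \<phi> (transpose_mat A * Q)) \<in> Lip n" by (rule Lip_transpose[OF Lip_right[OF p Q]])
      fix A assume "A \<in> orth n"
      then show "\<phi> (transpose_mat A * Q) = \<phi> (transpose_mat (transpose_mat Q * A))"
        using Q[THEN orth_carrier] by (subst transpose_mult[of _ n n]) (auto dest: orth_carrier)
    qed
    also have "\<dots> = lam (\<lambda>A. \<phi> (transpose_mat A))"
      by (rule left[OF Lip_transpose[OF p] orth_transpose[OF Q]])
    also have "\<dots> = lam \<phi>" by (rule tr[OF p])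
    finally show "lam (\<lambda>A. \<phi> (A * Q)) = lam \<phi>" .
  qed
qed

text \<open>Transposition turns the right invariant mean into the left invariant
  \<open>lam'\<close>, which is itself invariant under transposition; hence both means agree on
  Lipschitz functions.\<close>

lemma haarI_right:
  assumes m: "mean n lam"
    and right: "\<And>\<phi> Q. \<phi> \<in> Lip n \<Longrightarrow> Q \<in> orth n \<Longrightarrow> lam (\<lambda>A. \<phi> (A * Q)) = lam \<phi>"
  shows "haar n lam"
proof -
  interpret mean n lam by fact
  define lam' where "lam' \<phi> = lam (\<lambda>A. \<phi> (transpose_mat A))" for \<phi> :: "real mat \<Rightarrow> real"
  have m': "mean n lam'"
    by unfold_locales (auto simp: lam'_def add cmult one Lip_transpose orth_transpose intro!: nonneg)
  have left': "lam' (\<lambda>A. \<phi> (Q * A)) = lam' \<phi>" if p: "\<phi> \<in> Lip n" and Q: "Q \<in> orth n" for \<phi> Q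
  proof -
    have "lam (\<lambda>A. \<phi> (Q * transpose_mat A)) = lam (\<lambda>A. \<phi> (transpose_mat (A * transpose_mat Q)))"
    proof (rule eqI)
      show "(\<lambda>A. \<phi> (Q * transpose_mat A)) \<in> Lip n" by (rule Lip_transpose[OF Lip_left[OF p Q]])
      fix A assume "A \<in> orth n"
      then show "\<phi> (Q * transpose_mat A) = \<phi> (transpose_mat (A * transpose_mat Q))"
        using Q[THEN orth_carrier] by (subst transpose_mult[of _ n n]) (auto dest: orth_carrier)
    qed
    then show ?thesis unfolding lam'_def
      using right[OF Lip_transpose[OF p] orth_transpose[OF Q]] by simp
  qed
  have e: "lam \<phi> = lam' \<phi>" if p: "\<phi> \<in> Lip n" for \<phi>
  proof -
    have "lam' (\<lambda>A. \<phi> (transpose_mat A)) = lam' \<phi>"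
      by (rule mean_left_transpose[OF m' _ p]) (rule left')
    then show ?thesis by (simp add: lam'_def)
  qed
  interpret h: haar n lam' by (rule haarI_left[OF m']) (rule left')
  show ?thesis
    by unfold_locales (auto simp: e Lip_left Lip_right h.left h.right)
qed

subsection \<open>The circle\<close>

definition rot2 :: "real \<Rightarrow> real mat" where
  "rot2 t = mat 2 2 (\<lambda>(i,j). if i = 0 then (if j = 0 then cos t else - sin t) else (if j = 0 then sin t else cos t))"

definition flip2 :: "real mat" where
  "flip2 = mat 2 2 (\<lambda>(i,j). if i = j then (if i = 0 then 1 else -1) else 0)"

lemma rot2_carrier [simp]: "rot2 t \<in> carrier_mat 2 2" by (simp add: rot2_def)
lemma flip2_carrier [simp]: "flip2 \<in> carrier_mat 2 2" by (simp add: flip2_def)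

lemma mat2_eqI:
  assumes "A \<in> carrier_mat 2 2" "B \<in> carrier_mat 2 2"
    "A $$ (0,0) = B $$ (0,0)" "A $$ (0,1) = B $$ (0,1)" "A $$ (1,0) = B $$ (1,0)" "A $$ (1,1) = B $$ (1,1)"
  shows "A = B"
  by (rule eq_matI) (use assms in \<open>auto simp: less_2_cases_iff\<close>)

lemma mult2_index:
  assumes "A \<in> carrier_mat 2 2" "B \<in> carrier_mat 2 m" "i < 2" "j < m"
  shows "(A * B) $$ (i,j) = A $$ (i,0) * B $$ (0,j) + A $$ (i,1) * B $$ (1,j)"
  using mult_index_sum[OF assms] by (simp add: numeral_2_eq_2)

lemma mult22_index [simp]:
  assumes "A \<in> carrier_mat 2 2" "B \<in> carrier_mat 2 2"
  shows "(A * B) $$ (0,0) = A $$ (0,0) * B $$ (0,0) + A $$ (0,Suc 0) * B $$ (Suc 0,0)"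
    "(A * B) $$ (0,Suc 0) = A $$ (0,0) * B $$ (0,Suc 0) + A $$ (0,Suc 0) * B $$ (Suc 0,Suc 0)"
    "(A * B) $$ (Suc 0,0) = A $$ (Suc 0,0) * B $$ (0,0) + A $$ (Suc 0,Suc 0) * B $$ (Suc 0,0)"
    "(A * B) $$ (Suc 0,Suc 0) = A $$ (Suc 0,0) * B $$ (0,Suc 0) + A $$ (Suc 0,Suc 0) * B $$ (Suc 0,Suc 0)"
  using assms by (simp_all add: mult2_index[of A B 2] del: index_mult_mat)

lemma mult22_carrier [simp]: "A \<in> carrier_mat 2 2 \<Longrightarrow> B \<in> carrier_mat 2 2 \<Longrightarrow> A * B \<in> carrier_mat 2 2"
  by (rule mult_carrier_mat)

lemma rot2_index [simp]: "rot2 t $$ (0,0) = cos t" "rot2 t $$ (0,Suc 0) = - sin t" "rot2 t $$ (Suc 0,0) = sin t" "rot2 t $$ (Suc 0,Suc 0) = cos t"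
  by (auto simp: rot2_def)
lemma flip2_index [simp]: "flip2 $$ (0,0) = 1" "flip2 $$ (0,Suc 0) = 0" "flip2 $$ (Suc 0,0) = 0" "flip2 $$ (Suc 0,Suc 0) = -1"
  by (auto simp: flip2_def)

lemma rot2_add: "rot2 s * rot2 t = rot2 (s + t)"
  by (rule mat2_eqI) (auto simp: cos_add sin_add)

lemma flip2_rot2: "flip2 * rot2 t = rot2 (- t) * flip2"
  by (rule mat2_eqI) auto

lemma flip2_flip2: "flip2 * flip2 = 1\<^sub>m 2"
  by (rule mat2_eqI) auto

lemma rot2_0: "rot2 0 = 1\<^sub>m 2"
  by (rule mat2_eqI) auto

lemma rot2_2pi: "rot2 (t + 2 * pi) = rot2 t"
  by (rule mat2_eqI) auto

lemma sum_lt2: "(\<Sum>k<(2::nat). f k) = f 0 + f (Suc 0)"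
  by (simp add: numeral_2_eq_2)

lemma rot2_orth: "rot2 t \<in> orth 2"
  by (rule orth_I) (auto simp: sum_lt2 less_2_cases_iff power2_eq_square[symmetric])

lemma flip2_orth: "flip2 \<in> orth 2"
  by (rule orth_I) (auto simp: sum_lt2 less_2_cases_iff)

text \<open>With \<open>d\<close> the determinant, the second column is \<open>d\<close> times the
  first column turned by a right angle, and \<open>d\<close> is \<open>1\<close> or
  \<open>-1\<close>; the first column is a point of the circle and supplies the angle.\<close>

lemma orth2_cases:
  assumes g: "g \<in> orth 2"
  obtains t where "0 \<le> t" "t < 2 * pi" "g = rot2 t" | t where "0 \<le> t" "t < 2 * pi" "g = rot2 t * flip2"
proof -
  have c: "g \<in> carrier_mat 2 2" by (rule orth_carrier[OF g])
  define a b x y where "a = g $$ (0,0)" and "b = g $$ (0,1)" and "x = g $$ (1,0)" and "y = g $$ (1,1)"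
  have col: "a\<^sup>2 + x\<^sup>2 = 1" "a * b + x * y = 0" "b\<^sup>2 + y\<^sup>2 = 1"
    using orth_col_inner[OF g, of 0 0] orth_col_inner[OF g, of 0 1] orth_col_inner[OF g, of 1 1]
    by (simp_all add: sum_lt2 a_def b_def x_def y_def power2_eq_square)
  define d where "d = a * y - b * x"
  have d: "b = - d * x" "y = d * a"
  proof -
    have "b + d * x = b * (1 - x\<^sup>2) + a * x * y" by (simp add: d_def power2_eq_square algebra_simps)
    also have "1 - x\<^sup>2 = a\<^sup>2" using col by simp
    also have "b * a\<^sup>2 + a * x * y = a * (a * b + x * y)" by (simp add: power2_eq_square algebra_simps)
    finally show "b = - d * x" using col by simp
    have "y - d * a = y * (1 - a\<^sup>2) + a * b * x" by (simp add: d_def power2_eq_square algebra_simps)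
    also have "1 - a\<^sup>2 = x\<^sup>2" using col by simp
    also have "y * x\<^sup>2 + a * b * x = x * (a * b + x * y)" by (simp add: power2_eq_square algebra_simps)
    finally show "y = d * a" using col by simp
  qed
  have "d\<^sup>2 * (a\<^sup>2 + x\<^sup>2) = 1" using col(3) d by (simp add: power2_eq_square algebra_simps)
  then have "d\<^sup>2 = 1" using col by simp
  then have dd: "d = 1 \<or> d = -1" using power2_eq_1_iff by blast
  obtain t where t: "0 \<le> t" "t < 2 * pi" "a = cos t" "x = sin t"
    using sincos_total_2pi[OF col(1)] by metis
  from dd show thesis
  proof
    assume "d = 1"
    then have "g = rot2 t" using c d t by (intro mat2_eqI) (auto simp: a_def b_def x_def y_def)
    then show thesis using that(1) t by blast
  next
    assume "d = -1"
    then have "g = rot2 t * flip2" using c d t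
      by (intro mat2_eqI) (auto simp: a_def b_def x_def y_def)
    then show thesis using that(2) t by blast
  qed
qed

lemma sin_cos_lipschitz:
  fixes x y :: real
  shows "\<bar>sin x - sin y\<bar> \<le> \<bar>x - y\<bar>" "\<bar>cos x - cos y\<bar> \<le> \<bar>x - y\<bar>"
proof -
  have h: "\<bar>sin ((x - y) / 2)\<bar> \<le> \<bar>x - y\<bar> / 2" using abs_sin_x_le_abs_x[of "(x - y) / 2"] by simp
  have "\<bar>sin x - sin y\<bar> = 2 * \<bar>sin ((x - y) / 2)\<bar> * \<bar>cos ((x + y) / 2)\<bar>" by (simp add: sin_diff_sin abs_mult)
  also have "\<dots> \<le> 2 * \<bar>sin ((x - y) / 2)\<bar> * 1" by (intro mult_left_mono) auto
  also have "\<dots> \<le> \<bar>x - y\<bar>" using h by simp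
  finally show "\<bar>sin x - sin y\<bar> \<le> \<bar>x - y\<bar>" .
  have "\<bar>cos x - cos y\<bar> = 2 * \<bar>sin ((y - x) / 2)\<bar> * \<bar>sin ((x + y) / 2)\<bar>" by (simp add: cos_diff_cos abs_mult)
  also have "\<dots> \<le> 2 * \<bar>sin ((y - x) / 2)\<bar> * 1" by (intro mult_left_mono) auto
  also have "\<bar>sin ((y - x) / 2)\<bar> = \<bar>sin ((x - y) / 2)\<bar>"
  proof -
    have "(y - x) / 2 = - ((x - y) / 2)" by (simp add: field_simps)
    then show ?thesis by (simp only: sin_minus abs_minus_cancel)
  qed
  also have "2 * \<bar>sin ((x - y) / 2)\<bar> * 1 \<le> \<bar>x - y\<bar>" using h by simp
  finally show "\<bar>cos x - cos y\<bar> \<le> \<bar>x - y\<bar>" .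
qed

lemma fd_rot2: "fd (rot2 s) (rot2 t) \<le> 4 * \<bar>s - t\<bar>"
proof -
  have "fd (rot2 s) (rot2 t) \<le> real 2 * real 2 * \<bar>s - t\<bar>"
    by (rule fd_le_entries[of _ 2 2]) (use sin_cos_lipschitz[of s t] in \<open>auto simp: less_2_cases_iff\<close>)
  then show ?thesis by simp
qed

lemma Lip_rot2_continuous:
  assumes "\<phi> \<in> Lip 2"
  shows "continuous_on A (\<lambda>t. \<phi> (rot2 t))"
proof -
  obtain L where L: "lipw 2 L \<phi>" using assms by (auto simp: Lip_def)
  have "(L * 4)-lipschitz_on A (\<lambda>t. \<phi> (rot2 t))"
  proof (rule lipschitz_onI)
    fix s t
    have "\<bar>\<phi> (rot2 s) - \<phi> (rot2 t)\<bar> \<le> L * fd (rot2 s) (rot2 t)" by (intro lipwD[OF L] rot2_orth)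
    also have "\<dots> \<le> L * (4 * \<bar>s - t\<bar>)" by (intro mult_left_mono fd_rot2 lipw_nonneg[OF L])
    finally show "dist (\<phi> (rot2 s)) (\<phi> (rot2 t)) \<le> L * 4 * dist s t" by (simp add: dist_real_def)
  qed (use lipw_nonneg[OF L] in auto)
  then show ?thesis by (rule lipschitz_on_continuous_on)
qed

text \<open>The group \<open>O(2)\<close> consists of two circles, the rotations and the rotations
  followed by \<open>flip2\<close>; their total length \<open>4 * pi\<close> is the
  normalisation.\<close>

definition cmean :: "(real mat \<Rightarrow> real) \<Rightarrow> real" where
  "cmean \<phi> = (1 / (4 * pi)) * integral {0..2*pi} (\<lambda>t. \<phi> (rot2 t) + \<phi> (rot2 t * flip2))"

lemma integral_periodic_shift:
  fixes h :: "real \<Rightarrow> real"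
  assumes c: "continuous_on UNIV h" and p: "\<And>t. h (t + 2 * pi) = h t" and s: "0 \<le> s" "s < 2 * pi"
  shows "integral {0..2*pi} (\<lambda>t. h (t + s)) = integral {0..2*pi} h"
proof -
  have i: "h integrable_on {a..b}" for a b
    by (intro integrable_continuous_interval continuous_on_subset[OF c]) auto
  have sh: "integral {a..b} (\<lambda>t. h (t + u)) = integral {a + u..b + u} h" for a b u
    using integral_shift_real_ivl[of "a + u" u "b + u" h] by simp
  have "integral {0..2*pi} (\<lambda>t. h (t + s)) = integral {s..2*pi + s} h" using sh[of 0 "2*pi" s] by simp
  also have "\<dots> = integral {s..2*pi} h + integral {2*pi..2*pi+s} h"
    using s i by (intro Henstock_Kurzweil_Integration.integral_combine[symmetric]) auto
  also have "integral {2*pi..2*pi+s} h = integral {0..s} h"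
    using sh[of 0 s "2*pi"] p by (simp add: add.commute)
  also have "integral {s..2*pi} h + integral {0..s} h = integral {0..2*pi} h"
    using s i Henstock_Kurzweil_Integration.integral_combine[of 0 s "2*pi" h] by auto
  finally show ?thesis .
qed

lemma integral_periodic_reflect:
  fixes h :: "real \<Rightarrow> real"
  assumes c: "continuous_on UNIV h" and p: "\<And>t. h (t + 2 * pi) = h t" and s: "0 \<le> s" "s < 2 * pi"
  shows "integral {0..2*pi} (\<lambda>t. h (s - t)) = integral {0..2*pi} h"
proof -
  define k where "k t = h (- t)" for t
  have kc: "continuous_on UNIV k" unfolding k_def
    by (rule continuous_on_compose2[OF c]) (auto intro: continuous_intros)
  have kp: "k (t + 2 * pi) = k t" for t unfolding k_def using p[of "- t - 2 * pi"] by simp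
  have "integral {0..2*pi} k = integral {-(2*pi)..-0} h"
    unfolding k_def using Henstock_Kurzweil_Integration.integral_reflect_real[of 0 "-(2*pi)" h] by simp
  also have "\<dots> = integral {0..2*pi} (\<lambda>t. h (t - 2*pi))"
    using integral_shift_real_ivl[of "-(2*pi)" "-(2*pi)" 0 h] by (simp del: Henstock_Kurzweil_Integration.integral_reflect_real)
  also have "\<dots> = integral {0..2*pi} h" using p[of "_ - 2*pi"] by (intro integral_cong) (metis diff_add_cancel)
  finally have e: "integral {0..2*pi} k = integral {0..2*pi} h" .
  show ?thesis
  proof (cases "s = 0")
    case True then show ?thesis using e by (simp add: k_def[abs_def])
  next
    case False
    have "integral {0..2*pi} (\<lambda>t. h (s - t)) = integral {0..2*pi} (\<lambda>t. k (t + (2*pi - s)))"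
    proof (rule integral_cong)
      fix t show "h (s - t) = k (t + (2*pi - s))" using kp[of "t - s"] by (simp add: k_def algebra_simps)
    qed
    also have "\<dots> = integral {0..2*pi} k" using False s by (intro integral_periodic_shift kc kp) auto
    finally show ?thesis using e by simp
  qed
qed

text \<open>Left multiplication by a rotation shifts the angle on both circles. Left multiplication
  by a reflection reverses the angle and exchanges the circles, which the sum of the two integrands
  does not notice.\<close>

lemma haar_cmean: "haar 2 cmean"
proof (rule haarI_left, unfold_locales)
  have i: "(\<lambda>t. \<phi> (rot2 t)) integrable_on {0..2*pi}" "(\<lambda>t. \<phi> (rot2 t * flip2)) integrable_on {0..2*pi}"
    if "\<phi> \<in> Lip 2" for \<phi>
    using Lip_rot2_continuous[OF that] Lip_rot2_continuous[OF Lip_right[OF that flip2_orth]]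
    by (auto intro!: integrable_continuous_interval)
  show "cmean (\<lambda>A. \<phi> A + \<psi> A) = cmean \<phi> + cmean \<psi>" if "\<phi> \<in> Lip 2" "\<psi> \<in> Lip 2" for \<phi> \<psi>
    unfolding cmean_def using i[OF that(1)] i[OF that(2)]
    by (simp add: Henstock_Kurzweil_Integration.integral_add integrable_add distrib_left)
  show "cmean (\<lambda>A. c * \<phi> A) = c * cmean \<phi>" if "\<phi> \<in> Lip 2" for \<phi> c
    unfolding cmean_def by (simp add: distrib_left[symmetric])
  show "0 \<le> cmean \<phi>" if "\<phi> \<in> Lip 2" "\<And>A. A \<in> orth 2 \<Longrightarrow> 0 \<le> \<phi> A" for \<phi>
    unfolding cmean_def using i[OF that(1)] that(2) rot2_orth orth_mult[OF rot2_orth flip2_orth]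
    by (intro mult_nonneg_nonneg Henstock_Kurzweil_Integration.integral_nonneg integrable_add) auto
  show "cmean (\<lambda>_. 1) = 1" unfolding cmean_def by simp
  show "cmean (\<lambda>A. \<phi> (Q * A)) = cmean \<phi>" if p: "\<phi> \<in> Lip 2" and Q: "Q \<in> orth 2" for \<phi> Q
  proof -
    define h1 h2 where "h1 t = \<phi> (rot2 t)" and "h2 t = \<phi> (rot2 t * flip2)" for t
    have c: "continuous_on UNIV h1" "continuous_on UNIV h2"
      unfolding h1_def h2_def by (rule Lip_rot2_continuous[OF p], rule Lip_rot2_continuous[OF Lip_right[OF p flip2_orth]])
    have pe: "h1 (t + 2*pi) = h1 t" "h2 (t + 2*pi) = h2 t" for t by (simp_all only: h1_def h2_def rot2_2pi)
    have ii: "h1 integrable_on {0..2*pi}" "h2 integrable_on {0..2*pi}" using i[OF p] by (simp_all add: h1_def[abs_def] h2_def[abs_def])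
    have cc: "continuous_on UNIV (\<lambda>t. h1 t + h2 t)" using c by (intro continuous_intros)
    have ca: "(rot2 s * flip2) * rot2 t = rot2 (s - t) * flip2" for s t
      using assoc_mult_mat[of "rot2 s" 2 2 flip2 2 "rot2 t" 2] assoc_mult_mat[of "rot2 s" 2 2 "rot2 (-t)" 2 flip2 2]
      by (simp add: flip2_rot2 rot2_add)
    have cb: "(rot2 s * flip2) * (rot2 t * flip2) = rot2 (s - t)" for s t
      using assoc_mult_mat[of "rot2 s * flip2" 2 2 "rot2 t" 2 flip2 2] assoc_mult_mat[of "rot2 (s - t)" 2 2 flip2 2 flip2 2]
      by (simp add: ca flip2_flip2 right_mult_one_mat[OF rot2_carrier])
    have cd: "rot2 s * (rot2 t * flip2) = rot2 (t + s) * flip2" for s t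
      using assoc_mult_mat[of "rot2 s" 2 2 "rot2 t" 2 flip2 2] by (simp add: rot2_add add.commute)
    from Q show ?thesis
    proof (cases rule: orth2_cases)
      case (1 s)
      have "integral {0..2*pi} (\<lambda>t. \<phi> (Q * rot2 t) + \<phi> (Q * (rot2 t * flip2))) = integral {0..2*pi} (\<lambda>t. h1 (t + s) + h2 (t + s))"
        unfolding 1 cd rot2_add h1_def h2_def by (simp add: add.commute)
      also have "\<dots> = integral {0..2*pi} (\<lambda>t. h1 t + h2 t)"
        using 1 pe by (intro integral_periodic_shift[where h = "\<lambda>t. h1 t + h2 t"] cc) auto
      finally show ?thesis unfolding cmean_def h1_def h2_def by simp
    next
      case (2 s)
      have "integral {0..2*pi} (\<lambda>t. \<phi> (Q * rot2 t) + \<phi> (Q * (rot2 t * flip2))) = integral {0..2*pi} (\<lambda>t. h1 (s - t) + h2 (s - t))"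
        unfolding 2 ca cb h1_def h2_def by (simp add: add.commute)
      also have "\<dots> = integral {0..2*pi} (\<lambda>t. h1 t + h2 t)"
        using 2 pe by (intro integral_periodic_reflect[where h = "\<lambda>t. h1 t + h2 t"] cc) auto
      finally show ?thesis unfolding cmean_def h1_def h2_def by simp
    qed
  qed
qed

subsection \<open>Embedding small orthogonal groups; plane rotations generate\<close>

text \<open>The size \<open>m\<close> is left open because three embeddings are needed:
  \<open>O(2)\<close> in \<open>O(n)\<close>, \<open>O(3)\<close> in \<open>O(n)\<close>, and
  \<open>O(2)\<close> in \<open>O(3)\<close>. \<open>emb_emb\<close> relates them, so that plane
  rotations of \<open>n\<close> rows can be studied inside the three-dimensional group.\<close>

definition emb :: "nat \<Rightarrow> nat \<Rightarrow> (nat \<Rightarrow> nat) \<Rightarrow> real mat \<Rightarrow> real mat" where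
  "emb m n f g = mat n n (\<lambda>(a,b). if a \<in> f ` {..<m} \<and> b \<in> f ` {..<m}
     then g $$ (inv_into {..<m} f a, inv_into {..<m} f b) else if a = b then 1 else 0)"

definition embf :: "nat \<Rightarrow> nat \<Rightarrow> (nat \<Rightarrow> nat) \<Rightarrow> bool" where
  "embf m n f \<longleftrightarrow> inj_on f {..<m} \<and> f ` {..<m} \<subseteq> {..<n}"

lemma emb_carrier [simp]: "emb m n f g \<in> carrier_mat n n" by (simp add: emb_def)

lemma emb_in:
  "embf m n f \<Longrightarrow> p < m \<Longrightarrow> q < m \<Longrightarrow> emb m n f g $$ (f p, f q) = g $$ (p, q)"
  unfolding embf_def emb_def by (subst index_mat) (auto simp: inv_into_f_f)

lemma emb_out:
  "a < n \<Longrightarrow> b < n \<Longrightarrow> a \<notin> f ` {..<m} \<or> b \<notin> f ` {..<m} \<Longrightarrow> emb m n f g $$ (a, b) = (if a = b then 1 else 0)"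
  unfolding emb_def by (subst index_mat) auto

lemma emb_mult_in:
  assumes f: "embf m n f" and Z: "Z \<in> carrier_mat n k" and p: "p < m" and b: "b < k"
  shows "(emb m n f g * Z) $$ (f p, b) = (\<Sum>q<m. g $$ (p,q) * Z $$ (f q, b))"
proof -
  have fp: "f p < n" using f p by (auto simp: embf_def)
  have "(emb m n f g * Z) $$ (f p, b) = (\<Sum>l<n. emb m n f g $$ (f p, l) * Z $$ (l, b))"
    using Z b fp by (intro mult_index_sum) auto
  also have "\<dots> = (\<Sum>l\<in>f ` {..<m}. emb m n f g $$ (f p, l) * Z $$ (l, b))"
    using f p fp by (intro sum.mono_neutral_right) (auto simp: embf_def emb_out)
  also have "\<dots> = (\<Sum>q<m. emb m n f g $$ (f p, f q) * Z $$ (f q, b))"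
    using f by (subst sum.reindex) (auto simp: embf_def)
  finally show ?thesis using f p by (simp add: emb_in)
qed

lemma emb_mult_out:
  assumes Z: "Z \<in> carrier_mat n k" and a: "a < n" "a \<notin> f ` {..<m}" and b: "b < k"
  shows "(emb m n f g * Z) $$ (a, b) = Z $$ (a, b)"
proof -
  have "(emb m n f g * Z) $$ (a, b) = (\<Sum>l<n. emb m n f g $$ (a, l) * Z $$ (l, b))"
    using Z b a by (intro mult_index_sum) auto
  also have "\<dots> = (\<Sum>l<n. if a = l then Z $$ (l, b) else 0)"
    using a by (intro sum.cong) (auto simp: emb_out)
  finally show ?thesis using a by simp
qed

lemma emb_mult:
  assumes f: "embf m n f" and g: "g \<in> carrier_mat m m" and h: "h \<in> carrier_mat m m"
  shows "emb m n f (g * h) = emb m n f g * emb m n f h"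
proof (rule eq_matI)
  fix a b assume ab: "a < dim_row (emb m n f g * emb m n f h)" "b < dim_col (emb m n f g * emb m n f h)"
  then have ab: "a < n" "b < n" by (auto simp: emb_def)
  show "emb m n f (g * h) $$ (a,b) = (emb m n f g * emb m n f h) $$ (a,b)"
  proof (cases "a \<in> f ` {..<m}")
    case True
    then obtain p where p: "p < m" "a = f p" by auto
    have e: "(emb m n f g * emb m n f h) $$ (a,b) = (\<Sum>q<m. g $$ (p,q) * emb m n f h $$ (f q, b))"
      unfolding p(2) by (rule emb_mult_in[OF f _ p(1) ab(2)]) simp
    show ?thesis
    proof (cases "b \<in> f ` {..<m}")
      case True
      then obtain r where r: "r < m" "b = f r" by auto
      show ?thesis unfolding e unfolding r(2) p(2) using p r
        by (simp add: emb_in[OF f] mult_index_sum[OF g h] del: index_mult_mat)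
    next
      case False
      have "(\<Sum>q<m. g $$ (p,q) * emb m n f h $$ (f q, b)) = 0"
      proof (rule sum.neutral, rule ballI)
        fix q assume "q \<in> {..<m}"
        then have "f q < n" "f q \<noteq> b" using f False by (auto simp: embf_def)
        then show "g $$ (p,q) * emb m n f h $$ (f q, b) = 0" using ab False by (simp add: emb_out)
      qed
      then show ?thesis unfolding e using False True ab by (auto simp: emb_out)
    qed
  next
    case False
    then show ?thesis using ab by (simp add: emb_mult_out[OF _ ab(1) False ab(2)] emb_out del: index_mult_mat)
  qed
qed (auto simp: emb_def)

lemma emb_one: "embf m n f \<Longrightarrow> emb m n f (1\<^sub>m m) = 1\<^sub>m n"
proof (rule eq_matI)
  fix a b assume f: "embf m n f" and ab: "a < dim_row (1\<^sub>m n :: real mat)" "b < dim_col (1\<^sub>m n :: real mat)"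
  show "emb m n f (1\<^sub>m m) $$ (a,b) = 1\<^sub>m n $$ (a,b)"
  proof (cases "a \<in> f ` {..<m} \<and> b \<in> f ` {..<m}")
    case True
    then obtain p q where "p < m" "a = f p" "q < m" "b = f q" by auto
    then show ?thesis using f ab by (auto simp: emb_in embf_def inj_on_def)
  qed (use ab in \<open>auto simp: emb_out\<close>)
qed (auto simp: emb_def)

lemma emb_transpose:
  assumes f: "embf m n f" and g: "g \<in> carrier_mat m m"
  shows "emb m n f (transpose_mat g) = transpose_mat (emb m n f g)"
proof (rule eq_matI)
  fix a b assume ab: "a < dim_row (transpose_mat (emb m n f g))" "b < dim_col (transpose_mat (emb m n f g))"
  then have ab: "a < n" "b < n" by (auto simp: emb_def)
  have t: "transpose_mat (emb m n f g) $$ (a,b) = emb m n f g $$ (b,a)" using ab by (simp add: emb_def)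
  show "emb m n f (transpose_mat g) $$ (a,b) = transpose_mat (emb m n f g) $$ (a,b)"
  proof (cases "a \<in> f ` {..<m} \<and> b \<in> f ` {..<m}")
    case True
    then obtain p q where "p < m" "a = f p" "q < m" "b = f q" by auto
    then show ?thesis using f g unfolding t by (auto simp: emb_in)
  qed (use ab in \<open>auto simp: t emb_out\<close>)
qed (auto simp: emb_def)

lemma emb_orth:
  assumes f: "embf m n f" and g: "g \<in> orth m"
  shows "emb m n f g \<in> orth n"
proof -
  have c: "g \<in> carrier_mat m m" by (rule orth_carrier[OF g])
  have "emb m n f g * transpose_mat (emb m n f g) = emb m n f (g * transpose_mat g)"
    using c by (simp add: emb_mult[OF f] emb_transpose[OF f])
  also have "\<dots> = 1\<^sub>m n" by (simp add: orth_mult_transpose[OF g] emb_one[OF f])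
  finally show ?thesis by (simp add: orth_def)
qed

lemma fd_emb_le:
  assumes f: "embf m n f" and g: "g \<in> carrier_mat m m" "h \<in> carrier_mat m m"
  shows "fd (emb m n f g) (emb m n f h) \<le> real n * real n * fd g h"
proof (rule fd_le_entries)
  fix a b assume ab: "a < n" "b < n"
  show "\<bar>emb m n f g $$ (a,b) - emb m n f h $$ (a,b)\<bar> \<le> fd g h"
  proof (cases "a \<in> f ` {..<m} \<and> b \<in> f ` {..<m}")
    case True
    then obtain p q where "p < m" "a = f p" "q < m" "b = f q" by auto
    then show ?thesis using f entry_le_fd[OF g(1)] by (auto simp: emb_in)
  qed (use ab in \<open>auto simp: emb_out fd_nonneg\<close>)
qed simp

lemma emb_emb:
  assumes f: "embf m n f" and f': "embf k m f'"
  shows "emb m n f (emb k m f' g) = emb k n (f \<circ> f') g"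
proof (rule eq_matI)
  have ff: "embf k n (f \<circ> f')" using f f' unfolding embf_def by (auto intro: comp_inj_on inj_on_subset)
  fix a b assume ab: "a < dim_row (emb k n (f \<circ> f') g)" "b < dim_col (emb k n (f \<circ> f') g)"
  then have ab: "a < n" "b < n" by (auto simp: emb_def)
  have sub: "(f \<circ> f') ` {..<k} \<subseteq> f ` {..<m}" using f' by (auto simp: embf_def)
  show "emb m n f (emb k m f' g) $$ (a,b) = emb k n (f \<circ> f') g $$ (a,b)"
  proof (cases "a \<in> f ` {..<m} \<and> b \<in> f ` {..<m}")
    case True
    then obtain p q where pq: "p < m" "a = f p" "q < m" "b = f q" by auto
    have mem: "f p \<in> (f \<circ> f') ` {..<k} \<longleftrightarrow> p \<in> f' ` {..<k}" if "p < m" for p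
    proof
      assume "f p \<in> (f \<circ> f') ` {..<k}"
      then obtain x where x: "x < k" "f p = f (f' x)" by auto
      have i: "inj_on f {..<m}" using f by (simp add: embf_def)
      have x': "f' x \<in> {..<m}" using f' x(1) unfolding embf_def by blast
      have "p = f' x" by (rule inj_onD[OF i x(2) _ x']) (use that in simp)
      then show "p \<in> f' ` {..<k}" using x by auto
    qed auto
    have e: "emb m n f (emb k m f' g) $$ (a,b) = emb k m f' g $$ (p,q)"
      unfolding pq by (rule emb_in[OF f pq(1,3)])
    show ?thesis
    proof (cases "p \<in> f' ` {..<k} \<and> q \<in> f' ` {..<k}")
      case True
      then obtain p' q' where "p' < k" "p = f' p'" "q' < k" "q = f' q'" by auto
      then show ?thesis unfolding e using pq emb_in[OF f'] emb_in[OF ff] by auto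
    next
      case False
      then have "a \<notin> (f \<circ> f') ` {..<k} \<or> b \<notin> (f \<circ> f') ` {..<k}" using mem pq by auto
      moreover have "a = b \<longleftrightarrow> p = q" using f pq by (auto simp: embf_def inj_on_def)
      ultimately show ?thesis unfolding e using False ab pq by (auto simp: emb_out)
    qed
  next
    case False
    then have "a \<notin> (f \<circ> f') ` {..<k} \<or> b \<notin> (f \<circ> f') ` {..<k}" using sub by blast
    then show ?thesis using False ab by (auto simp: emb_out)
  qed
qed (auto simp: emb_def)

lemma emb_commute:
  assumes f: "embf m n f" and f': "embf k n f'" and dis: "f ` {..<m} \<inter> f' ` {..<k} = {}"
  shows "emb m n f g * emb k n f' h = emb k n f' h * emb m n f g"
proof (rule eq_matI)
  fix a b assume ab: "a < dim_row (emb k n f' h * emb m n f g)" "b < dim_col (emb k n f' h * emb m n f g)"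
  then have ab: "a < n" "b < n" by (auto simp: emb_def)
  have nn: "b \<notin> f ` {..<m} \<or> b \<notin> f' ` {..<k}" using dis by auto
  consider "a \<in> f ` {..<m}" | "a \<in> f' ` {..<k}" | "a \<notin> f ` {..<m}" "a \<notin> f' ` {..<k}" by auto
  then show "(emb m n f g * emb k n f' h) $$ (a,b) = (emb k n f' h * emb m n f g) $$ (a,b)"
  proof cases
    case 1
    then obtain p where p: "p < m" "a = f p" by auto
    have o: "f q \<notin> f' ` {..<k}" "f q < n" if "q < m" for q using dis f that by (auto simp: embf_def)
    have "(emb m n f g * emb k n f' h) $$ (a,b) = (\<Sum>q<m. g $$ (p,q) * emb k n f' h $$ (f q, b))"
      unfolding p(2) by (rule emb_mult_in[OF f _ p(1) ab(2)]) simp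
    also have "\<dots> = (\<Sum>q<m. if f q = b then g $$ (p,q) else 0)"
      using o ab by (intro sum.cong) (auto simp: emb_out)
    also have "\<dots> = emb m n f g $$ (a,b)"
    proof (cases "b \<in> f ` {..<m}")
      case True
      then obtain r where r: "r < m" "b = f r" by auto
      have "(\<Sum>q<m. if f q = b then g $$ (p,q) else 0) = (\<Sum>q<m. if q = r then g $$ (p,q) else 0)"
        using f r by (intro sum.cong) (auto simp: embf_def inj_on_def)
      then show ?thesis using r p by (simp add: emb_in[OF f])
    next
      case False
      then show ?thesis using ab 1 by (subst emb_out) (auto intro!: sum.neutral)
    qed
    also have "\<dots> = (emb k n f' h * emb m n f g) $$ (a,b)"
      by (rule emb_mult_out[symmetric]) (use ab p o in auto)
    finally show ?thesis .
  next
    case 2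
    then obtain p where p: "p < k" "a = f' p" by auto
    have o: "f' q \<notin> f ` {..<m}" "f' q < n" if "q < k" for q using dis f' that by (auto simp: embf_def)
    have "(emb k n f' h * emb m n f g) $$ (a,b) = (\<Sum>q<k. h $$ (p,q) * emb m n f g $$ (f' q, b))"
      unfolding p(2) by (rule emb_mult_in[OF f' _ p(1) ab(2)]) simp
    also have "\<dots> = (\<Sum>q<k. if f' q = b then h $$ (p,q) else 0)"
      using o ab by (intro sum.cong) (auto simp: emb_out)
    also have "\<dots> = emb k n f' h $$ (a,b)"
    proof (cases "b \<in> f' ` {..<k}")
      case True
      then obtain r where r: "r < k" "b = f' r" by auto
      have "(\<Sum>q<k. if f' q = b then h $$ (p,q) else 0) = (\<Sum>q<k. if q = r then h $$ (p,q) else 0)"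
        using f' r by (intro sum.cong) (auto simp: embf_def inj_on_def)
      then show ?thesis using r p by (simp add: emb_in[OF f'])
    next
      case False
      then show ?thesis using ab 2 by (subst emb_out) (auto intro!: sum.neutral)
    qed
    also have "\<dots> = (emb m n f g * emb k n f' h) $$ (a,b)"
      by (rule emb_mult_out[symmetric]) (use ab p o in auto)
    finally show ?thesis by simp
  next
    case 3
    have "(emb m n f g * emb k n f' h) $$ (a,b) = emb k n f' h $$ (a,b)"
      by (rule emb_mult_out) (use ab 3 in auto)
    moreover have "(emb k n f' h * emb m n f g) $$ (a,b) = emb m n f g $$ (a,b)"
      by (rule emb_mult_out) (use ab 3 in auto)
    ultimately show ?thesis using 3 ab by (simp add: emb_out)
  qed
qed (auto simp: emb_def)

section \<open>Plane rotations and elimination by them\<close>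

definition pr :: "nat \<Rightarrow> nat \<Rightarrow> nat \<Rightarrow> nat" where "pr i j = (\<lambda>k. if k = 0 then i else j)"

abbreviation e2 :: "nat \<Rightarrow> nat \<Rightarrow> nat \<Rightarrow> real mat \<Rightarrow> real mat" where
  "e2 n i j g \<equiv> emb 2 n (pr i j) g"

lemma pr_image: "pr i j ` {..<2} = {i,j}"
proof -
  have "{..<2} = {0, Suc 0}" by auto
  then show ?thesis by (auto simp: pr_def)
qed

lemma embf_pr: "i < n \<Longrightarrow> j < n \<Longrightarrow> i \<noteq> j \<Longrightarrow> embf 2 n (pr i j)"
  unfolding embf_def pr_image by (auto simp: inj_on_def pr_def less_2_cases_iff)

lemma e2_orth: "i < n \<Longrightarrow> j < n \<Longrightarrow> i \<noteq> j \<Longrightarrow> g \<in> orth 2 \<Longrightarrow> e2 n i j g \<in> orth n"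
  by (intro emb_orth embf_pr)

lemma e2_rows:
  assumes "i < n" "j < n" "i \<noteq> j" "Z \<in> carrier_mat n k" "b < k"
  shows "(e2 n i j g * Z) $$ (i,b) = g $$ (0,0) * Z $$ (i,b) + g $$ (0,Suc 0) * Z $$ (j,b)"
    "(e2 n i j g * Z) $$ (j,b) = g $$ (Suc 0,0) * Z $$ (i,b) + g $$ (Suc 0,Suc 0) * Z $$ (j,b)"
    "a < n \<Longrightarrow> a \<noteq> i \<Longrightarrow> a \<noteq> j \<Longrightarrow> (e2 n i j g * Z) $$ (a,b) = Z $$ (a,b)"
proof -
  note f = embf_pr[OF assms(1-3)]
  show "(e2 n i j g * Z) $$ (i,b) = g $$ (0,0) * Z $$ (i,b) + g $$ (0,Suc 0) * Z $$ (j,b)"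
    using emb_mult_in[OF f assms(4) _ assms(5), of 0 g] unfolding sum_lt2 by (simp add: pr_def)
  show "(e2 n i j g * Z) $$ (j,b) = g $$ (Suc 0,0) * Z $$ (i,b) + g $$ (Suc 0,Suc 0) * Z $$ (j,b)"
    using emb_mult_in[OF f assms(4) _ assms(5), of "Suc 0" g] unfolding sum_lt2 by (simp add: pr_def)
  show "(e2 n i j g * Z) $$ (a,b) = Z $$ (a,b)" if "a < n" "a \<noteq> i" "a \<noteq> j"
    by (rule emb_mult_out[OF assms(4) that(1) _ assms(5)]) (use that in \<open>simp add: pr_image\<close>)
qed

text \<open>The length is exactly \<open>k\<close>, not at most \<open>k\<close>: the same number of
  steps of the walk has to connect all pairs of points. The new letter stands on the right and acts
  first, which is the order in which \<open>Tk_shrink\<close> peels words.\<close>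

fun Wd :: "nat \<Rightarrow> nat \<Rightarrow> real mat set" where
  "Wd n 0 = {1\<^sub>m n}"
| "Wd n (Suc k) = {A * e2 n i j g | i j g A. i < n \<and> j < n \<and> i \<noteq> j \<and> g \<in> orth 2 \<and> A \<in> Wd n k}"

lemma Wd_orth: "A \<in> Wd n k \<Longrightarrow> A \<in> orth n"
  by (induction k arbitrary: A) (auto intro!: orth_one orth_mult e2_orth)

definition St :: "nat \<Rightarrow> nat \<Rightarrow> real mat \<Rightarrow> bool" where
  "St n k Q \<longleftrightarrow> Q \<in> orth n \<and> (\<forall>c<k. \<forall>r<n. Q $$ (r,c) = (if r = c then 1 else 0))"

text \<open>One more letter reduces the elimination problem for \<open>R'\<close> to the one for
  \<open>R\<close>. The word length \<open>m\<close> is chosen before the matrix \<open>Q\<close>,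
  and this uniformity is what the lemma preserves.\<close>

lemma Givens_step:
  assumes "i < n" "j < n" "i \<noteq> j"
    and P: "\<exists>m. \<forall>Q. R Q \<longrightarrow> (\<exists>A\<in>Wd n m. A * Q = 1\<^sub>m n)"
    and S: "\<And>Q. R' Q \<Longrightarrow> Q \<in> orth n \<and> (\<exists>g\<in>orth 2. R (e2 n i j g * Q))"
  shows "\<exists>m. \<forall>Q. R' Q \<longrightarrow> (\<exists>A\<in>Wd n m. A * Q = 1\<^sub>m n)"
proof -
  obtain m where m: "\<And>Q. R Q \<Longrightarrow> \<exists>A\<in>Wd n m. A * Q = 1\<^sub>m n" using P by blast
  have "\<exists>A\<in>Wd n (Suc m). A * Q = 1\<^sub>m n" if Q: "R' Q" for Q
  proof -
    obtain g where g: "g \<in> orth 2" "R (e2 n i j g * Q)" and Qo: "Q \<in> orth n" using S[OF Q] by auto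
    obtain A where A: "A \<in> Wd n m" "A * (e2 n i j g * Q) = 1\<^sub>m n" using m[OF g(2)] by auto
    have "(A * e2 n i j g) * Q = 1\<^sub>m n"
      using A(2) assoc_mult_mat[of A n n "e2 n i j g" n Q n] orth_carrier[OF Wd_orth[OF A(1)]] orth_carrier[OF Qo] by simp
    then show ?thesis using A g assms by (intro bexI[of _ "A * e2 n i j g"]) auto
  qed
  then show ?thesis by blast
qed

lemma kill_entry:
  fixes u v :: real
  shows "\<exists>g\<in>orth 2. g $$ (Suc 0,0) * u + g $$ (Suc 0,Suc 0) * v = 0"
proof (cases "u\<^sup>2 + v\<^sup>2 = 0")
  case True
  then have "u = 0" "v = 0" by (auto simp: sum_power2_eq_zero_iff)
  then show ?thesis by (intro bexI[of _ "1\<^sub>m 2"]) (auto simp: orth_one)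
next
  case False
  define r where "r = sqrt (u\<^sup>2 + v\<^sup>2)"
  have "u\<^sup>2 + v\<^sup>2 > 0" using False sum_power2_ge_zero[of u v] by linarith
  then have r: "r > 0" "r\<^sup>2 = u\<^sup>2 + v\<^sup>2" by (auto simp: r_def)
  have "(u / r)\<^sup>2 + (- v / r)\<^sup>2 = (u\<^sup>2 + v\<^sup>2) / r\<^sup>2" by (simp add: power_divide add_divide_distrib)
  also have "\<dots> = r\<^sup>2 / r\<^sup>2" using r(2) by simp
  also have "\<dots> = 1" using r(1) by simp
  finally have "(u / r)\<^sup>2 + (- v / r)\<^sup>2 = 1" .
  then obtain t where t: "u / r = cos t" "- v / r = sin t" using sincos_total_2pi by metis
  then have t': "u = r * cos t" "v = - (r * sin t)" using r by (auto simp: field_simps)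
  then have "sin t * u + cos t * v = 0" by (simp add: algebra_simps)
  then show ?thesis by (intro bexI[of _ "rot2 t"] rot2_orth) simp
qed

text \<open>Givens elimination, proved backwards from the identity. For column \<open>k\<close> the
  stages \<open>R r\<close> say that the entries strictly between rows \<open>k\<close> and
  \<open>r\<close> are already zero; each stage removes one more entry by a rotation with row
  \<open>k\<close>.\<close>

lemma Givens:
  assumes n: "2 \<le> n"
  shows "\<exists>m. \<forall>Q. St n 0 Q \<longrightarrow> (\<exists>A\<in>Wd n m. A * Q = 1\<^sub>m n)"
proof -
  define P where "P k \<longleftrightarrow> (\<exists>m. \<forall>Q. St n k Q \<longrightarrow> (\<exists>A\<in>Wd n m. A * Q = 1\<^sub>m n))" for k
  have top: "P n" unfolding P_def
  proof (intro exI[of _ 0] allI impI)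
    fix Q assume Q: "St n n Q"
    then have "Q = 1\<^sub>m n" by (intro eq_matI) (auto simp: St_def dest: orth_carrier)
    then show "\<exists>A\<in>Wd n 0. A * Q = 1\<^sub>m n" by simp
  qed
  have down: "P k" if PS: "P (Suc k)" and k: "k < n" for k
  proof -
    define R where "R r Q \<longleftrightarrow> St n k Q \<and> (\<forall>r'. k < r' \<and> r' < r \<longrightarrow> Q $$ (r',k) = 0)" for r Q
    define k' where "k' = (if k = 0 then Suc 0 else 0)"
    have k': "k' < n" "k \<noteq> k'" using n by (auto simp: k'_def)
    have Rn: "\<exists>m. \<forall>Q. R n Q \<longrightarrow> (\<exists>A\<in>Wd n m. A * Q = 1\<^sub>m n)"
    proof (rule Givens_step[OF k k', of "St n (Suc k)"])
      show "\<exists>m. \<forall>Q. St n (Suc k) Q \<longrightarrow> (\<exists>A\<in>Wd n m. A * Q = 1\<^sub>m n)" using PS unfolding P_def .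
      fix Q assume RQ: "R n Q"
      then have Q: "Q \<in> orth n" and cols: "\<And>c r. c < k \<Longrightarrow> r < n \<Longrightarrow> Q $$ (r,c) = (if r = c then 1 else 0)"
        and low: "\<And>r. k < r \<Longrightarrow> r < n \<Longrightarrow> Q $$ (r,k) = 0" by (auto simp: R_def St_def)
      have Qc: "Q \<in> carrier_mat n n" by (rule orth_carrier[OF Q])
      have up: "Q $$ (r,k) = 0" if "r < k" for r
      proof -
        have "(\<Sum>a<n. Q $$ (a,r) * Q $$ (a,k)) = (\<Sum>a<n. if a = r then Q $$ (a,k) else 0)"
          using cols that by (intro sum.cong) auto
        then show ?thesis using orth_col_inner[OF Q, of r k] that k by simp
      qed
      have z: "Q $$ (r,k) = 0" if "r < n" "r \<noteq> k" for r using up[of r] low[of r] that by (cases "r < k") auto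
      have "(\<Sum>a<n. Q $$ (a,k) * Q $$ (a,k)) = (\<Sum>a<n. if a = k then Q $$ (a,k) * Q $$ (a,k) else 0)"
        using z by (intro sum.cong) auto
      then have "Q $$ (k,k) * Q $$ (k,k) = 1" using orth_col_inner[OF Q k k] k by simp
      then have s: "Q $$ (k,k) = 1 \<or> Q $$ (k,k) = -1" by (simp only: square_eq_1_iff)
      \<comment> \<open>Column \<open>k\<close> is now concentrated on its diagonal entry, since the
        entries above vanish by orthogonality to the earlier columns. Only the sign of that entry is
        left to correct: \<open>rot2 pi * flip2\<close> is \<open>diag(-1,1)\<close>, which leaves
        the partner row \<open>k'\<close> alone, so that any other row may be the partner.\<close>
      define g :: "real mat" where "g = (if Q $$ (k,k) = 1 then 1\<^sub>m 2 else rot2 pi * flip2)"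
      have go: "g \<in> orth 2" by (auto simp: g_def orth_one intro!: orth_mult rot2_orth flip2_orth)
      have gi: "g $$ (0,0) = Q $$ (k,k)" "g $$ (0,Suc 0) = 0" "g $$ (Suc 0,0) = 0" "g $$ (Suc 0,Suc 0) = 1"
        using s by (auto simp: g_def)
      note rows = e2_rows[OF k k' Qc, where g = g]
      have "St n (Suc k) (e2 n k k' g * Q)" unfolding St_def
      proof (intro conjI allI impI)
        show "e2 n k k' g * Q \<in> orth n" by (intro orth_mult e2_orth k k' go Q)
        fix c r assume c: "c < Suc k" and r: "r < n"
        then have cn: "c < n" using k by linarith
        show "(e2 n k k' g * Q) $$ (r,c) = (if r = c then 1 else 0)"
        proof (cases "c = k")
          case True
          consider "r = k" | "r = k'" | "r \<noteq> k" "r \<noteq> k'" by auto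
          then show ?thesis
            by cases (use s z r k' True rows[OF cn] in \<open>auto simp: gi simp del: index_mult_mat\<close>)
        next
          case False
          then have ck: "c < k" using c by auto
          consider "r = k" | "r = k'" | "r \<noteq> k" "r \<noteq> k'" by auto
          then show ?thesis
            by cases (use ck cols[OF ck] k r k' False rows[OF cn] in \<open>auto simp: gi simp del: index_mult_mat\<close>)
        qed
      qed
      then show "Q \<in> orth n \<and> (\<exists>g\<in>orth 2. St n (Suc k) (e2 n k k' g * Q))" using go Q by blast
    qed
    have Rstep: "\<exists>m. \<forall>Q. R r Q \<longrightarrow> (\<exists>A\<in>Wd n m. A * Q = 1\<^sub>m n)"
      if RS: "\<exists>m. \<forall>Q. R (Suc r) Q \<longrightarrow> (\<exists>A\<in>Wd n m. A * Q = 1\<^sub>m n)" and r: "k < r" "r < n" for r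
    proof (rule Givens_step[of k n r "R (Suc r)"])
      fix Q assume RQ: "R r Q"
      then have Q: "Q \<in> orth n" and cols: "\<And>c r. c < k \<Longrightarrow> r < n \<Longrightarrow> Q $$ (r,c) = (if r = c then 1 else 0)"
        and low: "\<And>r'. k < r' \<Longrightarrow> r' < r \<Longrightarrow> Q $$ (r',k) = 0" by (auto simp: R_def St_def)
      have Qc: "Q \<in> carrier_mat n n" by (rule orth_carrier[OF Q])
      obtain g where g: "g \<in> orth 2" "g $$ (Suc 0,0) * Q $$ (k,k) + g $$ (Suc 0,Suc 0) * Q $$ (r,k) = 0"
        using kill_entry by blast
      have kr: "k \<noteq> r" using r by auto
      note rows = e2_rows[OF k r(2) kr Qc, where g = g]
      have "R (Suc r) (e2 n k r g * Q)" unfolding R_def St_def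
      proof (intro conjI allI impI)
        show "e2 n k r g * Q \<in> orth n" by (intro orth_mult e2_orth k r kr g Q)
        show "(e2 n k r g * Q) $$ (a,c) = (if a = c then 1 else 0)" if "c < k" "a < n" for c a
        proof -
          have cn: "c < n" using that k by linarith
          consider "a = k" | "a = r" | "a \<noteq> k" "a \<noteq> r" by auto
          then show ?thesis
            by cases (use that cols[OF that(1)] k r rows[OF cn] in \<open>auto simp del: index_mult_mat\<close>)
        qed
        show "(e2 n k r g * Q) $$ (r',k) = 0" if "k < r' \<and> r' < Suc r" for r'
        proof (cases "r' = r")
          case True then show ?thesis using rows(2)[OF k] g by simp
        next
          case False
          then show ?thesis using that low[of r'] rows(3)[OF k, of r'] r by auto
        qed
      qed
      then show "Q \<in> orth n \<and> (\<exists>g\<in>orth 2. R (Suc r) (e2 n k r g * Q))" using g Q by blast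
    qed (use RS r k in auto)
    have "\<exists>m. \<forall>Q. R (Suc k) Q \<longrightarrow> (\<exists>A\<in>Wd n m. A * Q = 1\<^sub>m n)"
    proof -
      have "Suc k \<le> n" using k by simp
      then show ?thesis
      proof (induction rule: inc_induct)
        case base show ?case by (rule Rn)
      next
        case (step r) show ?case by (rule Rstep[OF step(3)]) (use step in auto)
      qed
    qed
    then show "P k" unfolding P_def R_def by (auto simp: less_Suc_eq_le)
  qed
  have "P 0"
  proof -
    have "0 \<le> n" by simp
    then show ?thesis by (induction rule: inc_induct) (use top down in auto)
  qed
  then show ?thesis unfolding P_def .
qed

text \<open>A word that reduces \<open>Z W^T\<close> to the identity carries \<open>Z\<close> to
  \<open>W\<close>. One length serves all pairs of points.\<close>

lemma reach:
  assumes "2 \<le> n"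
  obtains m where "\<And>Z W. Z \<in> orth n \<Longrightarrow> W \<in> orth n \<Longrightarrow> \<exists>A\<in>Wd n m. A * Z = W"
proof -
  obtain m where m: "\<And>Q. St n 0 Q \<Longrightarrow> \<exists>A\<in>Wd n m. A * Q = 1\<^sub>m n" using Givens[OF assms] by blast
  have "\<exists>A\<in>Wd n m. A * Z = W" if Z: "Z \<in> orth n" and W: "W \<in> orth n" for Z W
  proof -
    note c = Z[THEN orth_carrier] W[THEN orth_carrier]
    have "St n 0 (Z * transpose_mat W)" unfolding St_def using Z W by (auto intro!: orth_mult orth_transpose)
    then obtain A where A: "A \<in> Wd n m" "A * (Z * transpose_mat W) = 1\<^sub>m n" using m by blast
    have Ac: "A \<in> carrier_mat n n" using Wd_orth[OF A(1)] by (rule orth_carrier)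
    have "A * Z = (A * Z) * (transpose_mat W * W)" using Ac c orth_transpose_mult[OF W] by simp
    also have "\<dots> = ((A * Z) * transpose_mat W) * W" using Ac c by (intro assoc_mult_mat[symmetric]) auto
    also have "(A * Z) * transpose_mat W = A * (Z * transpose_mat W)" using Ac c by (intro assoc_mult_mat) auto
    finally have "A * Z = W" using A(2) c by simp
    then show ?thesis using A(1) by blast
  qed
  then show thesis by (rule that)
qed

subsection \<open>Averaging over an embedded orthogonal group\<close>

definition avg :: "((real mat \<Rightarrow> real) \<Rightarrow> real) \<Rightarrow> nat \<Rightarrow> nat \<Rightarrow> (nat \<Rightarrow> nat) \<Rightarrow> (real mat \<Rightarrow> real) \<Rightarrow> real mat \<Rightarrow> real" where
  "avg lam m n f \<phi> Z = lam (\<lambda>g. \<phi> (emb m n f g * Z))"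

locale emb_avg = haar m lam for m lam +
  fixes n f
  assumes embf: "embf m n f"
begin

abbreviation "\<iota> \<equiv> emb m n f"
abbreviation "A \<equiv> avg lam m n f"

lemma \<iota>_orth: "g \<in> orth m \<Longrightarrow> \<iota> g \<in> orth n" by (rule emb_orth[OF embf])

lemma jl: "\<phi> \<in> Lip n \<Longrightarrow> jlip m n (\<lambda>g Z. \<phi> (\<iota> g * Z))"
  by (rule jlip_comp[OF jlip_mult, of _ _ _ _ "real n * real n"])
    (auto intro: \<iota>_orth fd_emb_le[OF embf] dest: orth_carrier)

lemma jl_Lip: "\<phi> \<in> Lip n \<Longrightarrow> Z \<in> orth n \<Longrightarrow> (\<lambda>g. \<phi> (\<iota> g * Z)) \<in> Lip m"
  by (rule jlip_fst[OF jl])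

lemma avg_lipw:
  assumes L: "lipw n L \<phi>"
  shows "lipw n L (A \<phi>)"
proof (rule lipwI[OF lipw_nonneg[OF L]])
  fix X Y assume XY: "X \<in> orth n" "Y \<in> orth n"
  show "\<bar>A \<phi> X - A \<phi> Y\<bar> \<le> L * fd X Y" unfolding avg_def
  proof (rule abs_diff_le[OF jl_Lip[OF LipI[OF L] XY(1)] jl_Lip[OF LipI[OF L] XY(2)]])
    fix g assume g: "g \<in> orth m"
    show "\<bar>\<phi> (\<iota> g * X) - \<phi> (\<iota> g * Y)\<bar> \<le> L * fd X Y"
      using lipwD[OF lipw_left[OF L \<iota>_orth[OF g]] XY] .
  qed
qed

lemma avg_Lip [intro,simp]: "\<phi> \<in> Lip n \<Longrightarrow> A \<phi> \<in> Lip n"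
  using avg_lipw by (auto simp: Lip_def)

lemma avg_add: "\<phi> \<in> Lip n \<Longrightarrow> \<psi> \<in> Lip n \<Longrightarrow> Z \<in> orth n \<Longrightarrow> A (\<lambda>X. \<phi> X + \<psi> X) Z = A \<phi> Z + A \<psi> Z"
  unfolding avg_def by (rule add[OF jl_Lip jl_Lip])

lemma avg_cmult: "\<phi> \<in> Lip n \<Longrightarrow> Z \<in> orth n \<Longrightarrow> A (\<lambda>X. c * \<phi> X) Z = c * A \<phi> Z"
  unfolding avg_def by (rule cmult[OF jl_Lip])

lemma avg_diff: "\<phi> \<in> Lip n \<Longrightarrow> \<psi> \<in> Lip n \<Longrightarrow> Z \<in> orth n \<Longrightarrow> A (\<lambda>X. \<phi> X - \<psi> X) Z = A \<phi> Z - A \<psi> Z"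
  unfolding avg_def by (rule diff[OF jl_Lip jl_Lip])

lemma avg_const: "A (\<lambda>X. c) Z = c"
  unfolding avg_def by (rule const)

lemma avg_mono:
  assumes "\<phi> \<in> Lip n" "\<psi> \<in> Lip n" "\<And>X. X \<in> orth n \<Longrightarrow> \<phi> X \<le> \<psi> X" "Z \<in> orth n"
  shows "A \<phi> Z \<le> A \<psi> Z"
  unfolding avg_def by (rule mono[OF jl_Lip jl_Lip]) (use assms orth_mult \<iota>_orth in auto)

lemma avg_cong:
  assumes "\<phi> \<in> Lip n" "\<And>X. X \<in> orth n \<Longrightarrow> \<phi> X = \<psi> X" "Z \<in> orth n"
  shows "A \<phi> Z = A \<psi> Z"
  unfolding avg_def by (rule eqI[OF jl_Lip]) (use assms orth_mult \<iota>_orth in auto)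

lemma avg_right:
  assumes p: "\<phi> \<in> Lip n" and Q: "Q \<in> orth n" and Z: "Z \<in> orth n"
  shows "A (\<lambda>X. \<phi> (X * Q)) Z = A \<phi> (Z * Q)"
  unfolding avg_def
proof (rule eqI[OF jl_Lip[OF Lip_right[OF p Q] Z]])
  fix g assume "g \<in> orth m"
  show "\<phi> (\<iota> g * Z * Q) = \<phi> (\<iota> g * (Z * Q))"
    by (subst assoc_mult_mat[of _ n n _ n _ n]) (use Q Z orth_carrier in auto)
qed

lemma emb_assoc:
  assumes "g \<in> orth m" "h \<in> orth m" "Z \<in> orth n"
  shows "\<iota> h * (\<iota> g * Z) = \<iota> (h * g) * Z"
  using assms[THEN orth_carrier]
  by (simp add: emb_mult[OF embf] assoc_mult_mat[of "\<iota> h" n n "\<iota> g" n Z n])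

lemma avg_inv:
  assumes p: "\<phi> \<in> Lip n" and g: "g \<in> orth m" and Z: "Z \<in> orth n"
  shows "A \<phi> (\<iota> g * Z) = A \<phi> Z"
proof -
  have "lam (\<lambda>h. \<phi> (\<iota> h * (\<iota> g * Z))) = lam (\<lambda>h. \<phi> (\<iota> (h * g) * Z))"
    by (rule eqI[OF jl_Lip[OF p orth_mult[OF \<iota>_orth[OF g] Z]]]) (simp add: emb_assoc g Z)
  also have "\<dots> = lam (\<lambda>h. \<phi> (\<iota> h * Z))"
    by (rule right[OF jl_Lip[OF p Z] g])
  finally show ?thesis unfolding avg_def .
qed

definition Inv :: "(real mat \<Rightarrow> real) \<Rightarrow> bool" where
  "Inv \<phi> \<longleftrightarrow> (\<forall>g\<in>orth m. \<forall>Z\<in>orth n. \<phi> (\<iota> g * Z) = \<phi> Z)"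

lemma Inv_avg: "\<phi> \<in> Lip n \<Longrightarrow> Inv (A \<phi>)"
  unfolding Inv_def by (simp add: avg_inv)

lemma avg_pull:
  assumes p: "Inv \<phi>" "\<phi> \<in> Lip n" and q: "\<psi> \<in> Lip n" and Z: "Z \<in> orth n"
  shows "A (\<lambda>X. \<phi> X * \<psi> X) Z = \<phi> Z * A \<psi> Z"
proof -
  have "lam (\<lambda>g. \<phi> (\<iota> g * Z) * \<psi> (\<iota> g * Z)) = lam (\<lambda>g. \<phi> Z * \<psi> (\<iota> g * Z))"
    by (rule eqI[OF Lip_mult[OF jl_Lip[OF p(2) Z] jl_Lip[OF q Z]]]) (use p Z in \<open>auto simp: Inv_def\<close>)
  also have "\<dots> = \<phi> Z * lam (\<lambda>g. \<psi> (\<iota> g * Z))" by (rule cmult[OF jl_Lip[OF q Z]])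
  finally show ?thesis unfolding avg_def .
qed

lemma avg_Inv:
  assumes p: "Inv \<phi>" "\<phi> \<in> Lip n" and Z: "Z \<in> orth n"
  shows "A \<phi> Z = \<phi> Z"
  using avg_pull[OF p Lip_const Z, of 1] by (simp add: avg_const)

lemma haar_avg:
  assumes h: "haar n Lam" and p: "\<phi> \<in> Lip n"
  shows "Lam (A \<phi>) = Lam \<phi>"
proof -
  interpret H: haar n Lam by fact
  have "Lam (\<lambda>Z. lam (\<lambda>g. \<phi> (\<iota> g * Z))) = lam (\<lambda>g. Lam (\<lambda>Z. \<phi> (\<iota> g * Z)))"
    by (rule mean_swap[symmetric, OF _ _ jl[OF p]]) unfold_locales
  also have "\<dots> = lam (\<lambda>g. Lam \<phi>)"
  proof (rule eqI)
    show "(\<lambda>g. Lam (\<lambda>Z. \<phi> (\<iota> g * Z))) \<in> Lip m"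
      by (rule jlip_mean_snd[OF _ jl[OF p]]) unfold_locales
  qed (rule H.left[OF p \<iota>_orth])
  finally show ?thesis unfolding avg_def[abs_def] by (simp add: const)
qed

text \<open>\<open>A\<close> is the orthogonal projection onto the invariant functions.\<close>

lemma haar_avg_mult:
  assumes h: "haar n Lam" and p: "\<phi> \<in> Lip n" and q: "\<psi> \<in> Lip n"
  shows "Lam (\<lambda>Z. A \<phi> Z * \<psi> Z) = Lam (\<lambda>Z. A \<phi> Z * A \<psi> Z)"
proof -
  interpret H: haar n Lam by fact
  have "Lam (\<lambda>Z. A \<phi> Z * \<psi> Z) = Lam (A (\<lambda>Z. A \<phi> Z * \<psi> Z))"
    using p q by (intro haar_avg[OF h, symmetric]) auto
  also have "\<dots> = Lam (\<lambda>Z. A \<phi> Z * A \<psi> Z)"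
    using p q by (intro H.eqI avg_pull Inv_avg) auto
  finally show ?thesis .
qed

end

lemma emb_avg_e2: "i < n \<Longrightarrow> j < n \<Longrightarrow> i \<noteq> j \<Longrightarrow> emb_avg 2 cmean n (pr i j)"
  using haar_cmean embf_pr by (simp add: emb_avg_def emb_avg_axioms_def)

subsection \<open>The Haar mean as a limit of averages over plane rotations\<close>

definition prs :: "nat \<Rightarrow> (nat \<times> nat) set" where
  "prs n = {(i,j). i < n \<and> j < n \<and> i \<noteq> j}"

lemma finite_prs [simp]: "finite (prs n)"
  by (rule finite_subset[of _ "{..<n} \<times> {..<n}"]) (auto simp: prs_def)

lemma card_prs: "card (prs n) = n * (n - 1)"
proof -
  have "prs n = (SIGMA i:{..<n}. {..<n} - {i})" by (auto simp: prs_def)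
  then show ?thesis by simp
qed

text \<open>\<open>P2 n (i,j)\<close> averages over \<open>O(2)\<close> acting on rows \<open>i\<close> and \<open>j\<close>; \<open>TT n\<close> is one step of Kac's walk.\<close>

definition P2 :: "nat \<Rightarrow> nat \<times> nat \<Rightarrow> (real mat \<Rightarrow> real) \<Rightarrow> real mat \<Rightarrow> real" where
  "P2 n p = avg cmean 2 n (pr (fst p) (snd p))"

definition TT :: "nat \<Rightarrow> (real mat \<Rightarrow> real) \<Rightarrow> real mat \<Rightarrow> real" where
  "TT n \<phi> Z = (\<Sum>p\<in>prs n. P2 n p \<phi> Z) / real (card (prs n))"

lemma P2_avg: "p \<in> prs n \<Longrightarrow> emb_avg 2 cmean n (pr (fst p) (snd p))"
  by (auto simp: prs_def intro: emb_avg_e2)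

lemma P2_Lip [intro,simp]: "p \<in> prs n \<Longrightarrow> \<phi> \<in> Lip n \<Longrightarrow> P2 n p \<phi> \<in> Lip n"
  unfolding P2_def by (rule emb_avg.avg_Lip[OF P2_avg])

context
  fixes n :: nat
  assumes n2: "2 \<le> n"
begin

lemma card_pos: "0 < card (prs n)" using n2 by (simp add: card_prs)

lemma TT_lipw:
  assumes L: "lipw n L \<phi>"
  shows "lipw n L (TT n \<phi>)"
proof (rule lipwI[OF lipw_nonneg[OF L]])
  fix X Y assume XY: "X \<in> orth n" "Y \<in> orth n"
  have "\<bar>(\<Sum>p\<in>prs n. P2 n p \<phi> X) - (\<Sum>p\<in>prs n. P2 n p \<phi> Y)\<bar> \<le> (\<Sum>p\<in>prs n. \<bar>P2 n p \<phi> X - P2 n p \<phi> Y\<bar>)"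
    unfolding sum_subtractf[symmetric] by (rule sum_abs)
  also have "\<dots> \<le> (\<Sum>p\<in>prs n. L * fd X Y)"
    unfolding P2_def by (intro sum_mono lipwD[OF emb_avg.avg_lipw[OF P2_avg L] XY])
  finally show "\<bar>TT n \<phi> X - TT n \<phi> Y\<bar> \<le> L * fd X Y"
    using card_pos unfolding TT_def diff_divide_distrib[symmetric] by (simp add: field_simps)
qed

lemma TT_mono:
  assumes "\<phi> \<in> Lip n" "\<psi> \<in> Lip n" "\<And>X. X \<in> orth n \<Longrightarrow> \<phi> X \<le> \<psi> X" "Z \<in> orth n"
  shows "TT n \<phi> Z \<le> TT n \<psi> Z"
  unfolding TT_def P2_def using assms by (intro divide_right_mono sum_mono emb_avg.avg_mono[OF P2_avg]) auto

lemma TT_const: "TT n (\<lambda>_. c) Z = c"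
  unfolding TT_def P2_def using card_pos by (auto simp: emb_avg.avg_const[OF P2_avg])

lemma TT_add: "\<phi> \<in> Lip n \<Longrightarrow> \<psi> \<in> Lip n \<Longrightarrow> Z \<in> orth n \<Longrightarrow> TT n (\<lambda>X. \<phi> X + \<psi> X) Z = TT n \<phi> Z + TT n \<psi> Z"
  unfolding TT_def P2_def by (simp add: emb_avg.avg_add[OF P2_avg] sum.distrib add_divide_distrib)

lemma TT_cmult: "\<phi> \<in> Lip n \<Longrightarrow> Z \<in> orth n \<Longrightarrow> TT n (\<lambda>X. c * \<phi> X) Z = c * TT n \<phi> Z"
  unfolding TT_def P2_def by (simp add: emb_avg.avg_cmult[OF P2_avg] sum_distrib_left)

lemma TT_right: "\<phi> \<in> Lip n \<Longrightarrow> Q \<in> orth n \<Longrightarrow> Z \<in> orth n \<Longrightarrow> TT n (\<lambda>X. \<phi> (X * Q)) Z = TT n \<phi> (Z * Q)"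
  unfolding TT_def P2_def by (simp add: emb_avg.avg_right[OF P2_avg])

lemma TT_cong:
  assumes "\<phi> \<in> Lip n" "\<And>X. X \<in> orth n \<Longrightarrow> \<phi> X = \<psi> X" "Z \<in> orth n"
  shows "TT n \<phi> Z = TT n \<psi> Z"
  unfolding TT_def P2_def using assms by (intro arg_cong2[where f = "(/)"] sum.cong emb_avg.avg_cong[OF P2_avg]) auto

abbreviation "Tk k \<equiv> TT n ^^ k"

lemma Tk_lipw: "lipw n L \<phi> \<Longrightarrow> lipw n L (Tk k \<phi>)"
  by (induction k) (auto intro: TT_lipw)

lemma Tk_Lip [intro,simp]: "\<phi> \<in> Lip n \<Longrightarrow> Tk k \<phi> \<in> Lip n"
  using Tk_lipw by (auto simp: Lip_def)

lemma Tk_const: "Tk k (\<lambda>_. c) = (\<lambda>_. c)"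
  by (induction k) (auto simp: TT_const)

lemma Tk_mono:
  assumes "\<phi> \<in> Lip n" "\<psi> \<in> Lip n" "\<And>X. X \<in> orth n \<Longrightarrow> \<phi> X \<le> \<psi> X"
  shows "Z \<in> orth n \<Longrightarrow> Tk k \<phi> Z \<le> Tk k \<psi> Z"
  using assms by (induction k arbitrary: Z) (auto intro!: TT_mono)

lemma Tk_add:
  assumes "\<phi> \<in> Lip n" "\<psi> \<in> Lip n"
  shows "Z \<in> orth n \<Longrightarrow> Tk k (\<lambda>X. \<phi> X + \<psi> X) Z = Tk k \<phi> Z + Tk k \<psi> Z"
proof (induction k arbitrary: Z)
  case (Suc k)
  have "TT n (Tk k (\<lambda>X. \<phi> X + \<psi> X)) Z = TT n (\<lambda>X. Tk k \<phi> X + Tk k \<psi> X) Z"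
    using assms by (intro TT_cong Suc) auto
  then show ?case using assms Suc(2) by (simp add: TT_add)
qed simp

lemma Tk_cmult:
  assumes "\<phi> \<in> Lip n"
  shows "Z \<in> orth n \<Longrightarrow> Tk k (\<lambda>X. c * \<phi> X) Z = c * Tk k \<phi> Z"
proof (induction k arbitrary: Z)
  case (Suc k)
  have "TT n (Tk k (\<lambda>X. c * \<phi> X)) Z = TT n (\<lambda>X. c * Tk k \<phi> X) Z"
    using assms by (intro TT_cong Suc) auto
  then show ?case using assms Suc(2) by (simp add: TT_cmult)
qed simp

lemma Tk_right:
  assumes "\<phi> \<in> Lip n" "Q \<in> orth n"
  shows "Z \<in> orth n \<Longrightarrow> Tk k (\<lambda>X. \<phi> (X * Q)) Z = Tk k \<phi> (Z * Q)"
proof (induction k arbitrary: Z)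
  case (Suc k)
  have "TT n (Tk k (\<lambda>X. \<phi> (X * Q))) Z = TT n (\<lambda>X. Tk k \<phi> (X * Q)) Z"
    using assms by (intro TT_cong Suc) auto
  then show ?case using assms Suc(2) by (simp add: TT_right)
qed simp

text \<open>The gain of one averaging step. A function on \<open>O(2)\<close> with Lipschitz
  constant \<open>K\<close> that lies \<open>\<eta>\<close> below its upper bound at one point stays
  below the bound by at least this tent around the point; the mean of the tent is what the average
  loses. By \<open>bump_shift\<close> it is the same for every point.\<close>

definition bump :: "real \<Rightarrow> real \<Rightarrow> real" where
  "bump K \<eta> = cmean (\<lambda>g. max 0 (\<eta> - K * fd g (1\<^sub>m 2)))"

lemma bump_Lip:
  assumes "0 \<le> K" "h \<in> orth 2"
  shows "(\<lambda>g. max 0 (\<eta> - K * fd g h)) \<in> Lip 2"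
proof (rule LipI[of 2 K], rule lipwI[OF assms(1)])
  fix X Y assume XY: "X \<in> orth 2" "Y \<in> orth 2"
  note c = XY[THEN orth_carrier] orth_carrier[OF assms(2)]
  have "fd X h \<le> fd X Y + fd Y h" "fd Y h \<le> fd X Y + fd X h"
    using fd_triangle[OF c] fd_triangle[OF c(2,1,3)] fd_commute[OF c(1,2)] by auto
  then have "\<bar>fd X h - fd Y h\<bar> \<le> fd X Y" by linarith
  then have "K * \<bar>fd X h - fd Y h\<bar> \<le> K * fd X Y" by (rule mult_left_mono[OF _ assms(1)])
  then have "\<bar>K * fd X h - K * fd Y h\<bar> \<le> K * fd X Y"
    using assms(1) by (simp only: right_diff_distrib[symmetric] abs_mult abs_of_nonneg)
  then show "\<bar>max 0 (\<eta> - K * fd X h) - max 0 (\<eta> - K * fd Y h)\<bar> \<le> K * fd X Y" by linarith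
qed

lemma bump_pos:
  assumes K: "0 \<le> K" and e: "0 < \<eta>"
  shows "0 < bump K \<eta>"
proof -
  interpret C: haar 2 cmean by (rule haar_cmean)
  define \<phi> where "\<phi> g = max 0 (\<eta> - K * fd g (1\<^sub>m 2))" for g
  have pL: "\<phi> \<in> Lip 2" unfolding \<phi>_def[abs_def] by (rule bump_Lip[OF K orth_one])
  define F where "F t = \<phi> (rot2 t) + \<phi> (rot2 t * flip2)" for t
  have c: "continuous_on {0..2*pi} F" unfolding F_def
    by (intro continuous_on_add Lip_rot2_continuous[OF pL] Lip_rot2_continuous[OF Lip_right[OF pL flip2_orth]])
  have nn: "0 \<le> F t" for t by (simp add: F_def \<phi>_def)
  have F0: "0 < F 0" unfolding F_def rot2_0 \<phi>_def using e by (simp add: fd_self)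
  have "integral {0..2*pi} F \<noteq> 0"
    using integral_eq_0_iff[OF c _ nn] F0 by (auto dest: bspec[of _ _ 0])
  moreover have "0 \<le> integral {0..2*pi} F"
    by (intro Henstock_Kurzweil_Integration.integral_nonneg integrable_continuous_interval c nn)
  ultimately have "0 < integral {0..2*pi} F" by linarith
  then have "0 < (1 / (4 * pi)) * integral {0..2*pi} F" by simp
  then show ?thesis unfolding bump_def cmean_def F_def \<phi>_def .
qed

lemma bump_shift:
  assumes K: "0 \<le> K" and h: "h \<in> orth 2"
  shows "cmean (\<lambda>g. max 0 (\<eta> - K * fd g h)) = bump K \<eta>"
proof -
  interpret C: haar 2 cmean by (rule haar_cmean)
  have "bump K \<eta> = cmean (\<lambda>g. max 0 (\<eta> - K * fd (transpose_mat h * g) (1\<^sub>m 2)))"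
    unfolding bump_def by (rule C.left[symmetric, OF bump_Lip[OF K orth_one] orth_transpose[OF h]])
  also have "\<dots> = cmean (\<lambda>g. max 0 (\<eta> - K * fd g h))"
  proof (rule C.eqI[OF Lip_left[OF bump_Lip[OF K orth_one] orth_transpose[OF h]]])
    fix g assume g: "g \<in> orth 2"
    have "fd (transpose_mat h * g) (transpose_mat h * h) = fd g h"
      by (rule fd_left[OF orth_transpose[OF h] orth_carrier[OF g] orth_carrier[OF h]])
    then show "max 0 (\<eta> - K * fd (transpose_mat h * g) (1\<^sub>m 2)) = max 0 (\<eta> - K * fd g h)"
      by (simp add: orth_transpose_mult[OF h])
  qed
  finally show ?thesis by simp
qed

text \<open>The pair \<open>(i,j)\<close> gains a \<open>bump\<close> and every other pair stays
  below \<open>b\<close>, hence the division by the number of pairs. The factor \<open>n * n\<close>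
  in the slope accounts for the embedding of \<open>O(2)\<close>, which expands distances by at most
  that much.\<close>

lemma TT_shrink:
  assumes L: "lipw n L \<psi>" and b: "\<And>X. X \<in> orth n \<Longrightarrow> \<psi> X \<le> b"
    and ij: "i < n" "j < n" "i \<noteq> j" and h: "h \<in> orth 2" and Z: "Z \<in> orth n"
    and v: "\<psi> (e2 n i j h * Z) \<le> b - \<eta>"
  shows "TT n \<psi> Z \<le> b - bump (L * (real n * real n)) \<eta> / real (card (prs n))"
proof -
  interpret emb_avg 2 cmean n "pr i j" by (rule emb_avg_e2[OF ij])
  define K where "K = L * (real n * real n)"
  have L0: "0 \<le> L" by (rule lipw_nonneg[OF L])
  then have K: "0 \<le> K" by (simp add: K_def)
  have pL: "\<psi> \<in> Lip n" by (rule LipI[OF L])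
  have "P2 n (i,j) \<psi> Z \<le> cmean (\<lambda>g. b - max 0 (\<eta> - K * fd g h))"
    unfolding P2_def avg_def fst_conv snd_conv
  proof (rule mono[OF jl_Lip[OF pL Z] Lip_diff[OF Lip_const bump_Lip[OF K h]]])
    fix g assume g: "g \<in> orth 2"
    have o: "\<iota> g * Z \<in> orth n" "\<iota> h * Z \<in> orth n" by (auto intro!: orth_mult \<iota>_orth g h Z)
    have "\<bar>\<psi> (\<iota> g * Z) - \<psi> (\<iota> h * Z)\<bar> \<le> L * fd (\<iota> g * Z) (\<iota> h * Z)" by (rule lipwD[OF L o])
    also have "fd (\<iota> g * Z) (\<iota> h * Z) = fd (\<iota> g) (\<iota> h)" by (rule fd_right[OF Z, where m = n]) auto
    also have "\<dots> \<le> real n * real n * fd g h" by (rule fd_emb_le[OF embf]) (use g h orth_carrier in auto)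
    finally have "\<bar>\<psi> (\<iota> g * Z) - \<psi> (\<iota> h * Z)\<bar> \<le> K * fd g h" using L0 by (simp add: K_def mult_left_mono mult.assoc)
    then show "\<psi> (\<iota> g * Z) \<le> b - max 0 (\<eta> - K * fd g h)" using v b[OF o(1)] by linarith
  qed
  also have "\<dots> = b - bump K \<eta>" by (simp add: diff[OF Lip_const bump_Lip[OF K h]] const bump_shift[OF K h])
  finally have 1: "P2 n (i,j) \<psi> Z \<le> b - bump K \<eta>" .
  have 2: "P2 n p \<psi> Z \<le> b" if "p \<in> prs n" for p
    using emb_avg.avg_mono[OF P2_avg[OF that] pL Lip_const b Z] emb_avg.avg_const[OF P2_avg[OF that], of b Z]
    by (simp add: P2_def)
  have p: "(i,j) \<in> prs n" using ij by (simp add: prs_def)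
  have "(\<Sum>p\<in>prs n. P2 n p \<psi> Z) = P2 n (i,j) \<psi> Z + (\<Sum>p\<in>prs n - {(i,j)}. P2 n p \<psi> Z)"
    by (rule sum.remove[OF finite_prs p])
  also have "(\<Sum>p\<in>prs n - {(i,j)}. P2 n p \<psi> Z) \<le> (\<Sum>p\<in>prs n - {(i,j)}. b)" by (intro sum_mono 2) auto
  also have "\<dots> = real (card (prs n)) * b - b" using card_pos p by (simp add: card_Diff_singleton of_nat_diff algebra_simps)
  finally have "(\<Sum>p\<in>prs n. P2 n p \<psi> Z) \<le> real (card (prs n)) * b - bump K \<eta>" using 1 by linarith
  then have "TT n \<psi> Z \<le> (real (card (prs n)) * b - bump K \<eta>) / real (card (prs n))"
    unfolding TT_def by (rule divide_right_mono) simp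
  then show ?thesis using card_pos by (auto simp: diff_divide_distrib K_def split: if_splits)
qed

text \<open>Since a word of fixed length connects any two points, a value below the upper bound somewhere lowers the bound
  everywhere after that many steps.\<close>

lemma Tk_shrink:
  assumes e: "0 < \<eta>" and L0: "0 \<le> L"
  shows "\<exists>\<epsilon>>0. \<forall>\<psi> b A Z. lipw n L \<psi> \<longrightarrow> (\<forall>X\<in>orth n. \<psi> X \<le> b) \<longrightarrow> A \<in> Wd n k \<longrightarrow> Z \<in> orth n \<longrightarrow>
     \<psi> (A * Z) \<le> b - \<eta> \<longrightarrow> Tk k \<psi> Z \<le> b - \<epsilon>"
proof (induction k)
  case 0
  show ?case using e by (intro exI[of _ \<eta>]) (auto dest: orth_carrier)
next
  case (Suc k)
  then obtain \<epsilon> where \<epsilon>: "\<epsilon> > 0" "\<And>\<psi> b A Z. lipw n L \<psi> \<Longrightarrow> (\<forall>X\<in>orth n. \<psi> X \<le> b) \<Longrightarrow> A \<in> Wd n k \<Longrightarrow>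
     Z \<in> orth n \<Longrightarrow> \<psi> (A * Z) \<le> b - \<eta> \<Longrightarrow> Tk k \<psi> Z \<le> b - \<epsilon>" by metis
  define \<epsilon>' where "\<epsilon>' = bump (L * (real n * real n)) \<epsilon> / real (card (prs n))"
  have "\<epsilon>' > 0" unfolding \<epsilon>'_def using L0 card_pos by (intro divide_pos_pos bump_pos \<epsilon>(1)) auto
  moreover have "Tk (Suc k) \<psi> Z \<le> b - \<epsilon>'"
    if L: "lipw n L \<psi>" and b: "\<forall>X\<in>orth n. \<psi> X \<le> b" and A: "A \<in> Wd n (Suc k)" and Z: "Z \<in> orth n"
      and v: "\<psi> (A * Z) \<le> b - \<eta>" for \<psi> b A Z
  proof -
    obtain i j g B where ij: "i < n" "j < n" "i \<noteq> j" and g: "g \<in> orth 2" and B: "B \<in> Wd n k" and AB: "A = B * e2 n i j g"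
      using A by auto
    have o: "e2 n i j g * Z \<in> orth n" by (intro orth_mult e2_orth ij g Z)
    have "A * Z = B * (e2 n i j g * Z)" unfolding AB
      using orth_carrier[OF Wd_orth[OF B]] orth_carrier[OF Z] by (intro assoc_mult_mat) auto
    then have w: "Tk k \<psi> (e2 n i j g * Z) \<le> b - \<epsilon>" using \<epsilon>(2)[OF L b B o] v by simp
    have bb: "Tk k \<psi> X \<le> b" if "X \<in> orth n" for X
      using Tk_mono[OF LipI[OF L] Lip_const, of b X k] b that by (simp add: Tk_const)
    show ?thesis unfolding \<epsilon>'_def
      using TT_shrink[OF Tk_lipw[OF L] bb ij g Z w] by simp
  qed
  ultimately show ?case by blast
qed

text \<open>Only the suprema \<open>U k\<close> are followed. They decrease to a limit
  \<open>l\<close>; if some value at a late time were more than \<open>e\<close> below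
  \<open>l\<close>, then \<open>m\<close> steps later the supremum would have dropped by a fixed
  \<open>\<epsilon>\<close>, below the limit. Thus the lower bound comes from the upper one.\<close>

lemma Tk_osc:
  assumes p: "\<phi> \<in> Lip n"
  obtains l where "\<And>e. e > 0 \<Longrightarrow> \<exists>k0. \<forall>k\<ge>k0. \<forall>Z\<in>orth n. \<bar>Tk k \<phi> Z - l\<bar> \<le> e"
proof -
  obtain L where L: "lipw n L \<phi>" using p by (auto simp: Lip_def)
  obtain B where B: "B > 0" "\<And>X. X \<in> orth n \<Longrightarrow> \<bar>\<phi> X\<bar> \<le> B" using Lip_bounded[OF p] by auto
  have kB: "\<bar>Tk k \<phi> X\<bar> \<le> B" if "X \<in> orth n" for k X
    using Tk_mono[OF p Lip_const, of B X k] Tk_mono[OF Lip_const p, of "-B" X k] B(2) that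
    by (simp add: Tk_const abs_le_iff) (metis minus_le_iff)
  define U where "U k = Sup (Tk k \<phi> ` orth n)" for k
  have bdd: "bdd_above (Tk k \<phi> ` orth n)" for k using kB by (intro bdd_aboveI[of _ B]) (auto simp: abs_le_iff)
  have ne: "Tk k \<phi> ` orth n \<noteq> {}" for k using orth_one by blast
  have leU: "Tk k \<phi> X \<le> U k" if "X \<in> orth n" for k X
    unfolding U_def by (rule cSup_upper[OF _ bdd]) (use that in auto)
  have Ule: "U k \<le> c" if "\<And>X. X \<in> orth n \<Longrightarrow> Tk k \<phi> X \<le> c" for k c
    unfolding U_def by (rule cSup_least[OF ne]) (use that in auto)
  have Tadd: "Tk (k + m) \<phi> = Tk m (Tk k \<phi>)" for k m by (simp only: add.commute[of k m] funpow_add o_apply)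
  have dec: "U (k + m) \<le> U k" for k m
  proof (rule Ule)
    fix X assume "X \<in> orth n"
    then show "Tk (k + m) \<phi> X \<le> U k" unfolding Tadd
      using Tk_mono[of "Tk k \<phi>" "\<lambda>_. U k" X m, OF Tk_Lip[OF p] Lip_const leU] by (simp add: Tk_const)
  qed
  have "decseq U" unfolding decseq_def using dec by (metis le_add_diff_inverse)
  moreover have lower: "- B \<le> U k" for k using leU[OF orth_one, of k] kB[OF orth_one, of k] by (simp add: abs_le_iff)
  ultimately obtain l where l: "U \<longlonglongrightarrow> l" "\<And>k. l \<le> U k" using decseq_convergent[of U "-B"] by blast
  show thesis
  proof (rule that[of l])
    fix e :: real assume e: "e > 0"
    obtain m where m: "\<And>Z W. Z \<in> orth n \<Longrightarrow> W \<in> orth n \<Longrightarrow> \<exists>A\<in>Wd n m. A * Z = W" using reach[OF n2] by blast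
    obtain \<epsilon> where \<epsilon>: "\<epsilon> > 0" "\<And>\<psi> b A Z. lipw n L \<psi> \<Longrightarrow> (\<forall>X\<in>orth n. \<psi> X \<le> b) \<Longrightarrow> A \<in> Wd n m \<Longrightarrow>
     Z \<in> orth n \<Longrightarrow> \<psi> (A * Z) \<le> b - e \<Longrightarrow> Tk m \<psi> Z \<le> b - \<epsilon>"
      using Tk_shrink[OF e lipw_nonneg[OF L], of m] by metis
    \<comment> \<open>The part \<open>d \<le> e\<close> bounds the values from above by
      \<open>l + e\<close>; the part \<open>d \<le> \<epsilon> / 2\<close> makes a drop of
      \<open>U\<close> by \<open>\<epsilon>\<close> fall below \<open>l\<close>.\<close>
    define d where "d = min e (\<epsilon> / 2)"
    have d: "d > 0" using e \<epsilon>(1) by (simp add: d_def)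
    obtain k0 where k0: "\<And>k. k \<ge> k0 \<Longrightarrow> \<bar>U k - l\<bar> < d" using LIMSEQ_D[OF l(1) d] by auto
    have "\<bar>Tk k \<phi> Z - l\<bar> \<le> e" if k: "k \<ge> k0" and Z: "Z \<in> orth n" for k Z
    proof (rule ccontr)
      assume "\<not> \<bar>Tk k \<phi> Z - l\<bar> \<le> e"
      moreover have "Tk k \<phi> Z \<le> l + e" using leU[OF Z, of k] k0[OF k] by (simp add: d_def abs_less_iff)
      ultimately have low: "Tk k \<phi> Z \<le> U k - e" using l(2)[of k] by linarith
      have "U (k + m) \<le> U k - \<epsilon>"
      proof (rule Ule)
        fix X assume X: "X \<in> orth n"
        obtain A where A: "A \<in> Wd n m" "A * X = Z" using m[OF X Z] by auto
        show "Tk (k + m) \<phi> X \<le> U k - \<epsilon>" unfolding Tadd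
          by (rule \<epsilon>(2)[OF Tk_lipw[OF L] _ A(1) X]) (use leU low A in auto)
      qed
      then show False using l(2)[of "k + m"] k0[OF k] \<epsilon>(1) by (auto simp: d_def)
    qed
    then show "\<exists>k0. \<forall>k\<ge>k0. \<forall>Z\<in>orth n. \<bar>Tk k \<phi> Z - l\<bar> \<le> e" by blast
  qed
qed

text \<open>The identity is an arbitrary base point: by \<open>Tk_osc\<close> the iterates converge
  uniformly to a constant.\<close>

definition hl :: "(real mat \<Rightarrow> real) \<Rightarrow> real" where
  "hl \<phi> = lim (\<lambda>k. Tk k \<phi> (1\<^sub>m n))"

lemma Tk_uniform:
  assumes p: "\<phi> \<in> Lip n" and e: "e > 0"
  shows "\<exists>k0. \<forall>k\<ge>k0. \<forall>Z\<in>orth n. \<bar>Tk k \<phi> Z - hl \<phi>\<bar> \<le> e"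
proof -
  obtain l where l: "\<And>e. e > 0 \<Longrightarrow> \<exists>k0. \<forall>k\<ge>k0. \<forall>Z\<in>orth n. \<bar>Tk k \<phi> Z - l\<bar> \<le> e" using Tk_osc[OF p] by blast
  have "(\<lambda>k. Tk k \<phi> (1\<^sub>m n)) \<longlonglongrightarrow> l"
  proof (rule LIMSEQ_I)
    fix r :: real assume "r > 0"
    then obtain k0 where "\<forall>k\<ge>k0. \<forall>Z\<in>orth n. \<bar>Tk k \<phi> Z - l\<bar> \<le> r / 2" using l[of "r / 2"] by auto
    then have "\<forall>k\<ge>k0. norm (Tk k \<phi> (1\<^sub>m n) - l) < r" using orth_one[of n] \<open>r > 0\<close> by force
    then show "\<exists>k0. \<forall>k\<ge>k0. norm (Tk k \<phi> (1\<^sub>m n) - l) < r" by blast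
  qed
  then have "hl \<phi> = l" unfolding hl_def by (rule limI)
  then show ?thesis using l[OF e] by simp
qed

lemma Tk_lim:
  assumes p: "\<phi> \<in> Lip n" and Z: "Z \<in> orth n"
  shows "(\<lambda>k. Tk k \<phi> Z) \<longlonglongrightarrow> hl \<phi>"
proof (rule LIMSEQ_I)
  fix r :: real assume r: "r > 0"
  then obtain k0 where "\<forall>k\<ge>k0. \<forall>Z\<in>orth n. \<bar>Tk k \<phi> Z - hl \<phi>\<bar> \<le> r / 2" using Tk_uniform[OF p, of "r / 2"] by auto
  then have "\<forall>k\<ge>k0. norm (Tk k \<phi> Z - hl \<phi>) < r" using Z r by force
  then show "\<exists>k0. \<forall>k\<ge>k0. norm (Tk k \<phi> Z - hl \<phi>) < r" by blast
qed

text \<open>The walk multiplies from the left and therefore commutes with right translations, so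
  right invariance is immediate for the limit; left invariance follows from
  \<open>haarI_right\<close>.\<close>

lemma haar_hl: "haar n hl"
proof (rule haarI_right)
  show "mean n hl"
  proof
    show "hl (\<lambda>A. \<phi> A + \<psi> A) = hl \<phi> + hl \<psi>" if pq: "\<phi> \<in> Lip n" "\<psi> \<in> Lip n" for \<phi> \<psi>
    proof -
      have "(\<lambda>k. Tk k (\<lambda>A. \<phi> A + \<psi> A) (1\<^sub>m n)) \<longlonglongrightarrow> hl \<phi> + hl \<psi>"
        unfolding Tk_add[OF pq orth_one] by (intro tendsto_add Tk_lim pq orth_one)
      then show ?thesis unfolding hl_def[of "\<lambda>A. \<phi> A + \<psi> A"] by (rule limI)
    qed
    show "hl (\<lambda>A. c * \<phi> A) = c * hl \<phi>" if p: "\<phi> \<in> Lip n" for \<phi> c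
    proof -
      have "(\<lambda>k. Tk k (\<lambda>A. c * \<phi> A) (1\<^sub>m n)) \<longlonglongrightarrow> c * hl \<phi>"
        unfolding Tk_cmult[OF p orth_one] by (intro tendsto_mult_left Tk_lim p orth_one)
      then show ?thesis unfolding hl_def[of "\<lambda>A. c * \<phi> A"] by (rule limI)
    qed
    show "0 \<le> hl \<phi>" if p: "\<phi> \<in> Lip n" and nn: "\<And>A. A \<in> orth n \<Longrightarrow> 0 \<le> \<phi> A" for \<phi>
    proof (rule LIMSEQ_le_const[OF Tk_lim[OF p orth_one]])
      show "\<exists>N. \<forall>k\<ge>N. 0 \<le> Tk k \<phi> (1\<^sub>m n)"
        using Tk_mono[OF Lip_const p nn orth_one] by (simp add: Tk_const)
    qed
    show "hl (\<lambda>_. 1) = 1" unfolding hl_def Tk_const by simp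
  qed
  show "hl (\<lambda>A. \<phi> (A * Q)) = hl \<phi>" if p: "\<phi> \<in> Lip n" and Q: "Q \<in> orth n" for \<phi> Q
  proof -
    have "(\<lambda>k. Tk k (\<lambda>A. \<phi> (A * Q)) (1\<^sub>m n)) \<longlonglongrightarrow> hl \<phi>"
      unfolding Tk_right[OF p Q orth_one] using Q orth_carrier[OF Q] by (simp add: Tk_lim[OF p])
    then show ?thesis unfolding hl_def[of "\<lambda>A. \<phi> (A * Q)"] by (rule limI)
  qed
qed

end

section \<open>Products of jointly Lipschitz functions; symmetry of the plane averages\<close>

lemma jlip_bounded:
  assumes "jlip m n \<Phi>"
  shows "\<exists>b>0. \<forall>g\<in>orth m. \<forall>Z\<in>orth n. \<bar>\<Phi> g Z\<bar> \<le> b"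
proof -
  obtain L where L: "L \<ge> 0" "\<And>g g' Z Z'. g\<in>orth m \<Longrightarrow> g'\<in>orth m \<Longrightarrow> Z\<in>orth n \<Longrightarrow> Z'\<in>orth n \<Longrightarrow>
     \<bar>\<Phi> g Z - \<Phi> g' Z'\<bar> \<le> L * (fd g g' + fd Z Z')" using assms by (auto simp: jlip_def)
  define b where "b = \<bar>\<Phi> (1\<^sub>m m) (1\<^sub>m n)\<bar> + L * (real m * real m * 2 + real n * real n * 2) + 1"
  have "\<bar>\<Phi> g Z\<bar> \<le> b" if g: "g \<in> orth m" and Z: "Z \<in> orth n" for g Z
  proof -
    have "\<bar>\<Phi> g Z - \<Phi> (1\<^sub>m m) (1\<^sub>m n)\<bar> \<le> L * (fd g (1\<^sub>m m) + fd Z (1\<^sub>m n))" by (rule L(2)[OF g orth_one Z orth_one])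
    also have "\<dots> \<le> L * (real m * real m * 2 + real n * real n * 2)"
      by (intro mult_left_mono add_mono fd_orth_le g Z orth_one L(1))
    finally show ?thesis unfolding b_def by linarith
  qed
  moreover have "b > 0" unfolding b_def using L(1) by (simp add: add_nonneg_pos)
  ultimately show ?thesis by blast
qed

lemma jlip_times:
  assumes "jlip m n \<Phi>" "jlip m n \<Psi>"
  shows "jlip m n (\<lambda>g Z. \<Phi> g Z * \<Psi> g Z)"
proof -
  obtain L where L: "L \<ge> 0" "\<And>g g' Z Z'. g\<in>orth m \<Longrightarrow> g'\<in>orth m \<Longrightarrow> Z\<in>orth n \<Longrightarrow> Z'\<in>orth n \<Longrightarrow>
     \<bar>\<Phi> g Z - \<Phi> g' Z'\<bar> \<le> L * (fd g g' + fd Z Z')" using assms(1) by (auto simp: jlip_def)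
  obtain L' where L': "L' \<ge> 0" "\<And>g g' Z Z'. g\<in>orth m \<Longrightarrow> g'\<in>orth m \<Longrightarrow> Z\<in>orth n \<Longrightarrow> Z'\<in>orth n \<Longrightarrow>
     \<bar>\<Psi> g Z - \<Psi> g' Z'\<bar> \<le> L' * (fd g g' + fd Z Z')" using assms(2) by (auto simp: jlip_def)
  obtain b where b: "b > 0" "\<And>g Z. g\<in>orth m \<Longrightarrow> Z\<in>orth n \<Longrightarrow> \<bar>\<Phi> g Z\<bar> \<le> b" using jlip_bounded[OF assms(1)] by auto
  obtain b' where b': "b' > 0" "\<And>g Z. g\<in>orth m \<Longrightarrow> Z\<in>orth n \<Longrightarrow> \<bar>\<Psi> g Z\<bar> \<le> b'" using jlip_bounded[OF assms(2)] by auto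
  show ?thesis unfolding jlip_def
  proof (intro exI[of _ "b * L' + b' * L"] conjI ballI)
    show "0 \<le> b * L' + b' * L" using b b' L L' by simp
    fix g g' Z Z' assume a: "g \<in> orth m" "g' \<in> orth m" "Z \<in> orth n" "Z' \<in> orth n"
    have "\<bar>\<Phi> g Z * \<Psi> g Z - \<Phi> g' Z' * \<Psi> g' Z'\<bar> = \<bar>\<Phi> g Z * (\<Psi> g Z - \<Psi> g' Z') + \<Psi> g' Z' * (\<Phi> g Z - \<Phi> g' Z')\<bar>"
      by (simp add: algebra_simps)
    also have "\<dots> \<le> \<bar>\<Phi> g Z\<bar> * \<bar>\<Psi> g Z - \<Psi> g' Z'\<bar> + \<bar>\<Psi> g' Z'\<bar> * \<bar>\<Phi> g Z - \<Phi> g' Z'\<bar>"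
      by (metis abs_mult abs_triangle_ineq)
    also have "\<dots> \<le> b * (L' * (fd g g' + fd Z Z')) + b' * (L * (fd g g' + fd Z Z'))"
      using L(2)[OF a] L'(2)[OF a] b(2)[OF a(1,3)] b'(2)[OF a(2,4)] b(1) b'(1)
      by (intro add_mono mult_mono) auto
    finally show "\<bar>\<Phi> g Z * \<Psi> g Z - \<Phi> g' Z' * \<Psi> g' Z'\<bar> \<le> (b * L' + b' * L) * (fd g g' + fd Z Z')"
      by (simp add: algebra_simps)
  qed
qed

lemma jlip_of_snd:
  assumes "\<phi> \<in> Lip n"
  shows "jlip m n (\<lambda>g Z. \<phi> Z)"
proof -
  obtain L where L: "lipw n L \<phi>" using assms by (auto simp: Lip_def)
  show ?thesis unfolding jlip_def
  proof (intro exI[of _ L] conjI ballI lipw_nonneg[OF L])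
    fix g g' Z Z' assume a: "g \<in> orth m" "g' \<in> orth m" "Z \<in> orth n" "Z' \<in> orth n"
    have "\<bar>\<phi> Z - \<phi> Z'\<bar> \<le> L * fd Z Z'" by (rule lipwD[OF L a(3,4)])
    also have "\<dots> \<le> L * (fd g g' + fd Z Z')" by (intro mult_left_mono lipw_nonneg[OF L]) (simp add: fd_nonneg)
    finally show "\<bar>\<phi> Z - \<phi> Z'\<bar> \<le> L * (fd g g' + fd Z Z')" .
  qed
qed

lemma jlip_of_fst: "\<phi> \<in> Lip m \<Longrightarrow> jlip m n (\<lambda>g Z. \<phi> g)"
  using jlip_swap[OF jlip_of_snd] .

definition sw :: "real mat" where "sw = mat 2 2 (\<lambda>(i,j). if i = j then 0 else 1)"

lemma sw_carrier [simp]: "sw \<in> carrier_mat 2 2" by (simp add: sw_def)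

lemma sw_index [simp]: "sw $$ (0,0) = 0" "sw $$ (0,Suc 0) = 1" "sw $$ (Suc 0,0) = 1" "sw $$ (Suc 0,Suc 0) = 0"
  by (auto simp: sw_def)

lemma sw_orth: "sw \<in> orth 2"
  by (rule orth_I) (auto simp: sum_lt2 less_2_cases_iff)

lemma e2_sw_conj:
  assumes "i < n" "j < n" "i \<noteq> j" and g: "g \<in> carrier_mat 2 2"
  shows "e2 n i j (sw * g * sw) = e2 n j i g"
proof (rule eq_matI)
  note f = embf_pr[OF assms(1-3)] embf_pr[OF assms(2,1)]
  have s: "(sw * g * sw) $$ (0,0) = g $$ (1,1)" "(sw * g * sw) $$ (0,1) = g $$ (1,0)"
     "(sw * g * sw) $$ (1,0) = g $$ (0,1)" "(sw * g * sw) $$ (1,1) = g $$ (0,0)"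
    using g by auto
  fix a b assume ab: "a < dim_row (e2 n j i g)" "b < dim_col (e2 n j i g)"
  then have ab: "a < n" "b < n" by (auto simp: emb_def)
  show "e2 n i j (sw * g * sw) $$ (a, b) = e2 n j i g $$ (a, b)"
  proof (cases "a \<in> {i,j} \<and> b \<in> {i,j}")
    case True
    have e: "e2 n i j h $$ (i,i) = h $$ (0,0)" "e2 n i j h $$ (i,j) = h $$ (0,1)" "e2 n i j h $$ (j,i) = h $$ (1,0)"
      "e2 n i j h $$ (j,j) = h $$ (1,1)" for h
      using emb_in[OF f(1), of 0 0 h] emb_in[OF f(1), of 0 1 h] emb_in[OF f(1), of 1 0 h] emb_in[OF f(1), of 1 1 h]
      by (simp_all add: pr_def)
    have e': "e2 n j i h $$ (j,j) = h $$ (0,0)" "e2 n j i h $$ (j,i) = h $$ (0,1)" "e2 n j i h $$ (i,j) = h $$ (1,0)"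
      "e2 n j i h $$ (i,i) = h $$ (1,1)" for h
      using emb_in[OF f(2), of 0 0 h] emb_in[OF f(2), of 0 1 h] emb_in[OF f(2), of 1 0 h] emb_in[OF f(2), of 1 1 h] assms(3)
      by (simp_all add: pr_def)
    show ?thesis using True s by (auto simp: e e')
  next
    case False
    then show ?thesis using ab by (subst (1 2) emb_out) (auto simp: pr_image)
  qed
qed (auto simp: emb_def)

text \<open>Exchanging the two rows conjugates the rotation by \<open>sw\<close>, and the Haar mean
  of \<open>O(2)\<close> is invariant under that conjugation.\<close>

lemma P2_sym:
  assumes ij: "(i,j) \<in> prs n" and p: "\<phi> \<in> Lip n" and Z: "Z \<in> orth n"
  shows "P2 n (i,j) \<phi> Z = P2 n (j,i) \<phi> Z"
proof -
  have i: "i < n" "j < n" "i \<noteq> j" using ij by (auto simp: prs_def)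
  interpret emb_avg 2 cmean n "pr i j" by (rule emb_avg_e2[OF i])
  define \<psi> where "\<psi> g = \<phi> (\<iota> g * Z)" for g
  have L: "\<psi> \<in> Lip 2" unfolding \<psi>_def[abs_def] by (rule jl_Lip[OF p Z])
  have "P2 n (j,i) \<phi> Z = cmean (\<lambda>g. \<psi> (sw * g * sw))"
  proof -
    have "cmean (\<lambda>g. \<psi> (sw * g * sw)) = cmean (\<lambda>g. \<phi> (e2 n j i g * Z))"
    proof (rule eqI)
      show "(\<lambda>g. \<psi> (sw * g * sw)) \<in> Lip 2" by (rule Lip_left[OF Lip_right[OF L sw_orth] sw_orth])
      fix g assume "g \<in> orth 2"
      then show "\<psi> (sw * g * sw) = \<phi> (e2 n j i g * Z)" unfolding \<psi>_def
        using e2_sw_conj[OF i orth_carrier] by simp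
    qed
    then show ?thesis by (simp add: P2_def avg_def)
  qed
  also have "\<dots> = cmean (\<lambda>g. \<psi> (g * sw))" by (rule left[OF Lip_right[OF L sw_orth] sw_orth])
  also have "\<dots> = cmean \<psi>" by (rule right[OF L sw_orth])
  finally show ?thesis by (simp add: P2_def avg_def \<psi>_def[abs_def])
qed

subsection \<open>The law of a matrix entry on the three-dimensional group\<close>

context
begin

interpretation haar 3 "hl 3" by (rule haar_hl) simp

private lemma L3 [intro,simp]: "i < 3 \<Longrightarrow> (\<lambda>g. g $$ (i,0)) \<in> Lip 3"
  by (rule Lip_entry) auto

private lemma rows01:
  assumes "g \<in> orth 2" "h \<in> orth 3"
  shows "(e2 3 0 (Suc 0) g * h) $$ (0,0) = g $$ (0,0) * h $$ (0,0) + g $$ (0,Suc 0) * h $$ (Suc 0,0)"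
  by (rule e2_rows(1)) (use orth_carrier[OF assms(2)] in auto)

lemma moment_rot:
  assumes "c\<^sup>2 + s\<^sup>2 = (1::real)"
  shows "hl 3 (\<lambda>g. (c * g $$ (0,0) - s * g $$ (Suc 0,0)) ^ j) = hl 3 (\<lambda>g. g $$ (0,0) ^ j)"
proof -
  obtain t where t: "c = cos t" "s = sin t" using sincos_total_2pi[OF assms] by metis
  have "hl 3 (\<lambda>g. g $$ (0,0) ^ j) = hl 3 (\<lambda>g. (e2 3 0 (Suc 0) (rot2 t) * g) $$ (0,0) ^ j)"
    by (rule left[symmetric, of "\<lambda>g. g $$ (0,0) ^ j"]) (auto intro!: e2_orth rot2_orth)
  also have "\<dots> = hl 3 (\<lambda>g. (c * g $$ (0,0) - s * g $$ (Suc 0,0)) ^ j)"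
  proof (rule eqI[symmetric])
    show "(c * g $$ (0,0) - s * g $$ (Suc 0,0)) ^ j = (e2 3 0 (Suc 0) (rot2 t) * g) $$ (0,0) ^ j" if "g \<in> orth 3" for g
      by (simp add: rows01[OF rot2_orth that] t del: index_mult_mat)
  qed auto
  finally show ?thesis by simp
qed

lemma moment_odd:
  assumes "odd j"
  shows "hl 3 (\<lambda>g. g $$ (0,0) ^ j) = 0"
proof -
  have "hl 3 (\<lambda>g. g $$ (0,0) ^ j) = hl 3 (\<lambda>g. (-1) * g $$ (0,0) ^ j)"
    using moment_rot[of "-1" 0 j] assms by (simp add: power_minus_odd)
  also have "\<dots> = (-1) * hl 3 (\<lambda>g. g $$ (0,0) ^ j)" by (rule cmult) auto
  finally show ?thesis by simp
qed

text \<open>Compare the coefficients of \<open>\<tau>\<^sup>2\<close> in \<open>E (x - \<tau> y)\<^sup>2\<^sup>k = (1 + \<tau>\<^sup>2)\<^sup>k E x\<^sup>2\<^sup>k\<close>, which is rotation invariance.\<close>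

lemma moment_mixed:
  assumes k: "1 \<le> k"
  shows "(2 * real k - 1) * hl 3 (\<lambda>g. (g $$ (Suc 0,0))\<^sup>2 * g $$ (0,0) ^ (2*k-2)) = hl 3 (\<lambda>g. g $$ (0,0) ^ (2*k))"
proof -
  define M where "M l = hl 3 (\<lambda>g. g $$ (Suc 0,0) ^ l * g $$ (0,0) ^ (2*k-l))" for l
  have e1: "(\<Sum>l\<le>2*k. (real (2*k choose l) * (-1)^l * M l) * \<tau>^l) = M 0 * (1 + \<tau>\<^sup>2) ^ k" for \<tau>
  proof -
    define r where "r = sqrt (1 + \<tau>\<^sup>2)"
    have r: "r > 0" "r\<^sup>2 = 1 + \<tau>\<^sup>2" by (auto simp: r_def add_pos_nonneg)
    have "(1 / r)\<^sup>2 + (\<tau> / r)\<^sup>2 = (1 + \<tau>\<^sup>2) / r\<^sup>2" by (simp add: power_divide add_divide_distrib)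
    also have "\<dots> = 1" using r by (metis divide_self_if not_less_iff_gr_or_eq zero_less_power)
    finally have cs: "(1 / r)\<^sup>2 + (\<tau> / r)\<^sup>2 = 1" .
    have "hl 3 (\<lambda>g. (g $$ (0,0) - \<tau> * g $$ (Suc 0,0)) ^ (2*k)) =
        hl 3 (\<lambda>g. r ^ (2*k) * (1 / r * g $$ (0,0) - \<tau> / r * g $$ (Suc 0,0)) ^ (2*k))"
    proof (rule eqI)
      fix g :: "real mat"
      have "g $$ (0,0) - \<tau> * g $$ (Suc 0,0) = r * (1 / r * g $$ (0,0) - \<tau> / r * g $$ (Suc 0,0))"
        using r by (simp add: field_simps)
      then show "(g $$ (0,0) - \<tau> * g $$ (Suc 0,0)) ^ (2*k) = r ^ (2*k) * (1 / r * g $$ (0,0) - \<tau> / r * g $$ (Suc 0,0)) ^ (2*k)"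
        by (simp only: power_mult_distrib)
    qed auto
    also have "\<dots> = r ^ (2*k) * hl 3 (\<lambda>g. (1 / r * g $$ (0,0) - \<tau> / r * g $$ (Suc 0,0)) ^ (2*k))"
      by (rule cmult) (intro Lip_power Lip_diff Lip_cmult L3, auto)
    also have "\<dots> = r ^ (2*k) * M 0" by (simp only: moment_rot[OF cs]) (simp add: M_def)
    also have "\<dots> = M 0 * (1 + \<tau>\<^sup>2) ^ k" using r by (simp add: power_mult)
    finally have a: "hl 3 (\<lambda>g. (g $$ (0,0) - \<tau> * g $$ (Suc 0,0)) ^ (2*k)) = M 0 * (1 + \<tau>\<^sup>2) ^ k" .
    have "hl 3 (\<lambda>g. (g $$ (0,0) - \<tau> * g $$ (Suc 0,0)) ^ (2*k)) =
       hl 3 (\<lambda>g. \<Sum>l\<le>2*k. (real (2*k choose l) * (-1)^l * \<tau>^l) * (g $$ (Suc 0,0) ^ l * g $$ (0,0) ^ (2*k-l)))"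
    proof (rule eqI)
      fix g :: "real mat"
      have "(g $$ (0,0) - \<tau> * g $$ (Suc 0,0)) ^ (2*k) = ((- \<tau>) * g $$ (Suc 0,0) + g $$ (0,0)) ^ (2*k)" by (simp add: algebra_simps)
      also have "\<dots> = (\<Sum>l\<le>2*k. real (2*k choose l) * ((- \<tau>) * g $$ (Suc 0,0)) ^ l * g $$ (0,0) ^ (2*k-l))"
        by (rule binomial_ring)
      also have "\<dots> = (\<Sum>l\<le>2*k. (real (2*k choose l) * (-1)^l * \<tau>^l) * (g $$ (Suc 0,0) ^ l * g $$ (0,0) ^ (2*k-l)))"
        by (intro sum.cong refl) (simp add: power_minus[of "\<tau> * _"] power_mult_distrib)
      finally show "(g $$ (0,0) - \<tau> * g $$ (Suc 0,0)) ^ (2*k) = \<dots>" .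
    qed auto
    also have "\<dots> = (\<Sum>l\<le>2*k. (real (2*k choose l) * (-1)^l * \<tau>^l) * M l)"
    proof (subst sum)
      show "(\<lambda>g. (real (2*k choose l) * (-1)^l * \<tau>^l) * (g $$ (Suc 0,0) ^ l * g $$ (0,0) ^ (2*k-l))) \<in> Lip 3" for l
        by (intro Lip_cmult Lip_mult Lip_power L3) auto
      have "hl 3 (\<lambda>g. (real (2*k choose l) * (-1)^l * \<tau>^l) * (g $$ (Suc 0,0) ^ l * g $$ (0,0) ^ (2*k-l))) =
         (real (2*k choose l) * (-1)^l * \<tau>^l) * M l" for l
        unfolding M_def by (rule cmult) (intro Lip_mult Lip_power L3, auto)
      then show "(\<Sum>l\<le>2*k. hl 3 (\<lambda>g. (real (2*k choose l) * (-1)^l * \<tau>^l) * (g $$ (Suc 0,0) ^ l * g $$ (0,0) ^ (2*k-l)))) =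
         (\<Sum>l\<le>2*k. (real (2*k choose l) * (-1)^l * \<tau>^l) * M l)" by simp
    qed
    finally show ?thesis using a by (simp add: mult_ac)
  qed
  have e2: "M 0 * (1 + \<tau>\<^sup>2) ^ k = (\<Sum>i\<le>2*k. (if even i then M 0 * real (k choose (i div 2)) else 0) * \<tau>^i)" for \<tau>
  proof -
    have "(\<Sum>i\<le>2*k. (if even i then M 0 * real (k choose (i div 2)) else 0) * \<tau>^i)
      = (\<Sum>i\<in>(\<lambda>j. 2*j) ` {..k}. M 0 * real (k choose (i div 2)) * \<tau>^i)"
      by (rule sum.mono_neutral_cong_right) (auto elim!: evenE)
    also have "\<dots> = (\<Sum>j\<le>k. M 0 * real (k choose j) * \<tau>^(2*j))"
      by (subst sum.reindex) (auto simp: inj_on_def)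
    also have "\<dots> = M 0 * (\<Sum>j\<le>k. real (k choose j) * (\<tau>\<^sup>2)^j * 1^(k-j))"
      by (simp only: sum_distrib_left power_mult[of \<tau> 2] power_one mult_1_right mult.assoc)
    also have "\<dots> = M 0 * (\<tau>\<^sup>2 + 1) ^ k" by (simp only: binomial_ring)
    finally show ?thesis by (simp add: add.commute)
  qed
  have "\<forall>i\<le>2*k. real (2*k choose i) * (-1)^i * M i = (if even i then M 0 * real (k choose (i div 2)) else 0)"
    by (subst polyfun_eq_coeffs[symmetric]) (simp only: e1 e2 simp_thms)
  from this[rule_format, of 2] k have "real (2*k choose 2) * M 2 = M 0 * real k" by simp
  moreover have "2 * k choose 2 = k * (2*k - 1)" by (simp add: choose_two)
  ultimately have "real k * ((2 * real k - 1) * M 2) = real k * M 0" using k by (simp add: of_nat_diff algebra_simps)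
  then have "(2 * real k - 1) * M 2 = M 0" using k by simp
  then show ?thesis by (simp add: M_def)
qed

text \<open>These are the moments of the uniform law on \<open>[-1,1]\<close>, as in Archimedes'
  theorem on the sphere. Inserting the squared length \<open>1\<close> of the first column splits a
  moment into the next one, \<open>m\<close>, and two equal mixed moments \<open>y\<close>, and
  \<open>moment_mixed\<close> expresses \<open>y\<close> through \<open>m\<close>.\<close>

lemma moment_even: "hl 3 (\<lambda>g. g $$ (0,0) ^ (2*k)) = 1 / (2 * real k + 1)"
proof (induction k)
  case 0 then show ?case by (simp add: const)
next
  case (Suc k)
  define m y where "m = hl 3 (\<lambda>g. g $$ (0,0) ^ (2*Suc k))" and "y = hl 3 (\<lambda>g. (g $$ (Suc 0,0))\<^sup>2 * g $$ (0,0) ^ (2*k))"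
  have LL: "i < 3 \<Longrightarrow> (\<lambda>g. (g $$ (i,0))\<^sup>2 * g $$ (0,0) ^ (2*k)) \<in> Lip 3" for i by auto
  have "hl 3 (\<lambda>g. (g $$ (Suc 0,0))\<^sup>2 * g $$ (0,0) ^ (2*k)) =
     hl 3 (\<lambda>g. ((e2 3 (Suc 0) 2 sw * g) $$ (Suc 0,0))\<^sup>2 * (e2 3 (Suc 0) 2 sw * g) $$ (0,0) ^ (2*k))"
    by (rule left[symmetric, OF LL]) (auto intro!: e2_orth sw_orth)
  also have "\<dots> = hl 3 (\<lambda>g. (g $$ (2,0))\<^sup>2 * g $$ (0,0) ^ (2*k))"
  proof (rule eqI[symmetric, OF LL])
    fix g :: "real mat" assume "g \<in> orth 3"
    then have g: "g \<in> carrier_mat 3 3" by (rule orth_carrier)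
    have "(e2 3 (Suc 0) 2 sw * g) $$ (Suc 0,0) = g $$ (2,0)"
      by (subst e2_rows(1)[OF _ _ _ g]) auto
    moreover have "(e2 3 (Suc 0) 2 sw * g) $$ (0,0) = g $$ (0,0)"
      by (subst e2_rows(3)[OF _ _ _ g]) auto
    ultimately show "(g $$ (2,0))\<^sup>2 * g $$ (0,0) ^ (2*k) = ((e2 3 (Suc 0) 2 sw * g) $$ (Suc 0,0))\<^sup>2 * (e2 3 (Suc 0) 2 sw * g) $$ (0,0) ^ (2*k)"
      by simp
  qed auto
  finally have y2: "hl 3 (\<lambda>g. (g $$ (2,0))\<^sup>2 * g $$ (0,0) ^ (2*k)) = y" by (simp add: y_def)
  have "hl 3 (\<lambda>g. g $$ (0,0) ^ (2*k)) = hl 3 (\<lambda>g. \<Sum>i<3. (g $$ (i,0))\<^sup>2 * g $$ (0,0) ^ (2*k))"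
  proof (rule eqI)
    show "g $$ (0,0) ^ (2*k) = (\<Sum>i<3. (g $$ (i,0))\<^sup>2 * g $$ (0,0) ^ (2*k))" if "g \<in> orth 3" for g
      using orth_col_inner[OF that, of 0 0] by (simp add: sum_distrib_right[symmetric] power2_eq_square)
  qed auto
  also have "\<dots> = (\<Sum>i<3. hl 3 (\<lambda>g. (g $$ (i,0))\<^sup>2 * g $$ (0,0) ^ (2*k)))" by (rule sum) auto
  also have "\<dots> = m + y + y"
  proof -
    have s3: "(\<Sum>i<3. F i) = F 0 + F (Suc 0) + F 2" for F :: "nat \<Rightarrow> real"
      by (simp add: numeral_3_eq_3 numeral_2_eq_2)
    have "hl 3 (\<lambda>g. (g $$ (0,0))\<^sup>2 * g $$ (0,0) ^ (2*k)) = m"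
      unfolding m_def by (simp add: power2_eq_square mult.assoc)
    then show ?thesis unfolding s3 y2 by (simp add: y_def)
  qed
  finally have "1 / (2 * real k + 1) = m + 2 * y" using Suc by simp
  moreover have "(2 * real k + 1) * y = m" using moment_mixed[of "Suc k"] by (simp add: m_def y_def algebra_simps)
  ultimately have "1 = (2 * real k + 1) * m + 2 * m" by (simp add: field_simps)
  then have "m = 1 / (2 * real k + 3)" by (simp add: field_simps)
  then show ?case by (simp add: m_def)
qed

lemma integral_cos_sin: "((\<lambda>t. cos t ^ j * sin t) has_integral ((1 - (-1) ^ Suc j) / real (Suc j))) {0..pi}"
proof -
  have "((\<lambda>t. cos t ^ j * sin t) has_integral (- (cos pi ^ Suc j / real (Suc j)) - (- (cos 0 ^ Suc j / real (Suc j))))) {0..pi}"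
  proof (rule fundamental_theorem_of_calculus)
    fix t :: real
    have "((\<lambda>t. - (cos t ^ Suc j / real (Suc j))) has_real_derivative (cos t ^ j * sin t)) (at t)"
      by (auto intro!: derivative_eq_intros simp del: power_Suc)
    then show "((\<lambda>t. - (cos t ^ Suc j / real (Suc j))) has_vector_derivative (cos t ^ j * sin t)) (at t within {0..pi})"
      by (simp add: has_real_derivative_iff_has_vector_derivative has_vector_derivative_at_within)
  qed simp
  then show ?thesis by (simp add: add_divide_distrib add.commute)
qed

lemma moment: "hl 3 (\<lambda>g. g $$ (0,0) ^ j) = (1/2) * integral {0..pi} (\<lambda>t. cos t ^ j * sin t)"
proof (cases "even j")
  case True
  then obtain k where "j = 2 * k" by (auto elim: evenE)
  then show ?thesis using integral_unique[OF integral_cos_sin[of j]] by (simp add: moment_even)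
next
  case False
  then show ?thesis using integral_unique[OF integral_cos_sin[of j]] by (simp add: moment_odd)
qed

text \<open>Weierstrass approximation passes from the moments to all continuous functions. The law
  is written in the angle, \<open>s = cos t\<close>, because the functions to which it is applied
  are given by an angle.\<close>

lemma entry_law:
  assumes F: "continuous_on {-1..1} F" and FL: "(\<lambda>g. F (g $$ (0,0))) \<in> Lip 3"
  shows "hl 3 (\<lambda>g. F (g $$ (0,0))) = (1/2) * integral {0..pi} (\<lambda>t. F (cos t) * sin t)"
proof -
  have Fc: "continuous_on {0..pi} (\<lambda>t. F (cos t) * sin t)"
    by (intro continuous_intros continuous_on_compose2[OF F]) auto
  have "\<bar>hl 3 (\<lambda>g. F (g $$ (0,0))) - (1/2) * integral {0..pi} (\<lambda>t. F (cos t) * sin t)\<bar> \<le> e" if e: "e > 0" for e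
  proof -
    have "e / 4 > 0" using e by simp
    then obtain p where p: "real_polynomial_function p" "\<And>x. x \<in> {-1..1} \<Longrightarrow> \<bar>F x - p x\<bar> < e / 4"
      using Stone_Weierstrass_real_polynomial_function[of "{-1..1}" F "e / 4"] F by auto
    obtain a d where pe: "p = (\<lambda>x. \<Sum>i\<le>d. a i * x ^ i)" using p(1) real_polynomial_function_iff_sum by auto
    have pL: "(\<lambda>g. p (g $$ (0,0))) \<in> Lip 3" unfolding pe by auto
    have pc: "continuous_on {0..pi} (\<lambda>t. p (cos t) * sin t)" unfolding pe by (intro continuous_intros)
    have "hl 3 (\<lambda>g. p (g $$ (0,0))) = (\<Sum>i\<le>d. a i * hl 3 (\<lambda>g. g $$ (0,0) ^ i))"
      unfolding pe by (subst sum) (auto simp: cmult)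
    also have "\<dots> = (\<Sum>i\<le>d. a i * ((1/2) * integral {0..pi} (\<lambda>t. cos t ^ i * sin t)))" by (simp add: moment)
    also have "\<dots> = (1/2) * (\<Sum>i\<le>d. integral {0..pi} (\<lambda>t. a i * (cos t ^ i * sin t)))" by (simp add: sum_distrib_left)
    also have "(\<Sum>i\<le>d. integral {0..pi} (\<lambda>t. a i * (cos t ^ i * sin t))) = integral {0..pi} (\<lambda>t. \<Sum>i\<le>d. a i * (cos t ^ i * sin t))"
      by (intro integral_sum[symmetric] integrable_continuous_interval continuous_intros) auto
    also have "\<dots> = integral {0..pi} (\<lambda>t. p (cos t) * sin t)" unfolding pe by (simp add: sum_distrib_right mult.assoc)
    finally have m: "hl 3 (\<lambda>g. p (g $$ (0,0))) = (1/2) * integral {0..pi} (\<lambda>t. p (cos t) * sin t)" .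
    have 1: "\<bar>hl 3 (\<lambda>g. F (g $$ (0,0))) - hl 3 (\<lambda>g. p (g $$ (0,0)))\<bar> \<le> e / 4"
    proof (rule abs_diff_le[OF FL pL])
      fix g assume "g \<in> orth 3"
      then have "g $$ (0,0) \<in> {-1..1}" using orth_entry_le[of g 3 0 0] by (auto simp: abs_le_iff)
      then show "\<bar>F (g $$ (0,0)) - p (g $$ (0,0))\<bar> \<le> e / 4" using p(2) by force
    qed
    have "\<bar>integral {0..pi} (\<lambda>t. F (cos t) * sin t) - integral {0..pi} (\<lambda>t. p (cos t) * sin t)\<bar>
       = \<bar>integral {0..pi} (\<lambda>t. F (cos t) * sin t - p (cos t) * sin t)\<bar>"
      by (subst Henstock_Kurzweil_Integration.integral_diff) (auto intro!: integrable_continuous_interval Fc pc)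
    also have "\<dots> \<le> integral {0..pi} (\<lambda>t. e / 4 * sin t)"
      unfolding real_norm_def[symmetric]
    proof (rule Henstock_Kurzweil_Integration.integral_norm_bound_integral)
      show "(\<lambda>t. F (cos t) * sin t - p (cos t) * sin t) integrable_on {0..pi}" "(\<lambda>t. e / 4 * sin t) integrable_on {0..pi}"
        by (auto intro!: integrable_continuous_interval continuous_intros Fc pc)
      fix t :: real assume t: "t \<in> {0..pi}"
      then have "0 \<le> sin t" by (intro sin_ge_zero) auto
      moreover have "\<bar>F (cos t) - p (cos t)\<bar> \<le> e / 4" using p(2)[of "cos t"] by force
      ultimately have "\<bar>F (cos t) - p (cos t)\<bar> * \<bar>sin t\<bar> \<le> e / 4 * sin t"
        by (simp only: abs_of_nonneg mult_right_mono)
      then show "norm (F (cos t) * sin t - p (cos t) * sin t) \<le> e / 4 * sin t"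
        by (simp only: real_norm_def left_diff_distrib[symmetric] abs_mult)
    qed
    also have "\<dots> = e / 2" using integral_unique[OF integral_cos_sin[of 0]] by simp
    finally show ?thesis using 1 m by linarith
  qed
  then have "\<bar>hl 3 (\<lambda>g. F (g $$ (0,0))) - (1/2) * integral {0..pi} (\<lambda>t. F (cos t) * sin t)\<bar> \<le> 0"
    by (rule field_le_epsilon) simp
  then show ?thesis by linarith
qed

end

subsection \<open>Bi-invariant functions on the three-dimensional group\<close>

text \<open>\<open>lo\<close> is the stabiliser of the first axis; \<open>hi\<close> rotates the
  first two axes. They are the two planes sharing an axis.\<close>

abbreviation lo :: "real mat \<Rightarrow> real mat" where "lo k \<equiv> e2 3 (Suc 0) 2 k"
abbreviation hi :: "real mat \<Rightarrow> real mat" where "hi k \<equiv> e2 3 0 (Suc 0) k"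

lemma lo_orth: "k \<in> orth 2 \<Longrightarrow> lo k \<in> orth 3" by (rule e2_orth) auto
lemma hi_orth: "k \<in> orth 2 \<Longrightarrow> hi k \<in> orth 3" by (rule e2_orth) auto

lemma embf_lo: "embf 2 3 (pr (Suc 0) 2)" by (rule embf_pr) auto
lemma embf_hi: "embf 2 3 (pr 0 (Suc 0))" by (rule embf_pr) auto

lemma sum_lt3: "(\<Sum>k<(3::nat). f k) = f 0 + f (Suc 0) + f 2"
  by (simp add: numeral_3_eq_3 numeral_2_eq_2)

lemma less_3_cases: "i < 3 \<Longrightarrow> i = 0 \<or> i = Suc 0 \<or> i = 2" by auto

lemma lo_entries:
  "lo k $$ (0,0) = 1" "lo k $$ (0,Suc 0) = 0" "lo k $$ (0,2) = 0" "lo k $$ (Suc 0,0) = 0" "lo k $$ (2,0) = 0"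
  "lo k $$ (Suc 0,Suc 0) = k $$ (0,0)" "lo k $$ (Suc 0,2) = k $$ (0,Suc 0)"
  "lo k $$ (2,Suc 0) = k $$ (Suc 0,0)" "lo k $$ (2,2) = k $$ (Suc 0,Suc 0)"
  by (simp_all add: emb_out pr_image)
    (insert emb_in[OF embf_lo, of 0 0 k] emb_in[OF embf_lo, of 0 1 k] emb_in[OF embf_lo, of 1 0 k] emb_in[OF embf_lo, of 1 1 k], simp_all add: pr_def)

lemma hi_entries:
  "hi k $$ (2,2) = 1" "hi k $$ (0,2) = 0" "hi k $$ (2,0) = 0" "hi k $$ (Suc 0,2) = 0" "hi k $$ (2,Suc 0) = 0"
  "hi k $$ (0,0) = k $$ (0,0)" "hi k $$ (0,Suc 0) = k $$ (0,Suc 0)"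
  "hi k $$ (Suc 0,0) = k $$ (Suc 0,0)" "hi k $$ (Suc 0,Suc 0) = k $$ (Suc 0,Suc 0)"
  by (simp_all add: emb_out pr_image)
    (insert emb_in[OF embf_hi, of 0 0 k] emb_in[OF embf_hi, of 0 1 k] emb_in[OF embf_hi, of 1 0 k] emb_in[OF embf_hi, of 1 1 k], simp_all add: pr_def)

lemma mat3_eqI:
  assumes "A \<in> carrier_mat 3 3" "B \<in> carrier_mat 3 3"
    and "\<And>i j. i \<in> {0, Suc 0, 2} \<Longrightarrow> j \<in> {0, Suc 0, 2} \<Longrightarrow> A $$ (i,j) = B $$ (i,j)"
  shows "A = B"
proof (rule eq_matI)
  fix i j assume "i < dim_row B" "j < dim_col B"
  then show "A $$ (i,j) = B $$ (i,j)" using assms(2) less_3_cases[of i] less_3_cases[of j] by (intro assms(3)) auto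
qed (use assms in auto)

lemma stabilizer_lo:
  assumes w: "w \<in> orth 3" and c: "w $$ (0,0) = 1" "w $$ (Suc 0,0) = 0" "w $$ (2,0) = 0"
  shows "\<exists>k\<in>orth 2. w = lo k"
proof -
  have r: "w $$ (0,Suc 0) = 0" "w $$ (0,2) = 0"
  proof -
    have "w $$ (0,Suc 0) * w $$ (0,Suc 0) + w $$ (0,2) * w $$ (0,2) = 0"
      using orth_row_inner[OF w, of 0 0] c by (simp add: sum_lt3)
    then show "w $$ (0,Suc 0) = 0" "w $$ (0,2) = 0" by (simp_all only: sum_squares_eq_zero_iff)
  qed
  define k where "k = mat 2 2 (\<lambda>(i,j). w $$ (Suc i, Suc j))"
  have ke: "k $$ (0,0) = w $$ (Suc 0,Suc 0)" "k $$ (0,Suc 0) = w $$ (Suc 0,2)" "k $$ (Suc 0,0) = w $$ (2,Suc 0)"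
    "k $$ (Suc 0,Suc 0) = w $$ (2,2)" by (auto simp: k_def numeral_2_eq_2)
  have "k \<in> orth 2"
  proof (rule orth_I)
    show "k \<in> carrier_mat 2 2" by (simp add: k_def)
    fix i j :: nat assume "i < 2" "j < 2"
    then show "(\<Sum>l<2. k $$ (i,l) * k $$ (j,l)) = (if i = j then 1 else 0)"
      using orth_row_inner[OF w, of "Suc i" "Suc j"] c
      by (auto simp: less_2_cases_iff sum_lt2 sum_lt3 ke numeral_2_eq_2[symmetric])
  qed
  moreover have "w = lo k"
    by (rule mat3_eqI[OF orth_carrier[OF w]]) (use c r in \<open>auto simp: lo_entries ke\<close>)
  ultimately show ?thesis by blast
qed

text \<open>The decomposition \<open>K A K\<close> of \<open>O(3)\<close>. A left factor from the
  stabiliser moves the first column into the plane of the first two axes and, after a sign change by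
  \<open>rot2 pi * flip2\<close>, makes its second entry nonnegative, so that the angle is the
  \<open>arccos\<close> of the corner entry. Undoing this angle leaves a matrix that fixes the first
  axis.\<close>

lemma double_coset:
  assumes g: "g \<in> orth 3"
  shows "\<exists>k\<in>orth 2. \<exists>k'\<in>orth 2. g = lo k * (hi (rot2 (arccos (g $$ (0,0)))) * lo k')"
proof -
  note gc = orth_carrier[OF g]
  obtain k0 where k0: "k0 \<in> orth 2" "k0 $$ (Suc 0,0) * g $$ (Suc 0,0) + k0 $$ (Suc 0,Suc 0) * g $$ (2,0) = 0"
    using kill_entry by blast
  define s where "s = k0 $$ (0,0) * g $$ (Suc 0,0) + k0 $$ (0,Suc 0) * g $$ (2,0)"
  define k where "k = (if s \<ge> 0 then k0 else (rot2 pi * flip2) * k0)"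
  have k: "k \<in> orth 2" using k0 by (auto simp: k_def intro!: orth_mult rot2_orth flip2_orth)
  have kk: "k $$ (Suc 0,0) * g $$ (Suc 0,0) + k $$ (Suc 0,Suc 0) * g $$ (2,0) = 0"
    "k $$ (0,0) * g $$ (Suc 0,0) + k $$ (0,Suc 0) * g $$ (2,0) \<ge> 0"
    using k0(2) orth_carrier[OF k0(1)] by (auto simp: k_def s_def algebra_simps)
  define h where "h = lo k * g"
  have ho: "h \<in> orth 3" unfolding h_def by (intro orth_mult lo_orth k g)
  have h0: "h $$ (0,0) = g $$ (0,0)" unfolding h_def by (subst e2_rows(3)[OF _ _ _ gc]) auto
  have h1: "h $$ (Suc 0,0) \<ge> 0" unfolding h_def by (subst e2_rows(1)[OF _ _ _ gc]) (use kk in auto)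
  have h2: "h $$ (2,0) = 0" unfolding h_def by (subst e2_rows(2)[OF _ _ _ gc]) (use kk in auto)
  define \<theta> where "\<theta> = arccos (g $$ (0,0))"
  have b: "\<bar>g $$ (0,0)\<bar> \<le> 1" by (rule orth_entry_le[OF g]) auto
  have ct: "cos \<theta> = g $$ (0,0)" unfolding \<theta>_def using b by (intro cos_arccos) auto
  have "h $$ (0,0) * h $$ (0,0) + h $$ (Suc 0,0) * h $$ (Suc 0,0) = 1"
    using orth_col_inner[OF ho, of 0 0] h2 by (simp add: sum_lt3)
  then have "h $$ (Suc 0,0) = sqrt (1 - (g $$ (0,0))\<^sup>2)"
    using h1 h0 by (intro real_sqrt_unique[symmetric]) (auto simp: power2_eq_square)
  also have "\<dots> = sin \<theta>" unfolding \<theta>_def using b by (intro sin_arccos_abs[symmetric])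
  finally have st: "h $$ (Suc 0,0) = sin \<theta>" .
  define w where "w = hi (rot2 (- \<theta>)) * h"
  have wo: "w \<in> orth 3" unfolding w_def by (intro orth_mult hi_orth rot2_orth ho)
  note hc = orth_carrier[OF ho]
  have w0: "w $$ (0,0) = 1" unfolding w_def
    by (subst e2_rows(1)[OF _ _ _ hc]) (auto simp: h0 st ct[symmetric] power2_eq_square[symmetric])
  have w1: "w $$ (Suc 0,0) = 0" unfolding w_def
    by (subst e2_rows(2)[OF _ _ _ hc]) (auto simp: h0 st ct[symmetric])
  have w2: "w $$ (2,0) = 0" unfolding w_def
    by (subst e2_rows(3)[OF _ _ _ hc]) (use h2 in auto)
  obtain k' where k': "k' \<in> orth 2" "w = lo k'" using stabilizer_lo[OF wo w0 w1 w2] by blast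
  have "hi (rot2 \<theta>) * w = (hi (rot2 \<theta>) * hi (rot2 (- \<theta>))) * h"
    unfolding w_def using hc by (intro assoc_mult_mat[of _ 3 3 _ 3 _ 3, symmetric]) auto
  also have "hi (rot2 \<theta>) * hi (rot2 (- \<theta>)) = hi (1\<^sub>m 2)"
    by (simp add: emb_mult[OF embf_hi, symmetric] rot2_add rot2_0)
  also have "\<dots> * h = h" using hc by (simp add: emb_one[OF embf_hi])
  finally have 1: "hi (rot2 \<theta>) * w = h" .
  have kc: "k \<in> carrier_mat 2 2" by (rule orth_carrier[OF k])
  have "lo (transpose_mat k) * h = (lo (transpose_mat k) * lo k) * g"
    unfolding h_def using gc by (intro assoc_mult_mat[of _ 3 3 _ 3 _ 3, symmetric]) auto
  also have "lo (transpose_mat k) * lo k = lo (1\<^sub>m 2)"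
    using kc by (simp add: emb_mult[OF embf_lo, symmetric] orth_transpose_mult[OF k])
  also have "\<dots> * g = g" using gc by (simp add: emb_one[OF embf_lo])
  finally have "g = lo (transpose_mat k) * (hi (rot2 \<theta>) * lo k')" using 1 k'(2) by simp
  then show ?thesis using orth_transpose[OF k] k'(1) unfolding \<theta>_def by blast
qed

text \<open>By the double coset decomposition such a function is a function \<open>q\<close> of one
  angle, and both the Haar mean on \<open>O(3)\<close> and the mean over \<open>hi\<close> become
  integrals over \<open>[0,pi]\<close>, with and without the weight \<open>sin t\<close>.\<close>

locale biinvariant =
  fixes Q :: "real mat \<Rightarrow> real"
  assumes QL: "Q \<in> Lip 3"
    and lo_left: "k \<in> orth 2 \<Longrightarrow> g \<in> orth 3 \<Longrightarrow> Q (lo k * g) = Q g"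
    and lo_right: "k \<in> orth 2 \<Longrightarrow> g \<in> orth 3 \<Longrightarrow> Q (g * lo k) = Q g"
begin

definition q :: "real \<Rightarrow> real" where "q t = Q (hi (rot2 t))"

lemma Q_q: "g \<in> orth 3 \<Longrightarrow> Q g = q (arccos (g $$ (0,0)))"
proof -
  assume g: "g \<in> orth 3"
  obtain k k' where k: "k \<in> orth 2" "k' \<in> orth 2" and e: "g = lo k * (hi (rot2 (arccos (g $$ (0,0)))) * lo k')"
    using double_coset[OF g] by blast
  have "Q (lo k * (hi (rot2 (arccos (g $$ (0,0)))) * lo k')) = Q (hi (rot2 (arccos (g $$ (0,0)))))"
    by (simp add: lo_left lo_right k orth_mult hi_orth rot2_orth lo_orth)
  then show ?thesis using e by (simp add: q_def)
qed

lemma Qhi_Lip: "(\<lambda>k. Q (hi k)) \<in> Lip 2"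
proof -
  obtain L where L: "lipw 3 L Q" using QL by (auto simp: Lip_def)
  have "lipw 2 (L * 9) (\<lambda>k. Q (hi k))"
  proof (rule lipwI)
    show "0 \<le> L * 9" using lipw_nonneg[OF L] by simp
    fix A B assume AB: "A \<in> orth 2" "B \<in> orth 2"
    have "\<bar>Q (hi A) - Q (hi B)\<bar> \<le> L * fd (hi A) (hi B)" by (intro lipwD[OF L] hi_orth AB)
    also have "\<dots> \<le> L * (real 3 * real 3 * fd A B)"
      by (intro mult_left_mono fd_emb_le embf_hi AB[THEN orth_carrier] lipw_nonneg[OF L])
    finally show "\<bar>Q (hi A) - Q (hi B)\<bar> \<le> L * 9 * fd A B" by simp
  qed
  then show ?thesis by (rule LipI)
qed

lemma q_cont: "continuous_on S q"
  unfolding q_def[abs_def] by (rule Lip_rot2_continuous[OF Qhi_Lip])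

lemma hl_moment:
  "hl 3 (\<lambda>g. g $$ (0,0) ^ j * Q g) = (1/2) * integral {0..pi} (\<lambda>t. cos t ^ j * q t * sin t)"
proof -
  interpret haar 3 "hl 3" by (rule haar_hl) simp
  define F where "F s = s ^ j * q (arccos s)" for s
  have JL: "(\<lambda>g. g $$ (0,0) ^ j * Q g) \<in> Lip 3" by (intro Lip_mult Lip_power Lip_entry QL) auto
  have e: "g $$ (0,0) ^ j * Q g = F (g $$ (0,0))" if "g \<in> orth 3" for g
    using Q_q[OF that] by (simp add: F_def)
  have "hl 3 (\<lambda>g. g $$ (0,0) ^ j * Q g) = hl 3 (\<lambda>g. F (g $$ (0,0)))" by (rule eqI[OF JL e])
  also have "\<dots> = (1/2) * integral {0..pi} (\<lambda>t. F (cos t) * sin t)"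
  proof (rule entry_law)
    show "continuous_on {-1..1} F" unfolding F_def
      by (intro continuous_intros continuous_on_compose2[OF q_cont]) auto
    show "(\<lambda>g. F (g $$ (0,0))) \<in> Lip 3" using JL Lip_cong[OF e] by simp
  qed
  also have "integral {0..pi} (\<lambda>t. F (cos t) * sin t) = integral {0..pi} (\<lambda>t. cos t ^ j * q t * sin t)"
    by (rule integral_cong) (simp add: F_def arccos_cos)
  finally show ?thesis .
qed

text \<open>The matrix \<open>diag(1,-1,1)\<close> lies in both copies of \<open>O(2)\<close>. This
  makes \<open>q\<close> even and lets the two circles of \<open>hi\<close> contribute
  equally.\<close>

lemma hi_flip: "hi flip2 = lo (rot2 pi * flip2)"
  by (rule mat3_eqI) (auto simp: lo_entries hi_entries)

lemma q_flip: "Q (hi (rot2 t * flip2)) = q t"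
proof -
  have "hi (rot2 t * flip2) = hi (rot2 t) * lo (rot2 pi * flip2)"
    by (simp add: emb_mult[OF embf_hi] hi_flip)
  then show ?thesis unfolding q_def by (simp add: lo_right hi_orth rot2_orth flip2_orth orth_mult)
qed

lemma q_minus: "q (- t) = q t"
proof -
  have "q (- t) = Q (hi (rot2 (- t) * flip2))" by (rule q_flip[symmetric])
  also have "\<dots> = Q (hi (flip2 * rot2 t))" by (simp only: flip2_rot2)
  also have "hi (flip2 * rot2 t) = lo (rot2 pi * flip2) * hi (rot2 t)"
    by (simp add: emb_mult[OF embf_hi] hi_flip)
  finally show ?thesis unfolding q_def by (simp add: lo_left hi_orth rot2_orth flip2_orth orth_mult)
qed

lemma cmean_hi: "cmean (\<lambda>k. Q (hi k)) = (1 / pi) * integral {0..pi} q"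
proof -
  have i: "q integrable_on {a..b}" for a b by (intro integrable_continuous_interval q_cont)
  have p: "q (t + 2 * pi) = q t" for t unfolding q_def by (simp only: rot2_2pi)
  have "integral {pi..2*pi} q = integral {-pi..0} (\<lambda>t. q (t + 2 * pi))"
    using integral_shift_real_ivl[of pi "2*pi" "2*pi" q] by simp
  also have "\<dots> = integral {-pi..-0} (\<lambda>t. q (- t))" by (simp add: p q_minus)
  also have "\<dots> = integral {0..pi} q"
    by (subst Henstock_Kurzweil_Integration.integral_reflect_real) simp
  finally have "integral {0..2*pi} q = 2 * integral {0..pi} q"
    using Henstock_Kurzweil_Integration.integral_combine[of 0 pi "2*pi" q] i by simp
  then show ?thesis unfolding cmean_def q_flip q_def[symmetric]
    by (simp add: Henstock_Kurzweil_Integration.integral_add[OF i i])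
qed

text \<open>The weight \<open>1 - v(3 - v\<^sup>2)/2\<close>, \<open>v = \<surd>1.5 sin t\<close>, is nonnegative and differs from \<open>1\<close> by a combination of the two
  functions orthogonal to \<open>q\<close>.\<close>

lemma cmean_hi_le:
  assumes B: "\<And>t. q t \<le> B" "0 \<le> B" and z0: "hl 3 Q = 0" and z2: "hl 3 (\<lambda>g. (g $$ (0,0))\<^sup>2 * Q g) = 0"
  shows "cmean (\<lambda>k. Q (hi k)) \<le> 0.2304 * B"
proof -
  \<comment> \<open>For the weight \<open>1 - v(3 - v^2)/2\<close> with \<open>v = s sin t\<close>
    the integral over \<open>[0,pi]\<close> is \<open>pi - 3s + 2s^3/3\<close>; it is least at
    \<open>s^2 = 3/2\<close>.\<close>
  define s where "s = sqrt (3/2)"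
  have s2: "s\<^sup>2 = 3/2" by (simp add: s_def)
  have s0: "s \<ge> 1.2247" unfolding s_def by (rule real_le_rsqrt) (simp add: power2_eq_square)
  define W where "W t = 1 - (3/4 * s) * sin t - (3/4 * s) * (cos t ^ 2 * sin t)" for t
  have W0: "0 \<le> W t" if "t \<in> {0..pi}" for t
  proof -
    define v where "v = s * sin t"
    have v: "0 \<le> v" using that s0 by (auto simp: v_def intro!: mult_nonneg_nonneg sin_ge_zero)
    have v2: "v * v = 3/2 * (sin t)\<^sup>2" using s2 by (simp add: v_def power2_eq_square algebra_simps)
    have "W t = 1 - (3/4 * s) * sin t - (3/4 * s) * ((1 - (sin t)\<^sup>2) * sin t)" by (simp only: W_def cos_squared_eq)
    then have "W t = 1 - 3/2 * v + 1/2 * (3/2 * (sin t)\<^sup>2) * v" by (simp add: W_def v_def algebra_simps)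
    also have "\<dots> = 1 - 3/2 * v + 1/2 * (v * v) * v" by (simp only: v2)
    also have "\<dots> = (v - 1)\<^sup>2 * (v + 2) / 2" by (simp add: power2_eq_square field_simps)
    finally have w: "W t = (v - 1)\<^sup>2 * (v + 2) / 2" .
    have "0 \<le> (v - 1)\<^sup>2 * (v + 2)" using v by (intro mult_nonneg_nonneg) auto
    then show ?thesis unfolding w by simp
  qed
  have Wc: "continuous_on {0..pi} W" unfolding W_def by (intro continuous_intros)
  note qc = q_cont[of "{0..pi}"]
  have i0: "integral {0..pi} (\<lambda>t. q t * sin t) = 0" using hl_moment[of 0] z0 by simp
  have i2: "integral {0..pi} (\<lambda>t. q t * (cos t ^ 2 * sin t)) = 0" using hl_moment[of 2] z2 by (simp add: mult_ac)
  have ic: "f integrable_on {0..pi}" if "continuous_on {0..pi} f" for f :: "real \<Rightarrow> real"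
    by (rule integrable_continuous_interval[OF that])
  have "integral {0..pi} (\<lambda>t. q t * W t) =
     integral {0..pi} (\<lambda>t. q t - (3/4 * s) * (q t * sin t) - (3/4 * s) * (q t * (cos t ^ 2 * sin t)))"
    by (simp add: W_def algebra_simps)
  also have "\<dots> = integral {0..pi} q - (3/4 * s) * integral {0..pi} (\<lambda>t. q t * sin t) - (3/4 * s) * integral {0..pi} (\<lambda>t. q t * (cos t ^ 2 * sin t))"
  proof -
    have a: "(\<lambda>t. (3/4 * s) * (q t * sin t)) integrable_on {0..pi}"
        "(\<lambda>t. (3/4 * s) * (q t * (cos t ^ 2 * sin t))) integrable_on {0..pi}"
        "(\<lambda>t. q t - (3/4 * s) * (q t * sin t)) integrable_on {0..pi}"
      by (intro ic continuous_intros qc)+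
    show ?thesis
      by (simp only: Henstock_Kurzweil_Integration.integral_diff[OF a(3,2)]
          Henstock_Kurzweil_Integration.integral_diff[OF ic[OF qc] a(1)] Henstock_Kurzweil_Integration.integral_mult_right)
  qed
  finally have qW: "integral {0..pi} q = integral {0..pi} (\<lambda>t. q t * W t)" using i0 i2 by simp
  also have "\<dots> \<le> integral {0..pi} (\<lambda>t. B * W t)"
    by (intro Henstock_Kurzweil_Integration.integral_le ic continuous_intros qc Wc mult_right_mono B W0)
  also have "\<dots> = B * integral {0..pi} W" by simp
  also have "integral {0..pi} W = pi - 2 * s"
  proof -
    have "(W has_integral (pi - (3/4 * s) * 2 - (3/4 * s) * (2/3))) {0..pi}"
      unfolding W_def using integral_cos_sin[of 0] integral_cos_sin[of 2] has_integral_const_real[of "1::real" 0 pi]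
      by (intro has_integral_diff has_integral_mult_right) auto
    then show ?thesis by (simp add: integral_unique)
  qed
  finally have "integral {0..pi} q \<le> B * (pi - 2 * s)" .
  then have "cmean (\<lambda>k. Q (hi k)) \<le> (1 / pi) * (B * (pi - 2 * s))" unfolding cmean_hi by (intro mult_left_mono) auto
  also have "\<dots> = B * (1 - 2 * s / pi)" by (simp add: field_simps)
  \<comment> \<open>The factor is about \<open>0.22\<close>. It is rounded up to
    \<open>0.2304 = 0.48^2\<close>, a square whose root is used in \<open>local_numeric\<close>, and
    this leaves room for the crude bound \<open>3.18\<close> for \<open>pi\<close>.\<close>
  also have "\<dots> \<le> B * 0.2304"
  proof (rule mult_left_mono[OF _ B(2)])
    have "0.7696 * pi \<le> 0.7696 * 3.18" using pi_approx by simp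
    also have "\<dots> \<le> 2 * s" using s0 by simp
    finally have "0.7696 \<le> 2 * s / pi" by (simp add: pos_le_divide_eq)
    then show "1 - 2 * s / pi \<le> 0.2304" by simp
  qed
  finally show ?thesis by simp
qed

end

subsection \<open>Two planes sharing an axis\<close>

text \<open>Pythagoras for the orthogonal projection \<open>A\<close>.\<close>

lemma (in emb_avg) haar_compl:
  assumes h: "haar n Lam" and p: "\<phi> \<in> Lip n"
  shows "Lam (\<lambda>Z. \<phi> Z * (\<phi> Z - A \<phi> Z)) = Lam (\<lambda>Z. (\<phi> Z)\<^sup>2) - Lam (\<lambda>Z. (A \<phi> Z)\<^sup>2)"
    "Lam (\<lambda>Z. (\<phi> Z - A \<phi> Z)\<^sup>2) = Lam (\<lambda>Z. (\<phi> Z)\<^sup>2) - Lam (\<lambda>Z. (A \<phi> Z)\<^sup>2)"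
    "Lam (\<lambda>Z. A \<phi> Z * \<phi> Z) = Lam (\<lambda>Z. (A \<phi> Z)\<^sup>2)"
proof -
  interpret H: haar n Lam by fact
  have L: "A \<phi> \<in> Lip n" using p by simp
  show m: "Lam (\<lambda>Z. A \<phi> Z * \<phi> Z) = Lam (\<lambda>Z. (A \<phi> Z)\<^sup>2)"
    using haar_avg_mult[OF h p p] by (simp add: power2_eq_square)
  have "Lam (\<lambda>Z. \<phi> Z * (\<phi> Z - A \<phi> Z)) = Lam (\<lambda>Z. (\<phi> Z)\<^sup>2 - A \<phi> Z * \<phi> Z)"
    by (simp add: power2_eq_square algebra_simps)
  also have "\<dots> = Lam (\<lambda>Z. (\<phi> Z)\<^sup>2) - Lam (\<lambda>Z. A \<phi> Z * \<phi> Z)"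
    by (intro H.diff Lip_power Lip_mult p L)
  finally show "Lam (\<lambda>Z. \<phi> Z * (\<phi> Z - A \<phi> Z)) = Lam (\<lambda>Z. (\<phi> Z)\<^sup>2) - Lam (\<lambda>Z. (A \<phi> Z)\<^sup>2)" by (simp add: m)
  have "Lam (\<lambda>Z. (\<phi> Z - A \<phi> Z)\<^sup>2) = Lam (\<lambda>Z. ((\<phi> Z)\<^sup>2 - 2 * (A \<phi> Z * \<phi> Z)) + (A \<phi> Z)\<^sup>2)"
    by (simp add: power2_eq_square algebra_simps)
  also have "\<dots> = Lam (\<lambda>Z. (\<phi> Z)\<^sup>2) - 2 * Lam (\<lambda>Z. A \<phi> Z * \<phi> Z) + Lam (\<lambda>Z. (A \<phi> Z)\<^sup>2)"
    using p L by (simp only: H.add H.diff H.cmult Lip_diff Lip_cmult Lip_power Lip_mult)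
  finally show "Lam (\<lambda>Z. (\<phi> Z - A \<phi> Z)\<^sup>2) = Lam (\<lambda>Z. (\<phi> Z)\<^sup>2) - Lam (\<lambda>Z. (A \<phi> Z)\<^sup>2)" by (simp add: m)
qed

lemma swap_row:
  assumes ab: "a < n" "b < n" "a \<noteq> b" and Z: "Z \<in> carrier_mat n n" and rs: "r < n" "s < n"
  shows "(e2 n a b sw * Z) $$ (r,s) = Z $$ (Transposition.transpose a b r, s)"
  using e2_rows[OF ab Z rs(2), where g = sw] rs ab by (auto simp: Transposition.transpose_def simp del: index_mult_mat)

lemma e2_swap_rows:
  assumes ab: "a < n" "b < n" "a \<noteq> b" and ij: "i < n" "j < n" "i \<noteq> j" and Z: "Z \<in> carrier_mat n n"
  shows "e2 n i j k * (e2 n a b sw * Z) =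
    e2 n a b sw * (e2 n (Transposition.transpose a b i) (Transposition.transpose a b j) k * Z)" (is "?L = ?R")
proof (rule eq_matI)
  let ?\<sigma> = "Transposition.transpose a b"
  fix r s assume "r < dim_row ?R" "s < dim_col ?R"
  then have rs: "r < n" "s < n" using Z by (auto simp: emb_def)
  have \<sigma>: "?\<sigma> x < n" if "x < n" for x using that ab by (simp add: Transposition.transpose_def)
  have \<sigma>ij: "?\<sigma> i \<noteq> ?\<sigma> j" using ij(3) by (auto dest: transpose_eq_imp_eq)
  have c1: "e2 n a b sw * Z \<in> carrier_mat n n" by (rule mult_carrier_mat[OF emb_carrier Z])
  have c2: "e2 n (?\<sigma> i) (?\<sigma> j) k * Z \<in> carrier_mat n n" by (rule mult_carrier_mat[OF emb_carrier Z])
  have R: "?R $$ (r,s) = (e2 n (?\<sigma> i) (?\<sigma> j) k * Z) $$ (?\<sigma> r, s)" by (rule swap_row[OF ab c2 rs])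
  note rows = e2_rows[OF ij c1 rs(2), where g = k] e2_rows[OF \<sigma>[OF ij(1)] \<sigma>[OF ij(2)] \<sigma>ij Z rs(2), where g = k]
  note sr = swap_row[OF ab Z _ rs(2)]
  consider "r = i" | "r = j" | "r \<noteq> i" "r \<noteq> j" by auto
  then show "?L $$ (r,s) = ?R $$ (r,s)"
  proof cases
    case 1 show ?thesis unfolding R unfolding 1 rows sr[OF ij(1)] sr[OF ij(2)] ..
  next
    case 2 show ?thesis unfolding R unfolding 2 rows sr[OF ij(1)] sr[OF ij(2)] ..
  next
    case 3
    then have "?\<sigma> r \<noteq> ?\<sigma> i" "?\<sigma> r \<noteq> ?\<sigma> j" by (auto dest: transpose_eq_imp_eq)
    then show ?thesis unfolding R using rows(3)[OF rs(1) 3] rows(6)[OF \<sigma>[OF rs(1)]] sr[OF rs(1)] by simp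
  qed
qed (use Z in \<open>auto simp: emb_def\<close>)

text \<open>A row transposition conjugates the rotations of one pair of rows into those of the image
  pair; on functions invariant under the transposition the averages are permuted
  accordingly.\<close>

lemma P2_conj_swap:
  assumes ab: "a < n" "b < n" "a \<noteq> b" and ij: "(i,j) \<in> prs n"
    and u: "u \<in> Lip n" and inv: "\<And>Z. Z \<in> orth n \<Longrightarrow> u (e2 n a b sw * Z) = u Z" and Z: "Z \<in> orth n"
  shows "P2 n (i,j) u (e2 n a b sw * Z) = P2 n (Transposition.transpose a b i, Transposition.transpose a b j) u Z"
proof -
  let ?\<sigma> = "Transposition.transpose a b"
  have i: "i < n" "j < n" "i \<noteq> j" using ij by (auto simp: prs_def)
  have \<sigma>: "?\<sigma> x < n" if "x < n" for x using that ab by (simp add: Transposition.transpose_def)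
  have ne: "?\<sigma> i \<noteq> ?\<sigma> j" using i(3) by (auto dest: transpose_eq_imp_eq)
  interpret emb_avg 2 cmean n "pr (?\<sigma> i) (?\<sigma> j)" by (rule emb_avg_e2[OF \<sigma>[OF i(1)] \<sigma>[OF i(2)] ne])
  have "cmean (\<lambda>k. u (e2 n (?\<sigma> i) (?\<sigma> j) k * Z)) = cmean (\<lambda>k. u (e2 n i j k * (e2 n a b sw * Z)))"
  proof (rule eqI[OF jl_Lip[OF u Z]])
    fix k assume k: "k \<in> orth 2"
    show "u (e2 n (?\<sigma> i) (?\<sigma> j) k * Z) = u (e2 n i j k * (e2 n a b sw * Z))"
      unfolding e2_swap_rows[OF ab i orth_carrier[OF Z]]
      by (rule inv[symmetric]) (intro orth_mult \<iota>_orth k Z)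
  qed
  then show ?thesis by (simp add: P2_def avg_def)
qed

lemma P2_swap:
  assumes abc: "a < n" "b < n" "c < n" "a \<noteq> b" "a \<noteq> c" "b \<noteq> c"
    and u: "u \<in> Lip n" and inv: "\<And>Z. Z \<in> orth n \<Longrightarrow> u (e2 n a b sw * Z) = u Z" and Z: "Z \<in> orth n"
  shows "P2 n (a,c) u (e2 n a b sw * Z) = P2 n (b,c) u Z"
  using P2_conj_swap[OF abc(1,2,4) _ u inv Z, of a c] abc by (simp add: prs_def Transposition.transpose_def)

text \<open>Eliminating \<open>c\<close> by the last hypothesis leaves the quadratic
  \<open>(U - B)(0.98 U - 1.5 B)\<close>. The third gives \<open>c \<le> 0.48 B\<close>, hence
  \<open>9 B \<le> 5.88 U\<close>, which is exactly nonnegativity of the second factor;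
  \<open>0.02\<close> is the remainder \<open>1 - 0.98\<close>.\<close>

lemma local_numeric:
  fixes U B c :: real
  assumes "0 \<le> B" "B \<le> U" "c\<^sup>2 \<le> 0.2304 * B\<^sup>2" "9 * B\<^sup>2 \<le> U * (3 * B + 6 * c)"
  shows "0.02 * (U - B) \<le> U - 2 * B + c"
proof (cases "B = 0")
  case True then show ?thesis using assms by simp
next
  case False
  then have B: "B > 0" and U: "U > 0" using assms by auto
  have "c\<^sup>2 \<le> (0.48 * B)\<^sup>2" using assms(3) by (simp add: power2_eq_square)
  then have "c \<le> 0.48 * B" by (rule power2_le_imp_le) (use B in simp)
  then have "9 * B\<^sup>2 \<le> U * (5.88 * B)" using assms(4) U by (elim order.trans) (intro mult_left_mono, auto)
  then have "(9 * B) * B \<le> (5.88 * U) * B" by (simp add: power2_eq_square)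
  then have BU: "9 * B \<le> 5.88 * U" using B by (rule mult_right_le_imp_le)
  have "0 \<le> (U - B) * (0.98 * U - 1.5 * B)" using assms(2) BU by (intro mult_nonneg_nonneg) auto
  also have "\<dots> = U * ((U - 2 * B + c) - 0.02 * (U - B)) - (U * (3 * B + 6 * c) - 9 * B\<^sup>2) / 6"
    by (simp add: power2_eq_square field_simps)
  also have "\<dots> \<le> U * ((U - 2 * B + c) - 0.02 * (U - B))" using assms(4) by simp
  finally have "0 \<le> (U - 2 * B + c) - 0.02 * (U - B)" using U by (simp add: zero_le_mult_iff)
  then show ?thesis by simp
qed

text \<open>Three rows suffice to compare the planes \<open>(a,b)\<close> and \<open>(b,c)\<close>.
  Invariance under the swaps of these rows makes the three plane averages interchangeable.\<close>

locale triple = H: haar n Lam for n Lam +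
  fixes a b c \<phi>
  assumes abc: "a < n" "b < n" "c < n" "a \<noteq> b" "a \<noteq> c" "b \<noteq> c"
    and \<phi>L: "\<phi> \<in> Lip n"
    and \<phi>sw: "i \<in> {a,b,c} \<Longrightarrow> j \<in> {a,b,c} \<Longrightarrow> i \<noteq> j \<Longrightarrow> Z \<in> orth n \<Longrightarrow> \<phi> (e2 n i j sw * Z) = \<phi> Z"
begin

definition f :: "nat \<Rightarrow> nat" where "f i = (if i = 0 then a else if i = 1 then b else c)"

lemma embf_f: "embf 3 n f"
  using abc by (auto simp: embf_def f_def inj_on_def)

lemma f_pr: "f \<circ> pr 0 (Suc 0) = pr a b" "f \<circ> pr (Suc 0) 2 = pr b c" "f \<circ> pr 0 2 = pr a c"
  by (auto simp: f_def pr_def fun_eq_iff)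

sublocale A3: emb_avg 3 "hl 3" n f
  using haar_hl[of 3] embf_f by (simp add: emb_avg_def emb_avg_axioms_def)
sublocale AB: emb_avg 2 cmean n "pr a b" by (rule emb_avg_e2) (use abc in auto)
sublocale BC: emb_avg 2 cmean n "pr b c" by (rule emb_avg_e2) (use abc in auto)
sublocale LO: emb_avg 2 cmean 3 "pr (Suc 0) 2" by (rule emb_avg_e2) auto

lemma emb_f: "emb 3 n f (hi k) = e2 n a b k" "emb 3 n f (lo k) = e2 n b c k" "emb 3 n f (e2 3 0 2 k) = e2 n a c k"
  using emb_emb[OF embf_f, of 2 "pr 0 (Suc 0)"] emb_emb[OF embf_f, of 2 "pr (Suc 0) 2"] emb_emb[OF embf_f, of 2 "pr 0 2"]
  by (simp_all add: f_pr embf_pr)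

text \<open>Functions invariant under \<open>O(3)\<close> on the three rows are fixed by every plane
  average, so the complements \<open>\<phi> - A \<phi>\<close> do not see them. They would also
  spoil any angle between two plane averages and are removed first.\<close>

definition u where "u Z = \<phi> Z - A3.A \<phi> Z"

lemma uL: "u \<in> Lip n" unfolding u_def[abs_def] using \<phi>L by auto

lemma u_sw: 
  assumes "i \<in> {a,b,c}" "j \<in> {a,b,c}" "i \<noteq> j" "Z \<in> orth n"
  shows "u (e2 n i j sw * Z) = u Z"
proof -
  have *: "A3.A \<phi> (e2 n i j sw * Z) = A3.A \<phi> Z"
  proof -
    obtain p q where pq: "p < 3" "q < 3" "i = f p" "j = f q" "p \<noteq> q"
      using assms(1-3) by (auto simp: f_def) (metis (full_types) less_3_cases f_def numeral_2_eq_2 numeral_3_eq_3 lessI less_SucI nat.simps(3) old.nat.inject One_nat_def zero_less_Suc)+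
    have "f \<circ> pr p q = pr i j" using pq by (auto simp: pr_def fun_eq_iff)
    then have "emb 3 n f (e2 3 p q sw) = e2 n i j sw" using emb_emb[OF embf_f embf_pr[of p 3 q]] pq by simp
    then show ?thesis using A3.avg_inv[OF \<phi>L e2_orth[of p 3 q sw] assms(4)] pq sw_orth by simp
  qed
  then show ?thesis using \<phi>sw[OF assms] by (simp add: u_def)
qed

lemma P0_inv: "A3.Inv \<psi> \<Longrightarrow> AB.Inv \<psi>" "A3.Inv \<psi> \<Longrightarrow> BC.Inv \<psi>"
  unfolding A3.Inv_def AB.Inv_def BC.Inv_def using emb_f hi_orth lo_orth by metis+

lemma P0_u: "Z \<in> orth n \<Longrightarrow> A3.A u Z = 0"
  unfolding u_def[abs_def] using \<phi>L by (simp add: A3.avg_diff A3.avg_Inv A3.Inv_avg)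

lemma compl_AB: "Z \<in> orth n \<Longrightarrow> \<phi> Z - AB.A \<phi> Z = u Z - AB.A u Z"
  unfolding u_def[abs_def] using \<phi>L by (simp add: AB.avg_diff AB.avg_Inv P0_inv A3.Inv_avg)

lemma compl_BC: "Z \<in> orth n \<Longrightarrow> \<phi> Z - BC.A \<phi> Z = u Z - BC.A u Z"
  unfolding u_def[abs_def] using \<phi>L by (simp add: BC.avg_diff BC.avg_Inv P0_inv A3.Inv_avg)

definition X where "X = BC.A u"

lemma XL: "X \<in> Lip n" unfolding X_def using uL by simp

text \<open>Along an orbit of \<open>O(3)\<close> the average over the plane \<open>(b,c)\<close>
  becomes the average over the stabiliser \<open>lo\<close>; this reduces the problem to the
  three-dimensional group.\<close>

lemma X_LO:
  assumes "Z \<in> orth n" "g \<in> orth 3"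
  shows "X (A3.\<iota> g * Z) = LO.A (\<lambda>g. u (A3.\<iota> g * Z)) g"
  unfolding X_def avg_def
proof (rule AB.eqI)
  show "(\<lambda>k. u (BC.\<iota> k * (A3.\<iota> g * Z))) \<in> Lip 2" by (intro BC.jl_Lip uL orth_mult A3.\<iota>_orth assms)
  show "u (BC.\<iota> k * (A3.\<iota> g * Z)) = u (A3.\<iota> (LO.\<iota> k * g) * Z)" if "k \<in> orth 2" for k
    using A3.emb_assoc[OF assms(2) LO.\<iota>_orth[OF that] assms(1)] by (simp add: emb_f)
qed

lemma P0_X: 
  assumes Z: "Z \<in> orth n"
  shows "A3.A X Z = 0"
proof -
  have L: "(\<lambda>g. u (A3.\<iota> g * Z)) \<in> Lip 3" by (rule A3.jl_Lip[OF uL Z])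
  have "A3.A X Z = hl 3 (LO.A (\<lambda>g. u (A3.\<iota> g * Z)))"
    unfolding avg_def[of "hl 3"] by (rule A3.eqI[OF A3.jl_Lip[OF XL Z] X_LO[OF Z]])
  also have "\<dots> = A3.A u Z" unfolding avg_def[of "hl 3"] by (rule LO.haar_avg[OF A3.haar_axioms L])
  finally show ?thesis by (simp add: P0_u Z)
qed

text \<open>The weight \<open>(g $$ (0,0))^2\<close> is invariant under \<open>lo\<close>, so
  \<open>X\<close> may be replaced by \<open>u\<close>. Row swaps show that the weights from the
  three entries of the first column give the same mean; they add up to the mean of \<open>u\<close>,
  which is zero.\<close>

lemma P0_X_sq:
  assumes Z: "Z \<in> orth n"
  shows "hl 3 (\<lambda>g. (g $$ (0,0))\<^sup>2 * X (A3.\<iota> g * Z)) = 0"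
proof -
  define \<theta> where "\<theta> g = u (A3.\<iota> g * Z)" for g
  have L: "\<theta> \<in> Lip 3" unfolding \<theta>_def[abs_def] by (rule A3.jl_Lip[OF uL Z])
  have EL: "i < 3 \<Longrightarrow> (\<lambda>g. (g $$ (i,0))\<^sup>2) \<in> Lip 3" for i by (intro Lip_power Lip_entry) auto
  have I: "LO.Inv (\<lambda>g. (g $$ (0,0))\<^sup>2)" unfolding LO.Inv_def
    by (auto simp: e2_rows(3)[OF _ _ _ orth_carrier] simp del: index_mult_mat)
  have "hl 3 (\<lambda>g. (g $$ (0,0))\<^sup>2 * X (A3.\<iota> g * Z)) = hl 3 (LO.A (\<lambda>g. (g $$ (0,0))\<^sup>2 * \<theta> g))"
  proof (rule A3.eqI)
    show "(\<lambda>g. (g $$ (0,0))\<^sup>2 * X (A3.\<iota> g * Z)) \<in> Lip 3" by (intro Lip_mult EL A3.jl_Lip XL Z) simp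
    show "(g $$ (0,0))\<^sup>2 * X (A3.\<iota> g * Z) = LO.A (\<lambda>g. (g $$ (0,0))\<^sup>2 * \<theta> g) g" if "g \<in> orth 3" for g
      using LO.avg_pull[OF I EL L that] X_LO[OF Z that] by (simp add: \<theta>_def[abs_def])
  qed
  also have "\<dots> = hl 3 (\<lambda>g. (g $$ (0,0))\<^sup>2 * \<theta> g)"
    by (rule LO.haar_avg[OF A3.haar_axioms]) (intro Lip_mult EL L, simp)
  finally have e0: "hl 3 (\<lambda>g. (g $$ (0,0))\<^sup>2 * X (A3.\<iota> g * Z)) = hl 3 (\<lambda>g. (g $$ (0,0))\<^sup>2 * \<theta> g)" .
  have er: "hl 3 (\<lambda>g. (g $$ (0,0))\<^sup>2 * \<theta> g) = hl 3 (\<lambda>g. (g $$ (r,0))\<^sup>2 * \<theta> g)" if r: "r = Suc 0 \<or> r = 2" for r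
  proof -
    have o: "e2 3 0 r sw \<in> orth 3" by (rule e2_orth) (use r sw_orth in auto)
    have LL: "(\<lambda>g. (g $$ (0,0))\<^sup>2 * \<theta> g) \<in> Lip 3" by (intro Lip_mult EL L) simp
    have em: "A3.\<iota> (e2 3 0 r sw) = e2 n a (f r) sw" using r emb_f by (auto simp: f_def)
    have "hl 3 (\<lambda>g. (g $$ (0,0))\<^sup>2 * \<theta> g) = hl 3 (\<lambda>g. ((e2 3 0 r sw * g) $$ (0,0))\<^sup>2 * \<theta> (e2 3 0 r sw * g))"
      by (rule A3.left[OF LL o, symmetric])
    also have "\<dots> = hl 3 (\<lambda>g. (g $$ (r,0))\<^sup>2 * \<theta> g)"
    proof (rule A3.eqI[symmetric])
      show "(\<lambda>g. (g $$ (r,0))\<^sup>2 * \<theta> g) \<in> Lip 3" by (intro Lip_mult EL L) (use r in auto)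
      fix g assume g: "g \<in> orth 3"
      have "\<theta> (e2 3 0 r sw * g) = u (e2 n a (f r) sw * (A3.\<iota> g * Z))"
        unfolding \<theta>_def using A3.emb_assoc[OF g o Z] em by simp
      also have "\<dots> = \<theta> g" unfolding \<theta>_def
        by (rule u_sw) (use r abc A3.\<iota>_orth[OF g] Z in \<open>auto simp: f_def intro!: orth_mult\<close>)
      finally show "(g $$ (r,0))\<^sup>2 * \<theta> g = ((e2 3 0 r sw * g) $$ (0,0))\<^sup>2 * \<theta> (e2 3 0 r sw * g)"
        using r by (subst e2_rows(1)[OF _ _ _ orth_carrier[OF g]]) auto
    qed
    finally show ?thesis .
  qed
  have "0 = A3.A u Z" by (simp add: P0_u Z)
  also have "\<dots> = hl 3 (\<lambda>g. \<Sum>i<3. (g $$ (i,0))\<^sup>2 * \<theta> g)" unfolding avg_def[of "hl 3"]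
  proof (rule A3.eqI[OF A3.jl_Lip[OF uL Z]])
    show "u (A3.\<iota> g * Z) = (\<Sum>i<3. (g $$ (i,0))\<^sup>2 * \<theta> g)" if "g \<in> orth 3" for g
      using orth_col_inner[OF that, of 0 0] by (simp add: sum_distrib_right[symmetric] power2_eq_square \<theta>_def)
  qed
  also have "\<dots> = (\<Sum>i<3. hl 3 (\<lambda>g. (g $$ (i,0))\<^sup>2 * \<theta> g))"
    by (rule A3.sum) (intro Lip_mult EL L, simp)
  also have "\<dots> = 3 * hl 3 (\<lambda>g. (g $$ (0,0))\<^sup>2 * \<theta> g)" using er[of "Suc 0"] er[of 2] by (simp add: sum_lt3)
  finally show ?thesis using e0 by simp
qed

text \<open>The autocorrelation of \<open>X\<close> along the group. It inherits invariance under
  \<open>lo\<close> on both sides from the invariance of \<open>X\<close>, its average over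
  \<open>hi\<close> is the inner product of \<open>X\<close> with its average over the plane
  \<open>(a,b)\<close>, and its value at the identity is \<open>B\<close>.\<close>

definition Q where "Q g = Lam (\<lambda>Z. X Z * X (A3.\<iota> g * Z))"
definition B where "B = Lam (\<lambda>Z. (X Z)\<^sup>2)"

lemma XX: "jlip 3 n (\<lambda>g Z. X Z * X (A3.\<iota> g * Z))"
  by (intro jlip_times jlip_of_snd A3.jl XL)

lemma X_inv: "k \<in> orth 2 \<Longrightarrow> Z \<in> orth n \<Longrightarrow> X (e2 n b c k * Z) = X Z"
  unfolding X_def by (rule BC.avg_inv[OF uL])

lemma X_left: "g \<in> orth 3 \<Longrightarrow> (\<lambda>Z. X (A3.\<iota> g * Z)) \<in> Lip n"
  by (rule Lip_left[OF XL A3.\<iota>_orth])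

sublocale Q: biinvariant Q
proof
  show "Q \<in> Lip 3" unfolding Q_def[abs_def] by (rule jlip_mean_snd[OF H.mean_axioms XX])
  fix k g assume k: "k \<in> orth 2" and g: "g \<in> orth 3"
  note lk = lo_orth[OF k]
  show "Q (lo k * g) = Q g" unfolding Q_def
  proof (rule H.eqI)
    show "(\<lambda>Z. X Z * X (A3.\<iota> (lo k * g) * Z)) \<in> Lip n" by (intro Lip_mult XL X_left orth_mult lk g)
    fix Z assume Z: "Z \<in> orth n"
    have "A3.\<iota> (lo k * g) * Z = e2 n b c k * (A3.\<iota> g * Z)" using A3.emb_assoc[OF g lk Z] by (simp add: emb_f)
    then show "X Z * X (A3.\<iota> (lo k * g) * Z) = X Z * X (A3.\<iota> g * Z)"
      using X_inv[OF k orth_mult[OF A3.\<iota>_orth[OF g] Z]] by simp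
  qed
  have "Q (g * lo k) = Lam (\<lambda>Z. X (e2 n b c k * Z) * X (A3.\<iota> g * (e2 n b c k * Z)))" unfolding Q_def
  proof (rule H.eqI)
    show "(\<lambda>Z. X Z * X (A3.\<iota> (g * lo k) * Z)) \<in> Lip n" by (intro Lip_mult XL X_left orth_mult lk g)
    fix Z assume Z: "Z \<in> orth n"
    have "A3.\<iota> (g * lo k) * Z = A3.\<iota> g * (e2 n b c k * Z)" using A3.emb_assoc[OF lk g Z] by (simp add: emb_f)
    then show "X Z * X (A3.\<iota> (g * lo k) * Z) = X (e2 n b c k * Z) * X (A3.\<iota> g * (e2 n b c k * Z))"
      using X_inv[OF k Z] by simp
  qed
  also have "\<dots> = Q g" unfolding Q_def
    by (rule H.left[of "\<lambda>Z. X Z * X (A3.\<iota> g * Z)"]) (intro Lip_mult XL X_left g BC.\<iota>_orth k)+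
  finally show "Q (g * lo k) = Q g" .
qed

lemma B0: "0 \<le> B" unfolding B_def by (rule H.sq_nonneg[OF XL])

lemma Q_le: 
  assumes g: "g \<in> orth 3"
  shows "Q g \<le> B"
proof -
  have "(Q g)\<^sup>2 \<le> B * Lam (\<lambda>Z. (X (A3.\<iota> g * Z))\<^sup>2)"
    unfolding Q_def B_def by (rule H.Cauchy_Schwarz[OF XL X_left[OF g]])
  also have "Lam (\<lambda>Z. (X (A3.\<iota> g * Z))\<^sup>2) = B" unfolding B_def
    by (rule H.left[of "\<lambda>Z. (X Z)\<^sup>2"]) (intro Lip_power XL A3.\<iota>_orth g)+
  finally have "(Q g)\<^sup>2 \<le> B\<^sup>2" by (simp add: power2_eq_square)
  then show ?thesis using B0 by (rule power2_le_imp_le)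
qed

text \<open>The left side is the squared norm of the projection of \<open>X\<close> to the other
  plane, so the factor bounds a squared cosine. The two vanishing conditions required by
  \<open>cmean_hi_le\<close> pass from \<open>X\<close> to \<open>Q\<close> by interchanging
  means.\<close>

lemma Q_hi: "Lam (\<lambda>Z. X Z * AB.A X Z) \<le> 0.2304 * B"
proof -
  have "Lam (\<lambda>Z. X Z * AB.A X Z) = Lam (\<lambda>Z. cmean (\<lambda>k. X Z * X (AB.\<iota> k * Z)))"
  proof (rule H.eqI)
    show "(\<lambda>Z. X Z * AB.A X Z) \<in> Lip n" using XL by (intro Lip_mult AB.avg_Lip)
    show "X Z * AB.A X Z = cmean (\<lambda>k. X Z * X (AB.\<iota> k * Z))" if "Z \<in> orth n" for Z
      unfolding avg_def by (rule AB.cmult[symmetric, OF AB.jl_Lip[OF XL that]])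
  qed
  also have "\<dots> = cmean (\<lambda>k. Lam (\<lambda>Z. X Z * X (AB.\<iota> k * Z)))"
    by (rule mean_swap[OF H.mean_axioms AB.mean_axioms]) (intro jlip_swap[OF jlip_times[OF jlip_of_snd AB.jl]] XL)
  also have "\<dots> = cmean (\<lambda>k. Q (hi k))" by (simp add: Q_def emb_f)
  also have "\<dots> \<le> 0.2304 * B"
  proof (rule Q.cmean_hi_le[OF _ B0])
    show "Q.q t \<le> B" for t unfolding Q.q_def by (intro Q_le hi_orth rot2_orth)
    have "hl 3 Q = Lam (\<lambda>Z. hl 3 (\<lambda>g. X Z * X (A3.\<iota> g * Z)))"
      unfolding Q_def[abs_def] by (rule mean_swap[OF A3.mean_axioms H.mean_axioms XX])
    also have "\<dots> = Lam (\<lambda>Z. 0)"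
    proof (rule H.eqI[OF jlip_mean_fst[OF A3.mean_axioms XX]])
      fix Z assume Z: "Z \<in> orth n"
      have "hl 3 (\<lambda>g. X Z * X (A3.\<iota> g * Z)) = X Z * A3.A X Z"
        unfolding avg_def by (rule A3.cmult[OF A3.jl_Lip[OF XL Z]])
      then show "hl 3 (\<lambda>g. X Z * X (A3.\<iota> g * Z)) = 0" by (simp add: P0_X Z)
    qed
    finally show "hl 3 Q = 0" by (simp add: H.const)
    have J2: "jlip 3 n (\<lambda>g Z. (g $$ (0,0))\<^sup>2 * (X Z * X (A3.\<iota> g * Z)))"
      by (intro jlip_times[OF jlip_of_fst XX] Lip_power Lip_entry) auto
    have "hl 3 (\<lambda>g. (g $$ (0,0))\<^sup>2 * Q g) = hl 3 (\<lambda>g. Lam (\<lambda>Z. (g $$ (0,0))\<^sup>2 * (X Z * X (A3.\<iota> g * Z))))"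
    proof (rule A3.eqI)
      show "(\<lambda>g. (g $$ (0,0))\<^sup>2 * Q g) \<in> Lip 3" by (intro Lip_mult Lip_power Lip_entry Q.QL) auto
      show "(g $$ (0,0))\<^sup>2 * Q g = Lam (\<lambda>Z. (g $$ (0,0))\<^sup>2 * (X Z * X (A3.\<iota> g * Z)))" if "g \<in> orth 3" for g
        unfolding Q_def by (rule H.cmult[symmetric, OF jlip_snd[OF XX that]])
    qed
    also have "\<dots> = Lam (\<lambda>Z. hl 3 (\<lambda>g. (g $$ (0,0))\<^sup>2 * (X Z * X (A3.\<iota> g * Z))))"
      by (rule mean_swap[OF A3.mean_axioms H.mean_axioms J2])
    also have "\<dots> = Lam (\<lambda>Z. 0)"
    proof (rule H.eqI[OF jlip_mean_fst[OF A3.mean_axioms J2]])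
      fix Z assume Z: "Z \<in> orth n"
      have "hl 3 (\<lambda>g. (g $$ (0,0))\<^sup>2 * (X Z * X (A3.\<iota> g * Z))) = hl 3 (\<lambda>g. X Z * ((g $$ (0,0))\<^sup>2 * X (A3.\<iota> g * Z)))"
        by (simp add: mult_ac)
      also have "\<dots> = X Z * hl 3 (\<lambda>g. (g $$ (0,0))\<^sup>2 * X (A3.\<iota> g * Z))"
        by (rule A3.cmult) (intro Lip_mult Lip_power Lip_entry A3.jl_Lip XL Z, auto)
      finally show "hl 3 (\<lambda>g. (g $$ (0,0))\<^sup>2 * (X Z * X (A3.\<iota> g * Z))) = 0" by (simp add: P0_X_sq Z)
    qed
    finally show "hl 3 (\<lambda>g. (g $$ (0,0))\<^sup>2 * Q g) = 0" by (simp add: H.const)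
  qed
  finally show ?thesis .
qed

text \<open>By symmetry the three plane projections of \<open>u\<close> have one common squared norm
  \<open>B\<close> and one common mutual inner product \<open>k\<close>, and the two sides become
  \<open>U - B\<close> and \<open>U - 2B + k\<close>. Two constraints enter: the angle bound
  \<open>k2\<close>, and Cauchy-Schwarz for \<open>u\<close> against the sum \<open>W\<close> of all
  three projections.\<close>

theorem shared_axis:
  "0.02 * Lam (\<lambda>Z. \<phi> Z * (\<phi> Z - BC.A \<phi> Z)) \<le> Lam (\<lambda>Z. (\<phi> Z - BC.A \<phi> Z) * (\<phi> Z - AB.A \<phi> Z))"
proof -
  define Y V where "Y = P2 n (a,b) u" and "V = P2 n (a,c) u"
  have ps: "(a,b) \<in> prs n" "(b,c) \<in> prs n" "(a,c) \<in> prs n" "(b,a) \<in> prs n" "(c,b) \<in> prs n" "(c,a) \<in> prs n"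
    using abc by (auto simp: prs_def)
  interpret AC: emb_avg 2 cmean n "pr a c" by (rule emb_avg_e2) (use abc in auto)
  interpret CA: emb_avg 2 cmean n "pr c a" by (rule emb_avg_e2) (use abc in auto)
  have XP: "X = P2 n (b,c) u" by (simp add: X_def P2_def)
  have YA: "Y = AB.A u" by (simp add: Y_def P2_def)
  have VA: "V = AC.A u" by (simp add: V_def P2_def)
  have YL: "Y \<in> Lip n" and VL: "V \<in> Lip n" unfolding YA VA using uL by simp_all
  have so: "e2 n a b sw \<in> orth n" "e2 n c a sw \<in> orth n" using abc by (auto intro!: e2_orth sw_orth)
  have s1: "V (e2 n a b sw * Z) = X Z" if "Z \<in> orth n" for Z
    unfolding XP V_def by (rule P2_swap[OF _ _ _ _ _ _ uL u_sw that]) (use abc in auto)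
  have s2: "Y (e2 n a b sw * Z) = Y Z" if "Z \<in> orth n" for Z
    unfolding YA by (rule AB.avg_inv[OF uL sw_orth that])
  have s3: "X (e2 n c a sw * Z) = Y Z" if Z: "Z \<in> orth n" for Z
  proof -
    have "X (e2 n c a sw * Z) = P2 n (c,b) u (e2 n c a sw * Z)" unfolding XP
      by (rule P2_sym[OF ps(2) uL orth_mult[OF so(2) Z]])
    also have "\<dots> = P2 n (a,b) u Z" by (rule P2_swap[OF _ _ _ _ _ _ uL u_sw Z]) (use abc in auto)
    finally show ?thesis by (simp add: Y_def)
  qed
  have s4: "V (e2 n c a sw * Z) = V Z" if Z: "Z \<in> orth n" for Z
  proof -
    have "V (e2 n c a sw * Z) = P2 n (c,a) u (e2 n c a sw * Z)" unfolding V_def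
      by (rule P2_sym[OF ps(3) uL orth_mult[OF so(2) Z]])
    also have "\<dots> = P2 n (c,a) u Z" unfolding P2_def fst_conv snd_conv by (rule CA.avg_inv[OF uL sw_orth Z])
    also have "\<dots> = V Z" unfolding V_def by (rule P2_sym[OF ps(3) uL Z, symmetric])
    finally show ?thesis .
  qed
  have tr: "Lam F = Lam G" if "F \<in> Lip n" "S \<in> orth n" "\<And>Z. Z \<in> orth n \<Longrightarrow> F (S * Z) = G Z" for F G S
  proof -
    have "Lam F = Lam (\<lambda>Z. F (S * Z))" by (rule H.left[symmetric, OF that(1,2)])
    also have "\<dots> = Lam G" by (rule H.eqI[OF Lip_left[OF that(1,2)] that(3)])
    finally show ?thesis .
  qed
  have VB: "Lam (\<lambda>Z. (V Z)\<^sup>2) = B" unfolding B_def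
    by (rule tr[OF Lip_power[OF VL] so(1)]) (simp add: s1)
  have YB: "Lam (\<lambda>Z. (Y Z)\<^sup>2) = B" unfolding B_def
    by (rule tr[OF Lip_power[OF XL] so(2), symmetric]) (simp add: s3)
  define k where "k = Lam (\<lambda>Z. X Z * Y Z)"
  have VY: "Lam (\<lambda>Z. V Z * Y Z) = k" unfolding k_def
    by (rule tr[OF Lip_mult[OF VL YL] so(1)]) (simp add: s1 s2)
  have XV: "Lam (\<lambda>Z. X Z * V Z) = k" unfolding VY[symmetric]
    by (rule tr[OF Lip_mult[OF XL VL] so(2)]) (simp add: s3 s4 mult.commute)
  define U where "U = Lam (\<lambda>Z. (u Z)\<^sup>2)"
  have uX: "Lam (\<lambda>Z. X Z * u Z) = B" unfolding B_def X_def by (rule BC.haar_compl(3)[OF H.haar_axioms uL])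
  have uY: "Lam (\<lambda>Z. Y Z * u Z) = B" using AB.haar_compl(3)[OF H.haar_axioms uL] YB by (simp add: YA)
  have uV: "Lam (\<lambda>Z. V Z * u Z) = B" using AC.haar_compl(3)[OF H.haar_axioms uL] VB by (simp add: VA)
  have BU: "B \<le> U" using H.sq_nonneg[of "\<lambda>Z. u Z - BC.A u Z"] BC.haar_compl(2)[OF H.haar_axioms uL] uL
    by (simp add: B_def U_def X_def)
  have k2: "k\<^sup>2 \<le> 0.2304 * B\<^sup>2"
  proof -
    have "k = Lam (\<lambda>Z. AB.A u Z * X Z)" by (simp add: k_def YA mult.commute)
    also have "\<dots> = Lam (\<lambda>Z. AB.A u Z * AB.A X Z)" by (rule AB.haar_avg_mult[OF H.haar_axioms uL XL])
    finally have "k\<^sup>2 \<le> Lam (\<lambda>Z. (AB.A u Z)\<^sup>2) * Lam (\<lambda>Z. (AB.A X Z)\<^sup>2)"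
      using H.Cauchy_Schwarz[OF AB.avg_Lip[OF uL] AB.avg_Lip[OF XL]] by simp
    also have "Lam (\<lambda>Z. (AB.A u Z)\<^sup>2) = B" using YB by (simp add: YA)
    also have "Lam (\<lambda>Z. (AB.A X Z)\<^sup>2) = Lam (\<lambda>Z. X Z * AB.A X Z)"
      using AB.haar_compl(3)[OF H.haar_axioms XL] by (simp add: mult.commute)
    also have "B * \<dots> \<le> B * (0.2304 * B)" by (intro mult_left_mono Q_hi B0)
    finally show ?thesis by (simp add: power2_eq_square)
  qed
  have W: "9 * B\<^sup>2 \<le> U * (3 * B + 6 * k)"
  proof -
    define W where "W Z = (X Z + Y Z) + V Z" for Z
    have WL: "W \<in> Lip n" unfolding W_def using XL YL VL by auto
    have "Lam (\<lambda>Z. u Z * W Z) = Lam (\<lambda>Z. (X Z * u Z + Y Z * u Z) + V Z * u Z)" by (simp add: W_def algebra_simps)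
    also have "\<dots> = 3 * B" using XL YL VL uL by (simp add: H.add uX uY uV)
    finally have 1: "Lam (\<lambda>Z. u Z * W Z) = 3 * B" .
    have "Lam (\<lambda>Z. (W Z)\<^sup>2) = Lam (\<lambda>Z. ((X Z)\<^sup>2 + (Y Z)\<^sup>2 + (V Z)\<^sup>2) + (2 * (X Z * Y Z) + 2 * (V Z * Y Z) + 2 * (X Z * V Z)))"
      by (simp add: W_def power2_eq_square algebra_simps)
    also have "\<dots> = 3 * B + 6 * k" using XL YL VL uL
      by (simp add: H.add H.cmult VB YB VY XV B_def[symmetric] k_def[symmetric])
    finally have "Lam (\<lambda>Z. (W Z)\<^sup>2) = 3 * B + 6 * k" .
    then show ?thesis using H.Cauchy_Schwarz[OF uL WL] 1 by (simp add: U_def power_mult_distrib)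
  qed
  have "Lam (\<lambda>Z. \<phi> Z * (\<phi> Z - BC.A \<phi> Z)) = Lam (\<lambda>Z. (\<phi> Z - BC.A \<phi> Z)\<^sup>2)"
    using BC.haar_compl[OF H.haar_axioms \<phi>L] by simp
  also have "\<dots> = Lam (\<lambda>Z. (u Z - BC.A u Z)\<^sup>2)"
    by (rule H.eqI) (use \<phi>L in \<open>auto simp: compl_BC\<close>)
  also have "\<dots> = U - B" using BC.haar_compl(2)[OF H.haar_axioms uL] by (simp add: U_def B_def X_def)
  finally have r: "Lam (\<lambda>Z. \<phi> Z * (\<phi> Z - BC.A \<phi> Z)) = U - B" .
  have "Lam (\<lambda>Z. (\<phi> Z - BC.A \<phi> Z) * (\<phi> Z - AB.A \<phi> Z)) = Lam (\<lambda>Z. ((u Z)\<^sup>2 - X Z * u Z - Y Z * u Z) + X Z * Y Z)"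
  proof (rule H.eqI)
    show "(\<lambda>Z. (\<phi> Z - BC.A \<phi> Z) * (\<phi> Z - AB.A \<phi> Z)) \<in> Lip n" using \<phi>L by auto
    show "(\<phi> Z - BC.A \<phi> Z) * (\<phi> Z - AB.A \<phi> Z) = ((u Z)\<^sup>2 - X Z * u Z - Y Z * u Z) + X Z * Y Z" if "Z \<in> orth n" for Z
      unfolding compl_BC[OF that] compl_AB[OF that] X_def YA by (simp add: power2_eq_square algebra_simps)
  qed
  also have "\<dots> = U - B - B + k" using uL XL YL by (simp add: H.add H.diff uX uY U_def k_def)
  finally show ?thesis unfolding r using local_numeric[OF B0 BU k2 W] by simp
qed

end

subsection \<open>Spectral gap for row-symmetric functions\<close>

definition EE :: "nat \<Rightarrow> nat \<times> nat \<Rightarrow> (real mat \<Rightarrow> real) \<Rightarrow> real mat \<Rightarrow> real" where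
  "EE n p \<phi> Z = \<phi> Z - P2 n p \<phi> Z"

text \<open>The unnormalised generator of Kac's walk, the number of pairs times
  \<open>1 - TT\<close>. The pairs are ordered, so every plane occurs twice.\<close>

definition DD :: "nat \<Rightarrow> (real mat \<Rightarrow> real) \<Rightarrow> real mat \<Rightarrow> real" where
  "DD n \<phi> Z = (\<Sum>p\<in>prs n. EE n p \<phi> Z)"

definition SYM :: "nat \<Rightarrow> (real mat \<Rightarrow> real) \<Rightarrow> bool" where
  "SYM n \<phi> \<longleftrightarrow> (\<forall>a<n. \<forall>b<n. \<forall>Z\<in>orth n. a \<noteq> b \<longrightarrow> \<phi> (e2 n a b sw * Z) = \<phi> Z)"

lemma EE_Lip [intro,simp]: "p \<in> prs n \<Longrightarrow> \<phi> \<in> Lip n \<Longrightarrow> EE n p \<phi> \<in> Lip n"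
  unfolding EE_def[abs_def] by auto

lemma DD_Lip [intro,simp]: "\<phi> \<in> Lip n \<Longrightarrow> DD n \<phi> \<in> Lip n"
  unfolding DD_def[abs_def] by auto

lemma P2_commute:
  assumes p: "(i,j) \<in> prs n" and q: "(k,l) \<in> prs n" and d: "{i,j} \<inter> {k,l} = {}"
    and \<phi>: "\<phi> \<in> Lip n" and Z: "Z \<in> orth n"
  shows "P2 n (i,j) (P2 n (k,l) \<phi>) Z = P2 n (k,l) (P2 n (i,j) \<phi>) Z"
proof -
  have ij: "i < n" "j < n" "i \<noteq> j" and kl: "k < n" "l < n" "k \<noteq> l" using p q by (auto simp: prs_def)
  interpret I: emb_avg 2 cmean n "pr i j" by (rule emb_avg_e2[OF ij])
  interpret K: emb_avg 2 cmean n "pr k l" by (rule emb_avg_e2[OF kl])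
  have com: "e2 n k l h * (e2 n i j g * Z) = e2 n i j g * (e2 n k l h * Z)" for g h
  proof -
    have "e2 n k l h * (e2 n i j g * Z) = (e2 n k l h * e2 n i j g) * Z"
      using orth_carrier[OF Z] by (intro assoc_mult_mat[symmetric, of _ n n _ n _ n]) auto
    also have "e2 n k l h * e2 n i j g = e2 n i j g * e2 n k l h"
      by (rule emb_commute[OF K.embf I.embf]) (use d in \<open>auto simp: pr_image\<close>)
    also have "\<dots> * Z = e2 n i j g * (e2 n k l h * Z)"
      using orth_carrier[OF Z] by (intro assoc_mult_mat[of _ n n _ n _ n]) auto
    finally show ?thesis .
  qed
  have J1: "jlip 2 n (\<lambda>g X. \<phi> (e2 n i j g * X))" by (rule I.jl[OF \<phi>])
  have "jlip 2 2 (\<lambda>g h. \<phi> (e2 n i j g * (e2 n k l h * Z)))"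
  proof -
    have J: "jlip n 2 (\<lambda>X g. \<phi> (e2 n i j g * X))" by (rule jlip_swap[OF J1])
    have "jlip 2 2 (\<lambda>h g. \<phi> (e2 n i j g * (e2 n k l h * Z)))"
    proof (rule jlip_comp[OF J, of _ _ "real n * real n"])
      show "e2 n k l g * Z \<in> orth n" if "g \<in> orth 2" for g by (intro orth_mult K.\<iota>_orth that Z)
      show "fd (e2 n k l g * Z) (e2 n k l g' * Z) \<le> real n * real n * fd g g'" if "g \<in> orth 2" "g' \<in> orth 2" for g g'
        using fd_emb_le[OF K.embf that[THEN orth_carrier]] fd_right[OF Z, of "e2 n k l g" n "e2 n k l g'"] by simp
    qed simp
    then show ?thesis by (rule jlip_swap)
  qed
  from mean_swap[OF I.mean_axioms I.mean_axioms this]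
  show ?thesis unfolding P2_def avg_def fst_conv snd_conv com by simp
qed

lemma P2_abs_le:
  assumes p: "p \<in> prs n" and \<phi>: "\<phi> \<in> Lip n" and b: "\<And>X. X \<in> orth n \<Longrightarrow> \<bar>\<phi> X\<bar> \<le> b" and Z: "Z \<in> orth n"
  shows "\<bar>P2 n p \<phi> Z\<bar> \<le> b"
proof -
  interpret emb_avg 2 cmean n "pr (fst p) (snd p)" by (rule P2_avg[OF p])
  show ?thesis unfolding P2_def avg_def
    by (rule abs_le[OF jl_Lip[OF \<phi> Z]]) (intro b orth_mult \<iota>_orth Z)
qed

lemma EE_diff:
  assumes "p \<in> prs n" "\<phi> \<in> Lip n" "\<psi> \<in> Lip n" "Z \<in> orth n"
  shows "EE n p (\<lambda>X. \<phi> X - \<psi> X) Z = EE n p \<phi> Z - EE n p \<psi> Z"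
  unfolding EE_def P2_def using assms by (simp add: emb_avg.avg_diff[OF P2_avg])

lemma EE_cmult:
  assumes "p \<in> prs n" "\<phi> \<in> Lip n" "Z \<in> orth n"
  shows "EE n p (\<lambda>X. t * \<phi> X) Z = t * EE n p \<phi> Z"
  unfolding EE_def P2_def using assms by (simp add: emb_avg.avg_cmult[OF P2_avg] algebra_simps)

lemma DD_diff:
  "\<phi> \<in> Lip n \<Longrightarrow> \<psi> \<in> Lip n \<Longrightarrow> Z \<in> orth n \<Longrightarrow> DD n (\<lambda>X. \<phi> X - \<psi> X) Z = DD n \<phi> Z - DD n \<psi> Z"
  unfolding DD_def by (simp add: EE_diff sum_subtractf)

lemma DD_cmult: "\<phi> \<in> Lip n \<Longrightarrow> Z \<in> orth n \<Longrightarrow> DD n (\<lambda>X. t * \<phi> X) Z = t * DD n \<phi> Z"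
  unfolding DD_def by (simp add: EE_cmult sum_distrib_left)

lemma DD_abs_le:
  assumes \<phi>: "\<phi> \<in> Lip n" and b: "\<And>X. X \<in> orth n \<Longrightarrow> \<bar>\<phi> X\<bar> \<le> b" and Z: "Z \<in> orth n"
  shows "\<bar>DD n \<phi> Z\<bar> \<le> real (card (prs n)) * (2 * b)"
proof -
  have "\<bar>DD n \<phi> Z\<bar> \<le> (\<Sum>p\<in>prs n. \<bar>EE n p \<phi> Z\<bar>)" unfolding DD_def by (rule sum_abs)
  also have "\<dots> \<le> (\<Sum>p\<in>prs n. 2 * b)"
  proof (rule sum_mono)
    fix p assume p: "p \<in> prs n"
    show "\<bar>EE n p \<phi> Z\<bar> \<le> 2 * b" using P2_abs_le[OF p \<phi> b Z] b[OF Z] unfolding EE_def by linarith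
  qed
  finally show ?thesis by simp
qed

lemma SYM_P2:
  assumes S: "SYM n \<phi>" and \<phi>: "\<phi> \<in> Lip n" and ab: "a < n" "b < n" "a \<noteq> b" and ij: "(i,j) \<in> prs n" and Z: "Z \<in> orth n"
  shows "P2 n (i,j) \<phi> (e2 n a b sw * Z) = P2 n (Transposition.transpose a b i, Transposition.transpose a b j) \<phi> Z"
  by (rule P2_conj_swap[OF ab ij \<phi> _ Z]) (use S ab in \<open>auto simp: SYM_def\<close>)

lemma SYM_TT:
  assumes S: "SYM n \<phi>" and \<phi>: "\<phi> \<in> Lip n"
  shows "SYM n (TT n \<phi>)"
  unfolding SYM_def
proof (intro allI impI ballI)
  fix a b Z assume ab: "a < n" "b < n" and Z: "Z \<in> orth n" and ne: "a \<noteq> b"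
  define \<sigma> where "\<sigma> = (\<lambda>(i,j). (Transposition.transpose a b i, Transposition.transpose a b j))"
  have "(\<Sum>p\<in>prs n. P2 n p \<phi> (e2 n a b sw * Z)) = (\<Sum>p\<in>prs n. P2 n (\<sigma> p) \<phi> Z)"
    by (intro sum.cong refl) (auto simp: \<sigma>_def intro!: SYM_P2[OF S \<phi> ab ne _ Z])
  also have "\<dots> = (\<Sum>p\<in>prs n. P2 n p \<phi> Z)"
  proof (rule sum.reindex_bij_betw)
    show "bij_betw \<sigma> (prs n) (prs n)"
      by (rule bij_betwI[of _ _ _ \<sigma>]) (use ab in \<open>auto simp: \<sigma>_def prs_def Transposition.transpose_def split: if_splits\<close>)
  qed
  finally show "TT n \<phi> (e2 n a b sw * Z) = TT n \<phi> Z" by (simp add: TT_def)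
qed

locale gap =
  fixes n :: nat
  assumes n3: "3 \<le> n"
begin

sublocale haar n "hl n" using n3 by (intro haar_hl) simp

lemma EE_facts:
  assumes p: "p \<in> prs n" and \<phi>: "\<phi> \<in> Lip n" and \<psi>: "\<psi> \<in> Lip n"
  shows "hl n (\<lambda>Z. EE n p \<phi> Z * \<psi> Z) = hl n (\<lambda>Z. EE n p \<phi> Z * EE n p \<psi> Z)"
proof -
  interpret P: emb_avg 2 cmean n "pr (fst p) (snd p)" by (rule P2_avg[OF p])
  have L: "P.A \<phi> \<in> Lip n" "P.A \<psi> \<in> Lip n" using \<phi> \<psi> by auto
  have sy: "hl n (\<lambda>Z. \<phi> Z * P.A \<psi> Z) = hl n (\<lambda>Z. P.A \<phi> Z * P.A \<psi> Z)"
    using P.haar_avg_mult[OF haar_axioms \<psi> \<phi>] by (simp add: mult.commute)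
  have "hl n (\<lambda>Z. EE n p \<phi> Z * EE n p \<psi> Z) =
     hl n (\<lambda>Z. EE n p \<phi> Z * \<psi> Z - (\<phi> Z * P.A \<psi> Z - P.A \<phi> Z * P.A \<psi> Z))"
    by (simp add: EE_def P2_def algebra_simps)
  also have "\<dots> = hl n (\<lambda>Z. EE n p \<phi> Z * \<psi> Z) - (hl n (\<lambda>Z. \<phi> Z * P.A \<psi> Z) - hl n (\<lambda>Z. P.A \<phi> Z * P.A \<psi> Z))"
    using L \<phi> \<psi> p by (simp add: diff)
  finally show ?thesis by (simp add: sy)
qed

lemma EE_sq:
  assumes p: "p \<in> prs n" and \<phi>: "\<phi> \<in> Lip n"
  shows "hl n (\<lambda>Z. \<phi> Z * EE n p \<phi> Z) = hl n (\<lambda>Z. (EE n p \<phi> Z)\<^sup>2)"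
  using EE_facts[OF p \<phi> \<phi>] by (simp add: power2_eq_square mult.commute)

lemma EE_nonneg: "p \<in> prs n \<Longrightarrow> \<phi> \<in> Lip n \<Longrightarrow> 0 \<le> hl n (\<lambda>Z. \<phi> Z * EE n p \<phi> Z)"
  by (simp add: EE_sq sq_nonneg)

lemma DD_sym:
  assumes \<phi>: "\<phi> \<in> Lip n" and \<psi>: "\<psi> \<in> Lip n"
  shows "hl n (\<lambda>Z. \<phi> Z * DD n \<psi> Z) = hl n (\<lambda>Z. \<psi> Z * DD n \<phi> Z)"
proof -
  have "hl n (\<lambda>Z. \<phi> Z * DD n \<psi> Z) = (\<Sum>p\<in>prs n. hl n (\<lambda>Z. EE n p \<psi> Z * EE n p \<phi> Z))" if "\<phi> \<in> Lip n" "\<psi> \<in> Lip n" for \<phi> \<psi>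
  proof -
    have "hl n (\<lambda>Z. \<phi> Z * DD n \<psi> Z) = hl n (\<lambda>Z. \<Sum>p\<in>prs n. EE n p \<psi> Z * \<phi> Z)"
      by (simp add: DD_def sum_distrib_left mult.commute)
    also have "\<dots> = (\<Sum>p\<in>prs n. hl n (\<lambda>Z. EE n p \<psi> Z * \<phi> Z))" using that by (intro sum) auto
    finally show ?thesis using that by (simp add: EE_facts)
  qed
  from this[OF assms] this[OF assms(2,1)] show ?thesis by (simp add: mult.commute)
qed

lemma DD_nonneg: 
  assumes \<phi>: "\<phi> \<in> Lip n"
  shows "0 \<le> hl n (\<lambda>Z. \<phi> Z * DD n \<phi> Z)"
proof -
  have "hl n (\<lambda>Z. \<phi> Z * DD n \<phi> Z) = hl n (\<lambda>Z. \<Sum>p\<in>prs n. \<phi> Z * EE n p \<phi> Z)" by (simp add: DD_def sum_distrib_left)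
  also have "\<dots> = (\<Sum>p\<in>prs n. hl n (\<lambda>Z. \<phi> Z * EE n p \<phi> Z))" using \<phi> by (intro sum) auto
  finally show ?thesis using \<phi> by (auto intro!: sum_nonneg EE_nonneg)
qed

lemma EE_sym: "(i,j) \<in> prs n \<Longrightarrow> \<phi> \<in> Lip n \<Longrightarrow> Z \<in> orth n \<Longrightarrow> EE n (i,j) \<phi> Z = EE n (j,i) \<phi> Z"
  unfolding EE_def using P2_sym by simp

lemma shared:
  assumes S: "SYM n \<phi>" and \<phi>: "\<phi> \<in> Lip n" and i: "i < n" "j < n" "k < n" "i \<noteq> j" "i \<noteq> k" "j \<noteq> k"
  shows "0.02 * hl n (\<lambda>Z. \<phi> Z * EE n (i,j) \<phi> Z) \<le> hl n (\<lambda>Z. EE n (i,j) \<phi> Z * EE n (k,i) \<phi> Z)"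
proof -
  interpret triple n "hl n" k i j \<phi>
    by unfold_locales (use i \<phi> S in \<open>auto simp: SYM_def\<close>)
  show ?thesis using shared_axis by (simp add: EE_def P2_def)
qed

lemma EE_EE_cong:
  assumes "\<phi> \<in> Lip n" "p \<in> prs n" "q \<in> prs n"
    and "\<And>Z. Z \<in> orth n \<Longrightarrow> EE n p \<phi> Z = EE n p' \<phi> Z" "\<And>Z. Z \<in> orth n \<Longrightarrow> EE n q \<phi> Z = EE n q' \<phi> Z"
  shows "hl n (\<lambda>Z. EE n p \<phi> Z * EE n q \<phi> Z) = hl n (\<lambda>Z. EE n p' \<phi> Z * EE n q' \<phi> Z)"
  by (rule eqI) (use assms in auto)

text \<open>Rotations of disjoint pairs of rows commute, hence so do the two projections, and the
  inner product equals the energy of \<open>EE n (i,j) \<phi>\<close> in the pair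
  \<open>(k,l)\<close>.\<close>

lemma EE_EE_disjoint:
  assumes p: "(i,j) \<in> prs n" and q: "(k,l) \<in> prs n" and d: "{i,j} \<inter> {k,l} = {}" and \<phi>: "\<phi> \<in> Lip n"
  shows "0 \<le> hl n (\<lambda>Z. EE n (i,j) \<phi> Z * EE n (k,l) \<phi> Z)"
proof -
  let ?p = "(i,j)" and ?q = "(k,l)"
  have L: "EE n ?p \<phi> \<in> Lip n" "EE n ?q \<phi> \<in> Lip n" "P2 n ?p \<phi> \<in> Lip n" "P2 n ?q \<phi> \<in> Lip n" using p q \<phi> by auto
  have c: "EE n ?p (EE n ?q \<phi>) Z = EE n ?q (EE n ?p \<phi>) Z" if Z: "Z \<in> orth n" for Z
  proof -
    have "P2 n ?p (EE n ?q \<phi>) Z = P2 n ?p \<phi> Z - P2 n ?p (P2 n ?q \<phi>) Z"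
      unfolding EE_def[abs_def] P2_def[of n ?p] using \<phi> L Z by (simp add: emb_avg.avg_diff[OF P2_avg[OF p, simplified]])
    moreover have "P2 n ?q (EE n ?p \<phi>) Z = P2 n ?q \<phi> Z - P2 n ?q (P2 n ?p \<phi>) Z"
      unfolding EE_def[abs_def] P2_def[of n ?q] using \<phi> L Z by (simp add: emb_avg.avg_diff[OF P2_avg[OF q, simplified]])
    ultimately show ?thesis using P2_commute[OF p q d \<phi> Z] by (simp add: EE_def[of n _ "EE _ _ _"]) (simp add: EE_def)
  qed
  have "hl n (\<lambda>Z. EE n ?p \<phi> Z * EE n ?q \<phi> Z) = hl n (\<lambda>Z. EE n ?p \<phi> Z * EE n ?p (EE n ?q \<phi>) Z)"
    by (rule EE_facts[OF p \<phi> L(2)])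
  also have "\<dots> = hl n (\<lambda>Z. EE n ?p \<phi> Z * EE n ?q (EE n ?p \<phi>) Z)"
    by (rule eqI) (use L p q c in auto)
  finally show ?thesis using EE_nonneg[OF q L(1)] by simp
qed

lemma EE_EE_nonneg:
  assumes S: "SYM n \<phi>" and \<phi>: "\<phi> \<in> Lip n" and p: "p \<in> prs n" and q: "q \<in> prs n"
  shows "0 \<le> hl n (\<lambda>Z. EE n p \<phi> Z * EE n q \<phi> Z)"
proof -
  obtain i j k l where e: "p = (i,j)" "q = (k,l)" by (metis surj_pair)
  have i: "i < n" "j < n" "i \<noteq> j" "k < n" "l < n" "k \<noteq> l" using p q e by (auto simp: prs_def)
  have pp: "(i,j) \<in> prs n" "(j,i) \<in> prs n" "(k,l) \<in> prs n" "(l,k) \<in> prs n" using i by (auto simp: prs_def)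
  note sy = EE_sym[OF _ \<phi>]
  have sq: "0 \<le> hl n (\<lambda>Z. EE n p \<phi> Z * EE n p \<phi> Z)" if "p \<in> prs n" for p
    using sq_nonneg[OF EE_Lip[OF that \<phi>]] by (simp add: power2_eq_square)
  have sh: "0 \<le> hl n (\<lambda>Z. EE n (a,b) \<phi> Z * EE n (c,a) \<phi> Z)" if "a < n" "b < n" "c < n" "a \<noteq> b" "a \<noteq> c" "b \<noteq> c" for a b c
    using shared[OF S \<phi> that] EE_nonneg[of "(a,b)" \<phi>] \<phi> that by (auto simp: prs_def)
  consider "k = i" "l = j" | "k = j" "l = i" | "k = i" "l \<noteq> j" | "k = j" "l \<noteq> i" | "l = i" "k \<noteq> j" | "l = j" "k \<noteq> i"
    | "{i,j} \<inter> {k,l} = {}" by auto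
  then show ?thesis unfolding e
  proof cases
    case 1 then show "0 \<le> hl n (\<lambda>Z. EE n (i,j) \<phi> Z * EE n (k,l) \<phi> Z)" using sq[OF pp(1)] by simp
  next
    case 2
    have "hl n (\<lambda>Z. EE n (i,j) \<phi> Z * EE n (k,l) \<phi> Z) = hl n (\<lambda>Z. EE n (i,j) \<phi> Z * EE n (l,k) \<phi> Z)"
      by (rule EE_EE_cong[OF \<phi> pp(1,3) refl sy[OF pp(3)]])
    then show "0 \<le> hl n (\<lambda>Z. EE n (i,j) \<phi> Z * EE n (k,l) \<phi> Z)" using sq[OF pp(1)] 2 by simp
  next
    case 3
    have "hl n (\<lambda>Z. EE n (i,j) \<phi> Z * EE n (k,l) \<phi> Z) = hl n (\<lambda>Z. EE n (i,j) \<phi> Z * EE n (l,k) \<phi> Z)"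
      by (rule EE_EE_cong[OF \<phi> pp(1,3) refl sy[OF pp(3)]])
    then show "0 \<le> hl n (\<lambda>Z. EE n (i,j) \<phi> Z * EE n (k,l) \<phi> Z)" using sh[of i j l] i 3 by simp
  next
    case 4
    have "hl n (\<lambda>Z. EE n (i,j) \<phi> Z * EE n (k,l) \<phi> Z) = hl n (\<lambda>Z. EE n (j,i) \<phi> Z * EE n (l,k) \<phi> Z)"
      by (rule EE_EE_cong[OF \<phi> pp(1,3) sy[OF pp(1)] sy[OF pp(3)]])
    then show "0 \<le> hl n (\<lambda>Z. EE n (i,j) \<phi> Z * EE n (k,l) \<phi> Z)" using sh[of j i l] i 4 by simp
  next
    case 5
    then show "0 \<le> hl n (\<lambda>Z. EE n (i,j) \<phi> Z * EE n (k,l) \<phi> Z)" using sh[of i j k] i by simp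
  next
    case 6
    have "hl n (\<lambda>Z. EE n (i,j) \<phi> Z * EE n (k,l) \<phi> Z) = hl n (\<lambda>Z. EE n (j,i) \<phi> Z * EE n (k,l) \<phi> Z)"
      by (rule EE_EE_cong[OF \<phi> pp(1,3) sy[OF pp(1)] refl])
    then show "0 \<le> hl n (\<lambda>Z. EE n (i,j) \<phi> Z * EE n (k,l) \<phi> Z)" using sh[of j i k] i 6 by simp
  next
    case 7
    then show "0 \<le> hl n (\<lambda>Z. EE n (i,j) \<phi> Z * EE n (k,l) \<phi> Z)" by (rule EE_EE_disjoint[OF pp(1,3) _ \<phi>])
  qed
qed

text \<open>\<open>0.02\<close> is the constant of \<open>shared_axis\<close>; \<open>n - 2\<close>
  counts the third rows \<open>k\<close> for which the pair \<open>(k,i)\<close> shares just the row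
  \<open>i\<close> with a given pair \<open>(i,j)\<close>.\<close>

definition \<gamma> :: real where "\<gamma> = 0.02 * real (n - 2)"

lemma \<gamma>_pos: "0 < \<gamma>" unfolding \<gamma>_def using n3 by simp

text \<open>In the expansion of the square all cross terms are nonnegative, and the pairs sharing a row contribute the gap.\<close>

lemma DD_gap:
  assumes S: "SYM n \<phi>" and \<phi>: "\<phi> \<in> Lip n"
  shows "\<gamma> * hl n (\<lambda>Z. \<phi> Z * DD n \<phi> Z) \<le> hl n (\<lambda>Z. (DD n \<phi> Z)\<^sup>2)"
proof -
  have "\<gamma> * hl n (\<lambda>Z. \<phi> Z * EE n p \<phi> Z) \<le> (\<Sum>q\<in>prs n. hl n (\<lambda>Z. EE n p \<phi> Z * EE n q \<phi> Z))" if p: "p \<in> prs n" for p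
  proof -
    obtain i j where e: "p = (i,j)" by (metis surj_pair)
    have i: "i < n" "j < n" "i \<noteq> j" using p e by (auto simp: prs_def)
    define K where "K = {..<n} - {i,j}"
    have cK: "card K = n - 2" unfolding K_def using i by (subst card_Diff_subset) auto
    have "\<gamma> * hl n (\<lambda>Z. \<phi> Z * EE n p \<phi> Z) = (\<Sum>k\<in>K. 0.02 * hl n (\<lambda>Z. \<phi> Z * EE n p \<phi> Z))"
      by (simp add: \<gamma>_def cK)
    also have "\<dots> \<le> (\<Sum>k\<in>K. hl n (\<lambda>Z. EE n p \<phi> Z * EE n (k,i) \<phi> Z))"
      unfolding e by (intro sum_mono shared[OF S \<phi>]) (use i in \<open>auto simp: K_def\<close>)
    also have "\<dots> = (\<Sum>q\<in>(\<lambda>k. (k,i)) ` K. hl n (\<lambda>Z. EE n p \<phi> Z * EE n q \<phi> Z))"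
      by (subst sum.reindex) (auto simp: inj_on_def)
    also have "\<dots> \<le> (\<Sum>q\<in>prs n. hl n (\<lambda>Z. EE n p \<phi> Z * EE n q \<phi> Z))"
    proof (rule sum_mono2[OF finite_prs])
      show "(\<lambda>k. (k,i)) ` K \<subseteq> prs n" using i by (auto simp: K_def prs_def)
      show "0 \<le> hl n (\<lambda>Z. EE n p \<phi> Z * EE n q \<phi> Z)" if "q \<in> prs n - (\<lambda>k. (k,i)) ` K" for q
        using that by (intro EE_EE_nonneg[OF S \<phi> p]) simp
    qed
    finally show ?thesis .
  qed
  then have "(\<Sum>p\<in>prs n. \<gamma> * hl n (\<lambda>Z. \<phi> Z * EE n p \<phi> Z)) \<le> (\<Sum>p\<in>prs n. \<Sum>q\<in>prs n. hl n (\<lambda>Z. EE n p \<phi> Z * EE n q \<phi> Z))"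
    by (rule sum_mono)
  also have "\<dots> = (\<Sum>p\<in>prs n. hl n (\<lambda>Z. \<Sum>q\<in>prs n. EE n p \<phi> Z * EE n q \<phi> Z))"
    using \<phi> by (intro sum.cong refl sum[symmetric]) auto
  also have "\<dots> = hl n (\<lambda>Z. \<Sum>p\<in>prs n. \<Sum>q\<in>prs n. EE n p \<phi> Z * EE n q \<phi> Z)"
    using \<phi> by (intro sum[symmetric] Lip_sum Lip_mult) auto
  also have "\<dots> = hl n (\<lambda>Z. (DD n \<phi> Z)\<^sup>2)" by (simp add: DD_def power2_eq_square sum_product)
  also have "(\<Sum>p\<in>prs n. \<gamma> * hl n (\<lambda>Z. \<phi> Z * EE n p \<phi> Z)) = \<gamma> * hl n (\<lambda>Z. \<phi> Z * DD n \<phi> Z)"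
  proof -
    have "hl n (\<lambda>Z. \<phi> Z * DD n \<phi> Z) = hl n (\<lambda>Z. \<Sum>p\<in>prs n. \<phi> Z * EE n p \<phi> Z)" by (simp add: DD_def sum_distrib_left)
    also have "\<dots> = (\<Sum>p\<in>prs n. hl n (\<lambda>Z. \<phi> Z * EE n p \<phi> Z))" using \<phi> by (intro sum) auto
    finally show ?thesis by (simp add: sum_distrib_left)
  qed
  finally show ?thesis .
qed

lemma TT_DD: "\<phi> \<in> Lip n \<Longrightarrow> \<phi> Z - TT n \<phi> Z = DD n \<phi> Z / real (card (prs n))"
  using n3 by (simp add: TT_def DD_def EE_def sum_subtractf card_prs field_simps)

text \<open>\<open>\<phi> - T\<^sup>k \<phi>\<close> lies in the range of \<open>DD\<close>, where the gap inequality for \<open>DD\<close> can be inverted.\<close>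

lemma poincare_range:
  assumes S: "SYM n \<phi>" and \<phi>: "\<phi> \<in> Lip n" and h: "h = (\<lambda>Z. \<phi> Z - (TT n ^^ k) \<phi> Z)"
  shows "\<gamma> * hl n (\<lambda>Z. (h Z)\<^sup>2) \<le> hl n (\<lambda>Z. h Z * DD n h Z)"
proof -
  have n2: "2 \<le> n" using n3 by simp
  have TL: "(TT n ^^ l) \<phi> \<in> Lip n" for l by (rule Tk_Lip[OF n2 \<phi>])
  have TS: "SYM n ((TT n ^^ l) \<phi>)" for l by (induction l) (auto intro: S SYM_TT TL)
  define C where "C = real (card (prs n))"
  have C: "C > 0" unfolding C_def using card_pos[OF n2] by simp
  \<comment> \<open>A partial Neumann series: since \<open>1 - TT\<close> is \<open>DD\<close>
    divided by \<open>C\<close>, applying \<open>DD\<close> to \<open>r\<close> telescopes to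
    \<open>h\<close>.\<close>
  define r where "r Z = (1 / C) * (\<Sum>l<k. (TT n ^^ l) \<phi> Z)" for Z
  have rL: "r \<in> Lip n" unfolding r_def[abs_def] by (intro Lip_cmult Lip_sum TL)
  have rS: "SYM n r" using TS by (auto simp: SYM_def r_def)
  have hL: "h \<in> Lip n" unfolding h by (intro Lip_diff \<phi> TL)
  have DDr: "DD n r Z = h Z" if Z: "Z \<in> orth n" for Z
  proof -
    have "DD n (\<lambda>X. \<Sum>l<k. (TT n ^^ l) \<phi> X) Z = (\<Sum>l<k. DD n ((TT n ^^ l) \<phi>) Z)"
    proof (induction k)
      case 0
      have "DD n (\<lambda>X. 0 * 0) Z = 0 * DD n (\<lambda>_. 0) Z" by (rule DD_cmult[OF Lip_const Z])
      then show ?case by simp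
    next
      case (Suc k)
      have "DD n (\<lambda>X. \<Sum>l<Suc k. (TT n ^^ l) \<phi> X) Z = DD n (\<lambda>X. (\<Sum>l<k. (TT n ^^ l) \<phi> X) - (-1) * (TT n ^^ k) \<phi> X) Z" by simp
      also have "\<dots> = DD n (\<lambda>X. \<Sum>l<k. (TT n ^^ l) \<phi> X) Z - DD n (\<lambda>X. (-1) * (TT n ^^ k) \<phi> X) Z"
        by (intro DD_diff Lip_sum Lip_cmult TL Z)
      also have "DD n (\<lambda>X. (-1) * (TT n ^^ k) \<phi> X) Z = (-1) * DD n ((TT n ^^ k) \<phi>) Z" by (rule DD_cmult[OF TL Z])
      finally show ?case using Suc by simp
    qed
    then have "DD n r Z = (1 / C) * (\<Sum>l<k. DD n ((TT n ^^ l) \<phi>) Z)"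
      unfolding r_def[abs_def] using DD_cmult[OF Lip_sum Z] TL by metis
    also have "\<dots> = (\<Sum>l<k. (TT n ^^ l) \<phi> Z - (TT n ^^ Suc l) \<phi> Z)"
      using TT_DD[OF TL] C by (simp add: sum_distrib_left C_def)
    also have "\<dots> = h Z" unfolding h by (subst sum_lessThan_telescope') simp
    finally show ?thesis .
  qed
  define N2 Fh Fr where "N2 = hl n (\<lambda>Z. (h Z)\<^sup>2)" and "Fh = hl n (\<lambda>Z. h Z * DD n h Z)" and "Fr = hl n (\<lambda>Z. r Z * DD n r Z)"
  have hr: "hl n (\<lambda>Z. h Z * DD n r Z) = N2" unfolding N2_def
    by (rule eqI) (use hL rL DDr in \<open>auto simp: power2_eq_square\<close>)
  have rh: "hl n (\<lambda>Z. r Z * DD n h Z) = N2" using DD_sym[OF rL hL] hr by simp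
  have "\<gamma> * Fr \<le> hl n (\<lambda>Z. (DD n r Z)\<^sup>2)" unfolding Fr_def by (rule DD_gap[OF rS rL])
  also have "\<dots> = N2" unfolding N2_def by (rule eqI) (use rL DDr in auto)
  finally have g: "\<gamma> * Fr \<le> N2" .
  \<comment> \<open>Expanding the nonnegative energy of \<open>w\<close> with
    \<open>DD n r = h\<close> gives \<open>Fh \<ge> 2 \<gamma> N2 - \<gamma>^2 Fr\<close>, and
    \<open>\<gamma> Fr \<le> N2\<close> is the gap inequality for \<open>r\<close>. No spectral
    decomposition or square root of \<open>DD\<close> is involved.\<close>
  define w where "w Z = h Z - \<gamma> * r Z" for Z
  have wL: "w \<in> Lip n" unfolding w_def using hL rL by auto
  have DL: "DD n h \<in> Lip n" "DD n r \<in> Lip n" using hL rL by auto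
  have "0 \<le> hl n (\<lambda>Z. w Z * DD n w Z)" by (rule DD_nonneg[OF wL])
  also have "\<dots> = hl n (\<lambda>Z. (h Z * DD n h Z - \<gamma> * (h Z * DD n r Z)) - (\<gamma> * (r Z * DD n h Z) - \<gamma>\<^sup>2 * (r Z * DD n r Z)))"
  proof (rule eqI)
    show "(\<lambda>Z. w Z * DD n w Z) \<in> Lip n" using wL by auto
    fix Z assume Z: "Z \<in> orth n"
    have Dw: "DD n w Z = DD n h Z - \<gamma> * DD n r Z" unfolding w_def[abs_def]
      using hL rL Z by (simp add: DD_diff DD_cmult)
    then show "w Z * DD n w Z = (h Z * DD n h Z - \<gamma> * (h Z * DD n r Z)) - (\<gamma> * (r Z * DD n h Z) - \<gamma>\<^sup>2 * (r Z * DD n r Z))"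
      unfolding Dw unfolding w_def by (simp add: power2_eq_square algebra_simps)
  qed
  also have "\<dots> = (Fh - \<gamma> * N2) - (\<gamma> * N2 - \<gamma>\<^sup>2 * Fr)"
    using hL rL DL by (simp add: diff cmult hr rh Fh_def Fr_def)
  also have "\<gamma>\<^sup>2 * Fr \<le> \<gamma> * N2" using mult_left_mono[OF g, of \<gamma>] \<gamma>_pos by (simp add: power2_eq_square mult.assoc)
  finally show ?thesis unfolding N2_def Fh_def by simp
qed

text \<open>The iterates of the walk converge uniformly to the mean, so
  \<open>\<phi> - hl n \<phi>\<close> is uniformly close to functions covered by
  \<open>poincare_range\<close>; \<open>DD\<close> is bounded in the supremum norm, and both sides
  pass to the limit.\<close>

theorem poincare:
  assumes S: "SYM n \<phi>" and \<phi>: "\<phi> \<in> Lip n"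
  shows "\<gamma> * hl n (\<lambda>Z. (\<phi> Z - hl n \<phi>)\<^sup>2) \<le> hl n (\<lambda>Z. \<phi> Z * DD n \<phi> Z)"
proof -
  have n2: "2 \<le> n" using n3 by simp
  obtain M where M: "M > 0" "\<And>X. X \<in> orth n \<Longrightarrow> \<bar>\<phi> X\<bar> \<le> M" using Lip_bounded[OF \<phi>] by auto
  define C where "C = real (card (prs n))"
  have C: "C > 0" unfolding C_def using card_pos[OF n2] by simp
  define c0 where "c0 = hl n \<phi>"
  have c0: "\<bar>c0\<bar> \<le> M" unfolding c0_def by (rule abs_le[OF \<phi> M(2)])
  define \<phi>' where "\<phi>' Z = \<phi> Z - c0" for Z
  have \<phi>'L: "\<phi>' \<in> Lip n" unfolding \<phi>'_def using \<phi> by auto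
  have \<phi>'M: "\<bar>\<phi>' Z\<bar> \<le> 2 * M" if "Z \<in> orth n" for Z using M(2)[OF that] c0 by (simp add: \<phi>'_def)
  have DDc: "DD n (\<lambda>_. c) Z = 0" for c Z
    unfolding DD_def EE_def P2_def by (simp add: emb_avg.avg_const[OF P2_avg])
  have DD': "DD n \<phi>' Z = DD n \<phi> Z" if "Z \<in> orth n" for Z
    unfolding \<phi>'_def using \<phi> that by (simp add: DD_diff DDc)
  have F': "hl n (\<lambda>Z. \<phi>' Z * DD n \<phi>' Z) = hl n (\<lambda>Z. \<phi> Z * DD n \<phi> Z)"
  proof -
    have "hl n (\<lambda>Z. \<phi>' Z * DD n \<phi>' Z) = hl n (\<lambda>Z. \<phi> Z * DD n \<phi> Z - c0 * DD n \<phi> Z)"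
    proof (rule eqI)
      show "(\<lambda>Z. \<phi>' Z * DD n \<phi>' Z) \<in> Lip n" by (intro Lip_mult DD_Lip \<phi>'L)
      show "\<phi>' Z * DD n \<phi>' Z = \<phi> Z * DD n \<phi> Z - c0 * DD n \<phi> Z" if "Z \<in> orth n" for Z
        unfolding DD'[OF that] by (simp add: \<phi>'_def algebra_simps)
    qed
    also have "\<dots> = hl n (\<lambda>Z. \<phi> Z * DD n \<phi> Z) - hl n (\<lambda>Z. c0 * DD n \<phi> Z)" using \<phi> by (intro diff) auto
    also have "hl n (\<lambda>Z. c0 * DD n \<phi> Z) = hl n (\<lambda>Z. \<phi> Z * DD n (\<lambda>_. c0) Z)" using DD_sym[OF Lip_const \<phi>] .
    also have "\<dots> = 0" by (simp add: DDc const)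
    finally show ?thesis by simp
  qed
  have "\<gamma> * hl n (\<lambda>Z. (\<phi>' Z)\<^sup>2) \<le> hl n (\<lambda>Z. \<phi> Z * DD n \<phi> Z) + e" if e: "e > 0" for e
  proof -
    define K where "K = \<gamma> * (4 * M + 1) + 2 * C * (4 * M + 1)"
    have K: "K > 0" unfolding K_def using \<gamma>_pos M(1) C by (intro add_pos_pos mult_pos_pos) auto
    define d where "d = min 1 (e / K)"
    have d: "d > 0" "d \<le> 1" "K * d \<le> e" using e K by (auto simp: d_def min_def field_simps)
    obtain k where k: "\<And>Z. Z \<in> orth n \<Longrightarrow> \<bar>(TT n ^^ k) \<phi> Z - c0\<bar> \<le> d"
      using Tk_uniform[OF n2 \<phi> d(1)] unfolding c0_def by blast
    have TL: "(TT n ^^ k) \<phi> \<in> Lip n" by (rule Tk_Lip[OF n2 \<phi>])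
    define g where "g Z = (TT n ^^ k) \<phi> Z - c0" for Z
    define h where "h Z = \<phi> Z - (TT n ^^ k) \<phi> Z" for Z
    have gL: "g \<in> Lip n" and hL: "h \<in> Lip n" unfolding g_def h_def using \<phi> TL by auto
    have hg: "h Z = \<phi>' Z - g Z" for Z by (simp add: h_def g_def \<phi>'_def)
    have gd: "\<bar>g Z\<bar> \<le> d" if "Z \<in> orth n" for Z using k[OF that] by (simp add: g_def)
    have hM: "\<bar>h Z\<bar> \<le> 2 * M + 1" if "Z \<in> orth n" for Z using gd[OF that] \<phi>'M[OF that] d hg[of Z] by linarith
    have P: "\<gamma> * hl n (\<lambda>Z. (h Z)\<^sup>2) \<le> hl n (\<lambda>Z. h Z * DD n h Z)"
      by (rule poincare_range[OF S \<phi>, of h k]) (simp add: h_def[abs_def])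
    have a: "\<bar>hl n (\<lambda>Z. (\<phi>' Z)\<^sup>2) - hl n (\<lambda>Z. (h Z)\<^sup>2)\<bar> \<le> d * (4 * M + 1)"
    proof (rule abs_diff_le)
      fix Z assume Z: "Z \<in> orth n"
      have "(\<phi>' Z)\<^sup>2 - (h Z)\<^sup>2 = g Z * (\<phi>' Z + h Z)" by (simp add: hg power2_eq_square algebra_simps)
      also have "\<bar>\<dots>\<bar> \<le> d * (4 * M + 1)" unfolding abs_mult
        using gd[OF Z] \<phi>'M[OF Z] hM[OF Z] d by (intro mult_mono) auto
      finally show "\<bar>(\<phi>' Z)\<^sup>2 - (h Z)\<^sup>2\<bar> \<le> d * (4 * M + 1)" .
    qed (use \<phi>'L hL in auto)
    have b: "\<bar>hl n (\<lambda>Z. h Z * DD n h Z) - hl n (\<lambda>Z. \<phi>' Z * DD n \<phi>' Z)\<bar> \<le> d * (2 * C * (4 * M + 1))"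
    proof (rule abs_diff_le)
      fix Z assume Z: "Z \<in> orth n"
      have D: "DD n h Z = DD n \<phi>' Z - DD n g Z" unfolding hg[abs_def] by (rule DD_diff[OF \<phi>'L gL Z])
      have "h Z * DD n h Z - \<phi>' Z * DD n \<phi>' Z = - (g Z * DD n h Z) - \<phi>' Z * DD n g Z"
        unfolding D hg by (simp add: algebra_simps)
      also have "\<bar>\<dots>\<bar> \<le> \<bar>g Z\<bar> * \<bar>DD n h Z\<bar> + \<bar>\<phi>' Z\<bar> * \<bar>DD n g Z\<bar>"
        unfolding abs_mult[symmetric] by linarith
      also have "\<dots> \<le> d * (C * (2 * (2 * M + 1))) + 2 * M * (C * (2 * d))"
        using gd[OF Z] \<phi>'M[OF Z] DD_abs_le[OF hL hM Z] DD_abs_le[OF gL gd Z] d M(1)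
        by (intro add_mono mult_mono) (auto simp: C_def)
      also have "\<dots> = d * (2 * C * (4 * M + 1))" by (simp add: algebra_simps)
      finally show "\<bar>h Z * DD n h Z - \<phi>' Z * DD n \<phi>' Z\<bar> \<le> d * (2 * C * (4 * M + 1))" .
    qed (use \<phi>'L hL in auto)
    have "\<gamma> * hl n (\<lambda>Z. (\<phi>' Z)\<^sup>2) \<le> \<gamma> * (hl n (\<lambda>Z. (h Z)\<^sup>2) + d * (4 * M + 1))"
      using a \<gamma>_pos by (intro mult_left_mono) (auto simp: abs_le_iff)
    also have "\<dots> \<le> hl n (\<lambda>Z. \<phi> Z * DD n \<phi> Z) + d * (2 * C * (4 * M + 1)) + \<gamma> * (d * (4 * M + 1))"
      using P b F' by (simp add: distrib_left abs_le_iff)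
    also have "\<dots> = hl n (\<lambda>Z. \<phi> Z * DD n \<phi> Z) + K * d" by (simp add: K_def algebra_simps)
    finally show ?thesis using d(3) by linarith
  qed
  then have "\<gamma> * hl n (\<lambda>Z. (\<phi>' Z)\<^sup>2) \<le> hl n (\<lambda>Z. \<phi> Z * DD n \<phi> Z)" by (rule field_le_epsilon)
  then show ?thesis by (simp add: \<phi>'_def c0_def)
qed

end

subsection \<open>Hypercontractivity on the cube\<close>

text \<open>A sign vector is encoded by the set of its negative coordinates.\<close>

definition sg :: "nat set \<Rightarrow> nat \<Rightarrow> real" where "sg X i = (if i \<in> X then -1 else 1)"

definition chi :: "nat set \<Rightarrow> nat set \<Rightarrow> real" where "chi S X = (\<Prod>i\<in>S. sg X i)"

lemma sg_sq [simp]: "sg X i * sg X i = 1" "(sg X i)\<^sup>2 = 1" "\<bar>sg X i\<bar> = 1"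
  by (auto simp: sg_def)

text \<open>Compare ratios of successive terms. With \<open>x = m - k\<close> the left side grows by
  \<open>(2x - 1)/(2k + 1)\<close> times \<open>x/(k + 1)\<close>, the right side by
  \<open>2m - 1\<close> times the same second factor.\<close>

lemma choose_even_le:
  assumes m: "1 \<le> m"
  shows "k \<le> m \<Longrightarrow> real (2*m choose (2*k)) \<le> real (m choose k) * (2 * real m - 1) ^ k"
proof (induction k)
  case (Suc k)
  define a b where "a = real (2*m choose (2*k))" and "b = real (m choose k)"
  have km: "k < m" using Suc by simp
  have e1: "real (Suc k) * real (m choose Suc k) = real (m - k) * b"
    using binomial_absorption[of k m] km unfolding b_def
    by (metis binomial_absorb_comp of_nat_mult binomial_absorption)
  have e2: "real (Suc (2*k)) * real (2*m choose Suc (2*k)) = real (2*m - 2*k) * a"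
    unfolding a_def by (metis binomial_absorb_comp of_nat_mult binomial_absorption)
  have e3: "real (Suc (Suc (2*k))) * real (2*m choose Suc (Suc (2*k))) = real (2*m - Suc (2*k)) * real (2*m choose Suc (2*k))"
    by (metis binomial_absorb_comp of_nat_mult binomial_absorption)
  define x where "x = real m - real k"
  have x: "real (m - k) = x" "real (2*m - 2*k) = 2 * x" "real (2*m - Suc (2*k)) = 2 * x - 1" "x \<ge> 1"
    using km by (auto simp: x_def of_nat_diff)
  have a': "a \<le> b * (2 * real m - 1) ^ k" using Suc by (simp add: a_def b_def)
  have R0: "2 * real m - 1 \<ge> 1" using m by simp
  have A: "real (2*m choose Suc (Suc (2*k))) = (2*x - 1) / (2*k + 1) * (x / (k + 1) * a)"
  proof -
    have c1: "real (2*m choose Suc (2*k)) = 2 * x * a / (2 * real k + 1)"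
      using e2 x(2) by (simp add: eq_divide_eq mult.commute add.commute)
    have c2: "real (2*m choose Suc (Suc (2*k))) = (2*x - 1) * real (2*m choose Suc (2*k)) / (2 * real k + 2)"
      using e3 x(3) by (simp add: eq_divide_eq mult.commute add.commute)
    have *: "(2*x - 1) * (2 * x * a / p) / (2 * q) = (2*x - 1) / p * (x / q * a)" if "p > 0" "q > 0" for p q :: real
      using that by (simp add: field_simps)
    show ?thesis unfolding c2 c1 using *[of "2 * real k + 1" "real k + 1"] by (simp add: algebra_simps)
  qed
  have B: "real (m choose Suc k) = x / (k + 1) * b" using e1 x by (simp add: field_simps)
  have "(2*x - 1) / (2*k + 1) \<le> 2 * real m - 1"
  proof -
    have "2 * x - 1 \<le> 2 * real m - 1" by (simp add: x_def)
    also have "\<dots> \<le> (2 * real m - 1) * (2 * real k + 1)"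
      using mult_left_mono[of 1 "2 * real k + 1" "2 * real m - 1"] R0 by simp
    finally show ?thesis by (simp add: divide_le_eq add.commute)
  qed
  then have "real (2*m choose Suc (Suc (2*k))) \<le> (2 * real m - 1) * (x / (k + 1) * (b * (2 * real m - 1) ^ k))"
    unfolding A using x(4) a' R0 by (intro mult_mono) (auto simp: a_def)
  then show ?case using B by (simp add: mult_ac)
qed simp

text \<open>The two-point hypercontractive inequality for an even exponent \<open>p = 2m\<close>,
  where \<open>2m - 1\<close> is the classical factor \<open>p - 1\<close>. The odd powers of
  \<open>b\<close> cancel and the even ones are compared coefficient by coefficient.\<close>

lemma two_point:
  fixes a b :: real
  assumes m: "1 \<le> m"
  shows "(a + b) ^ (2*m) + (a - b) ^ (2*m) \<le> 2 * (a\<^sup>2 + (2 * real m - 1) * b\<^sup>2) ^ m"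
proof -
  have "(a + b) ^ (2*m) + (a - b) ^ (2*m) = (b + a) ^ (2*m) + (- b + a) ^ (2*m)" by (simp add: add.commute)
  also have "\<dots> = (\<Sum>k\<le>2*m. real (2*m choose k) * b ^ k * a ^ (2*m-k) + real (2*m choose k) * (- b) ^ k * a ^ (2*m-k))"
    by (simp only: binomial_ring sum.distrib)
  also have "\<dots> = (\<Sum>k\<in>(\<lambda>j. 2*j) ` {..m}. 2 * (real (2*m choose k) * b ^ k * a ^ (2*m-k)))"
  proof (rule sum.mono_neutral_cong_right)
    show "\<forall>i\<in>{..2*m} - (\<lambda>j. 2*j) ` {..m}. real (2*m choose i) * b ^ i * a ^ (2*m-i) + real (2*m choose i) * (- b) ^ i * a ^ (2*m-i) = 0"
    proof
      fix i assume "i \<in> {..2*m} - (\<lambda>j. 2*j) ` {..m}"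
      then have "odd i" by (auto elim!: evenE)
      then show "real (2*m choose i) * b ^ i * a ^ (2*m-i) + real (2*m choose i) * (- b) ^ i * a ^ (2*m-i) = 0"
        by (simp add: power_minus_odd)
    qed
  qed auto
  also have "\<dots> = (\<Sum>j\<le>m. 2 * (real (2*m choose (2*j)) * b ^ (2*j) * a ^ (2*m-2*j)))"
    by (subst sum.reindex) (auto simp: inj_on_def)
  also have "\<dots> \<le> (\<Sum>j\<le>m. 2 * (real (m choose j) * (2 * real m - 1) ^ j * b ^ (2*j) * a ^ (2*m-2*j)))"
  proof (rule sum_mono)
    fix j assume "j \<in> {..m}"
    then have j: "j \<le> m" by simp
    have "2*m - 2*j = 2*(m - j)" by simp
    then have "0 \<le> b ^ (2*j) * a ^ (2*m-2*j)" by (simp add: zero_le_even_power)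
    from mult_right_mono[OF choose_even_le[OF m j] this]
    show "2 * (real (2*m choose (2*j)) * b ^ (2*j) * a ^ (2*m-2*j)) \<le> 2 * (real (m choose j) * (2 * real m - 1) ^ j * b ^ (2*j) * a ^ (2*m-2*j))"
      by (simp add: mult.assoc)
  qed
  also have "\<dots> = (\<Sum>j\<le>m. 2 * (real (m choose j) * ((2 * real m - 1) * b\<^sup>2) ^ j * (a\<^sup>2) ^ (m-j)))"
  proof (intro sum.cong refl)
    fix j
    have "2*m - 2*j = 2*(m - j)" by simp
    then have "a ^ (2*m-2*j) = (a\<^sup>2) ^ (m-j)" "b ^ (2*j) = (b\<^sup>2) ^ j" by (simp_all only: power_mult)
    then show "2 * (real (m choose j) * (2 * real m - 1) ^ j * b ^ (2*j) * a ^ (2*m-2*j)) =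
      2 * (real (m choose j) * ((2 * real m - 1) * b\<^sup>2) ^ j * (a\<^sup>2) ^ (m-j))"
      by (simp only: power_mult_distrib mult.assoc)
  qed
  also have "\<dots> = 2 * ((2 * real m - 1) * b\<^sup>2 + a\<^sup>2) ^ m" by (simp only: binomial_ring sum_distrib_left)
  finally show ?thesis by (simp add: add.commute)
qed

lemma convex_pow: "convex_on {0::real..} (\<lambda>x. x ^ m)"
proof (cases "even m")
  case True
  then show ?thesis using convex_on_subset[OF convex_power_even[OF True], of "{0..}"] by simp
qed (rule convex_power_odd)

lemma pow_mix:
  fixes x y p :: real
  assumes "0 \<le> x" "0 \<le> y" "0 \<le> p" "0 \<le> q" "p + q = 1"
  shows "(p * x + q * y) ^ m \<le> p * x ^ m + q * y ^ m"
proof -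
  have p: "p = 1 - q" using assms by simp
  show ?thesis unfolding p using convex_onD[OF convex_pow, of q x y m] assms by simp
qed

lemma sum_Pow_insert:
  assumes "finite A" "a \<notin> A"
  shows "(\<Sum>X\<in>Pow (insert a A). F X) = (\<Sum>X\<in>Pow A. F X) + (\<Sum>X\<in>Pow A. F (insert a X) :: real)"
proof -
  have "inj_on (insert a) (Pow A)" using assms(2) by (auto simp: inj_on_def)
  then have "(\<Sum>X\<in>insert a ` Pow A. F X) = (\<Sum>X\<in>Pow A. F (insert a X))" by (simp add: sum.reindex)
  moreover have "Pow A \<inter> insert a ` Pow A = {}" using assms(2) by auto
  ultimately show ?thesis using assms by (simp add: Pow_insert sum.union_disjoint)
qed

text \<open>Bonami's inequality for the exponent \<open>2m\<close>, by induction on the coordinates: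
  splitting off coordinate \<open>a\<close> turns the function into \<open>u + v\<close> and
  \<open>u - v\<close>. In place of Minkowski's inequality, \<open>u^2 + \<rho> v^2\<close> is
  written as \<open>K\<close> times a convex combination of \<open>u^2/U'\<close> and
  \<open>v^2/V'\<close>, so that convexity of the power finishes the step. The strict bound by
  \<open>K\<close> guarantees positive denominators.\<close>

lemma bonami:
  assumes A: "finite A" and m: "1 \<le> m" and K: "(\<Sum>S\<in>Pow A. (2 * real m - 1) ^ card S * (c S)\<^sup>2) < K"
  shows "(\<Sum>X\<in>Pow A. (\<Sum>S\<in>Pow A. c S * chi S X) ^ (2*m)) \<le> 2 ^ card A * K ^ m"
  using A K
proof (induction A arbitrary: c K rule: finite_induct)
  case empty
  then have "(c {})\<^sup>2 < K" by simp
  then have "((c {})\<^sup>2) ^ m \<le> K ^ m" by (intro power_mono) auto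
  then show ?case by (simp add: chi_def power_mult)
next
  case (insert a A)
  define \<rho> where "\<rho> = 2 * real m - 1"
  have \<rho>: "\<rho> \<ge> 1" using m by (simp add: \<rho>_def)
  define c' where "c' S = c (Set.insert a S)" for S
  define u v where "u X = (\<Sum>S\<in>Pow A. c S * chi S X)" and "v X = (\<Sum>S\<in>Pow A. c' S * chi S X)" for X
  define U V where "U = (\<Sum>S\<in>Pow A. \<rho> ^ card S * (c S)\<^sup>2)" and "V = (\<Sum>S\<in>Pow A. \<rho> ^ card S * (c' S)\<^sup>2)"
  have UV0: "0 \<le> U" "0 \<le> V" unfolding U_def V_def using \<rho> by (auto intro!: sum_nonneg)
  have fS: "finite S" "a \<notin> S" if "S \<in> Pow A" for S using that insert by (auto intro: finite_subset)
  have chi1: "chi S (Set.insert a X) = chi S X" if "S \<in> Pow A" for S X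
    unfolding chi_def using fS[OF that] by (intro prod.cong) (auto simp: sg_def)
  have chi2: "chi (Set.insert a S) X = chi S X" if "S \<in> Pow A" "X \<in> Pow A" for S X
    unfolding chi_def using fS[OF that(1)] fS[OF that(2)] by (simp add: sg_def)
  have chi3: "chi (Set.insert a S) (Set.insert a X) = - chi S X" if "S \<in> Pow A" for S X
    using fS[OF that] chi1[OF that, of X] unfolding chi_def by (simp add: sg_def[of _ a])
  have "(\<Sum>S\<in>Pow (Set.insert a A). \<rho> ^ card S * (c S)\<^sup>2) = U + \<rho> * V"
    using fS unfolding sum_Pow_insert[OF insert(1,2)] U_def V_def c'_def by (simp add: sum_distrib_left mult.assoc)
  then have lt: "U + \<rho> * V < K" using insert(4) by (simp add: \<rho>_def)
  \<comment> \<open>The slack is divided so that \<open>U' + \<rho> * V'\<close> is exactly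
    \<open>K\<close>, which makes the weights of the convex combination add up to one.\<close>
  define \<delta> where "\<delta> = (K - U - \<rho> * V) / (1 + \<rho>)"
  have \<delta>: "\<delta> > 0" unfolding \<delta>_def using lt \<rho> by (intro divide_pos_pos) auto
  define U' V' where "U' = U + \<delta>" and "V' = V + \<delta>"
  have UV': "U < U'" "V < V'" "0 < U'" "0 < V'" using UV0 \<delta> by (auto simp: U'_def V'_def)
  have "U' + \<rho> * V' = (U + \<rho> * V) + (1 + \<rho>) * \<delta>" by (simp add: U'_def V'_def algebra_simps)
  also have "(1 + \<rho>) * \<delta> = K - U - \<rho> * V" unfolding \<delta>_def using \<rho> by simp
  finally have KUV: "U' + \<rho> * V' = K" by simp
  have K0: "K > 0" unfolding KUV[symmetric] using UV' \<rho> by (simp add: add_pos_pos)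
  have IHu: "(\<Sum>X\<in>Pow A. u X ^ (2*m)) \<le> 2 ^ card A * U' ^ m"
    using insert.IH[of c U'] UV' by (simp add: u_def U_def \<rho>_def)
  have IHv: "(\<Sum>X\<in>Pow A. v X ^ (2*m)) \<le> 2 ^ card A * V' ^ m"
    using insert.IH[of c' V'] UV' by (simp add: v_def V_def \<rho>_def)
  have val1: "(\<Sum>S\<in>Pow (Set.insert a A). c S * chi S X) = u X + v X" if "X \<in> Pow A" for X
    using that unfolding sum_Pow_insert[OF insert(1,2)] u_def v_def c'_def by (simp add: chi2)
  have val2: "(\<Sum>S\<in>Pow (Set.insert a A). c S * chi S (Set.insert a X)) = u X - v X" if "X \<in> Pow A" for X
    unfolding sum_Pow_insert[OF insert(1,2)] u_def v_def c'_def by (simp add: chi1 chi3 sum_negf)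
  have step: "(u X + v X) ^ (2*m) + (u X - v X) ^ (2*m) \<le>
     2 * (K ^ m * ((U' / K) * (u X ^ (2*m) / U' ^ m) + (\<rho> * V' / K) * (v X ^ (2*m) / V' ^ m)))" for X
  proof -
    have "(u X)\<^sup>2 + \<rho> * (v X)\<^sup>2 = K * ((U' / K) * ((u X)\<^sup>2 / U') + (\<rho> * V' / K) * ((v X)\<^sup>2 / V'))"
      using K0 UV' by (simp add: field_simps)
    then have "((u X)\<^sup>2 + \<rho> * (v X)\<^sup>2) ^ m = K ^ m * ((U' / K) * ((u X)\<^sup>2 / U') + (\<rho> * V' / K) * ((v X)\<^sup>2 / V')) ^ m"
      by (simp only: power_mult_distrib)
    also have "\<dots> \<le> K ^ m * ((U' / K) * ((u X)\<^sup>2 / U') ^ m + (\<rho> * V' / K) * ((v X)\<^sup>2 / V') ^ m)"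
    proof (intro mult_left_mono pow_mix)
      show "U' / K + \<rho> * V' / K = 1" using KUV K0 by (simp add: add_divide_distrib[symmetric])
    qed (use K0 UV' \<rho> in auto)
    finally show ?thesis using two_point[OF m, of "u X" "v X"] by (simp add: \<rho>_def power_divide power_mult)
  qed
  have "(\<Sum>X\<in>Pow (Set.insert a A). (\<Sum>S\<in>Pow (Set.insert a A). c S * chi S X) ^ (2*m)) =
      (\<Sum>X\<in>Pow A. (u X + v X) ^ (2*m) + (u X - v X) ^ (2*m))"
    unfolding sum_Pow_insert[OF insert(1,2), of "\<lambda>X. (\<Sum>S\<in>Pow (Set.insert a A). c S * chi S X) ^ (2*m)"]
    by (simp add: val1 val2 sum.distrib)
  also have "\<dots> \<le> (\<Sum>X\<in>Pow A. 2 * (K ^ m * ((U' / K) * (u X ^ (2*m) / U' ^ m) + (\<rho> * V' / K) * (v X ^ (2*m) / V' ^ m))))"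
    by (rule sum_mono[OF step])
  also have "\<dots> = 2 * (K ^ m * ((U' / K) * ((\<Sum>X\<in>Pow A. u X ^ (2*m)) / U' ^ m) + (\<rho> * V' / K) * ((\<Sum>X\<in>Pow A. v X ^ (2*m)) / V' ^ m)))"
    by (simp add: sum_distrib_left[symmetric] sum.distrib sum_divide_distrib[symmetric])
  also have "\<dots> \<le> 2 * (K ^ m * ((U' / K) * 2 ^ card A + (\<rho> * V' / K) * 2 ^ card A))"
  proof (intro mult_left_mono add_mono)
    show "(\<Sum>X\<in>Pow A. u X ^ (2*m)) / U' ^ m \<le> 2 ^ card A" using IHu UV' by (simp add: divide_le_eq)
    show "(\<Sum>X\<in>Pow A. v X ^ (2*m)) / V' ^ m \<le> 2 ^ card A" using IHv UV' by (simp add: divide_le_eq)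
  qed (use K0 UV' \<rho> in auto)
  also have "\<dots> = 2 * (K ^ m * (2 ^ card A * ((U' + \<rho> * V') / K)))" by (simp add: add_divide_distrib algebra_simps)
  also have "\<dots> = 2 ^ card (Set.insert a A) * K ^ m" using insert(1,2) K0 by (simp add: KUV)
  finally show ?case .
qed

lemma bonami_le:
  assumes A: "finite A" and m: "1 \<le> m"
  shows "(\<Sum>X\<in>Pow A. (\<Sum>S\<in>Pow A. c S * chi S X) ^ (2*m)) \<le>
    2 ^ card A * (\<Sum>S\<in>Pow A. (2 * real m - 1) ^ card S * (c S)\<^sup>2) ^ m" (is "?L \<le> 2 ^ card A * ?k ^ m")
proof (rule LIMSEQ_le_const)
  show "(\<lambda>j. 2 ^ card A * (?k + inverse (real (Suc j))) ^ m) \<longlonglongrightarrow> 2 ^ card A * ?k ^ m"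
  proof -
    have "(\<lambda>j. ?k + inverse (real (Suc j))) \<longlonglongrightarrow> ?k + 0"
      by (intro tendsto_add tendsto_const LIMSEQ_inverse_real_of_nat)
    then show ?thesis by (intro tendsto_mult_left tendsto_power) simp
  qed
  have "?L \<le> 2 ^ card A * (?k + inverse (real (Suc j))) ^ m" for j
    by (rule bonami[OF A m]) simp
  then show "\<exists>N. \<forall>j\<ge>N. ?L \<le> 2 ^ card A * (?k + inverse (real (Suc j))) ^ m" by blast
qed

section \<open>Level-two inequality for functions with values in [0,1]\<close>

lemma weighted_power_mean:
  fixes f g :: "'a \<Rightarrow> real"
  assumes X: "finite X" and f: "\<And>x. x \<in> X \<Longrightarrow> 0 \<le> f x" and p: "even p"
  shows "(\<Sum>x\<in>X. f x * g x) ^ p * (\<Sum>x\<in>X. f x) \<le> (\<Sum>x\<in>X. f x) ^ p * (\<Sum>x\<in>X. f x * g x ^ p)"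
proof (cases "(\<Sum>x\<in>X. f x) = 0")
  case True
  then have "f x = 0" if "x \<in> X" for x using that X f by (simp add: sum_nonneg_eq_0_iff)
  then show ?thesis by simp
next
  case False
  define F where "F = (\<Sum>x\<in>X. f x)"
  have F: "F > 0" unfolding F_def using False sum_nonneg[of X f] f by fastforce
  have ne: "X \<noteq> {}" using False by auto
  have "(\<Sum>x\<in>X. (f x / F) *\<^sub>R g x) ^ p \<le> (\<Sum>x\<in>X. (f x / F) * g x ^ p)"
    by (rule convex_on_sum[OF X ne convex_power_even[OF p]])
       (use f F in \<open>auto simp: sum_divide_distrib[symmetric] F_def[symmetric]\<close>)
  then have "((\<Sum>x\<in>X. f x * g x) / F) ^ p \<le> (\<Sum>x\<in>X. f x * g x ^ p) / F"
    by (simp add: sum_divide_distrib)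
  then show ?thesis using F unfolding F_def[symmetric] by (simp add: power_divide field_simps)
qed

text \<open>Test \<open>f\<close> against its own level-two part \<open>g\<close>: the inner product
  is \<open>w\<close>. Jensen with the weight \<open>f\<close> raises it to the power
  \<open>2m\<close>, then \<open>f \<le> 1\<close> and Bonami bound the \<open>2m\<close>-th moment
  of \<open>g\<close> by \<open>w\<close> again. The conclusion says
  \<open>w \<le> (2m - 1)^2 a^(2 - 1/m)\<close>, kept free of roots.\<close>

lemma level_two:
  fixes f :: "nat set \<Rightarrow> real"
  assumes A: "finite A" and m: "1 \<le> m" and f: "\<And>X. X \<in> Pow A \<Longrightarrow> 0 \<le> f X" "\<And>X. X \<in> Pow A \<Longrightarrow> f X \<le> 1"
  defines "a \<equiv> (\<Sum>X\<in>Pow A. f X) / 2 ^ card A"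
    and "w \<equiv> (\<Sum>S | S \<subseteq> A \<and> card S = 2. ((\<Sum>X\<in>Pow A. f X * chi S X) / 2 ^ card A)\<^sup>2)"
  shows "w ^ m * a \<le> a ^ (2*m) * (2 * real m - 1) ^ (2*m)"
proof -
  define fh where "fh S = (\<Sum>X\<in>Pow A. f X * chi S X) / 2 ^ card A" for S
  define c where "c S = (if card S = 2 then fh S else 0)" for S
  define g where "g X = (\<Sum>S\<in>Pow A. c S * chi S X)" for X
  define n :: real where "n = 2 ^ card A"
  have n: "n > 0" by (simp add: n_def)
  have fin: "finite (Pow A)" using A by simp
  have w: "w = (\<Sum>S\<in>Pow A. (c S)\<^sup>2)"
    unfolding w_def fh_def[symmetric] by (rule sum.mono_neutral_cong_left) (use A in \<open>auto simp: c_def\<close>)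
  have w0: "0 \<le> w" unfolding w by (auto intro: sum_nonneg)
  have a0: "0 \<le> a" unfolding a_def using f by (auto intro!: divide_nonneg_pos sum_nonneg)
  have "(\<Sum>X\<in>Pow A. f X * g X) = (\<Sum>X\<in>Pow A. \<Sum>S\<in>Pow A. c S * (f X * chi S X))"
    unfolding g_def by (simp add: sum_distrib_left mult_ac)
  also have "\<dots> = (\<Sum>S\<in>Pow A. c S * (\<Sum>X\<in>Pow A. f X * chi S X))"
    by (subst sum.swap) (simp add: sum_distrib_left)
  also have "\<dots> = (\<Sum>S\<in>Pow A. n * (c S)\<^sup>2)"
    by (intro sum.cong refl) (auto simp: c_def fh_def n_def power2_eq_square)
  finally have fg: "(\<Sum>X\<in>Pow A. f X * g X) = n * w" by (simp add: w sum_distrib_left)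
  have fa: "(\<Sum>X\<in>Pow A. f X) = n * a" using n by (simp add: a_def n_def)
  have "(\<Sum>X\<in>Pow A. f X * g X ^ (2*m)) \<le> (\<Sum>X\<in>Pow A. g X ^ (2*m))"
    using f by (intro sum_mono mult_left_le_one_le) (auto simp: zero_le_even_power)
  also have "\<dots> \<le> n * (\<Sum>S\<in>Pow A. (2 * real m - 1) ^ card S * (c S)\<^sup>2) ^ m"
    unfolding g_def n_def by (rule bonami_le[OF A m])
  also have "(\<Sum>S\<in>Pow A. (2 * real m - 1) ^ card S * (c S)\<^sup>2) = (2 * real m - 1)\<^sup>2 * w"
    unfolding w sum_distrib_left by (intro sum.cong refl) (auto simp: c_def)
  finally have gm: "(\<Sum>X\<in>Pow A. f X * g X ^ (2*m)) \<le> n * ((2 * real m - 1)\<^sup>2 * w) ^ m" .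
  have "(n * w) ^ (2*m) * (n * a) \<le> (n * a) ^ (2*m) * (\<Sum>X\<in>Pow A. f X * g X ^ (2*m))"
    using weighted_power_mean[of "Pow A" f "2*m" g, OF fin f(1)] by (simp add: fg fa)
  also have "\<dots> \<le> (n * a) ^ (2*m) * (n * ((2 * real m - 1)\<^sup>2 * w) ^ m)"
    using gm by (intro mult_left_mono) (auto simp: zero_le_even_power)
  finally have "n ^ (2*m) * n * (w ^ (2*m) * a) \<le> n ^ (2*m) * n * (a ^ (2*m) * ((2 * real m - 1)\<^sup>2 * w) ^ m)"
    by (simp add: power_mult_distrib mult_ac)
  then have main: "w ^ (2*m) * a \<le> a ^ (2*m) * ((2 * real m - 1)\<^sup>2 * w) ^ m"
    using n by (simp add: mult_le_cancel_left_pos del: mult_le_cancel_left)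
  show ?thesis
  proof (cases "w = 0")
    case True
    then show ?thesis using m by (simp add: zero_le_even_power power_0_left)
  next
    case False
    then have wp: "w ^ m > 0" using w0 by simp
    have "w ^ m * (w ^ m * a) \<le> w ^ m * (a ^ (2*m) * (2 * real m - 1) ^ (2*m))"
      using main by (simp add: power_mult_distrib power_mult power2_eq_square mult_ac)
    then show ?thesis using wp by (simp add: mult_le_cancel_left_pos del: mult_le_cancel_left)
  qed
qed

text \<open>The loss \<open>a^(-1/m)\<close> of \<open>level_two\<close> is at most \<open>3\<close>
  while \<open>a \<ge> 3^-m\<close>. At points where the density \<open>a\<close> is smaller,
  \<open>max a b\<close> takes its place; \<open>b\<close> will be the overall mean, so such points
  cost only a multiple of \<open>b^2\<close>.\<close>

lemma level_two_le:
  fixes f :: "nat set \<Rightarrow> real"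
  assumes A: "finite A" and m: "1 \<le> m" and f: "\<And>X. X \<in> Pow A \<Longrightarrow> 0 \<le> f X" "\<And>X. X \<in> Pow A \<Longrightarrow> f X \<le> 1"
    and b: "(1/3) ^ m \<le> b"
  shows "(\<Sum>S | S \<subseteq> A \<and> card S = 2. ((\<Sum>X\<in>Pow A. f X * chi S X) / 2 ^ card A)\<^sup>2)
     \<le> 3 * (2 * real m - 1)\<^sup>2 * (((\<Sum>X\<in>Pow A. f X) / 2 ^ card A)\<^sup>2 + b\<^sup>2)" (is "?w \<le> 3 * ?R\<^sup>2 * (?a\<^sup>2 + b\<^sup>2)")
proof -
  have a0: "0 \<le> ?a" using f by (auto intro!: divide_nonneg_pos sum_nonneg)
  have w0: "0 \<le> ?w" by (auto intro: sum_nonneg)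
  have b0: "b > 0" using b less_le_trans[of 0 "(1/3)^m" b] by simp
  have R: "?R \<ge> 1" using m by simp
  define d where "d = max ?a b"
  have d: "?a \<le> d" "b \<le> d" "d > 0" using b0 by (auto simp: d_def)
  have "?w ^ m \<le> (3 * ?R\<^sup>2 * d\<^sup>2) ^ m"
  proof (cases "?a = 0")
    case True
    have "f X = 0" if "X \<in> Pow A" for X
    proof -
      have "(\<Sum>X\<in>Pow A. f X) = 0" using True by simp
      then show ?thesis using that A f(1) by (subst (asm) sum_nonneg_eq_0_iff) auto
    qed
    then have "?w = 0" by simp
    then show ?thesis using m by (simp add: power_0_left)
  next
    case False
    then have a: "?a > 0" using order.not_eq_order_implies_strict[OF False[symmetric] a0] by simp
    have lt: "?w ^ m * ?a \<le> ?a ^ (2*m) * ?R ^ (2*m)" by (rule level_two[OF A m f])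
    have "2*m = Suc (2*m - 1)" using m by simp
    then have s: "x ^ (2*m) = x * x ^ (2*m-1)" for x :: real by (metis power_Suc)
    have "?w ^ m * ?a \<le> (?a ^ (2*m-1) * ?R ^ (2*m)) * ?a" using lt unfolding s[of ?a] by (simp add: mult_ac)
    then have "?w ^ m \<le> ?a ^ (2*m-1) * ?R ^ (2*m)" using a by (rule mult_right_le_imp_le)
    also have "\<dots> \<le> d ^ (2*m-1) * ?R ^ (2*m)" using a0 d R by (intro mult_right_mono power_mono) auto
    also have "\<dots> = 1 * (d ^ (2*m-1) * ?R ^ (2*m))" by simp
    also have "\<dots> \<le> (3 ^ m * d) * (d ^ (2*m-1) * ?R ^ (2*m))"
    proof (rule mult_right_mono)
      have "(3::real) ^ m * (1/3) ^ m = 1" by (simp add: power_mult_distrib[symmetric])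
      moreover have "(3::real) ^ m * (1/3) ^ m \<le> 3 ^ m * d" using b d by (intro mult_left_mono) auto
      ultimately show "1 \<le> 3 ^ m * d" by linarith
    qed (use d R in auto)
    also have "\<dots> = 3 ^ m * (d ^ (2*m) * ?R ^ (2*m))" using s[of d] by (simp only: mult_ac)
    also have "\<dots> = (3 * ?R\<^sup>2 * d\<^sup>2) ^ m" by (simp only: power_mult_distrib power_mult[of d 2 m] power_mult[of ?R 2 m]) (simp only: mult_ac)
    finally show ?thesis .
  qed
  then have "?w \<le> 3 * ?R\<^sup>2 * d\<^sup>2"
    using power_strict_mono[of "3 * ?R\<^sup>2 * d\<^sup>2" ?w m] m by (cases "?w \<le> 3 * ?R\<^sup>2 * d\<^sup>2") auto
  also have "\<dots> \<le> 3 * ?R\<^sup>2 * (?a\<^sup>2 + b\<^sup>2)"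
    by (intro mult_left_mono) (auto simp: d_def max_def)
  finally show ?thesis .
qed

lemma sum_pairs:
  fixes F :: "nat set \<Rightarrow> real"
  shows "(\<Sum>(i,j)\<in>prs n. F {i,j}) = 2 * (\<Sum>S | S \<subseteq> {..<n} \<and> card S = 2. F S)"
proof -
  let ?U = "{(i,j). i < j \<and> j < n}" and ?D = "{(i,j). j < i \<and> i < n}" and ?T = "{S. S \<subseteq> {..<n} \<and> card S = 2}"
  have fin: "finite ?U" "finite ?D" by (rule finite_subset[of _ "{..<n} \<times> {..<n}"]; auto)+
  have "prs n = ?U \<union> ?D" by (auto simp: prs_def)
  then have "(\<Sum>(i,j)\<in>prs n. F {i,j}) = (\<Sum>(i,j)\<in>?U. F {i,j}) + (\<Sum>(i,j)\<in>?D. F {i,j})"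
    using fin by (simp add: sum.union_disjoint disjoint_iff)
  moreover have "(\<Sum>(i,j)\<in>?D. F {i,j}) = (\<Sum>(i,j)\<in>?U. F {i,j})"
    by (rule sum.reindex_bij_witness[of _ "\<lambda>(i,j). (j,i)" "\<lambda>(i,j). (j,i)"]) (auto simp: insert_commute)
  moreover have "(\<Sum>(i,j)\<in>?U. F {i,j}) = (\<Sum>S\<in>?T. F S)"
  proof (rule sum.reindex_bij_witness[of _ "\<lambda>S. (Min S, Max S)" "\<lambda>(i,j). {i,j}"])
    fix S assume "S \<in> ?T"
    then obtain x y where "S = {x,y}" "x \<noteq> y" "x < n" "y < n" by (auto simp: card_2_iff)
    then show "(case (Min S, Max S) of (i,j) \<Rightarrow> {i,j}) = S" "(Min S, Max S) \<in> ?U"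
      by (auto simp: min_def max_def)
  qed (auto simp: min_def max_def)
  ultimately show ?thesis by simp
qed

subsection \<open>Averages over conjugated sign matrices\<close>

definition dg :: "nat \<Rightarrow> nat set \<Rightarrow> real mat" where
  "dg n X = mat n n (\<lambda>(i,j). if i = j then sg X i else 0)"

definition cj :: "real mat \<Rightarrow> real mat \<Rightarrow> real mat" where
  "cj D Z = transpose_mat Z * (D * Z)"

lemma dg_carrier [simp]: "dg n X \<in> carrier_mat n n" by (simp add: dg_def)

lemma dg_left:
  assumes M: "M \<in> carrier_mat n m" and ab: "a < n" "b < m"
  shows "(dg n X * M) $$ (a,b) = sg X a * M $$ (a,b)"
proof -
  have "(dg n X * M) $$ (a,b) = (\<Sum>k<n. dg n X $$ (a,k) * M $$ (k,b))"
    by (rule mult_index_sum[OF _ M ab]) simp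
  also have "\<dots> = (\<Sum>k<n. if k = a then sg X a * M $$ (a,b) else 0)"
    using ab by (intro sum.cong) (auto simp: dg_def)
  finally show ?thesis using ab by simp
qed

lemma dg_right:
  assumes M: "M \<in> carrier_mat m n" and ab: "a < m" "b < n"
  shows "(M * dg n X) $$ (a,b) = M $$ (a,b) * sg X b"
proof -
  have "(M * dg n X) $$ (a,b) = (\<Sum>k<n. M $$ (a,k) * dg n X $$ (k,b))"
    by (rule mult_index_sum[OF M _ ab]) simp
  also have "\<dots> = (\<Sum>k<n. if k = b then M $$ (a,b) * sg X b else 0)"
    using ab by (intro sum.cong) (auto simp: dg_def)
  finally show ?thesis using ab by simp
qed

lemma dg_transpose: "transpose_mat (dg n X) = dg n X"
  by (rule eq_matI) (auto simp: dg_def)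

lemma dg_sq: "dg n X * dg n X = 1\<^sub>m n"
proof (rule eq_matI)
  fix i j assume "i < dim_row (1\<^sub>m n :: real mat)" "j < dim_col (1\<^sub>m n :: real mat)"
  then have ij: "i < n" "j < n" by auto
  show "(dg n X * dg n X) $$ (i,j) = 1\<^sub>m n $$ (i,j)"
    unfolding dg_left[OF dg_carrier ij] using ij by (simp add: dg_def)
qed (auto simp: dg_def)

lemma dg_orth: "dg n X \<in> orth n"
  unfolding orth_def by (simp add: dg_transpose dg_sq)

lemma cj_orth: "D \<in> orth n \<Longrightarrow> Z \<in> orth n \<Longrightarrow> cj D Z \<in> orth n"
  unfolding cj_def by (intro orth_mult orth_transpose)

lemma cj_mult:
  assumes Q: "Q \<in> orth n" and Z: "Z \<in> orth n" and D: "D \<in> carrier_mat n n" "D' \<in> carrier_mat n n"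
    and c: "D * Q = Q * D'"
  shows "cj D (Q * Z) = cj D' Z"
proof -
  note q = orth_carrier[OF Q] and z = orth_carrier[OF Z]
  have "D * (Q * Z) = (D * Q) * Z" by (rule assoc_mult_mat[symmetric, OF D(1) q z])
  also have "\<dots> = Q * (D' * Z)" unfolding c by (rule assoc_mult_mat[OF q D(2) z])
  finally have 1: "D * (Q * Z) = Q * (D' * Z)" .
  have dz: "D' * Z \<in> carrier_mat n n" by (rule mult_carrier_mat[OF D(2) z])
  have tq: "transpose_mat Q \<in> carrier_mat n n" and tz: "transpose_mat Z \<in> carrier_mat n n" using q z by auto
  have "cj D (Q * Z) = (transpose_mat Z * transpose_mat Q) * (Q * (D' * Z))"
    unfolding cj_def 1 by (simp add: transpose_mult[OF q z])
  also have "\<dots> = transpose_mat Z * (transpose_mat Q * (Q * (D' * Z)))"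
    by (rule assoc_mult_mat[OF tz tq mult_carrier_mat[OF q dz]])
  also have "transpose_mat Q * (Q * (D' * Z)) = (transpose_mat Q * Q) * (D' * Z)"
    by (rule assoc_mult_mat[symmetric, OF tq q dz])
  also have "\<dots> = D' * Z" unfolding orth_transpose_mult[OF Q] by (rule left_mult_one_mat[OF dz])
  finally show ?thesis by (simp add: cj_def)
qed

lemma fd_cj:
  assumes D: "D \<in> orth n" and A: "A \<in> orth n" and B: "B \<in> orth n"
  shows "fd (cj D A) (cj D B) \<le> 2 * fd A B"
proof -
  note DA = orth_mult[OF D A] and DB = orth_mult[OF D B]
  note c = orth_carrier[OF A] orth_carrier[OF B] orth_carrier[OF DA] orth_carrier[OF DB] orth_carrier[OF D]
  have "fd (cj D A) (cj D B) \<le> fd (transpose_mat A * (D * A)) (transpose_mat B * (D * A)) + fd (transpose_mat B * (D * A)) (transpose_mat B * (D * B))"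
    unfolding cj_def by (rule fd_triangle[of _ n n]) (use c in auto)
  also have "fd (transpose_mat A * (D * A)) (transpose_mat B * (D * A)) = fd (transpose_mat A) (transpose_mat B)"
    by (rule fd_right[OF DA, of _ n]) (use c in auto)
  also have "\<dots> = fd A B" by (rule fd_transpose[OF c(1,2)])
  also have "fd (transpose_mat B * (D * A)) (transpose_mat B * (D * B)) = fd (D * A) (D * B)"
    by (rule fd_left[OF orth_transpose[OF B] c(3,4)])
  also have "\<dots> = fd A B" by (rule fd_left[OF D c(1,2)])
  finally show ?thesis by simp
qed

lemma cj_Lip:
  assumes F: "F \<in> Lip n" and D: "D \<in> orth n"
  shows "(\<lambda>Z. F (cj D Z)) \<in> Lip n"
proof -
  obtain L where L: "lipw n L F" using F by (auto simp: Lip_def)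
  have "lipw n (L * 2) (\<lambda>Z. F (cj D Z))"
  proof (rule lipwI)
    show "0 \<le> L * 2" using lipw_nonneg[OF L] by simp
    fix A B assume AB: "A \<in> orth n" "B \<in> orth n"
    have "\<bar>F (cj D A) - F (cj D B)\<bar> \<le> L * fd (cj D A) (cj D B)" by (intro lipwD[OF L] cj_orth D AB)
    also have "\<dots> \<le> L * (2 * fd A B)" by (intro mult_left_mono fd_cj[OF D AB] lipw_nonneg[OF L])
    finally show "\<bar>F (cj D A) - F (cj D B)\<bar> \<le> L * 2 * fd A B" by simp
  qed
  then show ?thesis by (rule LipI)
qed

text \<open>Where the two signs agree, the diagonal matrix is scalar on the plane of rows
  \<open>i\<close> and \<open>j\<close>.\<close>

lemma dg_e2_commute:
  assumes ij: "i < n" "j < n" "i \<noteq> j" and s: "sg X i = sg X j"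
  shows "dg n X * e2 n i j g = e2 n i j g * dg n X"
proof (rule eq_matI)
  fix a b assume "a < dim_row (e2 n i j g * dg n X)" "b < dim_col (e2 n i j g * dg n X)"
  then have ab: "a < n" "b < n" by (auto simp: emb_def dg_def)
  have "sg X a * e2 n i j g $$ (a,b) = e2 n i j g $$ (a,b) * sg X b"
  proof (cases "a \<in> {i,j} \<and> b \<in> {i,j}")
    case True then show ?thesis using s by auto
  next
    case False
    then have "e2 n i j g $$ (a,b) = (if a = b then 1 else 0)"
      by (intro emb_out ab) (auto simp: pr_image)
    then show ?thesis by simp
  qed
  then show "(dg n X * e2 n i j g) $$ (a,b) = (e2 n i j g * dg n X) $$ (a,b)"
    unfolding dg_left[OF emb_carrier ab] dg_right[OF emb_carrier ab] .
qed (auto simp: emb_def dg_def)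

lemma sg_image:
  "sg (Transposition.transpose a b ` X) (Transposition.transpose a b i) = sg X i"
proof -
  have "Transposition.transpose a b i \<in> Transposition.transpose a b ` X \<longleftrightarrow> i \<in> X"
    by (auto dest: transpose_eq_imp_eq)
  then show ?thesis by (simp add: sg_def)
qed

lemma dg_swap:
  assumes ab: "a < n" "b < n" "a \<noteq> b"
  shows "dg n X * e2 n a b sw = e2 n a b sw * dg n (Transposition.transpose a b ` X)"
proof (rule eq_matI)
  let ?\<sigma> = "Transposition.transpose a b"
  fix r s assume "r < dim_row (e2 n a b sw * dg n (?\<sigma> ` X))" "s < dim_col (e2 n a b sw * dg n (?\<sigma> ` X))"
  then have rs: "r < n" "s < n" by (auto simp: emb_def dg_def)
  have "?\<sigma> r < n" using rs ab by (simp add: Transposition.transpose_def)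
  then have e: "e2 n a b sw $$ (r,s) = (if ?\<sigma> r = s then 1 else 0)"
    using swap_row[OF ab one_carrier_mat rs] rs by (simp add: right_mult_one_mat[OF emb_carrier] del: index_mult_mat)
  have "sg X r * e2 n a b sw $$ (r,s) = e2 n a b sw $$ (r,s) * sg (?\<sigma> ` X) s"
    unfolding e using sg_image[of a b X r] by auto
  then show "(dg n X * e2 n a b sw) $$ (r,s) = (e2 n a b sw * dg n (?\<sigma> ` X)) $$ (r,s)"
    unfolding dg_left[OF emb_carrier rs] dg_right[OF emb_carrier rs] .
qed (auto simp: emb_def dg_def)

text \<open>\<open>al n F\<close> is the function \<open>\<alpha>\<close> of the introduction, \<open>cc n F S\<close> the Fourier coefficient at \<open>S\<close>.\<close>

definition al :: "nat \<Rightarrow> (real mat \<Rightarrow> real) \<Rightarrow> real mat \<Rightarrow> real" where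
  "al n F Z = (\<Sum>X\<in>Pow {..<n}. F (cj (dg n X) Z)) / 2 ^ n"

definition cc :: "nat \<Rightarrow> (real mat \<Rightarrow> real) \<Rightarrow> nat set \<Rightarrow> real mat \<Rightarrow> real" where
  "cc n F S Z = (\<Sum>X\<in>Pow {..<n}. F (cj (dg n X) Z) * chi S X) / 2 ^ n"

lemma al_Lip [intro,simp]: "F \<in> Lip n \<Longrightarrow> al n F \<in> Lip n"
proof -
  assume F: "F \<in> Lip n"
  have "(\<lambda>Z. (1 / 2 ^ n) * (\<Sum>X\<in>Pow {..<n}. F (cj (dg n X) Z))) \<in> Lip n"
    by (intro Lip_cmult Lip_sum cj_Lip F dg_orth)
  then show ?thesis by (simp add: al_def[abs_def])
qed

lemma cc_Lip [intro,simp]: "F \<in> Lip n \<Longrightarrow> cc n F S \<in> Lip n"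
proof -
  assume F: "F \<in> Lip n"
  have "(\<lambda>Z. (1 / 2 ^ n) * (\<Sum>X\<in>Pow {..<n}. F (cj (dg n X) Z) * chi S X)) \<in> Lip n"
    by (intro Lip_cmult Lip_sum Lip_mult Lip_const cj_Lip F dg_orth)
  then show ?thesis by (simp add: cc_def[abs_def])
qed

lemma al_SYM: "SYM n (al n F)"
  unfolding SYM_def
proof (intro allI impI ballI)
  fix a b Z assume ab: "a < n" "b < n" and Z: "Z \<in> orth n" and ne: "a \<noteq> b"
  let ?\<sigma> = "Transposition.transpose a b"
  have "(\<Sum>X\<in>Pow {..<n}. F (cj (dg n X) (e2 n a b sw * Z))) = (\<Sum>X\<in>Pow {..<n}. F (cj (dg n (?\<sigma> ` X)) Z))"
    by (intro sum.cong refl arg_cong[of _ _ F] cj_mult[OF e2_orth Z _ _ dg_swap] ab ne sw_orth dg_carrier)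
  also have "\<dots> = (\<Sum>X\<in>Pow {..<n}. F (cj (dg n X) Z))"
  proof (rule sum.reindex_bij_betw)
    have s: "?\<sigma> ` {..<n} = {..<n}" using ab by (intro transpose_image_eq) auto
    show "bij_betw (\<lambda>X. ?\<sigma> ` X) (Pow {..<n}) (Pow {..<n})"
    proof (rule bij_betwI[of _ _ _ "\<lambda>X. ?\<sigma> ` X"])
      show "(\<lambda>X. ?\<sigma> ` X) \<in> Pow {..<n} \<rightarrow> Pow {..<n}" using s by blast
      then show "(\<lambda>X. ?\<sigma> ` X) \<in> Pow {..<n} \<rightarrow> Pow {..<n}" .
    qed (simp_all add: image_image)
  qed
  finally show "al n F (e2 n a b sw * Z) = al n F Z" by (simp add: al_def)
qed

text \<open>The sum weights each sign pattern by \<open>1 + chi {i,j} X\<close>, which kills the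
  patterns with different signs at \<open>i\<close> and \<open>j\<close>; for the remaining ones the
  rotation commutes with the sign matrix and drops out of the conjugate.\<close>

lemma al_cc_invariant:
  assumes ij: "i < n" "j < n" "i \<noteq> j" and g: "g \<in> orth 2" and Z: "Z \<in> orth n"
  shows "al n F (e2 n i j g * Z) + cc n F {i,j} (e2 n i j g * Z) = al n F Z + cc n F {i,j} Z"
proof -
  have e: "al n F W + cc n F {i,j} W = (\<Sum>X\<in>Pow {..<n}. F (cj (dg n X) W) * (1 + chi {i,j} X)) / 2 ^ n" for W
    by (simp add: al_def cc_def sum.distrib distrib_left add_divide_distrib)
  have "(\<Sum>X\<in>Pow {..<n}. F (cj (dg n X) (e2 n i j g * Z)) * (1 + chi {i,j} X)) =
        (\<Sum>X\<in>Pow {..<n}. F (cj (dg n X) Z) * (1 + chi {i,j} X))"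
  proof (intro sum.cong refl)
    fix X
    show "F (cj (dg n X) (e2 n i j g * Z)) * (1 + chi {i,j} X) = F (cj (dg n X) Z) * (1 + chi {i,j} X)"
    proof (cases "sg X i = sg X j")
      case True
      then show ?thesis using cj_mult[OF e2_orth[OF ij g] Z dg_carrier dg_carrier dg_e2_commute[OF ij True]] by simp
    next
      case False
      then have "chi {i,j} X = -1" using ij(3) by (auto simp: chi_def sg_def split: if_splits)
      then show ?thesis by simp
    qed
  qed
  then show ?thesis unfolding e by simp
qed

context gap
begin

text \<open>As \<open>al + cc\<close> is invariant under the rotations, the complement of
  \<open>al\<close> is minus that of the Fourier coefficient, and a projection does not increase the
  norm.\<close>

lemma pair_energy:
  assumes ij: "(i,j) \<in> prs n" and F: "F \<in> Lip n"
  shows "hl n (\<lambda>Z. al n F Z * EE n (i,j) (al n F) Z) \<le> hl n (\<lambda>Z. (cc n F {i,j} Z)\<^sup>2)"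
proof -
  have i: "i < n" "j < n" "i \<noteq> j" using ij by (auto simp: prs_def)
  interpret P: emb_avg 2 cmean n "pr i j" by (rule emb_avg_e2[OF i])
  define c where "c = cc n F {i,j}"
  have cL: "c \<in> Lip n" and aL: "al n F \<in> Lip n" using F by (auto simp: c_def)
  define s where "s Z = al n F Z - (-1) * c Z" for Z
  have sL: "s \<in> Lip n" unfolding s_def using aL cL by (intro Lip_diff Lip_cmult)
  have sI: "P.Inv s" unfolding P.Inv_def s_def c_def using al_cc_invariant[OF i] by simp
  have "EE n (i,j) (al n F) Z = - EE n (i,j) c Z" if Z: "Z \<in> orth n" for Z
  proof -
    have "0 = EE n (i,j) s Z" using P.avg_Inv[OF sI sL Z] by (simp add: EE_def P2_def)
    also have "\<dots> = EE n (i,j) (al n F) Z - EE n (i,j) (\<lambda>X. (-1) * c X) Z"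
      unfolding s_def[abs_def] by (rule EE_diff[OF ij aL _ Z]) (intro Lip_cmult cL)
    also have "EE n (i,j) (\<lambda>X. (-1) * c X) Z = (-1) * EE n (i,j) c Z" by (rule EE_cmult[OF ij cL Z])
    finally show ?thesis by simp
  qed
  then have e: "(EE n (i,j) (al n F) Z)\<^sup>2 = (EE n (i,j) c Z)\<^sup>2" if "Z \<in> orth n" for Z using that by simp
  have "hl n (\<lambda>Z. al n F Z * EE n (i,j) (al n F) Z) = hl n (\<lambda>Z. (EE n (i,j) (al n F) Z)\<^sup>2)" by (rule EE_sq[OF ij aL])
  also have "\<dots> = hl n (\<lambda>Z. (EE n (i,j) c Z)\<^sup>2)" by (rule eqI[OF _ e]) (use ij aL in auto)
  also have "\<dots> = hl n (\<lambda>Z. (c Z)\<^sup>2) - hl n (\<lambda>Z. (P.A c Z)\<^sup>2)"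
    using P.haar_compl(2)[OF haar_axioms cL] by (simp add: EE_def P2_def)
  also have "\<dots> \<le> hl n (\<lambda>Z. (c Z)\<^sup>2)" using sq_nonneg[OF P.avg_Lip[OF cL]] by simp
  finally show ?thesis by (simp add: c_def)
qed

definition unit_valued :: "(real mat \<Rightarrow> real) \<Rightarrow> bool" where
  "unit_valued F \<longleftrightarrow> F \<in> Lip n \<and> (\<forall>A\<in>orth n. 0 \<le> F A \<and> F A \<le> 1)"

text \<open>With \<open>V\<close> the variance, the Poincare inequality, \<open>pair_energy\<close>
  and the level-two bound give \<open>\<gamma> V \<le> K' (V + 2 a^2)\<close>. The \<open>6\<close>
  in \<open>K'\<close> is the \<open>3\<close> of \<open>level_two_le\<close> times two orders of
  each pair; \<open>\<gamma> \<ge> 21 K'\<close> then yields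
  \<open>20 V \<le> 2 a^2\<close>.\<close>

lemma variance_al:
  assumes F: "unit_valued F" and m: "1 \<le> m" and b: "(1/3) ^ m \<le> hl n (al n F)"
    and K: "21 * (6 * (2 * real m - 1)\<^sup>2) \<le> \<gamma>"
  shows "hl n (\<lambda>Z. (al n F Z - hl n (al n F))\<^sup>2) \<le> 0.1 * (hl n (al n F))\<^sup>2"
proof -
  define K' where "K' = 6 * (2 * real m - 1)\<^sup>2"
  have K': "K' > 0" unfolding K'_def using m by simp
  define a where "a = hl n (al n F)"
  have FL: "F \<in> Lip n" and F01: "\<And>A. A \<in> orth n \<Longrightarrow> 0 \<le> F A" "\<And>A. A \<in> orth n \<Longrightarrow> F A \<le> 1"
    using F by (auto simp: unit_valued_def)
  have aL: "al n F \<in> Lip n" using FL by simp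
  define V where "V = hl n (\<lambda>Z. (al n F Z - a)\<^sup>2)"
  have "V = hl n (\<lambda>Z. ((al n F Z)\<^sup>2 - 2 * a * al n F Z) + a\<^sup>2)"
    unfolding V_def by (simp add: power2_eq_square algebra_simps)
  also have "\<dots> = hl n (\<lambda>Z. (al n F Z)\<^sup>2) - 2 * a * a + a\<^sup>2"
    using aL by (simp add: add diff cmult const a_def)
  finally have sq: "hl n (\<lambda>Z. (al n F Z)\<^sup>2) = V + a\<^sup>2" by (simp add: power2_eq_square)
  have "\<gamma> * V \<le> hl n (\<lambda>Z. al n F Z * DD n (al n F) Z)"
    unfolding V_def a_def by (rule poincare[OF al_SYM aL])
  also have "\<dots> = hl n (\<lambda>Z. \<Sum>p\<in>prs n. al n F Z * EE n p (al n F) Z)" by (simp add: DD_def sum_distrib_left)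
  also have "\<dots> = (\<Sum>p\<in>prs n. hl n (\<lambda>Z. al n F Z * EE n p (al n F) Z))" using aL by (intro sum) auto
  also have "\<dots> \<le> (\<Sum>(i,j)\<in>prs n. hl n (\<lambda>Z. (cc n F {i,j} Z)\<^sup>2))"
    by (rule sum_mono) (auto intro: pair_energy[OF _ FL])
  also have "\<dots> = (\<Sum>p\<in>prs n. hl n (\<lambda>Z. (cc n F {fst p, snd p} Z)\<^sup>2))" by (simp add: case_prod_beta)
  also have "\<dots> = hl n (\<lambda>Z. \<Sum>p\<in>prs n. (cc n F {fst p, snd p} Z)\<^sup>2)" using FL by (intro sum[symmetric]) auto
  also have "\<dots> \<le> hl n (\<lambda>Z. K' * ((al n F Z)\<^sup>2 + a\<^sup>2))"
  proof (rule mono)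
    show "(\<lambda>Z. \<Sum>p\<in>prs n. (cc n F {fst p, snd p} Z)\<^sup>2) \<in> Lip n" using FL by (intro Lip_sum) auto
    show "(\<lambda>Z. K' * ((al n F Z)\<^sup>2 + a\<^sup>2)) \<in> Lip n" using aL by auto
    fix Z assume Z: "Z \<in> orth n"
    have "(\<Sum>p\<in>prs n. (cc n F {fst p, snd p} Z)\<^sup>2) = 2 * (\<Sum>S | S \<subseteq> {..<n} \<and> card S = 2. (cc n F S Z)\<^sup>2)"
      using sum_pairs[of "\<lambda>S. (cc n F S Z)\<^sup>2" n] by (simp add: case_prod_beta)
    also have "\<dots> \<le> 2 * (3 * (2 * real m - 1)\<^sup>2 * ((al n F Z)\<^sup>2 + a\<^sup>2))"
    proof (rule mult_left_mono)
      show "(\<Sum>S | S \<subseteq> {..<n} \<and> card S = 2. (cc n F S Z)\<^sup>2) \<le> 3 * (2 * real m - 1)\<^sup>2 * ((al n F Z)\<^sup>2 + a\<^sup>2)"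
        using level_two_le[of "{..<n}" m "\<lambda>X. F (cj (dg n X) Z)" a] m b F01 cj_orth[OF dg_orth Z]
        by (simp add: cc_def al_def a_def)
    qed simp
    finally show "(\<Sum>p\<in>prs n. (cc n F {fst p, snd p} Z)\<^sup>2) \<le> K' * ((al n F Z)\<^sup>2 + a\<^sup>2)" by (simp add: K'_def)
  qed
  also have "\<dots> = K' * ((V + a\<^sup>2) + a\<^sup>2)" using aL by (simp add: cmult add const sq)
  finally have 1: "\<gamma> * V \<le> K' * (V + 2 * a\<^sup>2)" by (simp add: algebra_simps)
  have V0: "0 \<le> V" unfolding V_def using aL by (intro sq_nonneg) auto
  have "21 * K' * V \<le> \<gamma> * V" using K V0 unfolding K'_def by (intro mult_right_mono) auto
  then have "K' * (20 * V) \<le> K' * (2 * a\<^sup>2)" using 1 by (simp add: algebra_simps)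
  then have "20 * V \<le> 2 * a\<^sup>2" using K' by (simp add: mult_le_cancel_left_pos)
  then show ?thesis unfolding V_def a_def by simp
qed

text \<open>Cauchy-Schwarz bounds the covariance by a tenth of the product of the means. The shift
  \<open>Q\<close> changes neither mean nor variance, so the estimate is the same for the yes and
  the no distribution.\<close>

lemma correlation:
  assumes F: "unit_valued F" and G: "unit_valued G" and m: "1 \<le> m"
    and bF: "(1/3) ^ m \<le> hl n (al n F)" and bG: "(1/3) ^ m \<le> hl n (al n G)"
    and K: "21 * (6 * (2 * real m - 1)\<^sup>2) \<le> \<gamma>" and Q: "Q \<in> orth n"
  shows "0.9 * (hl n (al n F) * hl n (al n G)) \<le> hl n (\<lambda>Z. al n F Z * al n G (Q * Z))"
proof -
  define a b where "a = hl n (al n F)" and "b = hl n (al n G)"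
  have p3: "(0::real) < (1/3) ^ m" by simp
  have a0: "a > 0" and b0: "b > 0" unfolding a_def b_def using less_le_trans[OF p3 bF] less_le_trans[OF p3 bG] by auto
  have FL: "al n F \<in> Lip n" and GL: "al n G \<in> Lip n" using F G by (auto simp: unit_valued_def)
  have GQ: "(\<lambda>Z. al n G (Q * Z)) \<in> Lip n" by (rule Lip_left[OF GL Q])
  have bQ: "hl n (\<lambda>Z. al n G (Q * Z)) = b" unfolding b_def by (rule left[OF GL Q])
  define c where "c = hl n (\<lambda>Z. (al n F Z - a) * (al n G (Q * Z) - b))"
  have "c = hl n (\<lambda>Z. (al n F Z * al n G (Q * Z) - b * al n F Z) - (a * al n G (Q * Z) - a * b))"
    unfolding c_def by (simp add: algebra_simps)
  also have "\<dots> = (hl n (\<lambda>Z. al n F Z * al n G (Q * Z)) - b * a) - (a * b - a * b)"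
    using FL GQ by (simp add: diff cmult const bQ a_def[symmetric])
  finally have e: "hl n (\<lambda>Z. al n F Z * al n G (Q * Z)) = a * b + c" by simp
  have "c\<^sup>2 \<le> hl n (\<lambda>Z. (al n F Z - a)\<^sup>2) * hl n (\<lambda>Z. (al n G (Q * Z) - b)\<^sup>2)"
    unfolding c_def by (rule Cauchy_Schwarz) (use FL GQ in auto)
  also have "hl n (\<lambda>Z. (al n G (Q * Z) - b)\<^sup>2) = hl n (\<lambda>Z. (al n G Z - b)\<^sup>2)"
    by (rule left[of "\<lambda>Z. (al n G Z - b)\<^sup>2"]) (use GL Q in auto)
  also have "hl n (\<lambda>Z. (al n F Z - a)\<^sup>2) * \<dots> \<le> (0.1 * a\<^sup>2) * (0.1 * b\<^sup>2)"
    unfolding a_def b_def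
    by (intro mult_mono variance_al[OF F m bF K] variance_al[OF G m bG K] sq_nonneg) (use GL in auto)
  also have "\<dots> = (0.1 * (a * b))\<^sup>2" by (simp add: power2_eq_square)
  finally have "\<bar>c\<bar> \<le> 0.1 * (a * b)" using a0 b0 by (intro power2_le_imp_le[of "\<bar>c\<bar>"]) auto
  then show ?thesis unfolding e a_def[symmetric] b_def[symmetric] by linarith
qed

end

subsection \<open>Hadamard matrices\<close>

text \<open>Sylvester's matrix, built from the lowest binary digits: the sign is \<open>-1\<close>
  to the number of positions where both \<open>i\<close> and \<open>j\<close> have digit
  \<open>1\<close>.\<close>

fun hadamard :: "nat \<Rightarrow> nat \<Rightarrow> nat \<Rightarrow> real" where
  "hadamard 0 i j = 1"
| "hadamard (Suc k) i j = (if odd i \<and> odd j then -1 else 1) * hadamard k (i div 2) (j div 2)"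

lemma hadamard_sq [simp]: "hadamard k i j * hadamard k i j = 1" "(hadamard k i j)\<^sup>2 = 1"
  by (induction k arbitrary: i j) (auto simp: power2_eq_square)

lemma sum_double:
  fixes F :: "nat \<Rightarrow> real"
  shows "(\<Sum>j<2*n. F j) = (\<Sum>j<n. F (2*j) + F (Suc (2*j)))"
  by (induction n) auto

lemma hadamard_orth:
  "i < 2^k \<Longrightarrow> l < 2^k \<Longrightarrow> (\<Sum>j<2^k. hadamard k i j * hadamard k l j) = (if i = l then 2^k else 0)"
proof (induction k arbitrary: i l)
  case (Suc k)
  define s t :: real where "s = (if odd i then -1 else 1)" and "t = (if odd l then -1 else 1)"
  have "(\<Sum>j<2^Suc k. hadamard (Suc k) i j * hadamard (Suc k) l j) =
     (\<Sum>j<2^k. (1 + s * t) * (hadamard k (i div 2) j * hadamard k (l div 2) j))"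
    unfolding power_Suc sum_double by (intro sum.cong refl) (auto simp: s_def t_def)
  also have "\<dots> = (1 + s * t) * (if i div 2 = l div 2 then 2^k else 0)"
    using Suc.IH[of "i div 2" "l div 2"] Suc.prems by (simp add: sum_distrib_left[symmetric] less_mult_imp_div_less mult.commute)
  also have "\<dots> = (if i = l then 2^Suc k else 0)"
  proof -
    have "i = l \<longleftrightarrow> i div 2 = l div 2 \<and> (odd i \<longleftrightarrow> odd l)"
      by (metis div_mod_decomp mod2_eq_if)
    then show ?thesis by (auto simp: s_def t_def)
  qed
  finally show ?case .
qed simp

definition HH :: "nat \<Rightarrow> real mat" where
  "HH k = mat (2^k) (2^k) (\<lambda>(i,j). hadamard k i j / sqrt (2^k))"

lemma HH_orth: "HH k \<in> orth (2^k)"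
proof (rule orth_I)
  fix i j :: nat assume ij: "i < 2^k" "j < 2^k"
  have "(\<Sum>l<2^k. HH k $$ (i,l) * HH k $$ (j,l)) = (\<Sum>l<2^k. hadamard k i l * hadamard k j l) / 2^k"
    using ij by (simp add: HH_def sum_divide_distrib)
  then show "(\<Sum>l<2^k. HH k $$ (i,l) * HH k $$ (j,l)) = (if i = j then 1 else 0)"
    using hadamard_orth[OF ij] by simp
qed (simp add: HH_def)

subsection \<open>Traces of words in conjugated sign matrices\<close>

definition rtr :: "real mat \<Rightarrow> real" where "rtr M = (\<Sum>i<dim_row M. M $$ (i,i))"

lemma rtr_mult:
  assumes "A \<in> carrier_mat n m" "B \<in> carrier_mat m n"
  shows "rtr (A * B) = (\<Sum>i<n. \<Sum>k<m. A $$ (i,k) * B $$ (k,i))"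
proof -
  have "rtr (A * B) = (\<Sum>i<n. (A * B) $$ (i,i))" using assms by (simp add: rtr_def)
  also have "\<dots> = (\<Sum>i<n. \<Sum>k<m. A $$ (i,k) * B $$ (k,i))"
    by (intro sum.cong refl mult_index_sum[OF assms]) auto
  finally show ?thesis .
qed

lemma rtr_commute:
  assumes "A \<in> carrier_mat n m" "B \<in> carrier_mat m n"
  shows "rtr (A * B) = rtr (B * A)"
  unfolding rtr_mult[OF assms] rtr_mult[OF assms(2,1)] by (subst sum.swap) (simp add: mult.commute)

lemma rtr_fd:
  assumes "A \<in> carrier_mat n n" "B \<in> carrier_mat n n"
  shows "\<bar>rtr A - rtr B\<bar> \<le> real n * fd A B"
proof -
  have "\<bar>rtr A - rtr B\<bar> = \<bar>\<Sum>i<n. A $$ (i,i) - B $$ (i,i)\<bar>" using assms by (simp add: rtr_def sum_subtractf)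
  also have "\<dots> \<le> (\<Sum>i<n. \<bar>A $$ (i,i) - B $$ (i,i)\<bar>)" by (rule sum_abs)
  also have "\<dots> \<le> (\<Sum>i<n. fd A B)" by (intro sum_mono entry_le_fd[OF assms(1)]) auto
  finally show ?thesis by simp
qed

lemma fd_mult:
  assumes "A \<in> orth n" "A' \<in> orth n" "B \<in> orth n" "B' \<in> orth n"
  shows "fd (A * B) (A' * B') \<le> fd A A' + fd B B'"
proof -
  note c = assms[THEN orth_carrier]
  have "fd (A * B) (A' * B') \<le> fd (A * B) (A' * B) + fd (A' * B) (A' * B')"
    by (rule fd_triangle[of _ n n]) (use c in auto)
  also have "\<dots> = fd A A' + fd B B'"
    unfolding fd_right[OF assms(3) c(1,2)] fd_left[OF assms(2) c(3,4)] ..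
  finally show ?thesis .
qed

definition tr4 :: "real mat \<Rightarrow> real mat \<Rightarrow> real" where
  "tr4 R S = rtr ((R * S) * (R * S))"

lemma tr4_close:
  assumes "R \<in> orth n" "R' \<in> orth n" "S \<in> orth n" "S' \<in> orth n"
    and "fd R R' \<le> e" "fd S S' \<le> e"
  shows "\<bar>tr4 R S - tr4 R' S'\<bar> \<le> real n * (4 * e)"
proof -
  note o = orth_mult[OF assms(1,3)] orth_mult[OF assms(2,4)]
  have f1: "fd (R * S) (R' * S') \<le> 2 * e" using fd_mult[OF assms(1-4)] assms(5,6) by linarith
  have f: "fd ((R * S) * (R * S)) ((R' * S') * (R' * S')) \<le> 4 * e"
    using fd_mult[OF o o] f1 by linarith
  have "\<bar>tr4 R S - tr4 R' S'\<bar> \<le> real n * fd ((R * S) * (R * S)) ((R' * S') * (R' * S'))"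
    unfolding tr4_def by (intro rtr_fd orth_carrier orth_mult o)
  also have "\<dots> \<le> real n * (4 * e)" by (intro mult_left_mono f) simp
  finally show ?thesis .
qed

lemma cj_mult_cj:
  assumes Z: "Z \<in> orth n" and A: "A \<in> carrier_mat n n" and B: "B \<in> carrier_mat n n"
  shows "cj A Z * cj B Z = cj (A * B) Z"
proof -
  note z = orth_carrier[OF Z]
  have tz: "transpose_mat Z \<in> carrier_mat n n" using z by simp
  have bz: "B * Z \<in> carrier_mat n n" and az: "A * Z \<in> carrier_mat n n" using A B z by (auto intro: mult_carrier_mat)
  have "cj A Z * cj B Z = transpose_mat Z * ((A * Z) * (transpose_mat Z * (B * Z)))"
    unfolding cj_def by (rule assoc_mult_mat[OF tz az mult_carrier_mat[OF tz bz]])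
  also have "(A * Z) * (transpose_mat Z * (B * Z)) = A * (Z * (transpose_mat Z * (B * Z)))"
    by (rule assoc_mult_mat[OF A z mult_carrier_mat[OF tz bz]])
  also have "Z * (transpose_mat Z * (B * Z)) = (Z * transpose_mat Z) * (B * Z)"
    by (rule assoc_mult_mat[OF z tz bz, symmetric])
  also have "\<dots> = B * Z" unfolding orth_mult_transpose[OF Z] by (rule left_mult_one_mat[OF bz])
  also have "A * (B * Z) = (A * B) * Z" by (rule assoc_mult_mat[OF A B z, symmetric])
  finally show ?thesis by (simp add: cj_def)
qed

lemma rtr_cj:
  assumes Z: "Z \<in> orth n" and A: "A \<in> carrier_mat n n"
  shows "rtr (cj A Z) = rtr A"
proof -
  note z = orth_carrier[OF Z]
  have tz: "transpose_mat Z \<in> carrier_mat n n" using z by simp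
  have az: "A * Z \<in> carrier_mat n n" using A z by (auto intro: mult_carrier_mat)
  have "rtr (cj A Z) = rtr ((A * Z) * transpose_mat Z)" unfolding cj_def by (rule rtr_commute[OF tz az])
  also have "(A * Z) * transpose_mat Z = A * (Z * transpose_mat Z)" by (rule assoc_mult_mat[OF A z tz])
  also have "\<dots> = A" unfolding orth_mult_transpose[OF Z] by (rule right_mult_one_mat[OF A])
  finally show ?thesis .
qed

lemma tr4_cj:
  assumes Z: "Z \<in> orth n" and A: "A \<in> carrier_mat n n" and B: "B \<in> carrier_mat n n"
  shows "tr4 (cj A Z) (cj B Z) = tr4 A B"
proof -
  have ab: "A * B \<in> carrier_mat n n" using A B by (rule mult_carrier_mat)
  show ?thesis unfolding tr4_def cj_mult_cj[OF Z A B] cj_mult_cj[OF Z ab ab]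
    by (rule rtr_cj[OF Z mult_carrier_mat[OF ab ab]])
qed

lemma cj_cj:
  assumes Q: "Q \<in> orth n" and Z: "Z \<in> orth n" and D: "D \<in> carrier_mat n n"
  shows "cj D (Q * Z) = cj (cj D Q) Z"
proof -
  note q = orth_carrier[OF Q] and z = orth_carrier[OF Z]
  have tq: "transpose_mat Q \<in> carrier_mat n n" and tz: "transpose_mat Z \<in> carrier_mat n n" using q z by auto
  have dq: "D * Q \<in> carrier_mat n n" using D q by (rule mult_carrier_mat)
  have "cj D (Q * Z) = (transpose_mat Z * transpose_mat Q) * ((D * Q) * Z)"
    unfolding cj_def transpose_mult[OF q z] assoc_mult_mat[OF D q z] ..
  also have "\<dots> = transpose_mat Z * (transpose_mat Q * ((D * Q) * Z))"
    by (rule assoc_mult_mat[OF tz tq mult_carrier_mat[OF dq z]])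
  also have "transpose_mat Q * ((D * Q) * Z) = (transpose_mat Q * (D * Q)) * Z"
    by (rule assoc_mult_mat[OF tq dq z, symmetric])
  finally show ?thesis by (simp add: cj_def)
qed

lemma tr4_diag: "tr4 (dg n X) (dg n Y) = real n"
proof -
  have e: "dg n X * dg n Y \<in> carrier_mat n n" by (rule mult_carrier_mat[OF dg_carrier dg_carrier])
  have i: "(dg n X * dg n Y) $$ (i,j) = (if i = j then sg X i * sg Y i else 0)" if "i < n" "j < n" for i j
    unfolding dg_left[OF dg_carrier that] using that by (simp add: dg_def)
  have "tr4 (dg n X) (dg n Y) = (\<Sum>i<n. \<Sum>k<n. (dg n X * dg n Y) $$ (i,k) * (dg n X * dg n Y) $$ (k,i))"
    unfolding tr4_def by (rule rtr_mult[OF e e])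
  also have "\<dots> = (\<Sum>i<n. \<Sum>k<n. if i = k then 1 else 0)"
  proof (intro sum.cong refl)
    fix i k assume "i \<in> {..<n}" "k \<in> {..<n}"
    then show "(dg n X * dg n Y) $$ (i,k) * (dg n X * dg n Y) $$ (k,i) = (if i = k then 1 else 0)"
      by (simp add: i del: index_mult_mat) (auto simp: sg_def)
  qed
  also have "\<dots> = real n" by simp
  finally show ?thesis .
qed

lemma tr4_dg:
  assumes M: "M \<in> carrier_mat n n"
  shows "tr4 (dg n X) M = (\<Sum>i<n. \<Sum>k<n. sg X i * sg X k * (M $$ (i,k) * M $$ (k,i)))"
proof -
  have e: "dg n X * M \<in> carrier_mat n n" using M by (auto intro: mult_carrier_mat[OF dg_carrier])
  have "tr4 (dg n X) M = (\<Sum>i<n. \<Sum>k<n. (dg n X * M) $$ (i,k) * (dg n X * M) $$ (k,i))"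
    unfolding tr4_def by (rule rtr_mult[OF e e])
  also have "\<dots> = (\<Sum>i<n. \<Sum>k<n. sg X i * sg X k * (M $$ (i,k) * M $$ (k,i)))"
  proof (intro sum.cong refl)
    fix i k assume ik: "i \<in> {..<n}" "k \<in> {..<n}"
    then show "(dg n X * M) $$ (i,k) * (dg n X * M) $$ (k,i) = sg X i * sg X k * (M $$ (i,k) * M $$ (k,i))"
      using dg_left[OF M, of i k X] dg_left[OF M, of k i X] by (simp del: index_mult_mat)
  qed
  finally show ?thesis .
qed

text \<open>\<open>B i j\<close> stands for the squared entries of the Hadamard conjugate of a sign matrix.\<close>

lemma quad_moment:
  assumes sym: "\<And>i j. B i j = B j i"
  shows "(\<Sum>X\<in>Pow {..<n}. (\<Sum>i<n. \<Sum>k<n. sg X i * sg X k * B i k)\<^sup>2)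
    \<le> 2 ^ n * ((\<Sum>i<n. B i i)\<^sup>2 + 2 * (\<Sum>i<n. \<Sum>k<n. (B i k)\<^sup>2))"
proof -
  let ?T = "{S. S \<subseteq> {..<n} \<and> card S = 2}"
  define b where "b = (\<Sum>i<n. B i i)"
  define F where "F S = B (Min S) (Max S)" for S :: "nat set"
  have F2: "F {i,j} = B i j" for i j using sym by (auto simp: F_def min_def max_def)
  define c where "c S = (if S = {} then b else if card S = 2 then 2 * F S else 0)" for S
  have split: "(\<Sum>i<n. \<Sum>k<n. G i k) = (\<Sum>i<n. G i i) + (\<Sum>(i,k)\<in>prs n. G i k)" for G :: "nat \<Rightarrow> nat \<Rightarrow> real"
  proof -
    have "(\<Sum>i<n. \<Sum>k<n. G i k) = (\<Sum>(i,k)\<in>{..<n}\<times>{..<n}. G i k)" by (simp add: sum.cartesian_product)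
    also have "{..<n}\<times>{..<n} = (\<lambda>i. (i,i)) ` {..<n} \<union> prs n" by (auto simp: prs_def)
    also have "(\<Sum>(i,k)\<in>\<dots>. G i k) = (\<Sum>(i,k)\<in>(\<lambda>i. (i,i)) ` {..<n}. G i k) + (\<Sum>(i,k)\<in>prs n. G i k)"
      by (rule sum.union_disjoint[OF _ finite_prs]) (auto simp: prs_def)
    also have "(\<Sum>(i,k)\<in>(\<lambda>i. (i,i)) ` {..<n}. G i k) = (\<Sum>i<n. G i i)" by (subst sum.reindex) (auto simp: inj_on_def)
    finally show ?thesis .
  qed
  have dec: "(\<Sum>S\<in>Pow {..<n}. H S) = H {} + (\<Sum>S\<in>?T. H S)"
    if "\<And>S. S \<noteq> {} \<Longrightarrow> card S \<noteq> 2 \<Longrightarrow> H S = 0" for H :: "nat set \<Rightarrow> real"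
  proof -
    have "(\<Sum>S\<in>Pow {..<n}. H S) = (\<Sum>S\<in>Set.insert {} ?T. H S)"
      by (rule sum.mono_neutral_right) (use that in auto)
    also have "\<dots> = H {} + (\<Sum>S\<in>?T. H S)" by (rule sum.insert) auto
    finally show ?thesis .
  qed
  have T: "(\<Sum>i<n. \<Sum>k<n. sg X i * sg X k * B i k) = (\<Sum>S\<in>Pow {..<n}. c S * chi S X)" for X
  proof -
    have "(\<Sum>i<n. \<Sum>k<n. sg X i * sg X k * B i k) = b + (\<Sum>(i,k)\<in>prs n. sg X i * sg X k * B i k)"
      unfolding split by (simp add: b_def)
    also have "(\<Sum>(i,k)\<in>prs n. sg X i * sg X k * B i k) = (\<Sum>(i,k)\<in>prs n. F {i,k} * chi {i,k} X)"
      by (intro sum.cong refl) (auto simp: F2 chi_def prs_def)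
    also have "\<dots> = 2 * (\<Sum>S\<in>?T. F S * chi S X)" by (rule sum_pairs)
    also have "\<dots> = (\<Sum>S\<in>?T. c S * chi S X)" unfolding sum_distrib_left by (intro sum.cong refl) (auto simp: c_def)
    also have "b + \<dots> = (\<Sum>S\<in>Pow {..<n}. c S * chi S X)" by (subst dec) (auto simp: c_def chi_def)
    finally show ?thesis .
  qed
  have "(\<Sum>S\<in>Pow {..<n}. (c S)\<^sup>2) = b\<^sup>2 + 4 * (\<Sum>S\<in>?T. (F S)\<^sup>2)"
    by (subst dec) (auto simp: c_def sum_distrib_left power_mult_distrib intro!: sum.cong)
  also have "4 * (\<Sum>S\<in>?T. (F S)\<^sup>2) = 2 * (\<Sum>(i,k)\<in>prs n. (F {i,k})\<^sup>2)" unfolding sum_pairs[of "\<lambda>S. (F S)\<^sup>2"] by simp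
  also have "(\<Sum>(i,k)\<in>prs n. (F {i,k})\<^sup>2) \<le> (\<Sum>i<n. \<Sum>k<n. (B i k)\<^sup>2)"
    unfolding split F2 by (simp add: sum_nonneg)
  finally have c2: "(\<Sum>S\<in>Pow {..<n}. (c S)\<^sup>2) \<le> b\<^sup>2 + 2 * (\<Sum>i<n. \<Sum>k<n. (B i k)\<^sup>2)" by simp
  have "(\<Sum>X\<in>Pow {..<n}. (\<Sum>i<n. \<Sum>k<n. sg X i * sg X k * B i k)\<^sup>2) \<le> 2 ^ n * (\<Sum>S\<in>Pow {..<n}. (c S)\<^sup>2)"
    unfolding T using bonami_le[of "{..<n}" 1 c] by simp
  also have "\<dots> \<le> 2 ^ n * (b\<^sup>2 + 2 * (\<Sum>i<n. \<Sum>k<n. (B i k)\<^sup>2))" by (intro mult_left_mono c2) simp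
  finally show ?thesis by (simp add: b_def)
qed

text \<open>Khinchine's inequality: Bonami with exponent \<open>4\<close> for a function of level
  one.\<close>

lemma linear_fourth_moment:
  assumes c: "\<And>l. l < n \<Longrightarrow> (c l)\<^sup>2 = d"
  shows "(\<Sum>Y\<in>Pow {..<n}. (\<Sum>l<n. c l * sg Y l) ^ 4) \<le> 2 ^ n * (3 * (real n * d))\<^sup>2"
proof -
  define c' where "c' S = (if card S = 1 then c (the_elem S) else 0)" for S :: "nat set"
  have dec: "(\<Sum>S\<in>Pow {..<n}. H S) = (\<Sum>l<n. H {l})" if "\<And>S. card S \<noteq> 1 \<Longrightarrow> H S = 0" for H :: "nat set \<Rightarrow> real"
  proof -
    have "(\<Sum>S\<in>Pow {..<n}. H S) = (\<Sum>S\<in>(\<lambda>l. {l}) ` {..<n}. H S)"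
    proof (rule sum.mono_neutral_right)
      show "\<forall>S\<in>Pow {..<n} - (\<lambda>l. {l}) ` {..<n}. H S = 0"
      proof
        fix S assume S: "S \<in> Pow {..<n} - (\<lambda>l. {l}) ` {..<n}"
        have "card S \<noteq> 1"
        proof
          assume "card S = 1"
          then obtain l where "S = {l}" by (auto simp: card_1_singleton_iff)
          then show False using S by auto
        qed
        then show "H S = 0" by (rule that)
      qed
    qed auto
    also have "\<dots> = (\<Sum>l<n. H {l})" by (subst sum.reindex) (auto simp: inj_on_def)
    finally show ?thesis .
  qed
  have e: "(\<Sum>l<n. c l * sg Y l) = (\<Sum>S\<in>Pow {..<n}. c' S * chi S Y)" for Y
    by (subst dec) (auto simp: c'_def chi_def)
  have e2: "(\<Sum>S\<in>Pow {..<n}. (2 * real 2 - 1) ^ card S * (c' S)\<^sup>2) = 3 * (real n * d)"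
    using c by (subst dec) (auto simp: c'_def)
  show ?thesis using bonami_le[of "{..<n}" 2 c'] unfolding e e2 by simp
qed

text \<open>The entries of the conjugated sign matrix are sign sums with coefficients of size
  \<open>1/n\<close>, so their fourth moments are at most \<open>9/n^2\<close>. In
  \<open>quad_moment\<close> the diagonal then contributes \<open>9\<close> and the double sum
  \<open>18\<close>; the mean square of the trace is bounded independently of
  \<open>n\<close>.\<close>

lemma HH_conj_moment:
  assumes n: "n = 2 ^ k"
  shows "(\<Sum>Y\<in>Pow {..<n}. \<Sum>X\<in>Pow {..<n}. (tr4 (dg n X) (cj (dg n Y) (HH k)))\<^sup>2) \<le> 27 * (2 ^ n * 2 ^ n)"
proof -
  have npos: "n > 0" by (simp add: n)
  define M where "M Y i j = (\<Sum>l<n. (hadamard k l i * hadamard k l j / real n) * sg Y l)" for Y i j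
  have ent: "cj (dg n Y) (HH k) $$ (i,j) = M Y i j" if ij: "i < n" "j < n" for Y i j
  proof -
    have h: "HH k \<in> carrier_mat n n" using orth_carrier[OF HH_orth] n by simp
    have "cj (dg n Y) (HH k) $$ (i,j) = (\<Sum>l<n. transpose_mat (HH k) $$ (i,l) * (dg n Y * HH k) $$ (l,j))"
      unfolding cj_def using h ij by (intro mult_index_sum mult_carrier_mat[OF dg_carrier]) auto
    also have "\<dots> = (\<Sum>l<n. hadamard k l i / sqrt (real n) * (sg Y l * (hadamard k l j / sqrt (real n))))"
    proof (intro sum.cong refl)
      fix l assume "l \<in> {..<n}"
      then have l: "l < n" by simp
      have "transpose_mat (HH k) $$ (i,l) = HH k $$ (l,i)" using h ij l by simp
      then show "transpose_mat (HH k) $$ (i,l) * (dg n Y * HH k) $$ (l,j) = hadamard k l i / sqrt (real n) * (sg Y l * (hadamard k l j / sqrt (real n)))"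
        unfolding dg_left[OF h l ij(2)] using ij l n by (simp add: HH_def)
    qed
    also have "\<dots> = M Y i j" unfolding M_def
    proof (intro sum.cong refl)
      fix l
      have "sqrt (real n) * sqrt (real n) = real n" by simp
      then show "hadamard k l i / sqrt (real n) * (sg Y l * (hadamard k l j / sqrt (real n))) = hadamard k l i * hadamard k l j / real n * sg Y l"
        by (simp add: field_simps)
    qed
    finally show ?thesis .
  qed
  have cc: "cj (dg n Y) (HH k) \<in> carrier_mat n n" for Y
    using orth_carrier[OF cj_orth[OF dg_orth]] HH_orth n by simp
  have symM: "M Y i j = M Y j i" for Y i j by (simp add: M_def mult.commute)
  have m4: "(\<Sum>Y\<in>Pow {..<n}. M Y i j ^ 4) \<le> 2 ^ n * (9 / (real n)\<^sup>2)" for i j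
  proof -
    have "(\<Sum>Y\<in>Pow {..<n}. M Y i j ^ 4) \<le> 2 ^ n * (3 * (real n * (1 / (real n)\<^sup>2)))\<^sup>2"
      unfolding M_def by (rule linear_fourth_moment) (simp add: power_divide power_mult_distrib)
    also have "(3 * (real n * (1 / (real n)\<^sup>2)))\<^sup>2 = 9 / (real n)\<^sup>2"
      using npos by (simp add: power2_eq_square)
    finally show ?thesis .
  qed
  have X: "(\<Sum>X\<in>Pow {..<n}. (tr4 (dg n X) (cj (dg n Y) (HH k)))\<^sup>2)
     \<le> 2 ^ n * (real n * (\<Sum>i<n. M Y i i ^ 4) + 2 * (\<Sum>i<n. \<Sum>j<n. M Y i j ^ 4))" for Y
  proof -
    have "tr4 (dg n X) (cj (dg n Y) (HH k)) = (\<Sum>i<n. \<Sum>j<n. sg X i * sg X j * (M Y i j)\<^sup>2)" for X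
      unfolding tr4_dg[OF cc] using symM by (intro sum.cong refl) (simp add: ent power2_eq_square)
    then have "(\<Sum>X\<in>Pow {..<n}. (tr4 (dg n X) (cj (dg n Y) (HH k)))\<^sup>2)
       \<le> 2 ^ n * ((\<Sum>i<n. (M Y i i)\<^sup>2)\<^sup>2 + 2 * (\<Sum>i<n. \<Sum>j<n. ((M Y i j)\<^sup>2)\<^sup>2))"
      using quad_moment[of "\<lambda>i j. (M Y i j)\<^sup>2" n] symM by simp
    also have "(\<Sum>i<n. (M Y i i)\<^sup>2)\<^sup>2 \<le> real n * (\<Sum>i<n. ((M Y i i)\<^sup>2)\<^sup>2)"
      using sum_squared_le_sum_of_squares[of "\<lambda>i. (M Y i i)\<^sup>2" "{..<n}"] by (simp add: mult.commute)
    finally show ?thesis by (simp add: power_mult[symmetric])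
  qed
  have "(\<Sum>Y\<in>Pow {..<n}. \<Sum>X\<in>Pow {..<n}. (tr4 (dg n X) (cj (dg n Y) (HH k)))\<^sup>2)
    \<le> (\<Sum>Y\<in>Pow {..<n}. 2 ^ n * (real n * (\<Sum>i<n. M Y i i ^ 4) + 2 * (\<Sum>i<n. \<Sum>j<n. M Y i j ^ 4)))"
    by (rule sum_mono[OF X])
  also have "\<dots> = 2 ^ n * (real n * (\<Sum>Y\<in>Pow {..<n}. \<Sum>i<n. M Y i i ^ 4) + 2 * (\<Sum>Y\<in>Pow {..<n}. \<Sum>i<n. \<Sum>j<n. M Y i j ^ 4))"
    by (simp add: sum_distrib_left[symmetric] sum.distrib)
  also have "(\<Sum>Y\<in>Pow {..<n}. \<Sum>i<n. M Y i i ^ 4) = (\<Sum>i<n. \<Sum>Y\<in>Pow {..<n}. M Y i i ^ 4)" by (rule sum.swap)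
  also have "(\<Sum>Y\<in>Pow {..<n}. \<Sum>i<n. \<Sum>j<n. M Y i j ^ 4) = (\<Sum>i<n. \<Sum>j<n. \<Sum>Y\<in>Pow {..<n}. M Y i j ^ 4)"
    by (subst sum.swap) (intro sum.cong refl sum.swap)
  also have "2 ^ n * (real n * (\<Sum>i<n. \<Sum>Y\<in>Pow {..<n}. M Y i i ^ 4) + 2 * (\<Sum>i<n. \<Sum>j<n. \<Sum>Y\<in>Pow {..<n}. M Y i j ^ 4))
     \<le> 2 ^ n * (real n * (\<Sum>i<n. 2 ^ n * (9 / (real n)\<^sup>2)) + 2 * (\<Sum>i<n. \<Sum>j<n. 2 ^ n * (9 / (real n)\<^sup>2)))"
    by (intro mult_left_mono add_mono sum_mono m4) auto
  also have "\<dots> = 27 * (2 ^ n * 2 ^ n)" using npos by (simp add: power2_eq_square field_simps)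
  finally show ?thesis .
qed

subsection \<open>Inputs in the special unitary group\<close>

definition cm :: "real mat \<Rightarrow> complex mat" where "cm R = map_mat complex_of_real R"

text \<open>An \<open>n\<close>-th root of the determinant \<open>1\<close> or \<open>-1\<close>:
  scaling \<open>R\<close> by it gives determinant \<open>det R\<close> squared, which is one. The
  second matrix of a party carries the conjugate phase, so all phases cancel in the trace of the
  product.\<close>

definition om :: "nat \<Rightarrow> real mat \<Rightarrow> complex" where
  "om n R = (if det R = 1 then 1 else cis (pi / real n))"

definition inp :: "nat \<Rightarrow> real mat \<Rightarrow> complex mat \<times> complex mat" where
  "inp n R = (om n R \<cdot>\<^sub>m cm R, cnj (om n R) \<cdot>\<^sub>m cm R)"

lemma orth_det: 
  assumes R: "R \<in> orth n"
  shows "det R = 1 \<or> det R = -1"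
proof -
  have "det R * det R = det (R * transpose_mat R)"
    using orth_carrier[OF R] by (simp add: det_mult[of _ n] det_transpose)
  also have "\<dots> = 1" by (simp add: orth_mult_transpose[OF R])
  finally show ?thesis by (simp only: square_eq_1_iff)
qed

lemma om_pow:
  assumes R: "R \<in> orth n" and n: "n > 0"
  shows "om n R ^ n = complex_of_real (det R)"
proof (cases "det R = 1")
  case False
  then have "det R = -1" using orth_det[OF R] by simp
  then show ?thesis using n by (simp add: om_def Complex.DeMoivre)
qed (simp add: om_def)

lemma om_norm: "om n R * cnj (om n R) = 1"
  by (simp add: om_def cis_cnj cis_mult)

lemma cm_carrier [simp]: "R \<in> carrier_mat n n \<Longrightarrow> cm R \<in> carrier_mat n n"
  by (simp add: cm_def)

lemma cm_mult: "A \<in> carrier_mat n n \<Longrightarrow> B \<in> carrier_mat n n \<Longrightarrow> cm A * cm B = cm (A * B)"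
  unfolding cm_def by (rule of_real_hom.mat_hom_mult[symmetric])

lemma smult_mult_smult:
  fixes A B :: "complex mat"
  assumes "A \<in> carrier_mat n n" "B \<in> carrier_mat n n"
  shows "(c \<cdot>\<^sub>m A) * (d \<cdot>\<^sub>m B) = (c * d) \<cdot>\<^sub>m (A * B)"
proof -
  have "(c \<cdot>\<^sub>m A) * (d \<cdot>\<^sub>m B) = c \<cdot>\<^sub>m (A * (d \<cdot>\<^sub>m B))"
    using assms by (intro mult_smult_assoc_mat) auto
  also have "A * (d \<cdot>\<^sub>m B) = d \<cdot>\<^sub>m (A * B)" by (rule mult_smult_distrib[OF assms])
  also have "c \<cdot>\<^sub>m (d \<cdot>\<^sub>m (A * B)) = (c * d) \<cdot>\<^sub>m (A * B)" by (rule eq_matI) (auto simp: mult.assoc)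
  finally show ?thesis .
qed

lemma smult_SU:
  assumes R: "R \<in> orth n" and c: "c * cnj c = 1" and d: "c ^ n * complex_of_real (det R) = 1"
  shows "c \<cdot>\<^sub>m cm R \<in> SU n"
proof -
  note r = orth_carrier[OF R]
  have ct: "ctrans (c \<cdot>\<^sub>m cm R) = cnj c \<cdot>\<^sub>m cm (transpose_mat R)"
    by (rule eq_matI) (use r in \<open>auto simp: ctrans_def cm_def\<close>)
  have tr: "transpose_mat R \<in> carrier_mat n n" using r by simp
  have "(c \<cdot>\<^sub>m cm R) * ctrans (c \<cdot>\<^sub>m cm R) = (c * cnj c) \<cdot>\<^sub>m (cm R * cm (transpose_mat R))"
    unfolding ct by (rule smult_mult_smult[OF cm_carrier[OF r] cm_carrier[OF tr]])
  also have "\<dots> = cm (1\<^sub>m n)" unfolding cm_mult[OF r tr] orth_mult_transpose[OF R] c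
    by (rule eq_matI) auto
  also have "\<dots> = 1\<^sub>m n" by (rule eq_matI) (auto simp: cm_def)
  finally have u: "(c \<cdot>\<^sub>m cm R) * ctrans (c \<cdot>\<^sub>m cm R) = 1\<^sub>m n" .
  have "det (c \<cdot>\<^sub>m cm R) = c ^ n * det (cm R)" using r by (simp add: det_smult cm_def)
  also have "det (cm R) = complex_of_real (det R)" unfolding cm_def by (rule of_real_hom.hom_det)
  finally show ?thesis using u d r by (simp add: SU_def)
qed

lemma inp_SU:
  assumes R: "R \<in> orth n" and n: "n > 0"
  shows "fst (inp n R) \<in> SU n" "snd (inp n R) \<in> SU n"
proof -
  have dd: "det R * det R = 1" using orth_det[OF R] by auto
  have 1: "om n R ^ n * complex_of_real (det R) = 1"
    unfolding om_pow[OF R n] of_real_mult[symmetric] dd by simp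
  have "cnj (om n R) ^ n * complex_of_real (det R) = cnj (om n R ^ n * complex_of_real (det R))" by simp
  also have "\<dots> = 1" unfolding 1 by simp
  finally have 2: "cnj (om n R) ^ n * complex_of_real (det R) = 1" .
  show "fst (inp n R) \<in> SU n" unfolding inp_def fst_conv by (rule smult_SU[OF R om_norm 1])
  show "snd (inp n R) \<in> SU n" unfolding inp_def snd_conv
    by (rule smult_SU[OF R _ 2]) (simp add: om_norm mult.commute[of "cnj _"])
qed

lemma inp_trace:
  assumes R: "R \<in> orth n" and S: "S \<in> orth n"
  shows "mtrace (fst (inp n R) * fst (inp n S) * snd (inp n R) * snd (inp n S)) = complex_of_real (tr4 R S)"
proof -
  note r = orth_carrier[OF R] and s = orth_carrier[OF S]
  let ?w = "om n R" and ?v = "om n S"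
  have rs: "R * S \<in> carrier_mat n n" using r s by (rule mult_carrier_mat)
  have rsr: "R * S * R \<in> carrier_mat n n" using rs r by (rule mult_carrier_mat)
  have "fst (inp n R) * fst (inp n S) * snd (inp n R) * snd (inp n S)
     = (?w \<cdot>\<^sub>m cm R) * (?v \<cdot>\<^sub>m cm S) * (cnj ?w \<cdot>\<^sub>m cm R) * (cnj ?v \<cdot>\<^sub>m cm S)" by (simp add: inp_def)
  also have "(?w \<cdot>\<^sub>m cm R) * (?v \<cdot>\<^sub>m cm S) = (?w * ?v) \<cdot>\<^sub>m cm (R * S)"
    using smult_mult_smult[OF cm_carrier[OF r] cm_carrier[OF s]] by (simp add: cm_mult[OF r s])
  also have "((?w * ?v) \<cdot>\<^sub>m cm (R * S)) * (cnj ?w \<cdot>\<^sub>m cm R) = (?w * ?v * cnj ?w) \<cdot>\<^sub>m cm (R * S * R)"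
    using smult_mult_smult[OF cm_carrier[OF rs] cm_carrier[OF r]] by (simp only: cm_mult[OF rs r])
  also have "((?w * ?v * cnj ?w) \<cdot>\<^sub>m cm (R * S * R)) * (cnj ?v \<cdot>\<^sub>m cm S) = (?w * ?v * cnj ?w * cnj ?v) \<cdot>\<^sub>m cm (R * S * R * S)"
    using smult_mult_smult[OF cm_carrier[OF rsr] cm_carrier[OF s]] by (simp only: cm_mult[OF rsr s])
  also have "?w * ?v * cnj ?w * cnj ?v = (?w * cnj ?w) * (?v * cnj ?v)" by (simp add: mult_ac)
  also have "\<dots> = 1" by (simp only: om_norm mult_1)
  also have "R * S * R * S = (R * S) * (R * S)" by (rule assoc_mult_mat[OF rs r s])
  also have "mtrace (1 \<cdot>\<^sub>m cm ((R * S) * (R * S))) = complex_of_real (tr4 R S)"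
    unfolding mtrace_def tr4_def rtr_def of_real_sum by (rule sum.cong) (use r s in \<open>auto simp: cm_def\<close>)
  finally show ?thesis .
qed

lemma inp_promise:
  assumes R: "R \<in> orth n" and S: "S \<in> orth n"
  shows "abcd_yes n (fst (inp n R)) (fst (inp n S)) (snd (inp n R)) (snd (inp n S)) \<longleftrightarrow> tr4 R S \<ge> 9/10 * real n"
    "abcd_no n (fst (inp n R)) (fst (inp n S)) (snd (inp n R)) (snd (inp n S)) \<longleftrightarrow> tr4 R S \<le> 1/10 * real n"
  unfolding abcd_yes_def abcd_no_def inp_trace[OF R S] by simp_all

subsection \<open>Protocols and rectangles\<close>

lemma sum_filter_split:
  fixes h :: "'i \<Rightarrow> real"
  assumes "finite A"
  shows "sum h A = sum h {a\<in>A. \<not> P a} + sum h {a\<in>A. P a}"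
proof -
  have "A = {a\<in>A. \<not> P a} \<union> {a\<in>A. P a}" by auto
  then show ?thesis using assms by (metis (no_types, lifting) sum.union_disjoint finite_Un disjoint_iff mem_Collect_eq)
qed

text \<open>Each message splits the current rectangle along one side. The product masses of the two
  parts add up, the allowance \<open>d\<close> is paid once per leaf, and there are at most
  \<open>2^c\<close> leaves. At a leaf the mass of the wrongly answered distribution is bounded by
  the rectangle hypothesis.\<close>

lemma protocol_error:
  fixes yes no :: "'i \<Rightarrow> 'i \<Rightarrow> real" and \<nu> :: "'i \<Rightarrow> real"
  assumes I: "finite I" and w: "0 \<le> w" and d: "0 \<le> d"
    and ry: "\<And>A B. A \<subseteq> I \<Longrightarrow> B \<subseteq> I \<Longrightarrow> w * (sum \<nu> A * sum \<nu> B - d) \<le> (\<Sum>a\<in>A. \<Sum>b\<in>B. yes a b)"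
    and rn: "\<And>A B. A \<subseteq> I \<Longrightarrow> B \<subseteq> I \<Longrightarrow> w * (sum \<nu> A * sum \<nu> B - d) \<le> (\<Sum>a\<in>A. \<Sum>b\<in>B. no a b)"
  shows "A \<subseteq> I \<Longrightarrow> B \<subseteq> I \<Longrightarrow> (\<forall>a\<in>A. \<forall>b\<in>B. bits p (x a) (y b) \<le> c) \<Longrightarrow>
    w * (sum \<nu> A * sum \<nu> B - 2 ^ c * d) \<le> (\<Sum>a\<in>A. \<Sum>b\<in>B. if run p (x a) (y b) then no a b else yes a b)"
proof (induction p arbitrary: A B c)
  case (Output v)
  have "d \<le> 2 ^ c * d" using d by (intro mult_right_mono[of 1 "2 ^ c" d, simplified]) auto
  then have "w * (sum \<nu> A * sum \<nu> B - 2 ^ c * d) \<le> w * (sum \<nu> A * sum \<nu> B - d)" using w by (intro mult_left_mono) auto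
  also have "\<dots> \<le> (\<Sum>a\<in>A. \<Sum>b\<in>B. if run (Output v) (x a) (y b) then no a b else yes a b)"
    using ry[OF Output(1,2)] rn[OF Output(1,2)] by (cases v) auto
  finally show ?case .
next
  case (AliceSends f p0 p1)
  have fA: "finite A" using AliceSends.prems(1) I finite_subset by blast
  show ?case
  \<comment> \<open>On an empty rectangle the cost hypothesis is vacuous and cannot give
    \<open>c > 0\<close>, but the claim is trivial there.\<close>
  proof (cases "A = {} \<or> B = {}")
    case True
    then show ?thesis using w d by (auto simp: mult_nonneg_nonpos)
  next
    case False
    then obtain a b where "a \<in> A" "b \<in> B" by auto
    then obtain c' where c': "c = Suc c'" using AliceSends.prems(3) by (cases c) force+
    let ?A0 = "{a\<in>A. \<not> f (x a)}" and ?A1 = "{a\<in>A. f (x a)}"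
    have 0: "w * (sum \<nu> ?A0 * sum \<nu> B - 2 ^ c' * d) \<le> (\<Sum>a\<in>?A0. \<Sum>b\<in>B. if run p0 (x a) (y b) then no a b else yes a b)"
      by (rule AliceSends.IH(1)) (use AliceSends.prems c' in force)+
    have 1: "w * (sum \<nu> ?A1 * sum \<nu> B - 2 ^ c' * d) \<le> (\<Sum>a\<in>?A1. \<Sum>b\<in>B. if run p1 (x a) (y b) then no a b else yes a b)"
      by (rule AliceSends.IH(2)) (use AliceSends.prems c' in force)+
    have "w * (sum \<nu> A * sum \<nu> B - 2 ^ c * d) = w * (sum \<nu> ?A0 * sum \<nu> B - 2 ^ c' * d) + w * (sum \<nu> ?A1 * sum \<nu> B - 2 ^ c' * d)"
      unfolding c' sum_filter_split[OF fA, of \<nu> "\<lambda>a. f (x a)"] by (simp add: algebra_simps)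
    also have "\<dots> \<le> (\<Sum>a\<in>?A0. \<Sum>b\<in>B. if run p0 (x a) (y b) then no a b else yes a b) + (\<Sum>a\<in>?A1. \<Sum>b\<in>B. if run p1 (x a) (y b) then no a b else yes a b)"
      by (rule add_mono[OF 0 1])
    also have "\<dots> = (\<Sum>a\<in>A. \<Sum>b\<in>B. if run (AliceSends f p0 p1) (x a) (y b) then no a b else yes a b)"
      unfolding sum_filter_split[OF fA, of _ "\<lambda>a. f (x a)"] by (intro arg_cong2[of _ _ _ _ "(+)"] sum.cong) auto
    finally show ?thesis .
  qed
next
  case (BobSends f p0 p1)
  have fB: "finite B" using BobSends.prems(2) I finite_subset by blast
  show ?case
  proof (cases "A = {} \<or> B = {}")
    case True
    then show ?thesis using w d by (auto simp: mult_nonneg_nonpos)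
  next
    case False
    then obtain a b where "a \<in> A" "b \<in> B" by auto
    then obtain c' where c': "c = Suc c'" using BobSends.prems(3) by (cases c) force+
    let ?B0 = "{b\<in>B. \<not> f (y b)}" and ?B1 = "{b\<in>B. f (y b)}"
    have 0: "w * (sum \<nu> A * sum \<nu> ?B0 - 2 ^ c' * d) \<le> (\<Sum>a\<in>A. \<Sum>b\<in>?B0. if run p0 (x a) (y b) then no a b else yes a b)"
      by (rule BobSends.IH(1)) (use BobSends.prems c' in force)+
    have 1: "w * (sum \<nu> A * sum \<nu> ?B1 - 2 ^ c' * d) \<le> (\<Sum>a\<in>A. \<Sum>b\<in>?B1. if run p1 (x a) (y b) then no a b else yes a b)"
      by (rule BobSends.IH(2)) (use BobSends.prems c' in force)+
    have "w * (sum \<nu> A * sum \<nu> B - 2 ^ c * d) = w * (sum \<nu> A * sum \<nu> ?B0 - 2 ^ c' * d) + w * (sum \<nu> A * sum \<nu> ?B1 - 2 ^ c' * d)"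
      unfolding c' sum_filter_split[OF fB, of \<nu> "\<lambda>b. f (y b)"] by (simp add: algebra_simps)
    also have "\<dots> \<le> (\<Sum>a\<in>A. \<Sum>b\<in>?B0. if run p0 (x a) (y b) then no a b else yes a b) + (\<Sum>a\<in>A. \<Sum>b\<in>?B1. if run p1 (x a) (y b) then no a b else yes a b)"
      by (rule add_mono[OF 0 1])
    also have "\<dots> = (\<Sum>a\<in>A. \<Sum>b\<in>B. if run (BobSends f p0 p1) (x a) (y b) then no a b else yes a b)"
      unfolding sum_filter_split[OF fB, of _ "\<lambda>b. f (y b)"] sum.distrib
      by (intro arg_cong2[of _ _ _ _ "(+)"] sum.cong refl) auto
    finally show ?thesis .
  qed
qed

subsection \<open>The hard distributions\<close>

text \<open>Inputs are rounded to the finite net \<open>prep n K \<kappa>\<close> with the weights \<open>pw n K \<kappa>\<close> of the partition of unity, so that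
  \<open>W Q\<close> is a distribution on finitely many pairs of inputs: yes instances for \<open>Q = 1\<close>, no instances for the
  Hadamard matrix.\<close>

definition FA :: "nat \<Rightarrow> nat \<Rightarrow> (nat \<times> nat \<Rightarrow> int) set \<Rightarrow> real mat \<Rightarrow> real" where
  "FA n K A R = (\<Sum>\<kappa>\<in>A. pw n K \<kappa> R)"

lemma al_FA: "al n (FA n K A) Z = (\<Sum>\<kappa>\<in>A. al n (pw n K \<kappa>) Z)"
  unfolding al_def FA_def by (subst sum.swap) (simp add: sum_divide_distrib)

lemma al_nonneg: "0 \<le> al n (pw n K \<kappa>) Z"
  unfolding al_def by (intro divide_nonneg_pos sum_nonneg pw_nonneg) simp

lemma al_mult:
  "al n F Z * al n G W = (\<Sum>X\<in>Pow {..<n}. \<Sum>Y\<in>Pow {..<n}. F (cj (dg n X) Z) * G (cj (dg n Y) W)) / (2 ^ n * 2 ^ n)"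
  unfolding al_def by (simp add: sum_product)

context gap
begin

context
  fixes K :: nat
begin

abbreviation "I \<equiv> pidx n K"

text \<open>The weight of a net point in the input of either party. Left invariance of the mean
  makes it independent of \<open>Q\<close>.\<close>

definition \<nu> where "\<nu> \<kappa> = hl n (al n (pw n K \<kappa>))"

definition W where "W Q \<kappa> \<iota> = hl n (\<lambda>Z. al n (pw n K \<kappa>) Z * al n (pw n K \<iota>) (Q * Z))"

lemma FA_unit: "A \<subseteq> I \<Longrightarrow> unit_valued (FA n K A)"
  unfolding unit_valued_def
proof (intro conjI ballI)
  show "FA n K A \<in> Lip n" unfolding FA_def[abs_def] by (intro Lip_sum pw_Lip)
  fix R assume A: "A \<subseteq> I" and R: "R \<in> orth n"
  show "0 \<le> FA n K A R" unfolding FA_def by (intro sum_nonneg pw_nonneg)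
  have "FA n K A R \<le> (\<Sum>\<kappa>\<in>I. pw n K \<kappa> R)" unfolding FA_def
    by (rule sum_mono2[OF finite_pidx A pw_nonneg])
  then show "FA n K A R \<le> 1" using pw_sum[OF R] by simp
qed

lemma hl_FA: "hl n (al n (FA n K A)) = sum \<nu> A"
  unfolding al_FA[abs_def] \<nu>_def by (rule sum) (intro al_Lip pw_Lip)

lemma W_Lip: "Q \<in> orth n \<Longrightarrow> (\<lambda>Z. al n (pw n K \<kappa>) Z * al n (pw n K \<iota>) (Q * Z)) \<in> Lip n"
  by (intro Lip_mult Lip_left al_Lip pw_Lip)

lemma W_nonneg: "Q \<in> orth n \<Longrightarrow> 0 \<le> W Q \<kappa> \<iota>"
  unfolding W_def by (rule nonneg[OF W_Lip]) (auto intro: mult_nonneg_nonneg al_nonneg)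

lemma W_sum:
  assumes Q: "Q \<in> orth n"
  shows "(\<Sum>\<kappa>\<in>A. \<Sum>\<iota>\<in>B. W Q \<kappa> \<iota>) = hl n (\<lambda>Z. al n (FA n K A) Z * al n (FA n K B) (Q * Z))"
proof -
  have "(\<Sum>\<kappa>\<in>A. \<Sum>\<iota>\<in>B. W Q \<kappa> \<iota>) = (\<Sum>\<kappa>\<in>A. hl n (\<lambda>Z. \<Sum>\<iota>\<in>B. al n (pw n K \<kappa>) Z * al n (pw n K \<iota>) (Q * Z)))"
    unfolding W_def by (intro sum.cong refl sum[symmetric] W_Lip Q)
  also have "\<dots> = hl n (\<lambda>Z. \<Sum>\<kappa>\<in>A. \<Sum>\<iota>\<in>B. al n (pw n K \<kappa>) Z * al n (pw n K \<iota>) (Q * Z))"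
    by (intro sum[symmetric] Lip_sum W_Lip Q)
  finally show ?thesis by (simp add: al_FA sum_product)
qed

lemma al_FA_one: "Z \<in> orth n \<Longrightarrow> al n (FA n K I) Z = 1"
  unfolding al_def FA_def by (simp add: pw_sum cj_orth dg_orth card_Pow)

lemma \<nu>_sum: "sum \<nu> I = 1"
proof -
  have "sum \<nu> I = hl n (\<lambda>_. 1)" unfolding hl_FA[symmetric]
    by (rule eqI[OF al_Lip]) (use FA_unit[of I] in \<open>auto simp: unit_valued_def al_FA_one\<close>)
  then show ?thesis by (simp add: const)
qed

lemma W_total:
  assumes Q: "Q \<in> orth n"
  shows "(\<Sum>\<kappa>\<in>I. \<Sum>\<iota>\<in>I. W Q \<kappa> \<iota>) = 1"
proof -
  have L: "al n (FA n K I) \<in> Lip n" using FA_unit[of I] by (auto simp: unit_valued_def)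
  have "(\<Sum>\<kappa>\<in>I. \<Sum>\<iota>\<in>I. W Q \<kappa> \<iota>) = hl n (\<lambda>_. 1)" unfolding W_sum[OF Q]
    by (rule eqI) (use L Q in \<open>auto simp: al_FA_one orth_mult intro!: Lip_mult Lip_left\<close>)
  then show ?thesis by (simp add: const)
qed

lemma \<nu>_nonneg: "0 \<le> \<nu> \<kappa>"
  unfolding \<nu>_def by (rule nonneg) (auto intro: al_nonneg pw_Lip)

text \<open>If both sides have mass at least \<open>3^-m\<close> this is \<open>correlation\<close>.
  Otherwise the product of the masses is at most \<open>3^-m\<close>, because no mass exceeds one,
  and the left side is not positive: the subtracted term pays for all small rectangles.\<close>

lemma W_rect:
  assumes Q: "Q \<in> orth n" and m: "1 \<le> m" and Km: "21 * (6 * (2 * real m - 1)\<^sup>2) \<le> \<gamma>"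
    and A: "A \<subseteq> I" and B: "B \<subseteq> I"
  shows "0.9 * (sum \<nu> A * sum \<nu> B - (1/3) ^ m) \<le> (\<Sum>\<kappa>\<in>A. \<Sum>\<iota>\<in>B. W Q \<kappa> \<iota>)"
proof (cases "(1/3) ^ m \<le> sum \<nu> A \<and> (1/3) ^ m \<le> sum \<nu> B")
  case True
  then have "0.9 * (sum \<nu> A * sum \<nu> B) \<le> (\<Sum>\<kappa>\<in>A. \<Sum>\<iota>\<in>B. W Q \<kappa> \<iota>)"
    using correlation[OF FA_unit[OF A] FA_unit[OF B] m _ _ Km Q] unfolding W_sum[OF Q] hl_FA by simp
  moreover have "0.9 * (sum \<nu> A * sum \<nu> B - (1/3) ^ m) \<le> 0.9 * (sum \<nu> A * sum \<nu> B)" by simp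
  ultimately show ?thesis by linarith
next
  case False
  have le1: "0 \<le> sum \<nu> C" "sum \<nu> C \<le> 1" if "C \<subseteq> I" for C
  proof -
    have "sum \<nu> C \<le> sum \<nu> I" by (rule sum_mono2[OF finite_pidx that \<nu>_nonneg])
    then show "sum \<nu> C \<le> 1" by (simp add: \<nu>_sum)
    show "0 \<le> sum \<nu> C" by (intro sum_nonneg \<nu>_nonneg)
  qed
  have "sum \<nu> A * sum \<nu> B \<le> (1/3) ^ m"
  proof (cases "(1/3) ^ m \<le> sum \<nu> A")
    case True
    then have "sum \<nu> B \<le> (1/3) ^ m" using False by simp
    then show ?thesis using mult_mono[OF le1(2)[OF A] _ _ le1(1)[OF B], of "(1/3) ^ m"] by simp
  next
    case False
    then have "sum \<nu> A \<le> (1/3) ^ m" by simp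
    then show ?thesis using mult_mono[OF _ le1(2)[OF B] _ le1(1)[OF B], of "sum \<nu> A" "(1/3) ^ m"] by simp
  qed
  then have "0.9 * (sum \<nu> A * sum \<nu> B - (1/3) ^ m) \<le> 0" by simp
  also have "0 \<le> (\<Sum>\<kappa>\<in>A. \<Sum>\<iota>\<in>B. W Q \<kappa> \<iota>)" by (intro sum_nonneg W_nonneg Q)
  finally show ?thesis .
qed

lemma W_support:
  assumes Q: "Q \<in> orth n" and W: "W Q \<kappa> \<iota> \<noteq> 0"
  shows "\<exists>Z\<in>orth n. \<exists>X Y. pw n K \<kappa> (cj (dg n X) Z) \<noteq> 0 \<and> pw n K \<iota> (cj (dg n Y) (Q * Z)) \<noteq> 0"
proof (rule ccontr)
  assume c: "\<not> ?thesis"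
  have "hl n (\<lambda>Z. al n (pw n K \<kappa>) Z * al n (pw n K \<iota>) (Q * Z)) = hl n (\<lambda>_. 0)"
  proof (rule eqI[OF W_Lip[OF Q]])
    fix Z assume Z: "Z \<in> orth n"
    have z: "pw n K \<kappa> (cj (dg n X) Z) * pw n K \<iota> (cj (dg n Y) (Q * Z)) = 0" for X Y
      using c Z by (cases "pw n K \<kappa> (cj (dg n X) Z) = 0") auto
    show "al n (pw n K \<kappa>) Z * al n (pw n K \<iota>) (Q * Z) = 0"
      unfolding al_mult z by simp
  qed
  then show False using W by (simp add: W_def const)
qed

end

text \<open>The mesh \<open>160 * n^2\<close> moves each matrix by at most
  \<open>n^2 * 2/(160 n^2) = 1/80\<close>. The trace has four factors and changes by at most
  \<open>4n/80 = n/20\<close>: yes instances keep trace at least \<open>0.95 n\<close>, and traces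
  up to \<open>n/20\<close> stay within the no promise.\<close>

lemma prep_tr4:
  assumes X: "R \<in> orth n" "S \<in> orth n" and p: "pw n (160 * n\<^sup>2) \<kappa> R \<noteq> 0" "pw n (160 * n\<^sup>2) \<iota> S \<noteq> 0"
  shows "\<bar>tr4 R S - tr4 (prep n (160 * n\<^sup>2) \<kappa>) (prep n (160 * n\<^sup>2) \<iota>)\<bar> \<le> real n / 20"
proof -
  let ?K = "160 * n\<^sup>2"
  have K: "?K > 0" using n3 by simp
  have e: "real n * real n * (2 / real ?K) = 1 / 80" using n3 by (simp add: power2_eq_square field_simps)
  have "\<bar>tr4 R S - tr4 (prep n ?K \<kappa>) (prep n ?K \<iota>)\<bar> \<le> real n * (4 * (1 / 80))"
    by (rule tr4_close[OF X(1) prep_orth X(2) prep_orth])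
       (use prep_close[OF X(1) p(1) K] prep_close[OF X(2) p(2) K] in \<open>simp_all only: e\<close>)
  then show ?thesis by simp
qed

lemma yes_promise:
  assumes W: "W (160 * n\<^sup>2) (1\<^sub>m n) \<kappa> \<iota> \<noteq> 0"
  shows "9/10 * real n \<le> tr4 (prep n (160 * n\<^sup>2) \<kappa>) (prep n (160 * n\<^sup>2) \<iota>)"
proof -
  obtain Z X Y where Z: "Z \<in> orth n" and p: "pw n (160 * n\<^sup>2) \<kappa> (cj (dg n X) Z) \<noteq> 0" "pw n (160 * n\<^sup>2) \<iota> (cj (dg n Y) (1\<^sub>m n * Z)) \<noteq> 0"
    using W_support[OF orth_one W] by blast
  have "1\<^sub>m n * Z = Z" using orth_carrier[OF Z] by simp
  then have p2: "pw n (160 * n\<^sup>2) \<iota> (cj (dg n Y) Z) \<noteq> 0" using p(2) by simp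
  have "tr4 (cj (dg n X) Z) (cj (dg n Y) Z) = real n"
    unfolding tr4_cj[OF Z dg_carrier dg_carrier] by (rule tr4_diag)
  then show ?thesis using prep_tr4[OF cj_orth[OF dg_orth Z] cj_orth[OF dg_orth Z] p(1) p2] by linarith
qed

text \<open>Chebyshev's inequality. A net pair outside the no promise has weight only where the
  unrounded trace exceeds \<open>n/20\<close>, and there \<open>400/n^2\<close> times its square is
  at least one; \<open>10800\<close> is \<open>400\<close> times the \<open>27\<close> of
  \<open>HH_conj_moment\<close>.\<close>

lemma bad_mass:
  assumes n: "n = 2 ^ k"
    and Bad: "Bad \<subseteq> pidx n (160 * n\<^sup>2) \<times> pidx n (160 * n\<^sup>2)"
    and big: "\<And>\<kappa> \<iota>. (\<kappa>,\<iota>) \<in> Bad \<Longrightarrow> 1/10 * real n < tr4 (prep n (160 * n\<^sup>2) \<kappa>) (prep n (160 * n\<^sup>2) \<iota>)"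
  shows "(\<Sum>(\<kappa>,\<iota>)\<in>Bad. W (160 * n\<^sup>2) (HH k) \<kappa> \<iota>) \<le> 10800 / (real n)\<^sup>2"
proof -
  let ?K = "160 * n\<^sup>2" and ?P = "Pow {..<n}"
  have H: "HH k \<in> orth n" using HH_orth n by simp
  have npos: "real n > 0" using n3 by simp
  define T where "T X Y = tr4 (dg n X) (cj (dg n Y) (HH k))" for X Y
  have fB: "finite Bad" using Bad finite_pidx by (metis finite_SigmaI finite_subset)
  have pt: "(\<Sum>(\<kappa>,\<iota>)\<in>Bad. pw n ?K \<kappa> (cj (dg n X) Z) * pw n ?K \<iota> (cj (dg n Y) (HH k * Z))) \<le> (T X Y)\<^sup>2 * (400 / (real n)\<^sup>2)"
    if Z: "Z \<in> orth n" for X Y Z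
  proof -
    let ?R = "cj (dg n X) Z" and ?S = "cj (dg n Y) (HH k * Z)"
    have R: "?R \<in> orth n" and S: "?S \<in> orth n" by (intro cj_orth dg_orth orth_mult H Z)+
    have t: "tr4 ?R ?S = T X Y" unfolding T_def cj_cj[OF H Z dg_carrier]
      by (rule tr4_cj[OF Z dg_carrier orth_carrier[OF cj_orth[OF dg_orth H]]])
    show ?thesis
    proof (cases "T X Y > real n / 20")
      case True
      have "(\<Sum>(\<kappa>,\<iota>)\<in>Bad. pw n ?K \<kappa> ?R * pw n ?K \<iota> ?S) \<le> (\<Sum>(\<kappa>,\<iota>)\<in>pidx n ?K \<times> pidx n ?K. pw n ?K \<kappa> ?R * pw n ?K \<iota> ?S)"
        by (rule sum_mono2[OF _ Bad]) (auto intro!: mult_nonneg_nonneg pw_nonneg finite_pidx)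
      also have "\<dots> = 1"
        unfolding sum.cartesian_product[symmetric] sum_product[symmetric] pw_sum[OF R] pw_sum[OF S] by simp
      also have "1 \<le> (T X Y)\<^sup>2 * (400 / (real n)\<^sup>2)"
      proof -
        have "(real n / 20)\<^sup>2 \<le> (T X Y)\<^sup>2" using True by (intro power_mono) auto
        then have "(real n / 20)\<^sup>2 * (400 / (real n)\<^sup>2) \<le> (T X Y)\<^sup>2 * (400 / (real n)\<^sup>2)" by (rule mult_right_mono) simp
        moreover have "(real n / 20)\<^sup>2 * (400 / (real n)\<^sup>2) = 1" using npos by (simp add: power_divide)
        ultimately show ?thesis by simp
      qed
      finally show ?thesis .
    next
      case False
      have "(\<Sum>(\<kappa>,\<iota>)\<in>Bad. pw n ?K \<kappa> ?R * pw n ?K \<iota> ?S) = 0"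
      proof (rule sum.neutral, clarify)
        fix \<kappa> \<iota> assume b: "(\<kappa>,\<iota>) \<in> Bad"
        show "pw n ?K \<kappa> ?R * pw n ?K \<iota> ?S = 0"
        proof (rule ccontr)
          assume "\<not> ?thesis"
          then have "pw n ?K \<kappa> ?R \<noteq> 0" "pw n ?K \<iota> ?S \<noteq> 0" by auto
          from prep_tr4[OF R S this] big[OF b] False show False unfolding t by linarith
        qed
      qed
      then show ?thesis by simp
    qed
  qed
  have "(\<Sum>(\<kappa>,\<iota>)\<in>Bad. W ?K (HH k) \<kappa> \<iota>) = (\<Sum>p\<in>Bad. hl n (\<lambda>Z. al n (pw n ?K (fst p)) Z * al n (pw n ?K (snd p)) (HH k * Z)))"
    by (simp add: W_def case_prod_beta)
  also have "\<dots> = hl n (\<lambda>Z. \<Sum>p\<in>Bad. al n (pw n ?K (fst p)) Z * al n (pw n ?K (snd p)) (HH k * Z))"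
    by (intro sum[symmetric] W_Lip H)
  also have "\<dots> \<le> hl n (\<lambda>_. 10800 / (real n)\<^sup>2)"
  proof (rule mono[OF _ Lip_const])
    show "(\<lambda>Z. \<Sum>p\<in>Bad. al n (pw n ?K (fst p)) Z * al n (pw n ?K (snd p)) (HH k * Z)) \<in> Lip n"
      by (intro Lip_sum W_Lip H)
    fix Z assume Z: "Z \<in> orth n"
    have "(\<Sum>p\<in>Bad. al n (pw n ?K (fst p)) Z * al n (pw n ?K (snd p)) (HH k * Z)) =
      (\<Sum>p\<in>Bad. \<Sum>X\<in>?P. \<Sum>Y\<in>?P. pw n ?K (fst p) (cj (dg n X) Z) * pw n ?K (snd p) (cj (dg n Y) (HH k * Z))) / (2 ^ n * 2 ^ n)"
      unfolding al_mult sum_divide_distrib ..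
    also have "(\<Sum>p\<in>Bad. \<Sum>X\<in>?P. \<Sum>Y\<in>?P. pw n ?K (fst p) (cj (dg n X) Z) * pw n ?K (snd p) (cj (dg n Y) (HH k * Z))) =
       (\<Sum>X\<in>?P. \<Sum>Y\<in>?P. \<Sum>p\<in>Bad. pw n ?K (fst p) (cj (dg n X) Z) * pw n ?K (snd p) (cj (dg n Y) (HH k * Z)))"
      by (subst sum.swap) (intro sum.cong refl sum.swap)
    also have "\<dots> \<le> (\<Sum>X\<in>?P. \<Sum>Y\<in>?P. (T X Y)\<^sup>2 * (400 / (real n)\<^sup>2))"
      by (intro sum_mono) (use pt[OF Z] in \<open>simp add: case_prod_beta\<close>)
    also have "\<dots> = (\<Sum>Y\<in>?P. \<Sum>X\<in>?P. (T X Y)\<^sup>2) * (400 / (real n)\<^sup>2)"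
      by (subst sum.swap) (simp only: sum_distrib_right)
    also have "\<dots> \<le> 27 * (2 ^ n * 2 ^ n) * (400 / (real n)\<^sup>2)"
      unfolding T_def by (intro mult_right_mono HH_conj_moment n) simp
    finally have "(\<Sum>p\<in>Bad. al n (pw n ?K (fst p)) Z * al n (pw n ?K (snd p)) (HH k * Z))
       \<le> 27 * (2 ^ n * 2 ^ n) * (400 / (real n)\<^sup>2) / (2 ^ n * 2 ^ n)" by (simp add: divide_right_mono)
    then show "(\<Sum>p\<in>Bad. al n (pw n ?K (fst p)) Z * al n (pw n ?K (snd p)) (HH k * Z)) \<le> 10800 / (real n)\<^sup>2" by simp
  qed
  finally show ?thesis by (simp add: const)
qed

text \<open>Every deterministic protocol errs with total mass at least the left side by
  \<open>protocol_error\<close>. Averaged over the shared randomness, correctness allows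
  \<open>1/3\<close> on each distribution, plus the mass of the no distribution that violates the
  promise.\<close>

lemma protocol_bound:
  assumes n: "n = 2 ^ k" and S: "solves_ABCD n M" and C: "cost_le n M c"
    and m: "1 \<le> m" and Km: "21 * (6 * (2 * real m - 1)\<^sup>2) \<le> \<gamma>"
  shows "0.9 * (1 - 2 ^ c * (1/3) ^ m) \<le> 2/3 + 10800 / (real n)\<^sup>2"
proof -
  interpret M: prob_space M using S by (simp add: solves_ABCD_def)
  define K where "K = 160 * n\<^sup>2"
  define J where "J = pidx n K"
  have fJ: "finite J" unfolding J_def by (rule finite_pidx)
  have npos: "n > 0" using n3 by simp
  have H: "HH k \<in> orth n" using HH_orth n by simp
  define x where "x \<kappa> = inp n (prep n K \<kappa>)" for \<kappa>
  have SU: "fst (x \<kappa>) \<in> SU n" "snd (x \<kappa>) \<in> SU n" for \<kappa> unfolding x_def by (rule inp_SU[OF prep_orth npos])+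
  define yes no where "yes = W K (1\<^sub>m n)" and "no = W K (HH k)"
  have y0: "0 \<le> yes \<kappa> \<iota>" and n0: "0 \<le> no \<kappa> \<iota>" for \<kappa> \<iota> unfolding yes_def no_def by (intro W_nonneg orth_one H)+
  define t where "t \<kappa> \<iota> = tr4 (prep n K \<kappa>) (prep n K \<iota>)" for \<kappa> \<iota>
  define E0 E1 where "E0 q = {p \<in> space M. \<not> run p (x (fst q)) (x (snd q))}"
    and "E1 q = {p \<in> space M. run p (x (fst q)) (x (snd q))}" for q
  define Y G B where "Y = {q \<in> J \<times> J. 9/10 * real n \<le> t (fst q) (snd q)}"
    and "G = {q \<in> J \<times> J. t (fst q) (snd q) \<le> 1/10 * real n}" and "B = {q \<in> J \<times> J. 1/10 * real n < t (fst q) (snd q)}"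
  have fin: "finite Y" "finite G" "finite B" unfolding Y_def G_def B_def using fJ by auto
  have sol: "(abcd_yes n (fst (x a)) (fst (x b)) (snd (x a)) (snd (x b)) \<longrightarrow>
        {p \<in> space M. run p (x a) (x b)} \<in> sets M \<and> measure M {p \<in> space M. run p (x a) (x b)} \<ge> 2/3) \<and>
      (abcd_no n (fst (x a)) (fst (x b)) (snd (x a)) (snd (x b)) \<longrightarrow>
        {p \<in> space M. \<not> run p (x a) (x b)} \<in> sets M \<and> measure M {p \<in> space M. \<not> run p (x a) (x b)} \<ge> 2/3)" for a b
    using S[unfolded solves_ABCD_def, THEN conjunct2, THEN bspec, OF SU(1)[of a], THEN bspec, OF SU(1)[of b],
        THEN bspec, OF SU(2)[of a], THEN bspec, OF SU(2)[of b]] unfolding prod.collapse .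
  have E0: "E0 q \<in> sets M" "measure M (E0 q) \<le> 1/3" if "q \<in> Y" for q
  proof -
    have "abcd_yes n (fst (x (fst q))) (fst (x (snd q))) (snd (x (fst q))) (snd (x (snd q)))"
      using that unfolding x_def inp_promise(1)[OF prep_orth prep_orth] by (simp add: Y_def t_def)
    then have s: "E1 q \<in> sets M" "measure M (E1 q) \<ge> 2/3"
      using sol[of "fst q" "snd q"] unfolding E1_def by simp_all
    have "E0 q = space M - E1 q" by (auto simp: E0_def E1_def)
    then show "E0 q \<in> sets M" "measure M (E0 q) \<le> 1/3" using s M.prob_compl[OF s(1)] by auto
  qed
  have E1: "E1 q \<in> sets M" "measure M (E1 q) \<le> 1/3" if "q \<in> G" for q
  proof -
    have "abcd_no n (fst (x (fst q))) (fst (x (snd q))) (snd (x (fst q))) (snd (x (snd q)))"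
      using that unfolding x_def inp_promise(2)[OF prep_orth prep_orth] by (simp add: G_def t_def)
    then have s: "E0 q \<in> sets M" "measure M (E0 q) \<ge> 2/3"
      using sol[of "fst q" "snd q"] unfolding E0_def by simp_all
    have "E1 q = space M - E0 q" by (auto simp: E0_def E1_def)
    then show "E1 q \<in> sets M" "measure M (E1 q) \<le> 1/3" using s M.prob_compl[OF s(1)] by auto
  qed
  define yq nq where "yq q = yes (fst q) (snd q)" and "nq q = no (fst q) (snd q)" for q
  have yq0: "0 \<le> yq q" and nq0: "0 \<le> nq q" for q using y0 n0 by (simp_all add: yq_def nq_def)
  \<comment> \<open>Error events are only known to be measurable on promise inputs. Pairs in
    \<open>B\<close> therefore enter with their full weight instead of an event, which keeps
    \<open>g\<close> integrable and still bounds the error from above.\<close>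
  define g where "g p = (\<Sum>q\<in>Y. yq q * indicat_real (E0 q) p) + (\<Sum>q\<in>G. nq q * indicat_real (E1 q) p) + sum nq B" for p
  have yY: "q \<in> Y" if "q \<in> J \<times> J" "yq q \<noteq> 0" for q
    using that yes_promise[of "fst q" "snd q"] by (simp add: Y_def t_def yq_def yes_def K_def)
  have lower: "0.9 * (1 - 2 ^ c * (1/3) ^ m) \<le> g p" if p: "p \<in> space M" for p
  proof -
    have "0.9 * (sum (\<nu> K) J * sum (\<nu> K) J - 2 ^ c * (1/3) ^ m) \<le> (\<Sum>a\<in>J. \<Sum>b\<in>J. if run p (x a) (x b) then no a b else yes a b)"
    proof (rule protocol_error[OF fJ])
      show "0.9 * (sum (\<nu> K) A * sum (\<nu> K) B - (1/3) ^ m) \<le> (\<Sum>a\<in>A. \<Sum>b\<in>B. yes a b)" if "A \<subseteq> J" "B \<subseteq> J" for A B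
        unfolding yes_def by (rule W_rect[OF orth_one m Km]) (use that in \<open>auto simp: J_def\<close>)
      show "0.9 * (sum (\<nu> K) A * sum (\<nu> K) B - (1/3) ^ m) \<le> (\<Sum>a\<in>A. \<Sum>b\<in>B. no a b)" if "A \<subseteq> J" "B \<subseteq> J" for A B
        unfolding no_def by (rule W_rect[OF H m Km]) (use that in \<open>auto simp: J_def\<close>)
      have "bits p (x a) (x b) \<le> c" for a b
        using C[unfolded cost_le_def, THEN bspec, OF p, THEN bspec, OF SU(1)[of a], THEN bspec, OF SU(1)[of b],
          THEN bspec, OF SU(2)[of a], THEN bspec, OF SU(2)[of b]] unfolding prod.collapse .
      then show "\<forall>a\<in>J. \<forall>b\<in>J. bits p (x a) (x b) \<le> c" by blast
    qed auto
    also have "sum (\<nu> K) J * sum (\<nu> K) J = 1" unfolding J_def \<nu>_sum by simp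
    also have "(\<Sum>a\<in>J. \<Sum>b\<in>J. if run p (x a) (x b) then no a b else yes a b)
      = (\<Sum>q\<in>J\<times>J. yq q * indicat_real (E0 q) p + nq q * indicat_real (E1 q) p)"
      unfolding sum.cartesian_product by (intro sum.cong refl) (use p in \<open>auto simp: yq_def nq_def E0_def E1_def\<close>)
    also have "\<dots> = (\<Sum>q\<in>J\<times>J. yq q * indicat_real (E0 q) p) + (\<Sum>q\<in>J\<times>J. nq q * indicat_real (E1 q) p)"
      by (rule sum.distrib)
    also have "(\<Sum>q\<in>J\<times>J. yq q * indicat_real (E0 q) p) = (\<Sum>q\<in>Y. yq q * indicat_real (E0 q) p)"
    proof (rule sum.mono_neutral_right)
      show "\<forall>q\<in>J \<times> J - Y. yq q * indicat_real (E0 q) p = 0" using yY by fastforce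
    qed (use fJ in \<open>auto simp: Y_def\<close>)
    also have "(\<Sum>q\<in>J\<times>J. nq q * indicat_real (E1 q) p) = (\<Sum>q\<in>G. nq q * indicat_real (E1 q) p) + (\<Sum>q\<in>B. nq q * indicat_real (E1 q) p)"
    proof -
      have u: "J \<times> J = G \<union> B" and d: "G \<inter> B = {}" by (auto simp: G_def B_def)
      show ?thesis unfolding u by (rule sum.union_disjoint[OF fin(2,3) d])
    qed
    also have "(\<Sum>q\<in>B. nq q * indicat_real (E1 q) p) \<le> sum nq B"
      by (intro sum_mono) (use nq0 in \<open>auto simp: indicator_def\<close>)
    finally show ?thesis by (simp add: g_def)
  qed
  have iE: "integrable M (indicat_real E)" if "E \<in> sets M" for E
    using that by (simp add: M.emeasure_eq_measure)
  have int: "integrable M (\<lambda>p. \<Sum>q\<in>Y. yq q * indicat_real (E0 q) p)" "integrable M (\<lambda>p. \<Sum>q\<in>G. nq q * indicat_real (E1 q) p)"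
    using E0(1) E1(1) by (auto intro!: Bochner_Integration.integrable_sum integrable_mult_right iE)
  have gi: "integrable M g" unfolding g_def using int by (intro Bochner_Integration.integrable_add) auto
  have "0.9 * (1 - 2 ^ c * (1/3) ^ m) \<le> M.expectation g"
    by (rule M.integral_ge_const[OF gi AE_I2[OF lower]])
  also have "M.expectation g = (\<Sum>q\<in>Y. yq q * measure M (E0 q)) + (\<Sum>q\<in>G. nq q * measure M (E1 q)) + sum nq B"
  proof -
    have "M.expectation (\<lambda>p. \<Sum>q\<in>Y. yq q * indicat_real (E0 q) p) = (\<Sum>q\<in>Y. yq q * measure M (E0 q))"
      using E0(1) iE by (subst Bochner_Integration.integral_sum) (auto intro!: sum.cong)
    moreover have "M.expectation (\<lambda>p. \<Sum>q\<in>G. nq q * indicat_real (E1 q) p) = (\<Sum>q\<in>G. nq q * measure M (E1 q))"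
      using E1(1) iE by (subst Bochner_Integration.integral_sum) (auto intro!: sum.cong)
    ultimately show ?thesis unfolding g_def using int by (simp add: Bochner_Integration.integral_add M.prob_space)
  qed
  also have "(\<Sum>q\<in>Y. yq q * measure M (E0 q)) \<le> (\<Sum>q\<in>Y. yq q * (1/3))"
    by (intro sum_mono mult_left_mono E0 yq0)
  also have "\<dots> \<le> (\<Sum>q\<in>J\<times>J. yq q * (1/3))"
    by (rule sum_mono2) (use fJ yq0 in \<open>auto simp: Y_def\<close>)
  also have "(\<Sum>q\<in>J\<times>J. yq q * (1/3)) = 1/3"
    using W_total[OF orth_one, of K]
    by (simp add: yq_def yes_def J_def sum_divide_distrib[symmetric] sum.cartesian_product case_prod_beta)
  also have "(\<Sum>q\<in>G. nq q * measure M (E1 q)) \<le> (\<Sum>q\<in>G. nq q * (1/3))"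
    by (intro sum_mono mult_left_mono E1 nq0)
  also have "\<dots> \<le> (\<Sum>q\<in>J\<times>J. nq q * (1/3))"
    by (rule sum_mono2) (use fJ nq0 in \<open>auto simp: G_def\<close>)
  also have "(\<Sum>q\<in>J\<times>J. nq q * (1/3)) = 1/3"
    using W_total[OF H, of K]
    by (simp add: nq_def no_def J_def sum_divide_distrib[symmetric] sum.cartesian_product case_prod_beta)
  also have "sum nq B \<le> 10800 / (real n)\<^sup>2"
  proof -
    have "(\<Sum>(\<kappa>,\<iota>)\<in>B. W (160 * n\<^sup>2) (HH k) \<kappa> \<iota>) \<le> 10800 / (real n)\<^sup>2"
      by (rule bad_mass[OF n]) (auto simp: B_def J_def K_def t_def)
    then show ?thesis by (simp add: nq_def[abs_def] no_def K_def case_prod_beta)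
  qed
  finally show ?thesis by simp
qed

end

text \<open>Without communication every protocol has a constant output, so acceptance of a yes
  instance and rejection of a no instance are complementary events and cannot both have probability
  \<open>2/3\<close>. The instances are four identities and three identities with minus the
  identity, whose determinant is one as \<open>n\<close> is even. The resulting bound serves small
  dimensions.\<close>

lemma cost_pos:
  assumes n: "even n" and S: "solves_ABCD n M" and C: "cost_le n M c"
  shows "1 \<le> c"
proof (rule ccontr)
  assume "\<not> 1 \<le> c"
  then have c0: "c = 0" by simp
  interpret M: prob_space M using S by (simp add: solves_ABCD_def)
  define U V where "U = 1 \<cdot>\<^sub>m cm (1\<^sub>m n)" and "V = (-1) \<cdot>\<^sub>m cm (1\<^sub>m n)"
  have US: "U \<in> SU n" unfolding U_def by (rule smult_SU[OF orth_one]) simp_all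
  have VS: "V \<in> SU n" unfolding V_def by (rule smult_SU[OF orth_one]) (use n in simp_all)
  have U1: "U = 1\<^sub>m n" by (rule eq_matI) (auto simp: U_def cm_def)
  have Vc: "V \<in> carrier_mat n n" by (simp add: V_def)
  have "mtrace (U * U * U * U) = of_nat n" unfolding U1 by (simp add: mtrace_def)
  then have yes: "abcd_yes n U U U U" by (simp add: abcd_yes_def)
  have "mtrace (U * U * U * V) = - of_nat n" unfolding U1 using Vc by (simp add: mtrace_def) (simp add: V_def cm_def)
  then have no: "abcd_no n U U U V" by (simp add: abcd_no_def)
  define E where "E = {p \<in> space M. run p (U, U) (U, U)}"
  have out: "\<exists>v. p = Output v" if "p \<in> space M" for p
    using C that US unfolding cost_le_def c0 by (cases p) fastforce+
  then have eq: "{p \<in> space M. \<not> run p (U, U) (U, V)} = space M - E"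
    unfolding E_def by force
  have "E \<in> sets M" "measure M E \<ge> 2/3" "measure M (space M - E) \<ge> 2/3"
    using S yes no US VS unfolding solves_ABCD_def E_def[symmetric] eq[symmetric] by (simp_all add: E_def)
  then show False using M.prob_compl[of E] by simp
qed

theorem theorem5p1:
  shows "\<exists>c0::real. c0 > 0 \<and>
    (\<forall>n::nat. \<forall>M::abcd_protocol measure. \<forall>c::nat.
       n > 0 \<longrightarrow> solves_ABCD (2 ^ n) M \<longrightarrow> cost_le (2 ^ n) M c \<longrightarrow>
       real c \<ge> c0 * sqrt (real (2 ^ n)))"
proof (intro exI[of _ "1/800"] conjI allI impI)
  fix n :: nat and M :: "abcd_protocol measure" and c :: nat
  assume n: "n > 0" and S: "solves_ABCD (2 ^ n) M" and C: "cost_le (2 ^ n) M c"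
  define N where "N = (2::nat) ^ n"
  define s where "s = sqrt (real N)"
  have s2: "s * s = real N" by (simp add: s_def)
  have s0: "s \<ge> 0" by (simp add: s_def)
  have c1: "1 \<le> c" using cost_pos[OF _ S C] n by simp
  have "1/800 * s \<le> real c"
  \<comment> \<open>Up to \<open>800\<close> one bit suffices for the claim. Beyond it
    \<open>m \<ge> 4\<close>, and \<open>(2/3)^4\<close> is below \<open>0.2\<close>, the loss that
    \<open>protocol_bound\<close> forces to be exceeded.\<close>
  proof (cases "s \<le> 800")
    case True
    then show ?thesis using c1 by simp
  next
    case False
    \<comment> \<open>With \<open>m\<close> at most \<open>s/200\<close> one has
      \<open>(2m - 1)^2 \<le> N/10000\<close>, and \<open>126/10000\<close> is below the
      \<open>0.02\<close> in the gap with room for the \<open>- 2\<close>.\<close>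
    define m where "m = nat \<lfloor>s / 200\<rfloor>"
    have m: "real m \<le> s / 200" "s / 200 < real m + 1" 
    proof -
      have "real m = of_int \<lfloor>s / 200\<rfloor>" using s0 by (simp add: m_def)
      then show "real m \<le> s / 200" "s / 200 < real m + 1" using floor_correct[of "s / 200"] by simp_all
    qed
    have m4: "4 \<le> m" using m(2) False by linarith
    have Nbig: "640000 \<le> real N" using mult_mono[of 800 s 800 s] False s0 by (simp add: s2)
    interpret gap N by unfold_locales (use Nbig in simp)
    have g: "\<gamma> = 0.02 * (real N - 2)" using n3 by (simp add: \<gamma>_def of_nat_diff)
    have "(2 * real m - 1)\<^sup>2 \<le> (s / 100)\<^sup>2" using m m4 by (intro power_mono) auto
    also have "\<dots> = real N / 10000" by (simp add: power2_eq_square s2)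
    finally have "21 * (6 * (2 * real m - 1)\<^sup>2) \<le> \<gamma>" unfolding g using Nbig by simp
    then have P: "0.9 * (1 - 2 ^ c * (1/3) ^ m) \<le> 2/3 + 10800 / (real N)\<^sup>2"
      using m4 by (intro protocol_bound[OF N_def S[folded N_def] C[folded N_def]]) auto
    have "10800 / (real N)\<^sup>2 \<le> 10800 / 640000\<^sup>2" using Nbig by (intro divide_left_mono power_mono) auto
    then have big: "0.2 < (2::real) ^ c * (1/3) ^ m" using P by simp
    have "m < c"
    proof (rule ccontr)
      assume "\<not> m < c"
      then have "(2::real) ^ c * (1/3) ^ m \<le> 2 ^ m * (1/3) ^ m" by (intro mult_right_mono power_increasing) auto
      also have "\<dots> = (2/3) ^ m" by (simp add: power_mult_distrib[symmetric])
      also have "\<dots> \<le> (2/3) ^ 4" by (rule power_decreasing[OF m4]) auto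
      also have "\<dots> < 0.2" by (simp add: power_divide)
      finally show False using big by simp
    qed
    then have "real m + 1 \<le> real c" by simp
    then show ?thesis using m(2) s0 by simp
  qed
  then show "1/800 * sqrt (real (2 ^ n)) \<le> real c" by (simp add: s_def N_def)
qed simp

end
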